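(* With all data and notation as in the context, let $\varkappa\in\mathbb Z_+$, assume $$-1\le\mathcal M<\beta,\qquad 3\mathcal M_1-2\mathcal M_2\ge\beta,$$ and $$\mathcal P(\Theta)\ne0\qquad\forall\,\Theta\in\mathbb R .$$ Then the solutions of the averaged deterministic system $$\frac{dR}{d\tau}=\Lambda_1(R,\Theta,\zeta(\tau),\tau),\qquad \frac{d\Theta}{d\tau}=\Lambda_2(R,\Theta,\zeta(\tau),\tau),\qquad \tau\ge\tilde\tau_0,$$ exit from any bounded domain in a finite time.
   Context: Conventions: $\mathbb R_+$ denotes positive reals, $\mathbb Z_+$ positive integers; $\langle f(\zeta)\rangle_{\varkappa\zeta}:=\frac1{2\pi\varkappa}\int_0^{2\pi\varkappa}f(\zeta)\,d\zeta$, $\{f(\zeta)\}_{\varkappa\zeta}:=f(\zeta)-\langle f(\zeta)\rangle_{\varkappa\zeta}$; $\delta_{i,j}$ is the Kronecker delta. Original system. $dx_1=x_2\,dt$, $dx_2=(-U'(x_1)+t^{-\alpha}Q(x_1,x_2,S(t)))dt+t^{-\gamma}\mu\,\sigma(x_1,x_2,S(t))\,dw(t)$ (Itô), $t\ge t_0\ge1$, where $\alpha,\gamma,\mu,\beta,s\in\mathbb R_+$, $h\in\mathbb Z_+$; $U(x)\equiv\frac{x^{2h+2}}{2h+2}+\sum_{i=0}^{2h+1}u_ix^i$, $u_i\in\mathbb R$; $S(t)\equiv st^{\beta+1}$; $w$ is a Wiener process on a probability space $(\Omega,\mathfrak A,\mathbb P)$; $Q,\sigma$ are infinitely differentiable on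 $\mathbb R^3$, deterministic, $$Q\equiv\sum_{i=0}^p\sum_{j=0}^lQ_{i,j}(S)x_1^ix_2^j,\quad 0\le l\le p\le2h+1;\qquad \sigma\equiv\sum_{i=0}^n\sum_{j=0}^m\sigma_{i,j}(S)x_1^ix_2^j,\quad 0\le n\le p,\ 0\le m\le l,$$ with integers $p,l,n,m$ and coefficients $2\pi$-periodic in $S$. Amplitude-angle variables. $H(x_1,x_2)\equiv\frac{x_2^2}2+U(x_1)$. There is $\rho_0>0$ such that for every $\rho\ge\rho_0$ the level line $\{H=\rho^{2h+2}\}$ is a closed curve corresponding to a $T(\rho)$-periodic solution $\hat x_1(t;\rho),\hat x_2(t;\rho)$ of $\dot x_1=\partial_{x_2}H$, $\dot x_2=-\partial_{x_1}H$ with $\hat x_2(0;\rho)=0$ and $\hat x_1(0;\rho)=x_+(\rho)>0$ the positive root of $U(x)=\rho^{2h+2}$. Put $\nu(\rho)\equiv2\pi/T(\rho)$, $\tilde\nu(\rho)\equiv\nu(\rho)\rho^{-h}$, $X_i(\varphi,\rho)\equiv\hat x_i(\varphi/\nu(\rho);\rho)$. The map $(\rho,\varphi)\mapsto(X_1,X_2)$ is invertible for $\rho\ge\rho_0$, $\varphi\in[0,2\pi)$, with inverse $\rho=Y_1(x_1,x_2)$, $\varphi=Y_2(x_1,x_2)$. With functions of $(x_1,x_2)$ evaluated at $(X_1(\varphi,\rho),X_2(\varphi,\rho))$, $$f_i\equiv Q\,\partial_{x_2}Y_i,\qquad g_i\equiv\tfrac{\mu^2}2\sigma^2\partial^2_{x_2}Y_i,\qquad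 c_i\equiv\sigma\,\partial_{x_2}Y_i,\qquad i\in\{1,2\},$$ as functions of $(\rho,\varphi,S)$; put $F_i(\rho,\varphi,S,t)\equiv t^{-\alpha}f_i+t^{-2\gamma}g_i$. In the variables $(\rho,\varphi)$ the original system reads $d\rho=F_1dt+t^{-\gamma}\mu c_1dw$, $d\varphi=(\nu(\rho)+F_2)dt+t^{-\gamma}\mu c_2dw$ with $S=S(t)$. Parameters. $a=p+(l-1)(h+1)$, $b=n+(m-1)(h+1)$, $\mathcal M_1=-\alpha+\frac{a\beta}h$, $\mathcal M_2=-2\gamma+\frac{2b\beta}h$, $\mathcal M=\max\{\mathcal M_1,\mathcal M_2\}$, $A=\frac12(\beta-\mathcal M)$, $B=\beta+1$, $C=\frac12(\beta-\min\{\mathcal M_1,\mathcal M_2\})$. Put $\tilde f_i\equiv f_i\rho^{-(a+2-i)}$, $\tilde g_i\equiv g_i\rho^{-(2b+2-i)}$, $\tilde c_i\equiv c_i\rho^{-(b+2-i)}$; these have asymptotic expansions in powers $\rho^{-k}$, $k\ge0$, as $\rho\to\infty$. Also $\tilde\nu(\rho)\to\nu_0$ with $\nu_0=2\pi/T_0$, $T_0=(2h+2)^{\frac1{2h+2}}\int_{-1}^1\frac{\sqrt2\,d\zeta}{\sqrt{1-\zeta^{2h+2}}}$, and $X_1\sim\rho X_{1,0}(\varphi)$, $X_2\sim\rho^{h+1}X_{2,0}(\varphi)$ as $\rho\to\infty$, where the $2\pi$-periodic $X_{1,0},X_{2,0}$ satisfy $\nu_0X_{1,0}'=X_{2,0}$,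 $\nu_0X_{2,0}'=-X_{1,0}^{2h+1}$, $\frac{X_{1,0}^{2h+2}}{2h+2}+\frac{X_{2,0}^2}2=1$, $X_{2,0}(0)=0$, $X_{1,0}(0)>0$. The leading coefficient of $\tilde f_1$ is $$f_{1,0}(\varphi,S)=\frac{\nu_0Q_{p,l}(S)}{2(h+1)}X_{1,0}^p X_{2,0}^l\,\partial_\varphi X_{1,0}.$$ Resonant amplitude. $\varrho_\varkappa(t)$ denotes the (large) smooth solution of $\nu(\varrho_\varkappa(t))=\varkappa^{-1}S'(t)$, defined for all large $t$; $z(t)\equiv\varrho_\varkappa(t)t^{-\beta/h}\to z_0=\big(\frac{s(\beta+1)}{\nu_0\varkappa}\big)^{1/h}$. The function $\mathcal P$. $$\mathcal P(\Theta)\equiv B^{-\frac AB}z_0^a\langle f_{1,0}(\varkappa^{-1}\zeta+\Theta,\zeta)\rangle_{\varkappa\zeta}-\delta_{B,2A}B^{\frac{A-B}B}\frac\beta h .$$ The averaged deterministic system ($\Lambda_1,\Lambda_2$). The substitution $\rho=\varrho_\varkappa(t)(1+t^{-A}r)$, $\varphi=\varkappa^{-1}S(t)+\theta$, $\tau=t^B/B$, $\zeta(\tau)=S((B\tau)^{1/B})=sB\tau$ brings the $(\rho,\varphi)$-system to $dr=\mathcal F_1d\tau+\tau^{-\frac{C-A}B}\mu\xi_1d\tilde w(\tau)$, $d\theta=\mathcal F_2d\tau+\tau^{-\frac CB}\mu\xi_2d\tilde w(\tau)$, with $\tilde w$ a Wiener process and, at $t=(B\tau)^{1/B}$ and with argument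 $(\ldots)=(\varrho_\varkappa(t)(1+t^{-A}r),\varkappa^{-1}\zeta+\theta,\zeta)$ (and additionally $t$ for $F_i$), $$\mathcal F_1\equiv t^{A+1-B}\{F_1(\ldots)-\varrho_\varkappa'(t)\}\varrho_\varkappa(t)^{-1}+t^{-B}r\big(A-t(\log\varrho_\varkappa(t))'\big),$$ $$\mathcal F_2\equiv t^{1-B}\{\nu(\varrho_\varkappa(t)(1+t^{-A}r))-\varkappa^{-1}S'(t)+F_2(\ldots)\},$$ $$\xi_1\equiv t^{C-\gamma+\frac{1-B}2}B^{-\frac{C-A}B}c_1(\ldots)\varrho_\varkappa(t)^{-1},\qquad \xi_2\equiv t^{C-\gamma+\frac{1-B}2}B^{-\frac CB}c_2(\ldots).$$ Let $\varsigma=sB$ and let $$\mathcal L:=\mathcal F_1\partial_r+\mathcal F_2\partial_\theta+\partial_\tau+\varsigma\partial_\zeta+\tfrac{\mu^2}2\tau^{-\frac{2(C-A)}B}\big(\xi_1^2\partial_r^2+2\tau^{-\frac AB}\xi_1\xi_2\partial_r\partial_\theta+\tau^{-\frac{2A}B}\xi_2^2\partial_\theta^2\big).$$ Set (at $t=(B\tau)^{1/B}$, same argument $(\ldots)$) $\mathcal F_{1,A}\equiv B^{-\frac AB}z(t)^a\tilde f_1(\ldots)$, $\mathcal F_{1,B-A}\equiv-B^{\frac{A-B}B}\big(\frac\beta h+t(\log z(t))'\big)$, $\mathcal F_{1,2A}\equiv rB^{-\frac AB}(a+1)\mathcal F_{1,A}$, $\mathcal F_{1,2C-A}\equiv B^{\frac{A-2C}B}z(t)^{2b}\tilde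 g_1(\ldots)$, $\mathcal F_{2,A}\equiv B^{-\frac AB}z(t)^h\{hr\tilde\nu(\varrho_\varkappa)+t^A(\tilde\nu(\varrho_\varkappa(1+t^{-A}r))-\tilde\nu(\varrho_\varkappa))\}$, $\mathcal F_{2,2A}\equiv rB^{-\frac{2A}B}z(t)^h\frac h2\{(h-1)r\tilde\nu(\varrho_\varkappa)+2t^A(\tilde\nu(\varrho_\varkappa(1+t^{-A}r))-\tilde\nu(\varrho_\varkappa))\}+B^{-\frac{2A}B}z(t)^a\tilde f_2(\ldots)$, $\xi_{1,0}\equiv B^{-\frac{C-A}B}z(t)^b\tilde c_1(\ldots)$. For a $2\pi\varkappa$-periodic function $G$ of $\zeta$ put $\mathcal I[G](\zeta):=-\frac1\varsigma\big\{\int_0^\zeta\{G\}_{\varkappa\zeta'}\,d\zeta'\big\}_{\varkappa\zeta}$, and let $\Lambda_{1,A}:=\langle\mathcal F_{1,A}\rangle_{\varkappa\zeta}$, $$Z_{1,A}:=\mathcal I[\mathcal F_{1,A}],\quad Z_{1,2A}:=\mathcal I\big[\mathcal F_{1,2A}-Z_{1,A}\partial_r\Lambda_{1,A}+(\mathcal F_{1,A}\partial_r+\mathcal F_{2,A}\partial_\theta)Z_{1,A}\big],\quad Z_{2,2A}:=\mathcal I\big[\mathcal F_{2,2A}-Z_{1,A}\partial_r\mathcal F_{2,A}\big],$$ $$Z_{1,2(B-A)}:=Z_{1,B}:=\mathcal I\big[\mathcal F_{1,B-A}\partial_rZ_{1,A}\big],\quad Z_{1,2C-A}:=\mathcal I\big[\mathcal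 F_{1,2C-A}+\tfrac{\mu^2}2\xi_{1,0}^2\partial_r^2Z_{1,A}\big],$$ $$\tilde R:=r+\tau^{-\frac AB}Z_{1,A}+\tau^{-\frac{2A}B}Z_{1,2A}+\tau^{-\frac{2(B-A)}B}Z_{1,2(B-A)}+\tau^{-\frac{2C-A}B}Z_{1,2C-A}+\tau^{-1}Z_{1,B},\qquad \tilde\Theta:=\theta+\tau^{-\frac{2A}B}Z_{2,2A}.$$ For suitable $r_0>R_0>0$ and all $\tau\ge\tilde\tau_0$ ($\tilde\tau_0$ large) the map $(r,\theta)\mapsto(R,\Theta)=(\tilde R,\tilde\Theta)(r,\theta,\zeta,\tau)$, $|r|\le r_0$, is invertible with image covering $|R|\le R_0$, and $\Lambda_1,\Lambda_2$ are the drifts in the new variables: $\Lambda_1(R,\Theta,\zeta,\tau):=\mathcal L\tilde R$, $\Lambda_2(R,\Theta,\zeta,\tau):=\mathcal L\tilde\Theta$, evaluated at the preimage $(r,\theta)$ of $(R,\Theta)$. *)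

theory Defs
  imports "HOL-Analysis.Analysis"
begin

section \<open>Infinitely differentiable functions\<close>

primrec Ck :: "nat \<Rightarrow> ('a::euclidean_space \<Rightarrow> real) \<Rightarrow> bool" where
  "Ck 0 f \<longleftrightarrow> continuous_on UNIV f"
| "Ck (Suc k) f \<longleftrightarrow> (\<forall>x. f differentiable (at x)) \<and> (\<forall>v. Ck k (\<lambda>x. frechet_derivative f (at x) v))"

definition smooth :: "('a::euclidean_space \<Rightarrow> real) \<Rightarrow> bool" where
  "smooth f \<longleftrightarrow> (\<forall>k. Ck k f)"


section \<open>The perturbed oscillator\<close>

text \<open>The data of the system
  \<open>dx\<^sub>1 = x\<^sub>2 dt\<close>,
  \<open>dx\<^sub>2 = (-U'(x\<^sub>1) + t powr -\<alpha> * Q(x\<^sub>1, x\<^sub>2, S(t))) dt + t powr -\<gamma> * \<mu> * \<sigma>(x\<^sub>1, x\<^sub>2, S(t)) dw(t)\<close>: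
  the potential \<open>U\<close> is given by the half-degree \<open>h\<close> and its lower coefficients \<open>u\<close>, and
  \<open>Q\<close>, \<open>\<sigma>\<close> by their coefficients, which are functions of the phase \<open>S\<close>.\<close>

record osc =
  halfdeg :: nat
  ucoef :: "nat \<Rightarrow> real"
  alpha :: real
  gamma :: real
  mu :: real
  beta :: real
  sfreq :: real
  degp :: nat
  degl :: nat
  Qcoef :: "nat \<Rightarrow> nat \<Rightarrow> real \<Rightarrow> real"
  degn :: nat
  degm :: nat
  sigcoef :: "nat \<Rightarrow> nat \<Rightarrow> real \<Rightarrow> real"

context
  fixes D :: osc
begin

definition potU :: "real \<Rightarrow> real" where
  "potU x = x ^ (2 * halfdeg D + 2) / real (2 * halfdeg D + 2)
            + (\<Sum>i\<le>2 * halfdeg D + 1. ucoef D i * x ^ i)"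

definition phase :: "real \<Rightarrow> real" where
  "phase t = sfreq D * t powr (beta D + 1)"

definition Qfun :: "real \<Rightarrow> real \<Rightarrow> real \<Rightarrow> real" where
  "Qfun x1 x2 S = (\<Sum>i\<le>degp D. \<Sum>j\<le>degl D. Qcoef D i j S * x1 ^ i * x2 ^ j)"

definition sigfun :: "real \<Rightarrow> real \<Rightarrow> real \<Rightarrow> real" where
  "sigfun x1 x2 S = (\<Sum>i\<le>degn D. \<Sum>j\<le>degm D. sigcoef D i j S * x1 ^ i * x2 ^ j)"

definition admissible :: bool where
  "admissible \<longleftrightarrow>
     halfdeg D \<ge> 1 \<and> alpha D > 0 \<and> gamma D > 0 \<and> mu D > 0 \<and> beta D > 0 \<and> sfreq D > 0 \<and>
     degl D \<le> degp D \<and> degp D \<le> 2 * halfdeg D + 1 \<and> degn D \<le> degp D \<and> degm D \<le> degl D \<and>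
     (\<forall>i\<le>degp D. \<forall>j\<le>degl D. \<forall>S. Qcoef D i j (S + 2 * pi) = Qcoef D i j S) \<and>
     (\<forall>i\<le>degn D. \<forall>j\<le>degm D. \<forall>S. sigcoef D i j (S + 2 * pi) = sigcoef D i j S) \<and>
     smooth (\<lambda>(x1, x2, S). Qfun x1 x2 S) \<and> smooth (\<lambda>(x1, x2, S). sigfun x1 x2 S)"


section \<open>Amplitude-angle variables\<close>

definition ham :: "real \<Rightarrow> real \<Rightarrow> real" where
  "ham x1 x2 = x2\<^sup>2 / 2 + potU x1"

definition x_plus :: "real \<Rightarrow> real" where
  "x_plus \<rho> = (THE x. x > 0 \<and> potU x = \<rho> ^ (2 * halfdeg D + 2))"

definition is_orbit :: "real \<Rightarrow> (real \<Rightarrow> real \<times> real) \<Rightarrow> bool" where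
  "is_orbit \<rho> y \<longleftrightarrow>
     (\<forall>t. ((\<lambda>t. fst (y t)) has_real_derivative deriv (\<lambda>v. ham (fst (y t)) v) (snd (y t))) (at t) \<and>
          ((\<lambda>t. snd (y t)) has_real_derivative - deriv (\<lambda>v. ham v (snd (y t))) (fst (y t))) (at t)) \<and>
     y 0 = (x_plus \<rho>, 0)"

text \<open>The choice below is immaterial: the potential is a polynomial, so the initial value
  problem has at most one solution.\<close>

definition xhat :: "real \<Rightarrow> real \<Rightarrow> real \<times> real" where
  "xhat \<rho> = (SOME y. is_orbit \<rho> y)"

definition is_min_period :: "real \<Rightarrow> real \<Rightarrow> bool" where
  "is_min_period \<rho> T \<longleftrightarrow> T > 0 \<and> (\<forall>t. xhat \<rho> (t + T) = xhat \<rho> t) \<and>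
     (\<forall>T'. 0 < T' \<and> T' < T \<longrightarrow> \<not> (\<forall>t. xhat \<rho> (t + T') = xhat \<rho> t))"

definition period :: "real \<Rightarrow> real" where
  "period \<rho> = (THE T. is_min_period \<rho> T)"

definition freq :: "real \<Rightarrow> real" where
  "freq \<rho> = 2 * pi / period \<rho>"

definition freq_scaled :: "real \<Rightarrow> real" where
  "freq_scaled \<rho> = freq \<rho> / \<rho> ^ halfdeg D"

definition Xmap :: "real \<Rightarrow> real \<Rightarrow> real \<times> real" where
  "Xmap \<phi> \<rho> = xhat \<rho> (\<phi> / freq \<rho>)"

text \<open>Above the threshold each level line of the Hamiltonian is a single periodic orbit
  and \<open>(\<rho>, \<phi>) \<mapsto> (X\<^sub>1, X\<^sub>2)\<close> is injective. All sufficiently large numbers are thresholds.\<close>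

definition amplitude_threshold :: "real \<Rightarrow> bool" where
  "amplitude_threshold \<rho>0 \<longleftrightarrow> \<rho>0 > 0 \<and>
     (\<forall>\<rho>\<ge>\<rho>0. (\<exists>!x. x > 0 \<and> potU x = \<rho> ^ (2 * halfdeg D + 2)) \<and>
             (\<exists>y. is_orbit \<rho> y) \<and> (\<exists>T. is_min_period \<rho> T) \<and>
             range (xhat \<rho>) = {(x1, x2). ham x1 x2 = \<rho> ^ (2 * halfdeg D + 2)}) \<and>
     inj_on (\<lambda>(\<rho>, \<phi>). Xmap \<phi> \<rho>) ({\<rho>0..} \<times> {0..<2 * pi})"


section \<open>Exponents and the limiting oscillator\<close>

definition expa :: real where
  "expa = real (degp D) + (real (degl D) - 1) * (real (halfdeg D) + 1)"

definition expb :: real where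
  "expb = real (degn D) + (real (degm D) - 1) * (real (halfdeg D) + 1)"

definition M1 :: real where
  "M1 = - alpha D + expa * beta D / real (halfdeg D)"

definition M2 :: real where
  "M2 = - 2 * gamma D + 2 * expb * beta D / real (halfdeg D)"

definition Mmax :: real where
  "Mmax = max M1 M2"

definition expA :: real where
  "expA = (beta D - Mmax) / 2"

definition expB :: real where
  "expB = beta D + 1"

definition expC :: real where
  "expC = (beta D - min M1 M2) / 2"

definition T0 :: real where
  "T0 = real (2 * halfdeg D + 2) powr (1 / real (2 * halfdeg D + 2)) *
        (LBINT x=-1..1. sqrt 2 / sqrt (1 - x ^ (2 * halfdeg D + 2)))"

definition nu0 :: real where
  "nu0 = 2 * pi / T0"

definition is_limit_orbit :: "(real \<Rightarrow> real \<times> real) \<Rightarrow> bool" where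
  "is_limit_orbit y \<longleftrightarrow>
     (\<forall>\<phi>. y (\<phi> + 2 * pi) = y \<phi>) \<and>
     (\<forall>\<phi>. (\<lambda>\<phi>. fst (y \<phi>)) differentiable (at \<phi>) \<and> nu0 * deriv (\<lambda>\<phi>. fst (y \<phi>)) \<phi> = snd (y \<phi>)) \<and>
     (\<forall>\<phi>. (\<lambda>\<phi>. snd (y \<phi>)) differentiable (at \<phi>) \<and>
          nu0 * deriv (\<lambda>\<phi>. snd (y \<phi>)) \<phi> = - (fst (y \<phi>) ^ (2 * halfdeg D + 1))) \<and>
     (\<forall>\<phi>. fst (y \<phi>) ^ (2 * halfdeg D + 2) / real (2 * halfdeg D + 2) + (snd (y \<phi>))\<^sup>2 / 2 = 1) \<and>
     snd (y 0) = 0 \<and> fst (y 0) > 0"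

definition X0 :: "real \<Rightarrow> real \<times> real" where
  "X0 = (SOME y. is_limit_orbit y)"

definition X10 :: "real \<Rightarrow> real" where
  "X10 \<phi> = fst (X0 \<phi>)"

definition X20 :: "real \<Rightarrow> real" where
  "X20 \<phi> = snd (X0 \<phi>)"

definition f10 :: "real \<Rightarrow> real \<Rightarrow> real" where
  "f10 \<phi> S = nu0 * Qcoef D (degp D) (degl D) S / (2 * (real (halfdeg D) + 1)) *
             X10 \<phi> ^ degp D * X20 \<phi> ^ degl D * deriv X10 \<phi>"

end


section \<open>Averaging and the function \<open>\<P>\<close>\<close>

definition avg :: "nat \<Rightarrow> (real \<Rightarrow> real) \<Rightarrow> real" where
  "avg \<kappa> f = (LBINT \<zeta>=0..2 * pi * real \<kappa>. f \<zeta>) / (2 * pi * real \<kappa>)"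

definition fluct :: "nat \<Rightarrow> (real \<Rightarrow> real) \<Rightarrow> real \<Rightarrow> real" where
  "fluct \<kappa> f \<zeta> = f \<zeta> - avg \<kappa> f"

definition z0 :: "osc \<Rightarrow> nat \<Rightarrow> real" where
  "z0 D \<kappa> = (sfreq D * (beta D + 1) / (nu0 D * real \<kappa>)) powr (1 / real (halfdeg D))"

definition Pfun :: "osc \<Rightarrow> nat \<Rightarrow> real \<Rightarrow> real" where
  "Pfun D \<kappa> \<Theta> =
     expB D powr (- expA D / expB D) * z0 D \<kappa> powr expa D * avg \<kappa> (\<lambda>\<zeta>. f10 D (\<zeta> / real \<kappa> + \<Theta>) \<zeta>)
     - (if expB D = 2 * expA D then 1 else 0) * expB D powr ((expA D - expB D) / expB D)
       * (beta D / real (halfdeg D))"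


section \<open>The resonant amplitude\<close>

text \<open>Since \<open>\<nu>(\<rho>)\<close> is asymptotic to \<open>\<nu>\<^sub>0 * \<rho> ^ h\<close>, the large solution of \<open>\<nu>(\<rho>\<^sub>r(t)) = S'(t) / \<varkappa>\<close>
  is the one that tends to infinity; it is determined for all large \<open>t\<close>.\<close>

definition resonant_amplitude :: "osc \<Rightarrow> nat \<Rightarrow> (real \<Rightarrow> real) \<Rightarrow> bool" where
  "resonant_amplitude D \<kappa> \<rho>\<^sub>r \<longleftrightarrow>
     filterlim \<rho>\<^sub>r at_top at_top \<and>
     (\<forall>\<^sub>F t in at_top. freq D (\<rho>\<^sub>r t) = deriv (phase D) t / real \<kappa> \<and>
        (\<forall>k. (deriv ^^ k) \<rho>\<^sub>r differentiable (at t)))"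


section \<open>The system in amplitude-angle variables\<close>

context
  fixes D :: osc and \<rho>0 :: real
begin

text \<open>The inverse of \<open>(\<rho>, \<phi>) \<mapsto> (X\<^sub>1, X\<^sub>2)\<close> with angle in \<open>[c, c + 2\<pi>)\<close>. The choice \<open>c = 0\<close>
  gives \<open>(Y\<^sub>1, Y\<^sub>2)\<close>, whose second component jumps across the ray \<open>\<phi> = 0\<close>. Derivatives at a
  point of angle \<open>\<phi>\<close> are therefore taken on the branch \<open>c = \<phi> - \<pi>\<close>, where \<open>\<phi>\<close> is interior;
  off that ray all these branches have the same derivatives.\<close>

definition Ybranch :: "real \<Rightarrow> real \<times> real \<Rightarrow> real \<times> real" where
  "Ybranch c = inv_into ({\<rho>0..} \<times> {c..<c + 2 * pi}) (\<lambda>(\<rho>, \<phi>). Xmap D \<phi> \<rho>)"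

definition Ycomp :: "nat \<Rightarrow> real \<Rightarrow> real \<Rightarrow> real \<Rightarrow> real" where
  "Ycomp i c x1 x2 = (if i = 1 then fst (Ybranch c (x1, x2)) else snd (Ybranch c (x1, x2)))"

definition dY :: "nat \<Rightarrow> nat \<Rightarrow> real \<Rightarrow> real \<Rightarrow> real" where
  "dY k i \<rho> \<phi> = (deriv ^^ k) (\<lambda>x2. Ycomp i (\<phi> - pi) (fst (Xmap D \<phi> \<rho>)) x2) (snd (Xmap D \<phi> \<rho>))"

definition fcoef :: "nat \<Rightarrow> real \<Rightarrow> real \<Rightarrow> real \<Rightarrow> real" where
  "fcoef i \<rho> \<phi> S = Qfun D (fst (Xmap D \<phi> \<rho>)) (snd (Xmap D \<phi> \<rho>)) S * dY 1 i \<rho> \<phi>"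

definition gcoef :: "nat \<Rightarrow> real \<Rightarrow> real \<Rightarrow> real \<Rightarrow> real" where
  "gcoef i \<rho> \<phi> S =
     (mu D)\<^sup>2 / 2 * (sigfun D (fst (Xmap D \<phi> \<rho>)) (snd (Xmap D \<phi> \<rho>)) S)\<^sup>2 * dY 2 i \<rho> \<phi>"

definition ccoef :: "nat \<Rightarrow> real \<Rightarrow> real \<Rightarrow> real \<Rightarrow> real" where
  "ccoef i \<rho> \<phi> S = sigfun D (fst (Xmap D \<phi> \<rho>)) (snd (Xmap D \<phi> \<rho>)) S * dY 1 i \<rho> \<phi>"

definition Fcoef :: "nat \<Rightarrow> real \<Rightarrow> real \<Rightarrow> real \<Rightarrow> real \<Rightarrow> real" where
  "Fcoef i \<rho> \<phi> S t = t powr (- alpha D) * fcoef i \<rho> \<phi> S + t powr (- 2 * gamma D) * gcoef i \<rho> \<phi> S"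

definition ftilde :: "nat \<Rightarrow> real \<Rightarrow> real \<Rightarrow> real \<Rightarrow> real" where
  "ftilde i \<rho> \<phi> S = fcoef i \<rho> \<phi> S * \<rho> powr (- (expa D + 2 - real i))"

definition gtilde :: "nat \<Rightarrow> real \<Rightarrow> real \<Rightarrow> real \<Rightarrow> real" where
  "gtilde i \<rho> \<phi> S = gcoef i \<rho> \<phi> S * \<rho> powr (- (2 * expb D + 2 - real i))"

definition ctilde :: "nat \<Rightarrow> real \<Rightarrow> real \<Rightarrow> real \<Rightarrow> real" where
  "ctilde i \<rho> \<phi> S = ccoef i \<rho> \<phi> S * \<rho> powr (- (expb D + 2 - real i))"

end


section \<open>The near-resonance variables\<close>

text \<open>Functions take their arguments in the order \<open>r, \<theta>, \<zeta>, \<tau>\<close>. The suffixes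
  \<open>BA\<close>, \<open>2BA\<close>, \<open>2CA\<close> stand for the indices \<open>B - A\<close>, \<open>2 * (B - A)\<close>, \<open>2 * C - A\<close>.\<close>

type_synonym fun4 = "real \<Rightarrow> real \<Rightarrow> real \<Rightarrow> real \<Rightarrow> real"

definition d_r :: "fun4 \<Rightarrow> fun4" where
  "d_r G r \<theta> \<zeta> \<tau> = deriv (\<lambda>x. G x \<theta> \<zeta> \<tau>) r"

definition d_theta :: "fun4 \<Rightarrow> fun4" where
  "d_theta G r \<theta> \<zeta> \<tau> = deriv (\<lambda>x. G r x \<zeta> \<tau>) \<theta>"

definition d_zeta :: "fun4 \<Rightarrow> fun4" where
  "d_zeta G r \<theta> \<zeta> \<tau> = deriv (\<lambda>x. G r \<theta> x \<tau>) \<zeta>"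

definition d_tau :: "fun4 \<Rightarrow> fun4" where
  "d_tau G r \<theta> \<zeta> \<tau> = deriv (\<lambda>x. G r \<theta> \<zeta> x) \<tau>"

context
  fixes D :: osc and \<rho>0 :: real and \<kappa> :: nat and \<rho>\<^sub>r :: "real \<Rightarrow> real"
begin

definition time :: "real \<Rightarrow> real" where
  "time \<tau> = (expB D * \<tau>) powr (1 / expB D)"

definition zeta_of :: "real \<Rightarrow> real" where
  "zeta_of \<tau> = phase D (time \<tau>)"

definition vsig :: real where
  "vsig = sfreq D * expB D"

definition amp :: "real \<Rightarrow> real \<Rightarrow> real" where
  "amp r \<tau> = \<rho>\<^sub>r (time \<tau>) * (1 + time \<tau> powr (- expA D) * r)"

definition ang :: "real \<Rightarrow> real \<Rightarrow> real" where
  "ang \<theta> \<zeta> = \<zeta> / real \<kappa> + \<theta>"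

definition zamp :: "real \<Rightarrow> real" where
  "zamp t = \<rho>\<^sub>r t * t powr (- beta D / real (halfdeg D))"

definition calF1 :: fun4 where
  "calF1 r \<theta> \<zeta> \<tau> = (let t = time \<tau> in
     t powr (expA D + 1 - expB D) * (Fcoef D \<rho>0 1 (amp r \<tau>) (ang \<theta> \<zeta>) \<zeta> t - deriv \<rho>\<^sub>r t) / \<rho>\<^sub>r t
     + t powr (- expB D) * r * (expA D - t * deriv (\<lambda>t. ln (\<rho>\<^sub>r t)) t))"

definition calF2 :: fun4 where
  "calF2 r \<theta> \<zeta> \<tau> = (let t = time \<tau> in
     t powr (1 - expB D) *
       (freq D (amp r \<tau>) - deriv (phase D) t / real \<kappa> + Fcoef D \<rho>0 2 (amp r \<tau>) (ang \<theta> \<zeta>) \<zeta> t))"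

definition xi1 :: fun4 where
  "xi1 r \<theta> \<zeta> \<tau> = (let t = time \<tau> in
     t powr (expC D - gamma D + (1 - expB D) / 2) * expB D powr (- (expC D - expA D) / expB D) *
       ccoef D \<rho>0 1 (amp r \<tau>) (ang \<theta> \<zeta>) \<zeta> / \<rho>\<^sub>r t)"

definition xi2 :: fun4 where
  "xi2 r \<theta> \<zeta> \<tau> = (let t = time \<tau> in
     t powr (expC D - gamma D + (1 - expB D) / 2) * expB D powr (- expC D / expB D) *
       ccoef D \<rho>0 2 (amp r \<tau>) (ang \<theta> \<zeta>) \<zeta>)"

definition generator :: "fun4 \<Rightarrow> fun4" where
  "generator G r \<theta> \<zeta> \<tau> =
     calF1 r \<theta> \<zeta> \<tau> * d_r G r \<theta> \<zeta> \<tau> + calF2 r \<theta> \<zeta> \<tau> * d_theta G r \<theta> \<zeta> \<tau>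
     + d_tau G r \<theta> \<zeta> \<tau> + vsig * d_zeta G r \<theta> \<zeta> \<tau>
     + (mu D)\<^sup>2 / 2 * \<tau> powr (- 2 * (expC D - expA D) / expB D) *
       ((xi1 r \<theta> \<zeta> \<tau>)\<^sup>2 * d_r (d_r G) r \<theta> \<zeta> \<tau>
        + 2 * \<tau> powr (- expA D / expB D) * xi1 r \<theta> \<zeta> \<tau> * xi2 r \<theta> \<zeta> \<tau> * d_r (d_theta G) r \<theta> \<zeta> \<tau>
        + \<tau> powr (- 2 * expA D / expB D) * (xi2 r \<theta> \<zeta> \<tau>)\<^sup>2 * d_theta (d_theta G) r \<theta> \<zeta> \<tau>)"

definition F1_A :: fun4 where
  "F1_A r \<theta> \<zeta> \<tau> =
     expB D powr (- expA D / expB D) * zamp (time \<tau>) powr expa D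
     * ftilde D \<rho>0 1 (amp r \<tau>) (ang \<theta> \<zeta>) \<zeta>"

definition F1_BA :: fun4 where
  "F1_BA r \<theta> \<zeta> \<tau> =
     - (expB D powr ((expA D - expB D) / expB D) *
        (beta D / real (halfdeg D) + time \<tau> * deriv (\<lambda>t. ln (zamp t)) (time \<tau>)))"

definition F1_2A :: fun4 where
  "F1_2A r \<theta> \<zeta> \<tau> = r * expB D powr (- expA D / expB D) * (expa D + 1) * F1_A r \<theta> \<zeta> \<tau>"

definition F1_2CA :: fun4 where
  "F1_2CA r \<theta> \<zeta> \<tau> =
     expB D powr ((expA D - 2 * expC D) / expB D) * zamp (time \<tau>) powr (2 * expb D)
     * gtilde D \<rho>0 1 (amp r \<tau>) (ang \<theta> \<zeta>) \<zeta>"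

definition F2_A :: fun4 where
  "F2_A r \<theta> \<zeta> \<tau> = (let t = time \<tau> in
     expB D powr (- expA D / expB D) * zamp t ^ halfdeg D *
       (real (halfdeg D) * r * freq_scaled D (\<rho>\<^sub>r t)
        + t powr expA D * (freq_scaled D (amp r \<tau>) - freq_scaled D (\<rho>\<^sub>r t))))"

definition F2_2A :: fun4 where
  "F2_2A r \<theta> \<zeta> \<tau> = (let t = time \<tau> in
     r * expB D powr (- 2 * expA D / expB D) * zamp t ^ halfdeg D * (real (halfdeg D) / 2) *
       ((real (halfdeg D) - 1) * r * freq_scaled D (\<rho>\<^sub>r t)
        + 2 * t powr expA D * (freq_scaled D (amp r \<tau>) - freq_scaled D (\<rho>\<^sub>r t)))
     + expB D powr (- 2 * expA D / expB D) * zamp t powr expa D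
       * ftilde D \<rho>0 2 (amp r \<tau>) (ang \<theta> \<zeta>) \<zeta>)"

definition xi1_0 :: fun4 where
  "xi1_0 r \<theta> \<zeta> \<tau> =
     expB D powr (- (expC D - expA D) / expB D) * zamp (time \<tau>) powr expb D
     * ctilde D \<rho>0 1 (amp r \<tau>) (ang \<theta> \<zeta>) \<zeta>"

definition Iop :: "fun4 \<Rightarrow> fun4" where
  "Iop G r \<theta> \<zeta> \<tau> =
     - (1 / vsig) * fluct \<kappa> (\<lambda>x. LBINT y=0..x. fluct \<kappa> (\<lambda>\<zeta>'. G r \<theta> \<zeta>' \<tau>) y) \<zeta>"

definition Lam1_A :: fun4 where
  "Lam1_A r \<theta> \<zeta> \<tau> = avg \<kappa> (\<lambda>\<zeta>'. F1_A r \<theta> \<zeta>' \<tau>)"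

definition Z1_A :: fun4 where
  "Z1_A = Iop F1_A"

definition Z1_2A :: fun4 where
  "Z1_2A = Iop (\<lambda>r \<theta> \<zeta> \<tau>. F1_2A r \<theta> \<zeta> \<tau> - Z1_A r \<theta> \<zeta> \<tau> * d_r Lam1_A r \<theta> \<zeta> \<tau>
     + F1_A r \<theta> \<zeta> \<tau> * d_r Z1_A r \<theta> \<zeta> \<tau> + F2_A r \<theta> \<zeta> \<tau> * d_theta Z1_A r \<theta> \<zeta> \<tau>)"

definition Z2_2A :: fun4 where
  "Z2_2A = Iop (\<lambda>r \<theta> \<zeta> \<tau>. F2_2A r \<theta> \<zeta> \<tau> - Z1_A r \<theta> \<zeta> \<tau> * d_r F2_A r \<theta> \<zeta> \<tau>)"

definition Z1_B :: fun4 where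
  "Z1_B = Iop (\<lambda>r \<theta> \<zeta> \<tau>. F1_BA r \<theta> \<zeta> \<tau> * d_r Z1_A r \<theta> \<zeta> \<tau>)"

definition Z1_2BA :: fun4 where
  "Z1_2BA = Z1_B"

definition Z1_2CA :: fun4 where
  "Z1_2CA = Iop (\<lambda>r \<theta> \<zeta> \<tau>. F1_2CA r \<theta> \<zeta> \<tau>
     + (mu D)\<^sup>2 / 2 * (xi1_0 r \<theta> \<zeta> \<tau>)\<^sup>2 * d_r (d_r Z1_A) r \<theta> \<zeta> \<tau>)"

definition Rtilde :: fun4 where
  "Rtilde r \<theta> \<zeta> \<tau> = r + \<tau> powr (- expA D / expB D) * Z1_A r \<theta> \<zeta> \<tau>
     + \<tau> powr (- 2 * expA D / expB D) * Z1_2A r \<theta> \<zeta> \<tau>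
     + \<tau> powr (- 2 * (expB D - expA D) / expB D) * Z1_2BA r \<theta> \<zeta> \<tau>
     + \<tau> powr (- (2 * expC D - expA D) / expB D) * Z1_2CA r \<theta> \<zeta> \<tau>
     + \<tau> powr (- 1) * Z1_B r \<theta> \<zeta> \<tau>"

definition Thetatilde :: fun4 where
  "Thetatilde r \<theta> \<zeta> \<tau> = \<theta> + \<tau> powr (- 2 * expA D / expB D) * Z2_2A r \<theta> \<zeta> \<tau>"


section \<open>The averaged system\<close>

definition change_of_var :: "real \<Rightarrow> real \<Rightarrow> real \<times> real \<Rightarrow> real \<times> real" where
  "change_of_var \<zeta> \<tau> = (\<lambda>(r, \<theta>). (Rtilde r \<theta> \<zeta> \<tau>, Thetatilde r \<theta> \<zeta> \<tau>))"

definition invertible_change :: "real \<Rightarrow> real \<Rightarrow> real \<Rightarrow> real \<Rightarrow> bool" where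
  "invertible_change r0 R0 \<zeta> \<tau> \<longleftrightarrow>
     inj_on (change_of_var \<zeta> \<tau>) ({- r0..r0} \<times> UNIV) \<and>
     {- R0..R0} \<times> UNIV \<subseteq> change_of_var \<zeta> \<tau> ` ({- r0..r0} \<times> UNIV)"

definition Lambda1 :: "real \<Rightarrow> fun4" where
  "Lambda1 r0 R \<Theta> \<zeta> \<tau> =
     (let (r, \<theta>) = inv_into ({- r0..r0} \<times> UNIV) (change_of_var \<zeta> \<tau>) (R, \<Theta>)
      in generator Rtilde r \<theta> \<zeta> \<tau>)"

definition Lambda2 :: "real \<Rightarrow> fun4" where
  "Lambda2 r0 R \<Theta> \<zeta> \<tau> =
     (let (r, \<theta>) = inv_into ({- r0..r0} \<times> UNIV) (change_of_var \<zeta> \<tau>) (R, \<Theta>)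
      in generator Thetatilde r \<theta> \<zeta> \<tau>)"

text \<open>The averaged system is posed on \<open>\<bar>R\<bar> \<le> R0\<close>, \<open>\<tau> \<ge> \<tau>0\<close>, where \<open>\<Lambda>\<^sub>1\<close>, \<open>\<Lambda>\<^sub>2\<close> are defined.\<close>

definition averaged_solution ::
    "real \<Rightarrow> real \<Rightarrow> real \<Rightarrow> real set \<Rightarrow> (real \<Rightarrow> real) \<Rightarrow> (real \<Rightarrow> real) \<Rightarrow> bool" where
  "averaged_solution r0 R0 \<tau>0 J R \<Theta> \<longleftrightarrow>
     is_interval J \<and> J \<noteq> {} \<and> J \<subseteq> {\<tau>0..} \<and>
     (\<forall>\<tau>\<in>J. \<bar>R \<tau>\<bar> \<le> R0 \<and>
        (R has_real_derivative Lambda1 r0 (R \<tau>) (\<Theta> \<tau>) (zeta_of \<tau>) \<tau>) (at \<tau> within J) \<and>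
        (\<Theta> has_real_derivative Lambda2 r0 (R \<tau>) (\<Theta> \<tau>) (zeta_of \<tau>) \<tau>) (at \<tau> within J))"

definition maximal_averaged_solution ::
    "real \<Rightarrow> real \<Rightarrow> real \<Rightarrow> real set \<Rightarrow> (real \<Rightarrow> real) \<Rightarrow> (real \<Rightarrow> real) \<Rightarrow> bool" where
  "maximal_averaged_solution r0 R0 \<tau>0 J R \<Theta> \<longleftrightarrow>
     averaged_solution r0 R0 \<tau>0 J R \<Theta> \<and>
     (\<forall>J' R' \<Theta>'. averaged_solution r0 R0 \<tau>0 J' R' \<Theta>' \<and> J \<subseteq> J' \<and>
        (\<forall>\<tau>\<in>J. R' \<tau> = R \<tau> \<and> \<Theta>' \<tau> = \<Theta> \<tau>) \<longrightarrow> J' = J)"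

end

end

theory Submission
  imports Defs "HOL-Complex_Analysis.Great_Picard"
begin

text \<open>With \<open>\<epsilon> = 1 / \<rho>\<close> the scaled orbits \<open>(X\<^sub>1 / \<rho>, X\<^sub>2 / \<rho> ^ (h + 1))\<close> and \<open>\<nu> / \<rho> ^ h\<close>
  extend smoothly to \<open>\<epsilon> = 0\<close>, where they belong to the limiting oscillator. Hence \<open>f\<^sub>i\<close>, \<open>g\<^sub>i\<close>,
  \<open>c\<^sub>i\<close> are powers of \<open>\<rho>\<close> times functions that are smooth up to \<open>\<epsilon> = 0\<close>, and along the resonant amplitude
  everything is a smooth function of \<open>1 / \<rho>\<^sub>r\<close>, \<open>t powr -A\<close>, \<open>r\<close>, \<open>\<theta>\<close>, \<open>\<zeta>\<close>, periodic in \<open>\<theta>\<close> and \<open>\<zeta>\<close>.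
  The corrector \<open>Z1_A\<close> removes the oscillating part of the leading drift, so
  \<open>\<tau> powr (A / B) * \<Lambda>\<^sub>1\<close> tends to \<open>\<P>\<close> uniformly. Since \<open>\<P>\<close> has constant sign and \<open>A / B \<le> 1 / 2\<close>,
  a solution that stays in a bounded domain satisfies \<open>\<bar>R'\<bar> \<ge> c / \<tau>\<close> with \<open>R'\<close> of constant sign for large \<open>\<tau>\<close>;
  existing for all times it would thus have unbounded \<open>R\<close>. If it exists only up to a finite time it can be
  continued, by its limit or by Peano's theorem, contradicting maximality.\<close>

section \<open>Smooth functions on open sets\<close>

text \<open>The obstacle is that orbits, frequency, angle coordinates and drifts are all given by
  choice, description or set-theoretic inversion, while the argument needs bounds and limits that
  are uniform in the angles and survive differentiation. Each object is therefore first identified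
  with an explicit one: polar coordinates on the scaled level curve turn the motion into a
  quadrature, and uniqueness for initial value problems shows that the chosen orbit is the explicit
  one. Smoothness up to \<epsilon> = 0 together with periodicity then lets compactness play the part
  of asymptotic expansions. The exponent hypotheses act through A > 0, 2 A \<le> B and 2 C \<ge> 3
  A. The last one pushes every effect of the noise on the averaged amplitude to order \<tau> powr (-
  2 A / B), the order of the correctors after the first. In 2 A \<le> B the case of equality is
  where the drift of the resonant amplitude itself enters \<open>Pfun\<close>. The averaged field is
  defined through an inverse map, so its continuity, which the continuation of solutions requires,
  is again drawn from compactness.\<close>

primrec Ck_on :: "nat \<Rightarrow> 'a::euclidean_space set \<Rightarrow> ('a \<Rightarrow> 'b::real_normed_vector) \<Rightarrow> bool" where
  "Ck_on 0 S f \<longleftrightarrow> continuous_on S f"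
| "Ck_on (Suc k) S f \<longleftrightarrow> (\<exists>f'. (\<forall>x\<in>S. (f has_derivative f' x) (at x)) \<and> (\<forall>v. Ck_on k S (\<lambda>x. f' x v)))"

text \<open>Derivatives are iterated one direction at a time: for fixed v the map
  \<open>\<lambda>x. f' x v\<close> has the same type as f, which keeps multilinear maps out of the
  induction over k. The derivatives are taken \<open>at x\<close>, so the sets of interest are
  open.\<close>

definition smooth_on :: "'a::euclidean_space set \<Rightarrow> ('a \<Rightarrow> 'b::real_normed_vector) \<Rightarrow> bool" where
  "smooth_on S f \<longleftrightarrow> (\<forall>k. Ck_on k S f)"

lemma Ck_on_SucI:
  assumes "\<And>x. x \<in> S \<Longrightarrow> (f has_derivative f' x) (at x)" "\<And>v. Ck_on k S (\<lambda>x. f' x v)"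
  shows "Ck_on (Suc k) S f"
  using assms by auto

lemma Ck_on_cong:
  assumes "open S" "\<And>x. x \<in> S \<Longrightarrow> f x = g x" "Ck_on k S f"
  shows "Ck_on k S g"
proof (cases k)
  case 0
  then show ?thesis using assms by (simp add: continuous_on_eq)
next
  case (Suc m)
  then obtain f' where f': "\<And>x. x \<in> S \<Longrightarrow> (f has_derivative f' x) (at x)" "\<And>v. Ck_on m S (\<lambda>x. f' x v)"
    using assms(3) by auto
  have "(g has_derivative f' x) (at x)" if "x \<in> S" for x
    using has_derivative_transform_within_open[OF f'(1)[OF that] assms(1) that assms(2)] by blast
  then show ?thesis using Suc f'(2) by auto
qed

lemma Ck_on_Suc_D: "Ck_on (Suc k) S f \<Longrightarrow> Ck_on k S f"
proof (induction k arbitrary: f)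
  case 0
  then obtain f' where "\<And>x. x \<in> S \<Longrightarrow> (f has_derivative f' x) (at x)" by auto
  then have "continuous_on S f"
    by (meson continuous_at_imp_continuous_on has_derivative_continuous)
  then show ?case by simp
next
  case (Suc k)
  obtain f' where f': "\<And>x. x \<in> S \<Longrightarrow> (f has_derivative f' x) (at x)" "\<And>v. Ck_on (Suc k) S (\<lambda>x. f' x v)"
    using Suc.prems by auto
  show ?case
    by (rule Ck_on_SucI[of _ _ f']) (use f' Suc.IH in \<open>auto simp del: Ck_on.simps\<close>)
qed

lemma Ck_on_subset: "Ck_on k S f \<Longrightarrow> T \<subseteq> S \<Longrightarrow> Ck_on k T f"
proof (induction k arbitrary: f)
  case 0
  then show ?case using continuous_on_subset by auto
next
  case (Suc k)
  obtain f' where f': "\<And>x. x \<in> S \<Longrightarrow> (f has_derivative f' x) (at x)" "\<And>v. Ck_on k S (\<lambda>x. f' x v)"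
    using Suc.prems(1) by auto
  show ?case
    by (rule Ck_on_SucI[of _ _ f']) (use f' Suc.IH Suc.prems(2) in \<open>auto\<close>)
qed

lemma Ck_on_const: "Ck_on k S (\<lambda>x. c)"
proof (induction k arbitrary: c)
  case (Suc k)
  show ?case
    by (rule Ck_on_SucI[of _ _ "\<lambda>x v. 0"])
      (auto simp: Suc)
qed auto

lemma Ck_on_bounded_linear:
  assumes L: "bounded_linear L"
  shows "Ck_on k S f \<Longrightarrow> Ck_on k S (\<lambda>x. L (f x))"
proof (induction k arbitrary: f)
  case 0
  then show ?case by (auto intro: bounded_linear.continuous_on[OF L])
next
  case (Suc k)
  then obtain f' where f': "\<And>x. x \<in> S \<Longrightarrow> (f has_derivative f' x) (at x)" "\<And>v. Ck_on k S (\<lambda>x. f' x v)"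
    by auto
  show ?case
    by (rule Ck_on_SucI[of _ _ "\<lambda>x v. L (f' x v)"])
      (auto intro!: bounded_linear.has_derivative[OF L] f' Suc.IH)
qed

lemma Ck_on_id: "Ck_on k S (\<lambda>x. x)"
proof (cases k)
  case (Suc m)
  show ?thesis
    unfolding Suc by (rule Ck_on_SucI[of _ _ "\<lambda>x v. v"]) (auto simp: Ck_on_const)
qed auto

lemma Ck_on_add: "Ck_on k S f \<Longrightarrow> Ck_on k S g \<Longrightarrow> Ck_on k S (\<lambda>x. f x + g x)"
proof (induction k arbitrary: f g)
  case 0
  then show ?case by (auto intro: continuous_on_add)
next
  case (Suc k)
  obtain f' where f': "\<And>x. x \<in> S \<Longrightarrow> (f has_derivative f' x) (at x)" "\<And>v. Ck_on k S (\<lambda>x. f' x v)"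
    using Suc.prems(1) by auto
  obtain g' where g': "\<And>x. x \<in> S \<Longrightarrow> (g has_derivative g' x) (at x)" "\<And>v. Ck_on k S (\<lambda>x. g' x v)"
    using Suc.prems(2) by auto
  show ?case
    by (rule Ck_on_SucI[of _ _ "\<lambda>x v. f' x v + g' x v"])
      (auto intro!: has_derivative_add f' g' Suc.IH)
qed

lemma Ck_on_bilinear:
  assumes B: "bounded_bilinear B"
  shows "Ck_on k S f \<Longrightarrow> Ck_on k S g \<Longrightarrow> Ck_on k S (\<lambda>x. B (f x) (g x))"
proof (induction k arbitrary: f g)
  case 0
  then show ?case by (auto intro: bounded_bilinear.continuous_on[OF B])
next
  case (Suc k)
  obtain f' where f': "\<And>x. x \<in> S \<Longrightarrow> (f has_derivative f' x) (at x)" "\<And>v. Ck_on k S (\<lambda>x. f' x v)"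
    using Suc.prems(1) by auto
  obtain g' where g': "\<And>x. x \<in> S \<Longrightarrow> (g has_derivative g' x) (at x)" "\<And>v. Ck_on k S (\<lambda>x. g' x v)"
    using Suc.prems(2) by auto
  note fg = Ck_on_Suc_D[OF Suc.prems(1)] Ck_on_Suc_D[OF Suc.prems(2)]
  show ?case
    by (rule Ck_on_SucI[of _ _ "\<lambda>x v. B (f x) (g' x v) + B (f' x v) (g x)"])
      (auto intro!: bounded_bilinear.FDERIV[OF B] f' g' Ck_on_add Suc.IH fg)
qed

lemma Ck_on_sum: "(\<And>i. i \<in> I \<Longrightarrow> Ck_on k S (f i)) \<Longrightarrow> Ck_on k S (\<lambda>x. \<Sum>i\<in>I. f i x)"
  by (induction I rule: infinite_finite_induct) (auto intro: Ck_on_add Ck_on_const)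

text \<open>In the chain rule \<open>f' (g x) (g' x v)\<close> the direction depends on x, a form
  that the induction hypothesis does not cover. Expanding the direction in the standard basis gives
  a finite sum of products of functions that it does cover.\<close>

lemma Ck_on_compose:
  fixes f :: "'b::euclidean_space \<Rightarrow> 'c::real_normed_vector" and g :: "'a::euclidean_space \<Rightarrow> 'b"
  assumes "\<And>x. x \<in> S \<Longrightarrow> g x \<in> T"
  shows "Ck_on k T f \<Longrightarrow> Ck_on k S g \<Longrightarrow> Ck_on k S (\<lambda>x. f (g x))"
proof (induction k arbitrary: f)
  case 0
  then show ?case using assms by (auto intro: continuous_on_compose2[of T f S g])
next
  case (Suc k)
  obtain f' where f': "\<And>x. x \<in> T \<Longrightarrow> (f has_derivative f' x) (at x)" "\<And>v. Ck_on k T (\<lambda>x. f' x v)"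
    using Suc.prems(1) by auto
  obtain g' where g': "\<And>x. x \<in> S \<Longrightarrow> (g has_derivative g' x) (at x)" "\<And>v. Ck_on k S (\<lambda>x. g' x v)"
    using Suc.prems(2) by auto
  have gk: "Ck_on k S g" using Suc.prems(2) by (rule Ck_on_Suc_D)
  have der: "((\<lambda>x. f (g x)) has_derivative (\<lambda>v. \<Sum>b\<in>Basis. (g' x v \<bullet> b) *\<^sub>R f' (g x) b)) (at x)" if "x \<in> S" for x
  proof -
    have "((\<lambda>x. f (g x)) has_derivative (\<lambda>v. f' (g x) (g' x v))) (at x)"
      by (rule has_derivative_compose[OF g'(1)[OF that] f'(1)[OF assms[OF that]]])
    moreover have "f' (g x) (g' x v) = (\<Sum>b\<in>Basis. (g' x v \<bullet> b) *\<^sub>R f' (g x) b)" for v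
    proof -
      have lin: "linear (f' (g x))" using f'(1)[OF assms[OF that]] has_derivative_linear by blast
      show ?thesis by (subst euclidean_representation[of "g' x v", symmetric])
         (simp add: linear_sum[OF lin] linear_scale[OF lin])
    qed
    ultimately show ?thesis by simp
  qed
  have "Ck_on k S (\<lambda>x. \<Sum>b\<in>Basis. (g' x v \<bullet> b) *\<^sub>R f' (g x) b)" for v
    by (intro Ck_on_sum Ck_on_bilinear[OF bounded_bilinear_scaleR] 
        Ck_on_bounded_linear[OF bounded_linear_inner_left] g' Suc.IH f' gk)
  with der show ?case by (rule Ck_on_SucI)
qed

named_theorems smooth_intros

lemma smooth_on_cong:
  assumes "smooth_on S f" "open S" "\<And>x. x \<in> S \<Longrightarrow> f x = g x"
  shows "smooth_on S g"
  unfolding smooth_on_def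
proof
  fix k
  show "Ck_on k S g" by (rule Ck_on_cong[OF assms(2,3)]) (use assms(1) in \<open>auto simp: smooth_on_def\<close>)
qed

lemma smooth_on_subset: "smooth_on S f \<Longrightarrow> T \<subseteq> S \<Longrightarrow> smooth_on T f"
  unfolding smooth_on_def using Ck_on_subset by blast

lemma smooth_on_const [smooth_intros]: "smooth_on S (\<lambda>x. c)"
  by (simp add: smooth_on_def Ck_on_const)

lemma smooth_on_id [smooth_intros]: "smooth_on S (\<lambda>x. x)"
  by (simp add: smooth_on_def Ck_on_id)

lemma smooth_on_bounded_linear: "bounded_linear L \<Longrightarrow> smooth_on S f \<Longrightarrow> smooth_on S (\<lambda>x. L (f x))"
  by (simp add: smooth_on_def Ck_on_bounded_linear)

lemma smooth_on_fst [smooth_intros]: "smooth_on S f \<Longrightarrow> smooth_on S (\<lambda>x. fst (f x))"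
  by (rule smooth_on_bounded_linear[OF bounded_linear_fst])

lemma smooth_on_snd [smooth_intros]: "smooth_on S f \<Longrightarrow> smooth_on S (\<lambda>x. snd (f x))"
  by (rule smooth_on_bounded_linear[OF bounded_linear_snd])

lemma smooth_on_add [smooth_intros]: "smooth_on S f \<Longrightarrow> smooth_on S g \<Longrightarrow> smooth_on S (\<lambda>x. f x + g x)"
  by (simp add: smooth_on_def Ck_on_add)

lemma smooth_on_minus [smooth_intros]: "smooth_on S f \<Longrightarrow> smooth_on S (\<lambda>x. - f x)"
  by (rule smooth_on_bounded_linear[OF bounded_linear_minus[OF bounded_linear_ident]])

lemma smooth_on_diff [smooth_intros]: "smooth_on S f \<Longrightarrow> smooth_on S g \<Longrightarrow> smooth_on S (\<lambda>x. f x - g x)"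
  using smooth_on_add[of S f "\<lambda>x. - g x"] smooth_on_minus[of S g] by simp

lemma smooth_on_bilinear:
  "bounded_bilinear B \<Longrightarrow> smooth_on S f \<Longrightarrow> smooth_on S g \<Longrightarrow> smooth_on S (\<lambda>x. B (f x) (g x))"
  by (simp add: smooth_on_def Ck_on_bilinear)

lemma smooth_on_mult [smooth_intros]:
  fixes f g :: "'a::euclidean_space \<Rightarrow> real"
  shows "smooth_on S f \<Longrightarrow> smooth_on S g \<Longrightarrow> smooth_on S (\<lambda>x. f x * g x)"
  by (rule smooth_on_bilinear[OF bounded_bilinear_mult])

lemma smooth_on_Pair [smooth_intros]:
  assumes "smooth_on S f" "smooth_on S g"
  shows "smooth_on S (\<lambda>x. (f x, g x))"
proof -
  have "bounded_linear (\<lambda>y::'b. (y, 0::'c))" "bounded_linear (\<lambda>y::'c. (0::'b, y))"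
    by (intro bounded_linear_Pair bounded_linear_ident bounded_linear_zero)+
  from smooth_on_add[OF smooth_on_bounded_linear[OF this(1) assms(1)] smooth_on_bounded_linear[OF this(2) assms(2)]]
  show ?thesis by simp
qed

lemma smooth_on_sum [smooth_intros]:
  "(\<And>i. i \<in> I \<Longrightarrow> smooth_on S (f i)) \<Longrightarrow> smooth_on S (\<lambda>x. \<Sum>i\<in>I. f i x)"
  by (simp add: smooth_on_def Ck_on_sum)

lemma smooth_on_power [smooth_intros]:
  fixes f :: "'a::euclidean_space \<Rightarrow> real"
  shows "smooth_on S f \<Longrightarrow> smooth_on S (\<lambda>x. f x ^ n)"
  by (induction n) (simp_all add: smooth_on_const smooth_on_mult)

lemma smooth_on_compose:
  fixes f :: "'b::euclidean_space \<Rightarrow> 'c::real_normed_vector" and g :: "'a::euclidean_space \<Rightarrow> 'b"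
  assumes "smooth_on T f" "smooth_on S g" "\<And>x. x \<in> S \<Longrightarrow> g x \<in> T"
  shows "smooth_on S (\<lambda>x. f (g x))"
  unfolding smooth_on_def
proof
  fix k
  show "Ck_on k S (\<lambda>x. f (g x))"
    by (rule Ck_on_compose[of S g T]) (use assms in \<open>auto simp: smooth_on_def\<close>)
qed

lemma smooth_on_has_derivative:
  assumes "smooth_on S f" "x \<in> S"
  shows "(f has_derivative frechet_derivative f (at x)) (at x)"
  using assms(1)[unfolded smooth_on_def, rule_format, of "Suc 0"] assms(2) frechet_derivative_works
  by (auto simp: differentiable_def)

lemma smooth_on_continuous: "smooth_on S f \<Longrightarrow> continuous_on S f"
  unfolding smooth_on_def using Ck_on.simps(1) by blast

lemma smooth_on_derivative [smooth_intros]: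
  assumes "smooth_on S f" "open S"
  shows "smooth_on S (\<lambda>x. frechet_derivative f (at x) v)"
  unfolding smooth_on_def
proof
  fix k
  obtain f' where f': "\<And>x. x \<in> S \<Longrightarrow> (f has_derivative f' x) (at x)" "\<And>v. Ck_on k S (\<lambda>x. f' x v)"
    using assms(1)[unfolded smooth_on_def, rule_format, of "Suc k"] by auto
  show "Ck_on k S (\<lambda>x. frechet_derivative f (at x) v)"
    by (rule Ck_on_cong[OF assms(2) _ f'(2)[of v]]) (metis f'(1) frechet_derivative_at)
qed

text \<open>For functions of one variable whose iterated derivatives have a closed form: F lists
  them, starting with the function itself.\<close>

lemma smooth_on_real_1I:
  fixes f :: "real \<Rightarrow> real"
  assumes "\<And>k x. x \<in> S \<Longrightarrow> (F k has_real_derivative F (Suc k) x) (at x)"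
  shows "smooth_on S (F 0)"
proof -
  \<comment> \<open>The factor c is carried along because the derivative in direction v is the next
    function times c * v, again of this shape.\<close>
  have "Ck_on k S (\<lambda>x. F m x * c)" for k m c
  proof (induction k arbitrary: m c)
    case 0
    have "continuous_on S (F m)" by (meson assms DERIV_isCont continuous_at_imp_continuous_on)
    then show ?case by (auto intro: continuous_intros)
  next
    case (Suc k)
    have "\<exists>h'. (\<forall>x\<in>S. ((\<lambda>x. F m x * c) has_derivative h' x) (at x)) \<and> (\<forall>v. Ck_on k S (\<lambda>x. h' x v))"
    proof (rule exI[of _ "\<lambda>x v. F (Suc m) x * (c * v)"], intro conjI ballI allI)
      fix x assume "x \<in> S"
      then have "((\<lambda>x. F m x * c) has_real_derivative F (Suc m) x * c) (at x)"
        using assms by (intro DERIV_cmult_right) auto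
      then show "((\<lambda>x. F m x * c) has_derivative (\<lambda>v. F (Suc m) x * (c * v))) (at x)"
        unfolding has_field_derivative_def by (rule has_derivative_eq_rhs) auto
    qed (use Suc in auto)
    then show ?case by simp
  qed
  from this[of _ 0 1] show ?thesis by (simp add: smooth_on_def)
qed

lemma smooth_on_real_exp: "smooth_on UNIV (exp :: real \<Rightarrow> real)"
  by (rule smooth_on_real_1I[of UNIV "\<lambda>_. exp"]) (rule DERIV_exp)

lemma smooth_on_sin [smooth_intros]:
  fixes f :: "'a::euclidean_space \<Rightarrow> real"
  assumes "smooth_on S f" shows "smooth_on S (\<lambda>x. sin (f x))"
proof -
  \<comment> \<open>Differentiating the sine shifts it by a quarter period.\<close>
  have "smooth_on UNIV (\<lambda>x::real. sin (x + real 0 * (pi/2)))"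
    by (rule smooth_on_real_1I[of UNIV "\<lambda>k x. sin (x + real k * (pi/2))"])
      (auto intro!: derivative_eq_intros simp: add_divide_distrib distrib_right sin_add cos_add)
  from smooth_on_compose[OF this assms] show ?thesis by simp
qed

lemma smooth_on_cos [smooth_intros]:
  fixes f :: "'a::euclidean_space \<Rightarrow> real"
  assumes "smooth_on S f" shows "smooth_on S (\<lambda>x. cos (f x))"
proof -
  have "smooth_on S (\<lambda>x. sin (f x + pi/2))" using assms by (intro smooth_intros)
  then show ?thesis by (simp add: sin_add)
qed

lemma smooth_on_inverse [smooth_intros]:
  fixes f :: "'a::euclidean_space \<Rightarrow> real"
  assumes "smooth_on S f" "\<And>x. x \<in> S \<Longrightarrow> f x \<noteq> 0"
  shows "smooth_on S (\<lambda>x. inverse (f x))"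
proof -
  have "smooth_on (- {0}) (\<lambda>x::real. (-1)^0 * fact 0 / x ^ Suc 0)"
  proof (rule smooth_on_real_1I[of _ "\<lambda>k x. (-1)^k * fact k / x ^ Suc k"])
    fix k and x :: real assume "x \<in> -{0}"
    then show "((\<lambda>x. (- 1) ^ k * fact k / x ^ Suc k) has_real_derivative
        (- 1) ^ Suc k * fact (Suc k) / x ^ Suc (Suc k)) (at x)"
      by (auto intro!: derivative_eq_intros simp: power2_eq_square divide_simps) (cases k; simp add: algebra_simps)
  qed
  from smooth_on_compose[OF this assms(1)] assms(2) show ?thesis by (simp add: inverse_eq_divide)
qed

lemma smooth_on_divide [smooth_intros]:
  fixes f :: "'a::euclidean_space \<Rightarrow> real"
  assumes "smooth_on S f" "smooth_on S g" "\<And>x. x \<in> S \<Longrightarrow> g x \<noteq> 0"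
  shows "smooth_on S (\<lambda>x. f x / g x)"
  unfolding divide_inverse using assms by (intro smooth_intros) auto

lemma smooth_on_powr [smooth_intros]:
  fixes f :: "'a::euclidean_space \<Rightarrow> real"
  assumes "smooth_on S f" "\<And>x. x \<in> S \<Longrightarrow> f x > 0"
  shows "smooth_on S (\<lambda>x. f x powr c)"
proof -
  have "smooth_on {0<..} (\<lambda>x::real. (\<Prod>i<0. c - real i) * x powr (c - real 0))"
  proof (rule smooth_on_real_1I[of _ "\<lambda>k x. (\<Prod>i<k. c - real i) * x powr (c - real k)"])
    fix k and x :: real assume "x \<in> {0<..}"
    then show "((\<lambda>x. (\<Prod>i<k. c - real i) * x powr (c - real k)) has_real_derivative
      (\<Prod>i<Suc k. c - real i) * x powr (c - real (Suc k))) (at x)"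
      by (auto intro!: derivative_eq_intros simp: diff_diff_eq add.commute)
  qed
  from smooth_on_compose[OF this assms(1)] assms(2) show ?thesis by simp
qed

lemma smooth_on_frechet_1:
  fixes f :: "real \<Rightarrow> real"
  assumes "smooth_on S f" "open S"
  shows "smooth_on S (deriv f)" and "\<And>x. x \<in> S \<Longrightarrow> (f has_real_derivative deriv f x) (at x)"
proof -
  have d: "(f has_real_derivative deriv f x) (at x)" if "x \<in> S" for x
    using smooth_on_has_derivative[OF assms(1) that]
    unfolding DERIV_deriv_iff_real_differentiable by (auto simp: differentiable_def)
  show "smooth_on S (deriv f)"
  proof (rule smooth_on_cong[OF smooth_on_derivative[OF assms, of 1] assms(2)])
    fix x assume "x \<in> S"
    show "frechet_derivative f (at x) 1 = deriv f x"
      using d[OF \<open>x \<in> S\<close>] frechet_derivative_at[of f "\<lambda>v. deriv f x * v" x]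
      by (metis has_field_derivative_def mult_1_right)
  qed
  show "\<And>x. x \<in> S \<Longrightarrow> (f has_real_derivative deriv f x) (at x)" by (rule d)
qed

section \<open>Integrals depending on a parameter\<close>

lemma Ck_on_continuous: "Ck_on k S f \<Longrightarrow> continuous_on S f"
proof (induction k)
  case (Suc k)
  then show ?case using Ck_on_Suc_D by blast
qed simp

text \<open>Differentiation under the integral sign: the derivative in direction v is the integral
  of \<open>f' (x, s) (v, 0)\<close>, which is again an integral of the same kind, so the induction
  closes.\<close>

lemma Ck_on_integral:
  fixes f :: "'a::euclidean_space \<times> real \<Rightarrow> real"
  assumes S: "open S" and W: "open W" "S \<times> {0..1} \<subseteq> W"
  shows "Ck_on k W f \<Longrightarrow> Ck_on k S (\<lambda>p. integral {0..1} (\<lambda>s. f (p, s)))"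
proof (induction k arbitrary: f)
  case 0
  then have "continuous_on (S \<times> cbox 0 1) (\<lambda>(x, t). f (x, t))"
    using continuous_on_subset[OF _ W(2)] by (simp add: cbox_interval case_prod_eta[of f])
  from integral_continuous_on_param[OF this] show ?case by (simp add: cbox_interval)
next
  case (Suc k)
  obtain f' where f': "\<And>x. x \<in> W \<Longrightarrow> (f has_derivative f' x) (at x)" "\<And>v. Ck_on k W (\<lambda>x. f' x v)"
    using Suc.prems by auto
  \<comment> \<open>\<open>leibniz_rule\<close> asks for the partial derivative as a continuous map
    into the bounded linear operators; its continuity is checked on basis vectors.\<close>
  define D where "D x t = Blinfun (\<lambda>v. f' (x, t) (v, 0))" for x t
  have part: "((\<lambda>x. f (x, t)) has_derivative (\<lambda>v. f' (x, t) (v, 0))) (at x)" if "x \<in> S" "t \<in> {0..1}" for x t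
  proof -
    have "((\<lambda>x. (x, t)) has_derivative (\<lambda>v. (v, 0))) (at x)" by (auto intro!: derivative_eq_intros)
    have "(x, t) \<in> W" using that W(2) by auto
    from has_derivative_compose[OF \<open>((\<lambda>x. (x, t)) has_derivative (\<lambda>v. (v, 0))) (at x)\<close> f'(1)[OF this]] show ?thesis .
  qed
  have D: "blinfun_apply (D x t) = (\<lambda>v. f' (x, t) (v, 0))" if "x \<in> S" "t \<in> {0..1}" for x t
    unfolding D_def by (rule bounded_linear_Blinfun_apply) (rule has_derivative_bounded_linear[OF part[OF that]])
  have cont: "continuous_on (S \<times> cbox 0 1) (\<lambda>(x, t). D x t)"
  proof (rule continuous_on_blinfun_componentwise)
    fix i :: 'a
    have "continuous_on W (\<lambda>x. f' x (i, 0))"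
      by (rule Ck_on_continuous[OF f'(2)])
    then have "continuous_on (S \<times> cbox 0 1) (\<lambda>x. f' x (i, 0))"
      by (rule continuous_on_subset) (use W(2) in auto)
    then show "continuous_on (S \<times> cbox 0 1) (\<lambda>x. blinfun_apply (case x of (x, t) \<Rightarrow> D x t) i)"
      by (rule continuous_on_eq) (use D in \<open>auto simp: cbox_interval\<close>)
  qed
  have contf: "continuous_on W f"
    using f'(1) by (meson continuous_at_imp_continuous_on has_derivative_continuous)
  have int: "(\<lambda>s. f (x, s)) integrable_on cbox 0 1" if "x \<in> S" for x
    by (rule integrable_continuous, rule continuous_on_compose2[OF contf])
      (use that W(2) in \<open>auto intro!: continuous_intros simp: cbox_interval\<close>)
  have der: "((\<lambda>p. integral {0..1} (\<lambda>s. f (p, s))) has_derivative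
      (\<lambda>v. integral {0..1} (\<lambda>s. f' (x0, s) (v, 0)))) (at x0)" if x0: "x0 \<in> S" for x0
  proof -
    obtain r where r: "r > 0" "ball x0 r \<subseteq> S" using S x0 open_contains_ball by blast
    have "((\<lambda>x. integral (cbox 0 1) (\<lambda>s. f (x, s))) has_derivative blinfun_apply (integral (cbox 0 1) (D x0))) (at x0 within ball x0 r)"
    proof (rule leibniz_rule[where U="ball x0 r"])
      fix x t assume xt: "x \<in> ball x0 r" "t \<in> cbox (0::real) 1"
      then show "((\<lambda>x. f (x, t)) has_derivative blinfun_apply (D x t)) (at x within ball x0 r)"
        using has_derivative_at_withinI[OF part[of x t]] D[of x t] r(2) by (auto simp: cbox_interval subset_iff)
    qed (use r int in \<open>auto intro: continuous_on_subset[OF cont]\<close>)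
    moreover have "at x0 within ball x0 r = at x0" using r by (intro at_within_open) auto
    moreover have "blinfun_apply (integral (cbox 0 1) (D x0)) = (\<lambda>v. integral {0..1} (\<lambda>s. f' (x0, s) (v, 0)))"
    proof
      fix v
      have "D x0 integrable_on cbox 0 1"
        by (rule integrable_continuous, rule continuous_on_compose2[OF cont, of _ "Pair x0", simplified])
          (use x0 in \<open>auto intro!: continuous_intros\<close>)
      then have "blinfun_apply (integral (cbox 0 1) (D x0)) v = integral (cbox 0 1) (\<lambda>s. blinfun_apply (D x0 s) v)"
        by (rule blinfun_apply_integral)
      also have "\<dots> = integral (cbox 0 1) (\<lambda>s. f' (x0, s) (v, 0))"
        by (rule integral_cong) (use D[OF x0] in \<open>auto simp: cbox_interval\<close>)
      finally show "blinfun_apply (integral (cbox 0 1) (D x0)) v = integral {0..1} (\<lambda>s. f' (x0, s) (v, 0))"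
        by (simp add: cbox_interval)
    qed
    ultimately show ?thesis by (simp add: cbox_interval)
  qed
  show ?case
    by (rule Ck_on_SucI[OF der]) (auto intro: Suc.IH f'(2))
qed

lemma Ck_on_Pair:
  assumes "Ck_on k S f" "Ck_on k S g"
  shows "Ck_on k S (\<lambda>x. (f x, g x))"
proof -
  have "bounded_linear (\<lambda>y::'b. (y, 0::'c))" "bounded_linear (\<lambda>y::'c. (0::'b, y))"
    by (intro bounded_linear_Pair bounded_linear_ident bounded_linear_zero)+
  from Ck_on_add[OF Ck_on_bounded_linear[OF this(1) assms(1)] Ck_on_bounded_linear[OF this(2) assms(2)]]
  show ?thesis by simp
qed

lemma smooth_on_integral:
  fixes f :: "'a::euclidean_space \<times> real \<Rightarrow> real"
  assumes "smooth_on W f" "open S" "open W" "S \<times> {0..1} \<subseteq> W"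
  shows "smooth_on S (\<lambda>p. integral {0..1} (\<lambda>s. f (p, s)))"
  unfolding smooth_on_def
proof
  fix k
  show "Ck_on k S (\<lambda>p. integral {0..1} (\<lambda>s. f (p, s)))"
    by (rule Ck_on_integral[OF assms(2-4)]) (use assms(1) in \<open>simp add: smooth_on_def\<close>)
qed

lemma LBINT_has_derivative:
  fixes g :: "real \<Rightarrow> real"
  assumes "continuous_on UNIV g"
  shows "((\<lambda>x. LBINT y=0..x. g y) has_real_derivative g x) (at x)"
proof -
  define a where "a = - \<bar>x\<bar> - 1"
  define b where "b = \<bar>x\<bar> + 1"
  have ab: "a < 0" "0 < b" "a < x" "x < b" by (auto simp: a_def b_def)
  have "((\<lambda>u. LBINT y=ereal 0..u. g y) has_vector_derivative (g x)) (at x within {a..b})"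
    by (rule interval_integral_FTC2) (use ab assms continuous_on_subset in auto)
  moreover have "at x within {a..b} = at x" using ab by (intro at_within_interior) auto
  ultimately show ?thesis by (simp add: has_real_derivative_iff_has_vector_derivative zero_ereal_def)
qed

lemma LBINT_FTC:
  fixes g G :: "real \<Rightarrow> real"
  assumes "continuous_on UNIV g" "\<And>x. (G has_real_derivative g x) (at x)"
  shows "(LBINT y=0..x. g y) = G x - G 0"
proof -
  have "(LBINT y=ereal 0..ereal x. g y) = G x - G 0"
    by (rule interval_integral_FTC_finite)
      (use assms continuous_on_subset[OF assms(1)] in \<open>auto simp: has_real_derivative_iff_has_vector_derivative[symmetric] intro: has_field_derivative_at_within\<close>)
  then show ?thesis by (simp add: zero_ereal_def)
qed

text \<open>The substitution y = x * s, valid for either sign of x, moves the variable endpoint into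
  the integrand. Smoothness in the endpoint thus becomes smoothness in a parameter over the fixed
  interval {0..1}.\<close>

lemma LBINT_scale:
  fixes g :: "real \<Rightarrow> real"
  assumes g: "continuous_on UNIV g"
  shows "(LBINT y=0..x. g y) = integral {0..1} (\<lambda>s. x * g (x * s))"
proof -
  define G where "G = (\<lambda>x. LBINT y=0..x. g y)"
  have G: "(G has_real_derivative g x) (at x)" for x unfolding G_def by (rule LBINT_has_derivative[OF g])
  have "((\<lambda>s. x * g (x * s)) has_integral (G (x * 1) - G (x * 0))) {0..1}"
  proof (rule fundamental_theorem_of_calculus)
    fix s :: real
    have "((\<lambda>s. G (x * s)) has_real_derivative (g (x * s) * x)) (at s)"
      by (rule DERIV_chain2[OF G]) (auto intro!: derivative_eq_intros)
    then show "((\<lambda>s. G (x * s)) has_vector_derivative x * g (x * s)) (at s within {0..1})"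
      by (simp add: has_real_derivative_iff_has_vector_derivative mult.commute has_vector_derivative_at_within)
  qed simp
  from integral_unique[OF this] LBINT_FTC[OF g G, of x] show ?thesis by simp
qed

lemma smooth_on_primitive:
  fixes f :: "'a::euclidean_space \<times> real \<Rightarrow> real"
  assumes f: "smooth_on (S \<times> UNIV) f" and S: "open S"
  shows "smooth_on (S \<times> UNIV) (\<lambda>q. LBINT y=0..ereal (snd q). f (fst q, y))"
proof -
  have "smooth_on ((S \<times> UNIV) \<times> UNIV) (\<lambda>z. snd (fst z) * f (fst (fst z), snd (fst z) * snd z))"
    by (intro smooth_intros smooth_on_compose[OF f]) auto
  then have A: "smooth_on (S \<times> UNIV) (\<lambda>p. integral {0..1} (\<lambda>s. (\<lambda>z. snd (fst z) * f (fst (fst z), snd (fst z) * snd z)) (p, s)))"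
    by (rule smooth_on_integral) (use S in \<open>auto intro!: open_Times\<close>)
  have "integral {0..1} (\<lambda>s. snd q * f (fst q, snd q * s)) = (LBINT y=0..ereal (snd q). f (fst q, y))"
    if q: "q \<in> S \<times> UNIV" for q
  proof -
    have "continuous_on UNIV (\<lambda>y. f (fst q, y))"
      by (rule continuous_on_compose2[OF smooth_on_continuous[OF f]]) (use q in \<open>auto intro!: continuous_intros\<close>)
    then show ?thesis by (simp add: LBINT_scale)
  qed
  then show ?thesis
    by (intro smooth_on_cong[OF A]) (use S in \<open>auto intro: open_Times\<close>)
qed

lemma smooth_on_partial2:
  fixes f :: "'a::euclidean_space \<times> real \<Rightarrow> real"
  assumes "smooth_on W f" "(p, t) \<in> W"
  shows "((\<lambda>t. f (p, t)) has_real_derivative frechet_derivative f (at (p, t)) (0, 1)) (at t)"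
proof -
  have d: "(f has_derivative frechet_derivative f (at (p, t))) (at (p, t))"
    by (rule smooth_on_has_derivative[OF assms])
  have "((\<lambda>t. (p, t)) has_derivative (\<lambda>v. (0, v))) (at t)" by (auto intro!: derivative_eq_intros)
  from has_derivative_compose[OF this d]
  have "((\<lambda>t. f (p, t)) has_derivative (\<lambda>v. frechet_derivative f (at (p, t)) (0, v))) (at t)" .
  moreover have "(\<lambda>v. frechet_derivative f (at (p, t)) (0, v)) = (*) (frechet_derivative f (at (p, t)) (0, 1))"
  proof
    fix v :: real
    show "frechet_derivative f (at (p, t)) (0, v) = frechet_derivative f (at (p, t)) (0, 1) * v"
      using linear_scale[OF has_derivative_linear[OF d], of v "(0, 1)"] by simp
  qed
  ultimately show ?thesis by (simp only: has_field_derivative_def)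
qed

text \<open>Hadamard's lemma: the quotient is the integral over s in {0..1} of the t-derivative at
  (p, t * s). It serves to divide the detuning of the frequency by the small factor t powr (- A)
  without losing smoothness.\<close>

lemma smooth_on_hadamard:
  fixes w :: "'a::euclidean_space \<times> real \<Rightarrow> real"
  assumes w: "smooth_on (S \<times> {-d<..<d}) w" and S: "open S" and 0: "\<And>p. p \<in> S \<Longrightarrow> w (p, 0) = 0"
  obtains w1 where "smooth_on (S \<times> {-d<..<d}) w1" "\<And>p t. p \<in> S \<Longrightarrow> \<bar>t\<bar> < d \<Longrightarrow> w (p, t) = t * w1 (p, t)"
proof
  let ?D = "\<lambda>x. frechet_derivative w (at x) (0, 1)"
  \<comment> \<open>An open set that contains every ((p, t), s) with s in {0..1} and on which (p, t
    * s) stays in the domain of w.\<close>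
  let ?W = "{z :: ('a \<times> real) \<times> real. fst (fst z) \<in> S \<and> \<bar>snd (fst z) * snd z\<bar> < d}"
  have oW: "open (S \<times> {-d<..<d})" using S by (simp add: open_Times)
  have D: "smooth_on (S \<times> {-d<..<d}) ?D"
    by (rule smooth_on_derivative[OF w oW])
  have "smooth_on ?W (\<lambda>z. ?D (fst (fst z), snd (fst z) * snd z))"
    by (rule smooth_on_compose[OF D]) (auto intro!: smooth_intros)
  moreover have "open ?W"
  proof -
    have "open ((\<lambda>z :: ('a \<times> real) \<times> real. fst (fst z)) -` S)" "open ((\<lambda>z :: ('a \<times> real) \<times> real. \<bar>snd (fst z) * snd z\<bar>) -` {..<d})"
      by (rule open_vimage, use S in simp, force intro!: continuous_intros)+
    then have "open ((\<lambda>z :: ('a \<times> real) \<times> real. fst (fst z)) -` S \<inter> (\<lambda>z. \<bar>snd (fst z) * snd z\<bar>) -` {..<d})"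
      by (rule open_Int)
    also have "\<dots> = ?W" by auto
    finally show ?thesis .
  qed
  moreover have sm: "\<bar>t * s\<bar> < d" if "\<bar>t\<bar> < d" "0 \<le> s" "s \<le> 1" for t s :: real
  proof -
    have "\<bar>t * s\<bar> \<le> \<bar>t\<bar> * 1" unfolding abs_mult using that by (intro mult_left_mono) auto
    then show ?thesis using that by simp
  qed
  ultimately show "smooth_on (S \<times> {-d<..<d}) (\<lambda>q. integral {0..1} (\<lambda>s. ?D (fst q, snd q * s)))"
    using smooth_on_integral[of ?W "\<lambda>z. ?D (fst (fst z), snd (fst z) * snd z)" "S \<times> {-d<..<d}"] oW
    by force
  fix p t assume p: "p \<in> S" and t: "\<bar>t\<bar> < d"
  have "((\<lambda>s. t * ?D (p, t * s)) has_integral (w (p, t * 1) - w (p, t * 0))) {0..1}"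
  proof (rule fundamental_theorem_of_calculus)
    fix s :: real assume s: "s \<in> {0..1}"
    have "((\<lambda>s. w (p, t * s)) has_real_derivative (?D (p, t * s) * t)) (at s)"
      by (rule DERIV_chain2[OF smooth_on_partial2[OF w]])
        (use sm[OF t, of s] s p in \<open>auto intro!: derivative_eq_intros simp: abs_less_iff\<close>)
    then show "((\<lambda>s. w (p, t * s)) has_vector_derivative t * ?D (p, t * s)) (at s within {0..1})"
      by (simp add: has_real_derivative_iff_has_vector_derivative mult.commute has_vector_derivative_at_within)
  qed simp
  from integral_unique[OF this] 0[OF p] show "w (p, t) = t * integral {0..1} (\<lambda>s. ?D (fst (p, t), snd (p, t) * s))"
    by simp
qed

text \<open>Strict signs of F on both sides of L x suffice: for y near x the signs at two levels
  slightly below and above L x persist, and they trap L y between these levels.\<close>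

lemma implicit_continuous:
  fixes F :: "'a::euclidean_space \<times> real \<Rightarrow> real"
  assumes F: "continuous_on (S \<times> I) F" and S: "open S" and I: "open I"
    and L: "\<And>x. x \<in> S \<Longrightarrow> L x \<in> I"
    and neg: "\<And>x l. x \<in> S \<Longrightarrow> l \<in> I \<Longrightarrow> l < L x \<Longrightarrow> F (x, l) < 0"
    and pos: "\<And>x l. x \<in> S \<Longrightarrow> l \<in> I \<Longrightarrow> l > L x \<Longrightarrow> F (x, l) > 0"
  shows "continuous_on S L"
proof (rule continuous_at_imp_continuous_on, rule ballI)
  fix x assume x: "x \<in> S"
  have lim: "((\<lambda>y. F (y, l)) \<longlongrightarrow> F (x, l)) (at x)" if "l \<in> I" for l
  proof -
    have "isCont F (x, l)" using F x that S I by (simp add: continuous_on_eq_continuous_at open_Times)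
    then show ?thesis
      by (intro isCont_tendsto_compose[where g=F]) (auto intro!: tendsto_intros)
  qed
  have S': "eventually (\<lambda>y. y \<in> S) (at x)" using S x by (meson eventually_at_topological)
  have ev: "eventually (\<lambda>y. L y \<le> l) (at x)" if l: "l > L x" "l \<in> I" for l
    using order_tendstoD(1)[OF lim[OF l(2)] pos[OF x l(2) l(1)]] S'
    by eventually_elim (use neg[OF _ l(2)] in force)
  have ev2: "eventually (\<lambda>y. L y \<ge> l) (at x)" if l: "l < L x" "l \<in> I" for l
    using order_tendstoD(2)[OF lim[OF l(2)] neg[OF x l(2) l(1)]] S'
    by eventually_elim (use pos[OF _ l(2)] in force)
  obtain e where e: "e > 0" "ball (L x) e \<subseteq> I" using I L[OF x] open_contains_ball by blast
  show "isCont L x"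
    unfolding isCont_def
  proof (rule order_tendstoI)
    fix a assume "a < L x"
    define l where "l = max ((a + L x)/2) (L x - e/2)"
    have "l < L x" "l \<in> I" using \<open>a < L x\<close> e by (auto simp: l_def dist_real_def subset_iff)
    from ev2[OF this] show "eventually (\<lambda>y. a < L y) (at x)" 
      by eventually_elim (use \<open>a < L x\<close> in \<open>auto simp: l_def max_def min_def split: if_splits\<close>)
  next
    fix a assume "a > L x"
    define l where "l = min ((a + L x)/2) (L x + e/2)"
    have "l > L x" "l \<in> I" using \<open>a > L x\<close> e by (auto simp: l_def dist_real_def subset_iff)
    from ev[OF this] show "eventually (\<lambda>y. a > L y) (at x)" 
      by eventually_elim (use \<open>a > L x\<close> in \<open>auto simp: l_def max_def min_def split: if_splits\<close>)
  qed
qed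

text \<open>The expansion of F at (x, L x) bounds \<open>P (y - x, 0) + b * (L y - L x)\<close> by
  an error that still contains L y - L x. A first use with a coarse error absorbs that term and
  shows that L is Lipschitz at x; a second use with a fine error then gives the derivative.\<close>

lemma implicit_has_derivative:
  fixes F :: "'a::euclidean_space \<times> real \<Rightarrow> real"
  assumes F: "(F has_derivative P) (at (x, L x))" and b: "P (0, 1) \<noteq> 0"
    and S: "open S" "x \<in> S" and 0: "\<And>y. y \<in> S \<Longrightarrow> F (y, L y) = 0" and c: "isCont L x"
  shows "(L has_derivative (\<lambda>v. - P (v, 0) / P (0, 1))) (at x)"
proof -
  define b where "b = P (0, 1)"
  have linP: "linear P" using F has_derivative_linear by blast
  have bl: "bounded_linear (\<lambda>v. P (v, 0))"
    using bounded_linear_compose[OF has_derivative_bounded_linear[OF F], of "\<lambda>v. (v, 0)"]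
    by (simp add: bounded_linear_Pair bounded_linear_ident bounded_linear_zero)
  obtain K where K: "K > 0" "\<And>v. \<bar>P (v, 0)\<bar> \<le> norm v * K" using bounded_linear.pos_bounded[OF bl] by auto
  have Psplit: "P (u, l) = P (u, 0) + b * l" for u l
  proof -
    have "P (u, l) = P ((u, 0) + l *\<^sub>R (0, 1))" by simp
    also have "\<dots> = P (u, 0) + l *\<^sub>R P (0, 1)" by (simp only: linear_add[OF linP] linear_scale[OF linP])
    finally show ?thesis by (simp add: b_def mult.commute)
  qed
  have b0: "\<bar>b\<bar> > 0" using b by (simp add: b_def)
  \<comment> \<open>The Lipschitz constant that results from solving |b| * |L y - L x| \<le> |b| / 2
    * (norm (y - x) + |L y - L x|) + K * norm (y - x) for |L y - L x|.\<close>
  define K2 where "K2 = (2 * K + \<bar>b\<bar>) / \<bar>b\<bar>"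
  have K2: "K2 > 0" using K b0 by (simp add: K2_def)
  have small: "\<exists>d>0. \<forall>y. norm (y - x) < d \<longrightarrow> \<bar>P (y - x, 0) + b * (L y - L x)\<bar> \<le> \<eta> * (norm (y - x) + \<bar>L y - L x\<bar>)"
    if "\<eta> > 0" for \<eta>
  proof -
    have "\<exists>d>0. \<forall>z. norm (z - (x, L x)) < d \<longrightarrow> norm (F z - F (x, L x) - P (z - (x, L x))) \<le> \<eta> * norm (z - (x, L x))"
      using F that unfolding has_derivative_at_alt by blast
    then obtain d where d: "d > 0" "\<And>z. norm (z - (x, L x)) < d \<Longrightarrow> \<bar>F z - F (x, L x) - P (z - (x, L x))\<bar> \<le> \<eta> * norm (z - (x, L x))"
      unfolding real_norm_def by blast
    obtain d1 where d1: "d1 > 0" "\<And>y. norm (y - x) < d1 \<Longrightarrow> \<bar>L y - L x\<bar> < d / 2"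
      using c[unfolded continuous_at_eps_delta, rule_format, of "d/2"] d(1) by (auto simp: dist_norm)
    obtain d2 where d2: "d2 > 0" "\<And>y. norm (y - x) < d2 \<Longrightarrow> y \<in> S"
      using S unfolding open_dist by (auto simp: dist_norm)
    show ?thesis
    proof (intro exI conjI allI impI)
      show "min (d/2) (min d1 d2) > 0" using d d1 d2 by simp
      fix y assume y: "norm (y - x) < min (d/2) (min d1 d2)"
      have n: "norm ((y, L y) - (x, L x)) \<le> norm (y - x) + \<bar>L y - L x\<bar>"
        using norm_Pair_le[of "y - x" "L y - L x"] by simp
      have "norm ((y, L y) - (x, L x)) < d" using n y d1(2)[of y] by simp
      from d(2)[OF this] have "\<bar>P (y - x, L y - L x)\<bar> \<le> \<eta> * norm ((y, L y) - (x, L x))"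
        using 0[of x] 0[of y] S(2) d2(2)[of y] y by simp
      also have "\<dots> \<le> \<eta> * (norm (y - x) + \<bar>L y - L x\<bar>)" using n that by (intro mult_left_mono) auto
      finally show "\<bar>P (y - x, 0) + b * (L y - L x)\<bar> \<le> \<eta> * (norm (y - x) + \<bar>L y - L x\<bar>)"
        using Psplit[of "y - x" "L y - L x"] by simp
    qed
  qed
  obtain d0 where d0: "d0 > 0" "\<And>y. norm (y - x) < d0 \<Longrightarrow> \<bar>P (y - x, 0) + b * (L y - L x)\<bar> \<le> \<bar>b\<bar>/2 * (norm (y - x) + \<bar>L y - L x\<bar>)"
    using small[of "\<bar>b\<bar>/2"] b0 by auto
  have lip: "\<bar>L y - L x\<bar> \<le> K2 * norm (y - x)" if "norm (y - x) < d0" for y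
  proof -
    have "\<bar>b\<bar> * \<bar>L y - L x\<bar> = \<bar>(P (y - x, 0) + b * (L y - L x)) - P (y - x, 0)\<bar>" by (simp add: abs_mult)
    also have "\<dots> \<le> \<bar>b\<bar>/2 * (norm (y - x) + \<bar>L y - L x\<bar>) + norm (y - x) * K"
      using d0(2)[OF that] K(2)[of "y - x"] by linarith
    finally have "\<bar>b\<bar> * \<bar>L y - L x\<bar> \<le> (2 * K + \<bar>b\<bar>) * norm (y - x)" by (simp add: algebra_simps)
    then show ?thesis using b0 by (simp add: K2_def field_simps)
  qed
  show ?thesis
    unfolding has_derivative_at_alt
  proof (intro conjI allI impI)
    show "bounded_linear (\<lambda>v. - P (v, 0) / P (0, 1))"
      using bounded_linear_mult_left[THEN bounded_linear_compose, OF bl, of "- 1 / P (0, 1)"]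
      by (simp add: field_simps)
    fix e :: real assume e: "e > 0"
    \<comment> \<open>With the Lipschitz bound the error becomes \<eta> * (1 + K2) * norm (y - x),
      which is to equal |b| * e * norm (y - x).\<close>
    define \<eta> where "\<eta> = e * \<bar>b\<bar> / (1 + K2)"
    have \<eta>: "\<eta> > 0" using e b0 K2 by (simp add: \<eta>_def)
    obtain d where d: "d > 0" "\<And>y. norm (y - x) < d \<Longrightarrow> \<bar>P (y - x, 0) + b * (L y - L x)\<bar> \<le> \<eta> * (norm (y - x) + \<bar>L y - L x\<bar>)"
      using small[OF \<eta>] by auto
    show "\<exists>d>0. \<forall>y. norm (y - x) < d \<longrightarrow> norm (L y - L x - - P (y - x, 0) / P (0, 1)) \<le> e * norm (y - x)"
    proof (intro exI conjI allI impI)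
      show "min d d0 > 0" using d d0 by simp
      fix y assume y: "norm (y - x) < min d d0"
      have "\<bar>b\<bar> * norm (L y - L x - - P (y - x, 0) / P (0, 1)) = \<bar>P (y - x, 0) + b * (L y - L x)\<bar>"
      proof -
        have "L y - L x - - P (y - x, 0) / P (0, 1) = (P (y - x, 0) + b * (L y - L x)) / b"
          using b by (simp add: b_def field_simps)
        then show ?thesis using b0 by (simp add: abs_divide)
      qed
      also have "\<dots> \<le> \<eta> * (norm (y - x) + \<bar>L y - L x\<bar>)" using d(2) y by simp
      also have "\<dots> \<le> \<eta> * (norm (y - x) + K2 * norm (y - x))"
        using lip[of y] y \<eta> by (intro mult_left_mono add_left_mono) auto
      also have "\<dots> = \<bar>b\<bar> * (e * norm (y - x))" using K2 by (simp add: \<eta>_def field_simps)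
      finally show "norm (L y - L x - - P (y - x, 0) / P (0, 1)) \<le> e * norm (y - x)" using b0 by simp
    qed
  qed
qed

text \<open>Bootstrapping: the derivative of L is a quotient of derivatives of F along (x, L x), so
  it is as often differentiable as L, and L gains one order in each round.\<close>

lemma implicit_smooth:
  fixes F :: "'a::euclidean_space \<times> real \<Rightarrow> real"
  assumes F: "smooth_on W F" and W: "open W" and S: "open S"
    and L: "\<And>x. x \<in> S \<Longrightarrow> (x, L x) \<in> W" "\<And>x. x \<in> S \<Longrightarrow> F (x, L x) = 0"
    and d: "\<And>x. x \<in> S \<Longrightarrow> frechet_derivative F (at (x, L x)) (0, 1) \<noteq> 0"
    and c: "continuous_on S L"
  shows "smooth_on S L"
proof -
  have der: "(L has_derivative (\<lambda>v. - frechet_derivative F (at (x, L x)) (v, 0) / frechet_derivative F (at (x, L x)) (0, 1))) (at x)"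
    if "x \<in> S" for x
    by (rule implicit_has_derivative[OF smooth_on_has_derivative[OF F L(1)[OF that]] d[OF that] S that L(2)])
      (use c S that in \<open>simp_all add: continuous_on_eq_continuous_at\<close>)
  have "Ck_on k S L" for k
  proof (induction k)
    case 0
    then show ?case using c by simp
  next
    case (Suc k)
    have P: "Ck_on k S (\<lambda>x. frechet_derivative F (at (x, L x)) v)" for v
      by (rule Ck_on_compose[where g="\<lambda>x. (x, L x)" and T=W and f="\<lambda>z. frechet_derivative F (at z) v"])
        (use smooth_on_derivative[OF F W, of v] Suc L(1) in
          \<open>auto simp: smooth_on_def intro!: Ck_on_bilinear[OF bounded_bilinear_mult] Ck_on_Pair Ck_on_id\<close>)
    have inv: "Ck_on k S (\<lambda>x. inverse (frechet_derivative F (at (x, L x)) (0, 1)))"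
      by (rule Ck_on_compose[where T="-{0}" and f=inverse])
        (use P d smooth_on_inverse[of "-{0}" "\<lambda>x::real. x"] in \<open>auto simp: smooth_on_def Ck_on_id\<close>)
    show ?case
    proof (rule Ck_on_SucI[OF der])
      fix v
      have "Ck_on k S (\<lambda>x. - (frechet_derivative F (at (x, L x)) (v, 0) * inverse (frechet_derivative F (at (x, L x)) (0, 1))))"
        by (intro Ck_on_bounded_linear[OF bounded_linear_minus[OF bounded_linear_ident]] Ck_on_bilinear[OF bounded_bilinear_mult] P inv)
      then show "Ck_on k S (\<lambda>x. - frechet_derivative F (at (x, L x)) (v, 0) / frechet_derivative F (at (x, L x)) (0, 1))"
        by (simp add: divide_inverse)
    qed
  qed
  then show ?thesis by (simp add: smooth_on_def)
qed

section \<open>Ordinary differential equations\<close>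

text \<open>The integral from a vanishes for endpoints left of a, so the estimate holds for all s
  \<le> t \<le> b. In \<open>peano\<close> the delayed arguments reach back before a.\<close>

lemma norm_integral_lipschitz:
  fixes h :: "real \<Rightarrow> 'a::euclidean_space"
  assumes h: "continuous_on {a..b} h" "\<And>s. s \<in> {a..b} \<Longrightarrow> norm (h s) \<le> M" and st: "s \<le> t" "t \<le> b" and M: "M \<ge> 0"
  shows "norm (integral {a..t} h - integral {a..s} h) \<le> M * (t - s)"
proof -
  consider "t \<le> a" | "s \<le> a" "a \<le> t" | "a \<le> s" by linarith
  then show ?thesis
  proof cases
    case 1
    then have "integral {a..t} h = 0" "integral {a..s} h = 0" using st
      by (cases "t = a"; cases "s = a"; simp)+
    then show ?thesis using M st by simp
  next
    case 2
    have 0: "integral {a..s} h = 0" using 2 by (cases "s = a") simp_all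
    have "norm (integral {a..t} h) \<le> M * (t - a)"
      by (rule integral_bound) (use 2 st h continuous_on_subset[OF h(1)] in auto)
    also have "\<dots> \<le> M * (t - s)" using 2 M by (intro mult_left_mono) auto
    finally show ?thesis using 0 by simp
  next
    case 3
    have "integral {a..s} h + integral {s..t} h = integral {a..t} h"
      by (rule Henstock_Kurzweil_Integration.integral_combine)
        (use 3 st continuous_on_subset[OF h(1)] in \<open>auto intro!: integrable_continuous_interval\<close>)
    then have "integral {a..t} h - integral {a..s} h = integral {s..t} h" by (simp add: algebra_simps)
    moreover have "norm (integral {s..t} h) \<le> M * (t - s)"
      by (rule integral_bound) (use 3 st h continuous_on_subset[OF h(1)] in auto)
    ultimately show ?thesis by simp
  qed
qed

text \<open>Tonelli's construction: with a delay \<open>1 / (n + 1)\<close> the integral equation is solved exactly after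
  finitely many iterations; Arzela-Ascoli yields a limit as the delay vanishes.\<close>

theorem peano:
  fixes f :: "real \<Rightarrow> 'a::euclidean_space \<Rightarrow> 'a"
  assumes cont: "continuous_on ({a..a+1} \<times> UNIV) (\<lambda>(t, x). f t x)"
    and bnd: "\<And>t x. t \<in> {a..a+1} \<Longrightarrow> norm (f t x) \<le> M"
  obtains x where "x a = x0" "\<And>t. t \<in> {a..a+1} \<Longrightarrow> (x has_vector_derivative f t (x t)) (at t within {a..a+1})"
proof -
  define \<delta> where "\<delta> n = 1 / (real n + 1)" for n :: nat
  have \<delta>: "\<delta> n > 0" for n by (simp add: \<delta>_def)
  \<comment> \<open>For t \<le> a the integral is zero, which prescribes the constant history x0
    before the initial time.\<close>
  define \<Phi> where "\<Phi> n y = (\<lambda>t. x0 + integral {a..t} (\<lambda>s. f s (y (s - \<delta> n))))" for n y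
  define Y where "Y n k = (\<Phi> n ^^ k) (\<lambda>_. x0)" for n k
  have M: "M \<ge> 0" using bnd[of a x0] norm_ge_zero[of "f a x0"] by (simp del: norm_ge_zero)
  have fc: "continuous_on {a..a+1} (\<lambda>s. f s (y (s - \<delta> n)))" if "continuous_on {..a+1} y" for y n
  proof -
    have "continuous_on {a..a+1} (\<lambda>s. y (s - \<delta> n))"
      by (rule continuous_on_compose2[OF that]) (use \<delta>[of n] in \<open>auto intro!: continuous_intros\<close>)
    then show ?thesis
      by (intro continuous_on_compose2[OF cont, of _ "\<lambda>s. (s, y (s - \<delta> n))", simplified]) (auto intro!: continuous_intros)
  qed
  have lip: "norm (\<Phi> n y t - \<Phi> n y s) \<le> M * \<bar>t - s\<bar>" if "continuous_on {..a+1} y" "s \<le> a+1" "t \<le> a+1" for n y s t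
  proof (cases "s \<le> t")
    case True
    then show ?thesis using norm_integral_lipschitz[OF fc[OF that(1), of n] bnd True that(3) M]
      by (simp add: \<Phi>_def)
  next
    case False
    then show ?thesis using norm_integral_lipschitz[OF fc[OF that(1), of n] bnd _ that(2) M, of t]
      by (simp add: \<Phi>_def norm_minus_commute)
  qed
  have cP: "continuous_on {..a+1} (\<Phi> n y)" if "continuous_on {..a+1} y" for n y
    unfolding continuous_on_iff
  proof (intro ballI allI impI)
    fix s and e :: real assume s: "s \<in> {..a+1}" and e: "e > 0"
    show "\<exists>d>0. \<forall>x'\<in>{..a + 1}. dist x' s < d \<longrightarrow> dist (\<Phi> n y x') (\<Phi> n y s) < e"
    proof (intro exI[of _ "e / (M + 1)"] conjI ballI impI)
      show "e / (M + 1) > 0" using e M by simp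
      fix t assume t: "t \<in> {..a+1}" "dist t s < e / (M + 1)"
      have "norm (\<Phi> n y t - \<Phi> n y s) \<le> M * \<bar>t - s\<bar>" using lip[OF that] s t by simp
      also have "\<dots> \<le> (M + 1) * \<bar>t - s\<bar>" by (simp add: mult_right_mono)
      also have "\<dots> < e" using t(2) M by (simp add: dist_real_def field_simps)
      finally show "dist (\<Phi> n y t) (\<Phi> n y s) < e" by (simp add: dist_norm)
    qed
  qed
  have cY: "continuous_on {..a+1} (Y n k)" for n k
    by (induction k) (auto simp: Y_def intro: cP)
  \<comment> \<open>After k iterations the values up to a + k * \<delta> are final, since the
    delayed argument lies one step further left, where the previous iterates already agree.\<close>
  have stab: "t \<le> a + real k * \<delta> n \<Longrightarrow> Y n (Suc k) t = Y n k t" for n k t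
  proof (induction k arbitrary: t)
    case 0
    then show ?case by (cases "t = a") (auto simp: Y_def \<Phi>_def)
  next
    case (Suc k)
    have "integral {a..t} (\<lambda>s. f s (Y n (Suc k) (s - \<delta> n))) = integral {a..t} (\<lambda>s. f s (Y n k (s - \<delta> n)))"
    proof (rule integral_cong)
      fix s assume "s \<in> {a..t}"
      then have "s - \<delta> n \<le> a + real k * \<delta> n" using Suc.prems by (auto simp: algebra_simps)
      then show "f s (Y n (Suc k) (s - \<delta> n)) = f s (Y n k (s - \<delta> n))" using Suc.IH by simp
    qed
    then have "\<Phi> n (Y n (Suc k)) t = \<Phi> n (Y n k) t" unfolding \<Phi>_def by simp
    then show ?case by (simp add: Y_def)
  qed
  \<comment> \<open>n + 1 steps of length 1 / (n + 1) reach a + 1, so on {..a + 1} this iterate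
    solves the delayed equation exactly.\<close>
  define y where "y n = Y n (Suc n)" for n
  have y_fix: "y n t = \<Phi> n (y n) t" if "t \<le> a + 1" for n t
  proof -
    have "real (Suc n) * \<delta> n = 1" by (simp add: \<delta>_def)
    then show ?thesis using stab[of t "Suc n" n] that by (simp add: y_def Y_def)
  qed
  have cy: "continuous_on {..a+1} (y n)" for n unfolding y_def by (rule cY)
  have ylip: "norm (y n t - y n s) \<le> M * \<bar>t - s\<bar>" if "s \<le> a+1" "t \<le> a+1" for n s t
    using lip[OF cy that, of n] y_fix[OF that(1), of n] y_fix[OF that(2), of n] by simp
  have ya: "y n a = x0" for n using y_fix[of a n] by (simp add: \<Phi>_def)
  obtain g k where g: "continuous_on {a..a+1} g" "strict_mono (k :: nat \<Rightarrow> nat)"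
      "\<And>e. 0 < e \<Longrightarrow> \<exists>N. \<forall>n x. n \<ge> N \<and> x \<in> {a..a+1} \<longrightarrow> norm (y (k n) x - g x) < e"
  proof (rule Arzela_Ascoli[of "{a..a+1}" y "norm x0 + M"])
    fix n t assume t: "t \<in> {a..a+1}"
    have "norm (y n t) \<le> norm (y n a) + norm (y n t - y n a)" by (metis norm_triangle_sub)
    also have "\<dots> \<le> norm x0 + M * 1"
      using ylip[of a t n] t ya M mult_left_mono[of "\<bar>t - a\<bar>" 1 M] by (auto intro: order_trans)
    finally show "norm (y n t) \<le> norm x0 + M" by simp
  next
    fix s and e :: real assume s: "s \<in> {a..a+1}" "0 < e"
    show "\<exists>d. 0 < d \<and> (\<forall>n t. t \<in> {a..a+1} \<and> norm (s - t) < d \<longrightarrow> norm (y n s - y n t) < e)"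
    proof (intro exI[of _ "e / (M + 1)"] conjI allI impI)
      show "e / (M + 1) > 0" using s M by simp
      fix n t assume t: "t \<in> {a..a+1} \<and> norm (s - t) < e / (M + 1)"
      have "norm (y n s - y n t) \<le> M * \<bar>s - t\<bar>" using ylip s t by simp
      also have "\<dots> \<le> (M + 1) * \<bar>s - t\<bar>" by (simp add: mult_right_mono)
      also have "\<dots> < e" using t M by (simp add: field_simps)
      finally show "norm (y n s - y n t) < e" .
    qed
  qed auto
  have lim: "(\<lambda>n. y (k n) t) \<longlonglongrightarrow> g t" if "t \<in> {a..a+1}" for t
    unfolding LIMSEQ_iff using g(3) that by blast
  have \<delta>0: "(\<lambda>n. \<delta> (k n)) \<longlonglongrightarrow> 0"
  proof -
    have "\<delta> \<longlonglongrightarrow> 0" unfolding \<delta>_def using LIMSEQ_inverse_real_of_nat by (simp add: inverse_eq_divide add.commute)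
    from LIMSEQ_subseq_LIMSEQ[OF this g(2)] show ?thesis by (simp add: o_def)
  qed
  have gint: "g t = x0 + integral {a..t} (\<lambda>s. f s (g s))" if t: "t \<in> {a..a+1}" for t
  proof -
    have "(\<lambda>n. integral {a..t} (\<lambda>s. f s (y (k n) (s - \<delta> (k n))))) \<longlonglongrightarrow> integral {a..t} (\<lambda>s. f s (g s))"
    proof (rule dominated_convergence(2)[where h="\<lambda>_. M"])
      fix n
      show "(\<lambda>s. f s (y (k n) (s - \<delta> (k n)))) integrable_on {a..t}"
        by (rule integrable_continuous_interval, rule continuous_on_subset[OF fc[OF cy]]) (use t in auto)
      show "\<And>s. s \<in> {a..t} \<Longrightarrow> norm (f s (y (k n) (s - \<delta> (k n)))) \<le> M" using bnd t by auto
    next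
      fix s assume s: "s \<in> {a..t}"
      \<comment> \<open>The common Lipschitz constant M makes the effect of the delay at most M *
        \<delta>.\<close>
      have "(\<lambda>n. y (k n) (s - \<delta> (k n)) - y (k n) s) \<longlonglongrightarrow> 0"
      proof (rule Lim_null_comparison)
        show "\<forall>\<^sub>F n in sequentially. norm (y (k n) (s - \<delta> (k n)) - y (k n) s) \<le> M * \<delta> (k n)"
        proof (intro always_eventually allI)
          fix n
          show "norm (y (k n) (s - \<delta> (k n)) - y (k n) s) \<le> M * \<delta> (k n)"
            using ylip[of s "s - \<delta> (k n)" "k n"] s t \<delta>[of "k n"] by auto
        qed
        show "(\<lambda>n. M * \<delta> (k n)) \<longlonglongrightarrow> 0" using tendsto_mult_left[OF \<delta>0, of M] by simp
      qed
      from tendsto_add[OF this lim[of s]] have "(\<lambda>n. y (k n) (s - \<delta> (k n))) \<longlonglongrightarrow> g s" using s t by simp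
      moreover have "continuous_on UNIV (f s)"
        by (rule continuous_on_compose2[OF cont, of _ "Pair s", simplified]) (use s t in \<open>auto intro!: continuous_intros\<close>)
      ultimately show "(\<lambda>n. f s (y (k n) (s - \<delta> (k n)))) \<longlonglongrightarrow> f s (g s)"
        by (intro continuous_on_tendsto_compose[of UNIV "f s"]) auto
    qed auto
    then have "(\<lambda>n. \<Phi> (k n) (y (k n)) t) \<longlonglongrightarrow> x0 + integral {a..t} (\<lambda>s. f s (g s))"
      unfolding \<Phi>_def by (intro tendsto_intros)
    then have "(\<lambda>n. y (k n) t) \<longlonglongrightarrow> x0 + integral {a..t} (\<lambda>s. f s (g s))" using y_fix t by simp
    then show ?thesis using lim[OF t] LIMSEQ_unique by blast
  qed
  have fg: "continuous_on {a..a+1} (\<lambda>s. f s (g s))"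
    by (intro continuous_on_compose2[OF cont, of _ "\<lambda>s. (s, g s)", simplified]) (auto intro!: continuous_intros g(1))
  show ?thesis
  proof (rule that[of g])
    show "g a = x0" using gint[of a] by simp
    fix t assume t: "t \<in> {a..a+1}"
    have "((\<lambda>t. x0 + integral {a..t} (\<lambda>s. f s (g s))) has_vector_derivative f t (g t)) (at t within {a..a+1})"
      using integral_has_vector_derivative[OF fg t] by (auto intro!: derivative_eq_intros)
    from has_vector_derivative_transform[OF t gint this]
    show "(g has_vector_derivative f t (g t)) (at t within {a..a+1})" .
  qed
qed

text \<open>Gronwall's argument: with L a Lipschitz constant on a ball containing both solutions up
  to time t, the squared distance times exp (- 2 * L * s) does not increase, and it starts at
  0.\<close>

lemma ode_unique_forward:
  fixes f :: "'a::real_inner \<Rightarrow> 'a"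
  assumes lip: "\<And>R. \<exists>L. \<forall>u\<in>cball 0 R. \<forall>v\<in>cball 0 R. norm (f u - f v) \<le> L * norm (u - v)"
    and y: "\<And>t. (y has_vector_derivative f (y t)) (at t)" and z: "\<And>t. (z has_vector_derivative f (z t)) (at t)"
    and 0: "y 0 = z 0" and t: "t \<ge> 0"
  shows "y t = z t"
proof -
  have c: "continuous_on {0..t} y" "continuous_on {0..t} z"
    using y z by (meson continuous_at_imp_continuous_on has_vector_derivative_continuous)+
  have "bounded (y ` {0..t} \<union> z ` {0..t})"
    using c by (auto intro!: compact_imp_bounded compact_continuous_image)
  then obtain R where R: "\<And>s. s \<in> {0..t} \<Longrightarrow> norm (y s) \<le> R" "\<And>s. s \<in> {0..t} \<Longrightarrow> norm (z s) \<le> R"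
    unfolding bounded_iff by (metis UnCI imageI)
  obtain L where L: "\<And>u v. norm u \<le> R \<Longrightarrow> norm v \<le> R \<Longrightarrow> norm (f u - f v) \<le> L * norm (u - v)"
    using lip[of R] by (metis mem_cball_0)
  define E where "E s = ((y s - z s) \<bullet> (y s - z s)) * exp (- 2 * L * s)" for s
  have "E t \<le> E 0"
  proof (rule DERIV_nonpos_imp_nonincreasing[OF t])
    fix s assume s: "0 \<le> s" "s \<le> t"
    define u where "u = y s - z s"
    define w where "w = f (y s) - f (z s)"
    have d: "((\<lambda>s. y s - z s) has_vector_derivative w) (at s)"
      unfolding w_def by (rule has_vector_derivative_diff[OF y z])
    have "((\<lambda>s. (y s - z s) \<bullet> (y s - z s)) has_vector_derivative (u \<bullet> w + w \<bullet> u)) (at s)"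
      using bounded_bilinear.has_vector_derivative[OF bounded_bilinear_inner d d] by (simp add: u_def)
    then have "((\<lambda>s. (y s - z s) \<bullet> (y s - z s)) has_real_derivative (2 * (u \<bullet> w))) (at s)"
      by (simp add: has_real_derivative_iff_has_vector_derivative inner_commute)
    then have "(E has_real_derivative (2 * (u \<bullet> w) - 2 * L * (u \<bullet> u)) * exp (- 2 * L * s)) (at s)"
      unfolding E_def
    proof (rule DERIV_cong[OF DERIV_mult])
      show "((\<lambda>s. exp (- 2 * L * s)) has_real_derivative exp (- 2 * L * s) * (- 2 * L)) (at s)"
        by (auto intro!: derivative_eq_intros)
    qed (simp add: u_def[symmetric] left_diff_distrib)
    moreover have "u \<bullet> w \<le> L * (u \<bullet> u)"
    proof -
      have "u \<bullet> w \<le> norm u * norm w" by (rule norm_cauchy_schwarz)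
      also have "\<dots> \<le> norm u * (L * norm u)"
        unfolding u_def w_def using L R s by (intro mult_left_mono) auto
      also have "\<dots> = L * (u \<bullet> u)" by (simp add: power2_norm_eq_inner[symmetric] power2_eq_square)
      finally show ?thesis .
    qed
    ultimately show "\<exists>d. (E has_real_derivative d) (at s) \<and> d \<le> 0"
      by (intro exI conjI) (auto simp: mult_le_0_iff)
  qed
  then have "(y t - z t) \<bullet> (y t - z t) \<le> 0" using 0 by (simp add: E_def mult_le_0_iff)
  then have "(y t - z t) \<bullet> (y t - z t) = 0" using inner_ge_zero[of "y t - z t"] by linarith
  then show ?thesis by simp
qed

text \<open>Negative times reduce to positive ones, as reversing time turns a solution for f into
  one for - f.\<close>

lemma ode_unique:
  fixes f :: "'a::real_inner \<Rightarrow> 'a"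
  assumes lip: "\<And>R. \<exists>L. \<forall>u\<in>cball 0 R. \<forall>v\<in>cball 0 R. norm (f u - f v) \<le> L * norm (u - v)"
    and y: "\<And>t. (y has_vector_derivative f (y t)) (at t)" and z: "\<And>t. (z has_vector_derivative f (z t)) (at t)"
    and 0: "y 0 = z 0"
  shows "y t = z t"
proof (cases "t \<ge> 0")
  case True
  then show ?thesis using ode_unique_forward[OF lip y z 0] by simp
next
  case False
  have rev: "((\<lambda>s. w (- s)) has_vector_derivative - f (w (- s))) (at s)"
    if "\<And>t. (w has_vector_derivative f (w t)) (at t)" for w s
  proof -
    have "(uminus has_vector_derivative (-1::real)) (at s)" by (auto intro!: derivative_eq_intros)
    from vector_diff_chain_at[OF this that] show ?thesis by (simp add: o_def)
  qed
  have "y (- (- t)) = z (- (- t))"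
    by (rule ode_unique_forward[of "\<lambda>u. - f u" "\<lambda>s. y (- s)" "\<lambda>s. z (- s)"])
      (use lip rev[OF y] rev[OF z] 0 False in \<open>auto simp: norm_minus_commute\<close>)
  then show ?thesis by simp
qed

text \<open>The field is Lipschitz on balls because g' is bounded on compact intervals. The constant
  c lets the lemma serve orbits in time (c = 1) as well as the limiting orbit, whose parameter is
  the angle (c = 1 / nu0).\<close>

lemma planar_hamiltonian_unique:
  fixes g g' :: "real \<Rightarrow> real"
  assumes g: "\<And>x. (g has_real_derivative g' x) (at x)" and g': "continuous_on UNIV g'"
    and 1: "\<And>t. ((\<lambda>t. fst (y t)) has_real_derivative c * snd (y t)) (at t)"
      "\<And>t. ((\<lambda>t. snd (y t)) has_real_derivative - (c * g (fst (y t)))) (at t)"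
    and 2: "\<And>t. ((\<lambda>t. fst (z t)) has_real_derivative c * snd (z t)) (at t)"
      "\<And>t. ((\<lambda>t. snd (z t)) has_real_derivative - (c * g (fst (z t)))) (at t)"
    and 0: "y 0 = z 0"
  shows "y = z"
proof
  define f where "f u = (c * snd u, - (c * g (fst u)))" for u
  have lip: "\<exists>L. \<forall>u\<in>cball 0 R. \<forall>v\<in>cball 0 R. norm (f u - f v) \<le> L * norm (u - v)" for R
  proof -
    have "bounded (g' ` {-R..R})"
      using g' by (intro compact_imp_bounded compact_continuous_image) (auto intro: continuous_on_subset)
    then obtain B where B: "\<And>x. x \<in> {-R..R} \<Longrightarrow> \<bar>g' x\<bar> \<le> B"
      unfolding bounded_iff real_norm_def by blast
    have gl: "\<bar>g x - g y\<bar> \<le> B * \<bar>x - y\<bar>" if "x \<in> {-R..R}" "y \<in> {-R..R}" for x y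
      using field_differentiable_bound[of "{-R..R}" g g' B x y] that B g
      by (auto intro: has_field_derivative_at_within simp: abs_minus_commute)
    show ?thesis
    proof (intro exI[of _ "\<bar>c\<bar> + \<bar>c\<bar> * B"] ballI)
      fix u v :: "real \<times> real" assume uv: "u \<in> cball 0 R" "v \<in> cball 0 R"
      have fs: "\<bar>fst w\<bar> \<le> norm w" "\<bar>snd w\<bar> \<le> norm w" for w :: "real \<times> real"
        using norm_fst_le[of "fst w" "snd w"] norm_snd_le[of "snd w" "fst w"] by simp_all
      have "fst u \<in> {-R..R}" "fst v \<in> {-R..R}" using uv fs(1)[of u] fs(1)[of v] by auto
      note gl' = gl[OF this]
      have B0: "B \<ge> 0" using B[of "fst u"] \<open>fst u \<in> {-R..R}\<close> by (meson abs_ge_zero order_trans)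
      have "norm (f u - f v) \<le> \<bar>c * snd u - c * snd v\<bar> + \<bar>c * g (fst u) - c * g (fst v)\<bar>"
        using norm_Pair_le[of "c * snd u - c * snd v" "- (c * g (fst u) - c * g (fst v))"] by (simp add: f_def)
      also have "\<dots> = \<bar>c\<bar> * \<bar>snd (u - v)\<bar> + \<bar>c\<bar> * \<bar>g (fst u) - g (fst v)\<bar>"
        by (simp add: abs_mult[symmetric] algebra_simps)
      also have "\<dots> \<le> \<bar>c\<bar> * norm (u - v) + \<bar>c\<bar> * (B * norm (u - v))"
      proof (intro add_mono mult_left_mono)
        have "B * \<bar>fst u - fst v\<bar> \<le> B * norm (u - v)" using fs(1)[of "u - v"] B0 by (intro mult_left_mono) auto
        then show "\<bar>g (fst u) - g (fst v)\<bar> \<le> B * norm (u - v)" using gl' by linarith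
      qed (use fs(2)[of "u - v"] in auto)
      finally show "norm (f u - f v) \<le> (\<bar>c\<bar> + \<bar>c\<bar> * B) * norm (u - v)" by (simp add: algebra_simps)
    qed
  qed
  have vd: "(w has_vector_derivative f (w t)) (at t)"
    if "\<And>t. ((\<lambda>t. fst (w t)) has_real_derivative c * snd (w t)) (at t)"
      "\<And>t. ((\<lambda>t. snd (w t)) has_real_derivative - (c * g (fst (w t)))) (at t)" for w t
    using has_vector_derivative_Pair[OF that(1)[of t, unfolded has_real_derivative_iff_has_vector_derivative]
        that(2)[of t, unfolded has_real_derivative_iff_has_vector_derivative]]
    by (simp add: f_def)
  fix t
  show "y t = z t"
    by (rule ode_unique[of f, OF lip]) (auto intro!: vd 1 2 0)
qed

section \<open>The oscillator in scaled variables\<close>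

locale scaled_oscillator =
  fixes h N :: nat and u :: "nat \<Rightarrow> real"
  assumes h1: "h \<ge> 1" and N: "N = 2 * h + 2"
begin

lemma N_facts: "N \<ge> 4" "even N" "N > 0" "N \<noteq> 0" "real N \<ge> 4" "real N > 0"
  using h1 N by auto

text \<open>For e not 0 this is e^N * U (x / e), a polynomial in e: at e = 1 the original potential,
  at e = 0 the limiting one.\<close>

definition pot :: "real \<Rightarrow> real \<Rightarrow> real" where
  "pot x e = x ^ N / real N + (\<Sum>i<N. u i * e ^ (N - i) * x ^ i)"

definition dpot :: "real \<Rightarrow> real \<Rightarrow> real" where
  "dpot x e = x ^ (N - 1) + (\<Sum>i<N. u i * e ^ (N - i) * (real i * x ^ (i - 1)))"

text \<open>The scaled Hamiltonian at the point with polar radius l and angle \<psi>. The ordinate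
  is later taken as - l * sin \<psi>, which has the same square.\<close>

definition energy :: "real \<Rightarrow> real \<Rightarrow> real \<Rightarrow> real" where
  "energy e \<psi> l = (l * sin \<psi>)\<^sup>2 / 2 + pot (l * cos \<psi>) e"

definition denergy :: "real \<Rightarrow> real \<Rightarrow> real \<Rightarrow> real" where
  "denergy e \<psi> l = l * (sin \<psi>)\<^sup>2 + cos \<psi> * dpot (l * cos \<psi>) e"

definition energy0 :: "real \<Rightarrow> real \<Rightarrow> real" where
  "energy0 \<psi> l = (l * sin \<psi>)\<^sup>2 / 2 + (l * cos \<psi>) ^ N / real N"

definition usum :: real where "usum = (\<Sum>i<N. \<bar>u i\<bar>)"

text \<open>Twice the reciprocal of the lower bound for (sin \<psi>)^2 / 2 + (cos \<psi>)^N / N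
  obtained in \<open>energy0_lsup\<close>; at this radius the unperturbed energy is at least 2 in
  every direction.\<close>

definition lsup :: real where "lsup = 2 * (real N * 2 ^ (h + 1))"

text \<open>Chosen so that eps0 * (1 + Q) = 1 / 2, where e * Q bounds the weighted sum of the
  lower-order terms on |x| \<le> lsup + 1 for 0 \<le> e \<le> 1.\<close>

definition eps0 :: real where
  "eps0 = 1 / (2 * (1 + real N * usum * (lsup + 1) ^ N))"

lemma usum_nonneg: "usum \<ge> 0" by (simp add: usum_def sum_nonneg)

lemma lsup_ge1: "lsup \<ge> 1"
proof -
  have "real N * 2 ^ (h + 1) \<ge> 1 * 1" using N_facts by (intro mult_mono one_le_power) auto
  then show ?thesis by (simp add: lsup_def)
qed

lemma eps0: "0 < eps0" "eps0 \<le> 1"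
proof -
  have "0 \<le> real N * usum * (lsup + 1) ^ N" using usum_nonneg lsup_ge1 by simp
  then show "0 < eps0" "eps0 \<le> 1" unfolding eps0_def by (simp_all add: divide_simps)
qed

text \<open>Every term with i < N carries at least one factor e. The weights are 1 for the potential
  and i for x times its derivative, so that one estimate serves both.\<close>

lemma perturbation_bound:
  assumes e: "\<bar>e\<bar> < eps0" and x: "\<bar>x\<bar> \<le> lsup + 1" and a: "\<And>i. i < N \<Longrightarrow> \<bar>a i\<bar> \<le> real N"
  shows "\<bar>\<Sum>i<N. u i * e ^ (N - i) * (a i * x ^ i)\<bar> < 1 / 2"
proof -
    let ?Q = "real N * usum * (lsup + 1) ^ N"
  have e1: "\<bar>e\<bar> \<le> 1" using e eps0 by linarith
  have "\<bar>\<Sum>i<N. u i * e ^ (N - i) * (a i * x ^ i)\<bar> \<le> (\<Sum>i<N. \<bar>u i\<bar> * (\<bar>e\<bar> * (real N * (lsup + 1) ^ N)))"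
  proof (rule order_trans[OF sum_abs], rule sum_mono)
    fix i assume i: "i \<in> {..<N}"
    have "\<bar>e\<bar> ^ (N - i) \<le> \<bar>e\<bar> ^ 1" by (rule power_decreasing) (use i e1 in auto)
    moreover have "\<bar>x\<bar> ^ i \<le> (lsup + 1) ^ i" by (rule power_mono[OF x]) simp
    moreover have "(lsup + 1) ^ i \<le> (lsup + 1) ^ N" by (rule power_increasing) (use i lsup_ge1 in auto)
    ultimately have "\<bar>e\<bar> ^ (N - i) * (\<bar>a i\<bar> * \<bar>x\<bar> ^ i) \<le> \<bar>e\<bar> * (real N * (lsup + 1) ^ N)"
      using a[of i] i by (intro mult_mono) auto
    then show "\<bar>u i * e ^ (N - i) * (a i * x ^ i)\<bar> \<le> \<bar>u i\<bar> * (\<bar>e\<bar> * (real N * (lsup + 1) ^ N))"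
      by (simp add: abs_mult power_abs mult.assoc mult_left_mono)
  qed
  also have "\<dots> = \<bar>e\<bar> * ?Q" unfolding usum_def sum_distrib_right[symmetric] by simp
  also have "\<dots> \<le> \<bar>e\<bar> * (1 + ?Q)" by (simp add: mult_left_mono)
  also have "\<dots> < eps0 * (1 + ?Q)"
    using e usum_nonneg lsup_ge1 by (intro mult_strict_right_mono) (auto intro!: add_pos_nonneg)
  also have "\<dots> = 1 / 2"
  proof -
    have "1 + ?Q > 0" using usum_nonneg lsup_ge1 by (intro add_pos_nonneg) auto
    then show ?thesis unfolding eps0_def by (simp add: divide_simps)
  qed
  finally show ?thesis .
qed

lemma DERIV_pot: "((\<lambda>x. pot x e) has_real_derivative dpot x e) (at x)"
  unfolding pot_def dpot_def
  using N_facts by (auto intro!: derivative_eq_intros sum.cong)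

lemma mult_dpot: "x * dpot x e = x ^ N + (\<Sum>i<N. u i * e ^ (N - i) * (real i * x ^ i))"
proof -
  have 1: "x * (u i * e ^ (N - i) * (real i * x ^ (i - 1))) = u i * e ^ (N - i) * (real i * x ^ i)" for i
    by (cases i) (auto simp: algebra_simps)
  have 2: "x * x ^ (N - 1) = x ^ N" using N_facts by (simp add: power_eq_if)
  show ?thesis unfolding dpot_def distrib_left sum_distrib_left
    by (intro arg_cong2[of _ _ _ _ "(+)"] sum.cong refl 1 2)
qed

lemma DERIV_energy: "((\<lambda>l. energy e \<psi> l) has_real_derivative denergy e \<psi> l) (at l)"
  unfolding energy_def denergy_def
  by (auto intro!: derivative_eq_intros DERIV_chain2[OF DERIV_pot] simp: field_simps power2_eq_square)

lemma energy_near: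
  assumes "\<bar>e\<bar> < eps0" "0 \<le> l" "l \<le> lsup + 1"
  shows "\<bar>energy e \<psi> l - energy0 \<psi> l\<bar> < 1 / 2"
proof -
  have "\<bar>l * cos \<psi>\<bar> \<le> (lsup + 1) * 1"
    unfolding abs_mult using assms lsup_ge1 by (intro mult_mono) auto
  from perturbation_bound[OF assms(1), of "l * cos \<psi>" "\<lambda>_. 1"] this show ?thesis
    by (simp add: energy_def energy0_def pot_def)
qed

text \<open>Multiplied by l, the radial derivative is (l * sin \<psi>)^2 + x^N plus a perturbation
  below 1 / 2, with x = l * cos \<psi>. Since N \<ge> 2, the first part is at least twice the
  unperturbed energy.\<close>

lemma denergy_pos:
  assumes "\<bar>e\<bar> < eps0" "0 < l" "l \<le> lsup + 1" "energy0 \<psi> l \<ge> 1 / 2"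
  shows "denergy e \<psi> l > 0"
proof -
  let ?x = "l * cos \<psi>"
  have x: "\<bar>?x\<bar> \<le> (lsup + 1) * 1"
    unfolding abs_mult using assms lsup_ge1 by (intro mult_mono) auto
  have "?x ^ N \<ge> 0" by (rule zero_le_even_power) (rule N_facts)
  then have "?x ^ N \<ge> 2 * (?x ^ N / real N)"
    using N_facts by (simp add: field_simps mult_right_mono)
  then have "(l * sin \<psi>)\<^sup>2 + ?x ^ N \<ge> 1" using assms(4) unfolding energy0_def by argo
  moreover have "l * denergy e \<psi> l = (l * sin \<psi>)\<^sup>2 + ?x * dpot ?x e"
    by (simp add: denergy_def power2_eq_square algebra_simps)
  ultimately have "l * denergy e \<psi> l > 0"
    using perturbation_bound[OF assms(1), of ?x real] x unfolding mult_dpot by force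
  then show ?thesis using assms(2) by (simp add: zero_less_mult_iff)
qed

lemma energy0_mono:
  assumes "0 \<le> l" "l \<le> m" shows "energy0 \<psi> l \<le> energy0 \<psi> m"
proof -
  have "(l * sin \<psi>)\<^sup>2 \<le> (m * sin \<psi>)\<^sup>2" using assms by (simp add: power_mult_distrib mult_right_mono power_mono)
  moreover have "(l * cos \<psi>) ^ N \<le> (m * cos \<psi>) ^ N"
    unfolding power_mult_distrib using assms N_facts by (intro mult_right_mono power_mono zero_le_even_power) auto
  ultimately show ?thesis unfolding energy0_def by (intro add_mono divide_right_mono) auto
qed

text \<open>One of (sin \<psi>)^2 and (cos \<psi>)^2 is at least 1 / 2; in the second case (cos
  \<psi>)^N is at least (1 / 2)^(h + 1). Beyond radius 1 both terms grow at least like the square of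
  the radius.\<close>

lemma energy0_lsup: "energy0 \<psi> lsup \<ge> 2"
proof -
    define c where "c = 1 / (real N * 2 ^ (h + 1))"
  have c: "c > 0" "c * lsup = 2" using N_facts by (simp_all add: c_def lsup_def)
  have "c \<le> (sin \<psi>)\<^sup>2 / 2 + (cos \<psi>) ^ N / real N"
  proof (cases "(sin \<psi>)\<^sup>2 \<ge> 1 / 2")
    case True
    have "real N * 2 ^ (h + 1) \<ge> 2 * 2" using N_facts by (intro mult_mono self_le_power order_trans[OF _ power_increasing[of 1]]) auto
    then have "c \<le> 1 / 4" unfolding c_def by (simp add: divide_simps)
    moreover have "(cos \<psi>) ^ N / real N \<ge> 0" using N_facts by (simp add: zero_le_even_power)
    ultimately show ?thesis using True by linarith
  next
    case False
    then have "(cos \<psi>)\<^sup>2 \<ge> 1 / 2" using sin_cos_squared_add[of \<psi>] by linarith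
    then have "(1 / 2) ^ (h + 1) \<le> ((cos \<psi>)\<^sup>2) ^ (h + 1)" by (intro power_mono) auto
    also have "\<dots> = (cos \<psi>) ^ N" by (simp only: power_mult[symmetric] N) (simp add: algebra_simps)
    finally have "c \<le> (cos \<psi>) ^ N / real N" by (simp add: c_def power_one_over divide_simps mult.commute)
    moreover have "(sin \<psi>)\<^sup>2 / 2 \<ge> 0" by simp
    ultimately show ?thesis by linarith
  qed
  then have "c * lsup\<^sup>2 \<le> ((sin \<psi>)\<^sup>2 / 2 + (cos \<psi>) ^ N / real N) * lsup\<^sup>2" by (intro mult_right_mono) auto
  also have "\<dots> \<le> (lsup * sin \<psi>)\<^sup>2 / 2 + (lsup * cos \<psi>) ^ N / real N"
  proof -
    have "lsup ^ 2 \<le> lsup ^ N" using lsup_ge1 N_facts by (intro power_increasing) auto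
    then have "lsup ^ 2 * (cos \<psi>) ^ N / real N \<le> lsup ^ N * (cos \<psi>) ^ N / real N"
      using N_facts by (intro divide_right_mono mult_right_mono zero_le_even_power) auto
    then show ?thesis by (simp add: power_mult_distrib algebra_simps)
  qed
  also have "\<dots> = energy0 \<psi> lsup" by (simp add: energy0_def)
  finally have "c * lsup * lsup \<le> energy0 \<psi> lsup" by (simp add: power2_eq_square)
  then show ?thesis using c lsup_ge1 by simp
qed

text \<open>Energy at least 1 means unperturbed energy at least 1 / 2, which does not decrease with
  the radius, and there the radial derivative is positive. So the energy crosses the level 1 only
  once along a ray.\<close>

lemma energy_sign:
  assumes e: "\<bar>e\<bar> < eps0" and L: "0 < l" "l \<le> lsup + 1" "energy e \<psi> l \<ge> 1" and m: "l < m" "m \<le> lsup + 1"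
  shows "energy e \<psi> l < energy e \<psi> m"
proof (rule DERIV_pos_imp_increasing[OF m(1)])
  fix x assume x: "l \<le> x" "x \<le> m"
  have "energy0 \<psi> l \<ge> 1 / 2" using energy_near[OF e, of l \<psi>] L by (auto simp: abs_if split: if_splits)
  then have "energy0 \<psi> x \<ge> 1 / 2" using energy0_mono[of l x \<psi>] L x by simp
  then have "denergy e \<psi> x > 0" using denergy_pos[OF e] L x m by simp
  then show "\<exists>y. ((energy e \<psi>) has_real_derivative y) (at x) \<and> y > 0"
    using DERIV_energy[of e \<psi> x] by blast
qed

text \<open>The energy is below 1 at the centre and above 1 at radius lsup. The strict bound lsup +
  1 leaves room beyond the root, as the implicit function argument works on an open
  interval.\<close>

lemma radius_exists:
  assumes e: "\<bar>e\<bar> < eps0"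
  shows "\<exists>!l. 0 < l \<and> l < lsup + 1 \<and> energy e \<psi> l = 1"
proof (rule ex_ex1I)
  have "energy0 \<psi> 0 = 0" using N_facts by (simp add: energy0_def)
  then have "energy e \<psi> 0 < 1" using energy_near[OF e, of 0 \<psi>] lsup_ge1 by (simp add: abs_less_iff)
  moreover have "energy e \<psi> lsup > 1"
    using energy_near[OF e, of lsup \<psi>] lsup_ge1 energy0_lsup[of \<psi>] by linarith
  ultimately have "\<exists>l. 0 \<le> l \<and> l \<le> lsup \<and> energy e \<psi> l = 1"
    using lsup_ge1 by (intro IVT') (auto intro!: continuous_at_imp_continuous_on DERIV_isCont[OF DERIV_energy])
  then obtain l where l: "0 \<le> l" "l \<le> lsup" "energy e \<psi> l = 1" by blast
  have "l \<noteq> 0" using l(3) \<open>energy e \<psi> 0 < 1\<close> by auto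
  then show "\<exists>l. 0 < l \<and> l < lsup + 1 \<and> energy e \<psi> l = 1" using l by (intro exI[of _ l]) auto
next
  fix l m assume "0 < l \<and> l < lsup + 1 \<and> energy e \<psi> l = 1" "0 < m \<and> m < lsup + 1 \<and> energy e \<psi> m = 1"
  then show "l = m" using energy_sign[OF e, of l \<psi> m] energy_sign[OF e, of m \<psi> l]
    by (cases l m rule: linorder_cases) auto
qed

section \<open>Level curves in polar coordinates\<close>

definition radius :: "real \<times> real \<Rightarrow> real" where
  "radius p = (THE l. 0 < l \<and> l < lsup + 1 \<and> energy (fst p) (snd p) l = 1)"

abbreviation dom :: "(real \<times> real) set" where "dom \<equiv> {-eps0<..<eps0} \<times> UNIV"

lemma open_dom: "open dom" by (simp add: open_Times)

lemma radius:
  assumes "p \<in> dom"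
  shows "0 < radius p" "radius p < lsup + 1" "energy (fst p) (snd p) (radius p) = 1"
  using theI'[OF radius_exists[of "fst p" "snd p"]] assms unfolding radius_def by auto

lemma smooth_energy: "smooth_on UNIV (\<lambda>(q :: (real \<times> real) \<times> real). energy (fst (fst q)) (snd (fst q)) (snd q))"
  unfolding energy_def pot_def divide_inverse by (intro smooth_intros)

lemma denergy_radius_pos: "p \<in> dom \<Longrightarrow> denergy (fst p) (snd p) (radius p) > 0"
proof (rule denergy_pos)
  assume p: "p \<in> dom"
  show "1 / 2 \<le> energy0 (snd p) (radius p)"
  proof -
    have "\<bar>fst p\<bar> < eps0" using p by (auto simp: abs_less_iff)
    from energy_near[OF this, of "radius p" "snd p"] radius[OF p] show ?thesis by linarith
  qed
qed (use radius in \<open>auto simp: less_imp_le\<close>)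

lemma smooth_radius: "smooth_on dom radius"
proof -
  define F where "F = (\<lambda>(q :: (real \<times> real) \<times> real). energy (fst (fst q)) (snd (fst q)) (snd q) - 1)"
  have F: "smooth_on UNIV F" unfolding F_def by (intro smooth_intros smooth_energy)
  have c: "continuous_on dom radius"
  proof (rule implicit_continuous[where F=F and I="{0<..<lsup+1}"])
    show "continuous_on (dom \<times> {0<..<lsup+1}) F" using smooth_on_continuous[OF F] continuous_on_subset by blast
    fix p l assume p: "p \<in> dom" and l: "l \<in> {0<..<lsup+1}"
    note r = radius[OF p]
    have e: "\<bar>fst p\<bar> < eps0" using p by (auto simp: abs_less_iff)
    show "F (p, l) > 0" if "l > radius p"
      using energy_sign[OF e, of "radius p" "snd p" l] r l that by (simp add: F_def)
    show "F (p, l) < 0" if "l < radius p"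
      using energy_sign[OF e, of l "snd p" "radius p"] r l that by (fastforce simp: F_def)
  qed (use open_dom radius in auto)
  show ?thesis
  proof (rule implicit_smooth[OF F _ open_dom _ _ _ c])
    fix p assume p: "p \<in> dom"
    show "F (p, radius p) = 0" using radius[OF p] by (simp add: F_def)
    have "((\<lambda>t. F (p, t)) has_real_derivative denergy (fst p) (snd p) (radius p)) (at (radius p))"
      unfolding F_def by (auto intro!: derivative_eq_intros DERIV_energy)
    from DERIV_unique[OF this smooth_on_partial2[OF F]] denergy_radius_pos[OF p]
    show "frechet_derivative F (at (p, radius p)) (0, 1) \<noteq> 0" by simp
  qed auto
qed

text \<open>Angular velocity of the scaled motion in the clockwise polar angle: for (x, y) = (l *
  cos \<psi>, - l * sin \<psi>) with x' = y and y' = - \<open>dpot\<close>, it is (y^2 + x * dpot) /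
  l^2, that is \<open>denergy\<close> / l.\<close>

definition omega :: "real \<times> real \<Rightarrow> real" where
  "omega p = denergy (fst p) (snd p) (radius p) / radius p"

lemma omega_pos: "p \<in> dom \<Longrightarrow> omega p > 0"
  using denergy_radius_pos radius(1) by (simp add: omega_def)

lemma smooth_omega: "smooth_on dom omega"
  unfolding omega_def denergy_def dpot_def
  by (intro smooth_intros smooth_radius) (use radius(1) in \<open>fastforce\<close>)

lemma DERIV_radius:
  assumes e: "\<bar>e\<bar> < eps0"
  shows "((\<lambda>\<psi>. radius (e, \<psi>)) has_real_derivative
    (radius (e, \<psi>) * sin \<psi> * dpot (radius (e, \<psi>) * cos \<psi>) e - (radius (e, \<psi>))\<^sup>2 * sin \<psi> * cos \<psi>)
      / denergy e \<psi> (radius (e, \<psi>))) (at \<psi>)"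
proof -
  have p: "(e, \<psi>) \<in> dom" for \<psi> using e by auto
  let ?r = "radius (e, \<psi>)"
  obtain r' where r': "((\<lambda>\<psi>. radius (e, \<psi>)) has_real_derivative r') (at \<psi>)"
    using smooth_on_partial2[OF smooth_radius p] by blast
  have "((\<lambda>\<psi>. energy e \<psi> (radius (e, \<psi>))) has_real_derivative
     (?r * sin \<psi>) * (r' * sin \<psi> + ?r * cos \<psi>) + dpot (?r * cos \<psi>) e * (r' * cos \<psi> - ?r * sin \<psi>)) (at \<psi>)"
    unfolding energy_def by (auto intro!: derivative_eq_intros r' DERIV_chain2[OF DERIV_pot] simp: algebra_simps power2_eq_square)
  moreover have "(\<lambda>\<psi>. energy e \<psi> (radius (e, \<psi>))) = (\<lambda>_. 1)" using radius(3)[OF p] by simp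
  ultimately have "(?r * sin \<psi>) * (r' * sin \<psi> + ?r * cos \<psi>) + dpot (?r * cos \<psi>) e * (r' * cos \<psi> - ?r * sin \<psi>) = 0"
    using DERIV_unique[OF _ DERIV_const] by metis
  then have "r' * denergy e \<psi> ?r = ?r * sin \<psi> * dpot (?r * cos \<psi>) e - ?r\<^sup>2 * sin \<psi> * cos \<psi>"
    unfolding denergy_def by algebra
  moreover have "denergy e \<psi> ?r > 0" using denergy_radius_pos[OF p] by simp
  ultimately have "r' = (?r * sin \<psi> * dpot (?r * cos \<psi>) e - ?r\<^sup>2 * sin \<psi> * cos \<psi>) / denergy e \<psi> ?r"
    by (simp add: eq_divide_eq)
  then show ?thesis using r' by simp
qed

text \<open>Parametrized by the polar angle, the level curve follows the Hamiltonian field divided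
  by the angular velocity. After insertion of \<open>DERIV_radius\<close> the numerators collapse by
  (sin \<psi>)^2 + (cos \<psi>)^2 = 1.\<close>

lemma DERIV_curve:
  assumes e: "\<bar>e\<bar> < eps0"
  shows "((\<lambda>\<psi>. radius (e, \<psi>) * cos \<psi>) has_real_derivative - (radius (e, \<psi>) * sin \<psi>) / omega (e, \<psi>)) (at \<psi>)"
    and "((\<lambda>\<psi>. - (radius (e, \<psi>) * sin \<psi>)) has_real_derivative - dpot (radius (e, \<psi>) * cos \<psi>) e / omega (e, \<psi>)) (at \<psi>)"
proof -
  have p: "(e, \<psi>) \<in> dom" using e by auto
  let ?r = "radius (e, \<psi>)"
  let ?d = "denergy e \<psi> ?r"
  let ?D = "dpot (?r * cos \<psi>) e"
  have r: "?r > 0" and d: "?d > 0" using radius(1)[OF p] denergy_radius_pos[OF p] by auto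
  have sc: "(sin \<psi>)\<^sup>2 + (cos \<psi>)\<^sup>2 = 1" by simp
  have dd: "?d = ?r * (sin \<psi>)\<^sup>2 + cos \<psi> * ?D" by (simp add: denergy_def)
  have "(?r * sin \<psi> * ?D - ?r\<^sup>2 * sin \<psi> * cos \<psi>) * cos \<psi> - ?r * sin \<psi> * ?d = - (?r * sin \<psi>) * ?r * ((sin \<psi>)\<^sup>2 + (cos \<psi>)\<^sup>2)"
    unfolding dd by algebra
  note num = this[unfolded sc]
  have "(?r * sin \<psi> * ?D - ?r\<^sup>2 * sin \<psi> * cos \<psi>) / ?d * cos \<psi> - ?r * sin \<psi> =
      ((?r * sin \<psi> * ?D - ?r\<^sup>2 * sin \<psi> * cos \<psi>) * cos \<psi> - ?r * sin \<psi> * ?d) / ?d"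
    using d by (simp add: field_simps)
  also have "\<dots> = - (?r * sin \<psi>) / omega (e, \<psi>)"
    unfolding num omega_def by simp
  finally have "(?r * sin \<psi> * ?D - ?r\<^sup>2 * sin \<psi> * cos \<psi>) / ?d * cos \<psi> - ?r * sin \<psi> = - (?r * sin \<psi>) / omega (e, \<psi>)" .
  then show "((\<lambda>\<psi>. radius (e, \<psi>) * cos \<psi>) has_real_derivative - (?r * sin \<psi>) / omega (e, \<psi>)) (at \<psi>)"
    by (auto intro!: derivative_eq_intros DERIV_radius[OF e] simp: mult.commute[of "sin \<psi>"])
  have "- ((?r * sin \<psi> * ?D - ?r\<^sup>2 * sin \<psi> * cos \<psi>) * sin \<psi>) - ?r * cos \<psi> * ?d = - ?D * ?r * ((sin \<psi>)\<^sup>2 + (cos \<psi>)\<^sup>2)"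
    unfolding dd by algebra
  note num = this[unfolded sc]
  have "- ((?r * sin \<psi> * ?D - ?r\<^sup>2 * sin \<psi> * cos \<psi>) / ?d * sin \<psi> + ?r * cos \<psi>) =
      (- ((?r * sin \<psi> * ?D - ?r\<^sup>2 * sin \<psi> * cos \<psi>) * sin \<psi>) - ?r * cos \<psi> * ?d) / ?d"
    using d by (simp add: field_simps)
  also have "\<dots> = - ?D / omega (e, \<psi>)"
    unfolding num omega_def by simp
  finally have "- ((?r * sin \<psi> * ?D - ?r\<^sup>2 * sin \<psi> * cos \<psi>) / ?d * sin \<psi> + ?r * cos \<psi>) = - ?D / omega (e, \<psi>)" .
  then show "((\<lambda>\<psi>. - (radius (e, \<psi>) * sin \<psi>)) has_real_derivative - ?D / omega (e, \<psi>)) (at \<psi>)"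
    by (auto intro!: derivative_eq_intros DERIV_radius[OF e] simp: algebra_simps)
qed

section \<open>Time, period and phase along a level curve\<close>

lemma radius_2pi: "\<bar>e\<bar> < eps0 \<Longrightarrow> radius (e, \<psi> + 2 * pi) = radius (e, \<psi>)"
  unfolding radius_def by (simp add: energy_def)

lemma omega_2pi: "\<bar>e\<bar> < eps0 \<Longrightarrow> omega (e, \<psi> + 2 * pi) = omega (e, \<psi>)"
  using radius_2pi by (simp add: omega_def denergy_def)

text \<open>Travel time from polar angle 0, by integrating d\<psi> / \<open>omega\<close>. Then
  \<open>tper\<close> is the period of the scaled motion, \<open>nn\<close> its frequency, and
  \<open>Phi\<close> the phase that grows uniformly in time.\<close>

definition tm :: "real \<times> real \<Rightarrow> real" where
  "tm p = (LBINT y=0..snd p. 1 / omega (fst p, y))"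

definition tper :: "real \<Rightarrow> real" where "tper e = tm (e, 2 * pi)"

definition nn :: "real \<Rightarrow> real" where "nn e = 2 * pi / tper e"

definition Phi :: "real \<times> real \<Rightarrow> real" where "Phi p = nn (fst p) * tm p"

lemma omega_pos': "\<bar>e\<bar> < eps0 \<Longrightarrow> omega (e, y) > 0"
  by (rule omega_pos) (auto simp: abs_less_iff)

lemma radius_pos: "\<bar>e\<bar> < eps0 \<Longrightarrow> radius (e, y) > 0"
  by (rule radius(1)) (auto simp: abs_less_iff)

lemma smooth_inv_omega: "smooth_on dom (\<lambda>p. 1 / omega p)"
  by (intro smooth_intros smooth_omega) (use omega_pos in \<open>fastforce\<close>)

lemma smooth_tm: "smooth_on dom tm"
  unfolding tm_def using smooth_on_primitive[OF smooth_inv_omega] by simp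

lemma cont_inv_omega: "\<bar>e\<bar> < eps0 \<Longrightarrow> continuous_on UNIV (\<lambda>y. 1 / omega (e, y))"
  by (rule continuous_on_compose2[OF smooth_on_continuous[OF smooth_inv_omega]])
    (auto intro!: continuous_intros)

lemma DERIV_tm: "\<bar>e\<bar> < eps0 \<Longrightarrow> ((\<lambda>y. tm (e, y)) has_real_derivative 1 / omega (e, y)) (at y)"
  unfolding tm_def using LBINT_has_derivative[OF cont_inv_omega] by simp

lemma tm_0: "tm (e, 0) = 0"
  by (simp add: tm_def zero_ereal_def[symmetric])

lemma tm_less:
  assumes e: "\<bar>e\<bar> < eps0" and "y < z" shows "tm (e, y) < tm (e, z)"
proof (rule DERIV_pos_imp_increasing[OF assms(2)])
  fix x
  have "1 / omega (e, x) > 0" using omega_pos'[OF e] by simp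
  then show "\<exists>d. ((\<lambda>y. tm (e, y)) has_real_derivative d) (at x) \<and> 0 < d" using DERIV_tm[OF e] by blast
qed

text \<open>Stated for any period c of the angular velocity: 2 * pi in general, and also pi at e =
  0, where a half turn is a symmetry.\<close>

lemma tm_add:
  assumes e: "\<bar>e\<bar> < eps0" and c: "\<And>y. omega (e, y + c) = omega (e, y)"
  shows "tm (e, y + c) = tm (e, y) + tm (e, c)"
proof -
  define G where "G y = tm (e, y + c) - tm (e, y)" for y
  have "(G has_real_derivative 0) (at y)" for y
    unfolding G_def
    by (rule derivative_eq_intros DERIV_chain2[OF DERIV_tm[OF e]] DERIV_tm[OF e] refl)+ (simp add: c)
  then have "G y = G 0" using DERIV_isconst_all by blast
  then show ?thesis by (simp add: G_def tm_0)
qed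

lemma tper_pos: "\<bar>e\<bar> < eps0 \<Longrightarrow> tper e > 0"
  using tm_less[of e 0 "2 * pi"] tm_0 by (simp add: tper_def)

lemma nn_pos: "\<bar>e\<bar> < eps0 \<Longrightarrow> nn e > 0"
  using tper_pos by (simp add: nn_def)

lemma smooth_nn: "smooth_on {-eps0<..<eps0} nn"
  unfolding nn_def tper_def
proof (intro smooth_intros smooth_on_compose[OF smooth_tm])
  fix e assume "e \<in> {-eps0<..<eps0}"
  then show "tm (e, 2 * pi) \<noteq> 0" using tper_pos[of e] by (auto simp: tper_def abs_less_iff)
qed auto

lemma smooth_Phi: "smooth_on dom Phi"
  unfolding Phi_def by (intro smooth_intros smooth_tm smooth_on_compose[OF smooth_nn]) auto

lemma DERIV_Phi: "\<bar>e\<bar> < eps0 \<Longrightarrow> ((\<lambda>y. Phi (e, y)) has_real_derivative nn e / omega (e, y)) (at y)"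
  unfolding Phi_def by (auto intro!: derivative_eq_intros DERIV_tm)

lemma Phi_less: "\<bar>e\<bar> < eps0 \<Longrightarrow> y < z \<Longrightarrow> Phi (e, y) < Phi (e, z)"
  using tm_less nn_pos by (simp add: Phi_def)

lemma Phi_0: "Phi (e, 0) = 0" by (simp add: Phi_def tm_0)

lemma Phi_2pi: "\<bar>e\<bar> < eps0 \<Longrightarrow> Phi (e, y + 2 * pi) = Phi (e, y) + 2 * pi"
  using tm_add[of e "2 * pi" y] tper_pos[of e] omega_2pi[of e]
  by (simp add: Phi_def distrib_left nn_def tper_def[symmetric])

lemma Phi_multiple: "\<bar>e\<bar> < eps0 \<Longrightarrow> Phi (e, y + real k * (2 * pi)) = Phi (e, y) + real k * (2 * pi)"
proof (induction k)
  case (Suc k)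
  have "y + real (Suc k) * (2 * pi) = (y + real k * (2 * pi)) + 2 * pi" by (simp add: algebra_simps)
  then have "Phi (e, y + real (Suc k) * (2 * pi)) = Phi (e, y + real k * (2 * pi)) + 2 * pi"
    using Phi_2pi[OF Suc.prems] by metis
  then show ?case using Suc by (simp add: algebra_simps)
qed simp

lemma Phi_surj:
  assumes e: "\<bar>e\<bar> < eps0" shows "\<exists>!y. Phi (e, y) = \<phi>"
proof (rule ex_ex1I)
  \<comment> \<open>At integer multiples of 2 * pi the phase equals the polar angle, so \<phi> is
    bracketed between two such multiples.\<close>
  obtain k :: nat where k: "\<bar>\<phi>\<bar> / (2 * pi) \<le> real k" using real_arch_simple by blast
  then have k: "\<bar>\<phi>\<bar> \<le> real k * (2 * pi)" by (simp add: divide_simps)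
  have "Phi (e, real k * (2 * pi)) = real k * (2 * pi)" "Phi (e, - (real k * (2 * pi))) = - (real k * (2 * pi))"
    using Phi_multiple[OF e, of 0 k] Phi_multiple[OF e, of "- (real k * (2 * pi))" k] by (simp_all add: Phi_0)
  then have "\<exists>y. - (real k * (2 * pi)) \<le> y \<and> y \<le> real k * (2 * pi) \<and> Phi (e, y) = \<phi>"
    using k by (intro IVT') (auto intro!: continuous_at_imp_continuous_on DERIV_isCont[OF DERIV_Phi[OF e]])
  then show "\<exists>y. Phi (e, y) = \<phi>" by blast
next
  fix y z assume "Phi (e, y) = \<phi>" "Phi (e, z) = \<phi>"
  then show "y = z" using Phi_less[OF e, of y z] Phi_less[OF e, of z y] by (cases y z rule: linorder_cases) auto
qed

definition angle :: "real \<times> real \<Rightarrow> real" where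
  "angle p = (THE y. Phi (fst p, y) = snd p)"

lemma Phi_angle: "\<bar>e\<bar> < eps0 \<Longrightarrow> Phi (e, angle (e, \<phi>)) = \<phi>"
  unfolding angle_def using theI'[OF Phi_surj] by simp

lemma angle_Phi: "\<bar>e\<bar> < eps0 \<Longrightarrow> Phi (e, y) = \<phi> \<Longrightarrow> angle (e, \<phi>) = y"
  unfolding angle_def using the1_equality[OF Phi_surj] by simp

lemma angle_0: "\<bar>e\<bar> < eps0 \<Longrightarrow> angle (e, 0) = 0"
  using angle_Phi Phi_0 by blast

lemma angle_2pi: "\<bar>e\<bar> < eps0 \<Longrightarrow> angle (e, \<phi> + 2 * pi) = angle (e, \<phi>) + 2 * pi"
  by (rule angle_Phi) (simp_all add: Phi_2pi Phi_angle)

lemma angle_less: 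
  assumes e: "\<bar>e\<bar> < eps0" and "\<phi> < \<psi>" shows "angle (e, \<phi>) < angle (e, \<psi>)"
  using Phi_less[OF e, of "angle (e, \<psi>)" "angle (e, \<phi>)"] Phi_angle[OF e] assms(2) 
  by (cases "angle (e, \<phi>)" "angle (e, \<psi>)" rule: linorder_cases) (auto, metis less_irrefl)

text \<open>Implicit functions for \<open>Phi (e, y) = \<phi>\<close>, whose derivative in y is the
  positive quotient \<open>nn\<close> / \<open>omega\<close>.\<close>

lemma smooth_angle: "smooth_on dom angle"
proof -
  define F where "F = (\<lambda>(q :: (real \<times> real) \<times> real). Phi (fst (fst q), snd q) - snd (fst q))"
  have oW: "open (dom \<times> (UNIV :: real set))" using open_dom by (simp add: open_Times)
  have F: "smooth_on (dom \<times> UNIV) F" unfolding F_def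
    by (intro smooth_intros smooth_on_compose[OF smooth_Phi]) auto
  have c: "continuous_on dom angle"
  proof (rule implicit_continuous[where F=F and I=UNIV])
    show "continuous_on (dom \<times> UNIV) F" using smooth_on_continuous[OF F] .
    fix p and l :: real assume p: "p \<in> dom"
    have e: "\<bar>fst p\<bar> < eps0" using p by (auto simp: abs_less_iff)
    have "Phi (fst p, angle p) = snd p" using Phi_angle[OF e, of "snd p"] by simp
    then show "l > angle p \<Longrightarrow> F (p, l) > 0" "l < angle p \<Longrightarrow> F (p, l) < 0"
      using Phi_less[OF e, of "angle p" l] Phi_less[OF e, of l "angle p"] by (simp_all add: F_def)
  qed (use open_dom in auto)
  show ?thesis
  proof (rule implicit_smooth[OF F oW open_dom _ _ _ c])
    fix p assume p: "p \<in> dom"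
    have e: "\<bar>fst p\<bar> < eps0" using p by (auto simp: abs_less_iff)
    show "F (p, angle p) = 0" using Phi_angle[OF e, of "snd p"] by (simp add: F_def)
    show pW: "(p, angle p) \<in> dom \<times> UNIV" using p by simp
    have "((\<lambda>t. F (p, t)) has_real_derivative nn (fst p) / omega (fst p, angle p)) (at (angle p))"
      unfolding F_def by (auto intro!: derivative_eq_intros DERIV_Phi[OF e])
    moreover have "nn (fst p) / omega (fst p, angle p) > 0" using nn_pos[OF e] omega_pos[of "(fst p, angle p)"] p by auto
    ultimately show "frechet_derivative F (at (p, angle p)) (0, 1) \<noteq> 0"
      using DERIV_unique[OF _ smooth_on_partial2[OF F pW]] by fastforce
  qed
qed

lemma DERIV_angle:
  assumes e: "\<bar>e\<bar> < eps0"
  shows "((\<lambda>\<phi>. angle (e, \<phi>)) has_real_derivative omega (e, angle (e, \<phi>)) / nn e) (at \<phi>)"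
proof -
  have p: "(e, \<phi>) \<in> dom" "(e, angle (e, \<phi>)) \<in> dom" using e by auto
  obtain d where d: "((\<lambda>\<phi>. angle (e, \<phi>)) has_real_derivative d) (at \<phi>)"
    using smooth_on_partial2[OF smooth_angle p(1)] by blast
  have "((\<lambda>\<phi>. Phi (e, angle (e, \<phi>))) has_real_derivative nn e / omega (e, angle (e, \<phi>)) * d) (at \<phi>)"
    by (rule DERIV_chain2[OF DERIV_Phi[OF e] d])
  then have "((\<lambda>\<phi>. \<phi>) has_real_derivative nn e / omega (e, angle (e, \<phi>)) * d) (at \<phi>)"
    using Phi_angle[OF e] by simp
  then have "nn e / omega (e, angle (e, \<phi>)) * d = 1" using DERIV_unique DERIV_ident by blast
  then have "d = omega (e, angle (e, \<phi>)) / nn e" using nn_pos[OF e] omega_pos[OF p(2)] by (simp add: field_simps)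
  then show ?thesis using d by simp
qed

text \<open>\<open>xi\<close> and \<open>eta\<close> are the coordinates of the scaled orbit as
  functions of phase. The motion runs clockwise, whence the minus sign in
  \<open>eta\<close>.\<close>

definition xi :: "real \<times> real \<Rightarrow> real" where
  "xi p = radius (fst p, angle p) * cos (angle p)"

definition eta :: "real \<times> real \<Rightarrow> real" where
  "eta p = - (radius (fst p, angle p) * sin (angle p))"

lemma smooth_xi: "smooth_on dom xi"
  unfolding xi_def by (intro smooth_intros smooth_angle smooth_on_compose[OF smooth_radius]) auto

lemma smooth_eta: "smooth_on dom eta"
  unfolding eta_def by (intro smooth_intros smooth_angle smooth_on_compose[OF smooth_radius]) auto

lemma DERIV_xi:
  assumes e: "\<bar>e\<bar> < eps0"
  shows "((\<lambda>\<phi>. xi (e, \<phi>)) has_real_derivative eta (e, \<phi>) / nn e) (at \<phi>)"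
proof -
  have "omega (e, angle (e, \<phi>)) > 0" using omega_pos'[OF e] by simp
  then show ?thesis
    using DERIV_chain2[OF DERIV_curve(1)[OF e] DERIV_angle[OF e], of \<phi>]
    by (simp add: xi_def eta_def)
qed

lemma DERIV_eta:
  assumes e: "\<bar>e\<bar> < eps0"
  shows "((\<lambda>\<phi>. eta (e, \<phi>)) has_real_derivative - dpot (xi (e, \<phi>)) e / nn e) (at \<phi>)"
proof -
  have "omega (e, angle (e, \<phi>)) > 0" using omega_pos'[OF e] by simp
  then show ?thesis
    using DERIV_chain2[OF DERIV_curve(2)[OF e] DERIV_angle[OF e], of \<phi>]
    by (simp add: xi_def eta_def)
qed

lemma xi_2pi: "\<bar>e\<bar> < eps0 \<Longrightarrow> xi (e, \<phi> + 2 * pi) = xi (e, \<phi>)"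
  by (simp add: xi_def angle_2pi radius_2pi)

lemma eta_2pi: "\<bar>e\<bar> < eps0 \<Longrightarrow> eta (e, \<phi> + 2 * pi) = eta (e, \<phi>)"
  by (simp add: eta_def angle_2pi radius_2pi)

lemma energy_xi_eta: "\<bar>e\<bar> < eps0 \<Longrightarrow> (eta (e, \<phi>))\<^sup>2 / 2 + pot (xi (e, \<phi>)) e = 1"
  using radius(3)[of "(e, angle (e, \<phi>))"] by (auto simp: energy_def xi_def eta_def abs_less_iff)

lemma xi_eta_0: "\<bar>e\<bar> < eps0 \<Longrightarrow> xi (e, 0) > 0" "\<bar>e\<bar> < eps0 \<Longrightarrow> eta (e, 0) = 0"
  using radius(1)[of "(e, 0)"] by (auto simp: xi_def eta_def angle_0 abs_less_iff)

text \<open>A return to the start needs eta = 0 and xi > 0. Strictly between 0 and 2 * pi the sine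
  of the polar angle vanishes only at pi, where the cosine is negative.\<close>

lemma xi_eta_minimal:
  assumes e: "\<bar>e\<bar> < eps0" and \<phi>: "0 < \<phi>" "\<phi> < 2 * pi"
  shows "(xi (e, \<phi>), eta (e, \<phi>)) \<noteq> (xi (e, 0), eta (e, 0))"
proof
  let ?a = "angle (e, \<phi>)"
  assume *: "(xi (e, \<phi>), eta (e, \<phi>)) = (xi (e, 0), eta (e, 0))"
  have a: "0 < ?a" "?a < 2 * pi"
    using angle_less[OF e \<phi>(1)] angle_less[OF e \<phi>(2)] angle_2pi[OF e, of 0] by (simp_all add: angle_0[OF e])
  have r: "radius (e, ?a) > 0" using radius_pos[OF e] by simp
  have "xi (e, \<phi>) > 0" "eta (e, \<phi>) = 0" using * xi_eta_0[OF e] by auto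
  then have "sin ?a = 0" "cos ?a > 0"
    using r by (auto simp: xi_def eta_def zero_less_mult_iff)
  moreover have "?a = pi" if "sin ?a = 0"
    using a that sin_gt_zero[of ?a] sin_lt_zero[of ?a] by (cases ?a pi rule: linorder_cases) auto
  ultimately show False by (metis cos_pi less_numeral_extra(1) not_less_iff_gr_or_eq neg_0_less_iff_less)
qed

lemma pot_0: "pot x 0 = x ^ N / real N"
proof -
  have "(\<Sum>i<N. u i * 0 ^ (N - i) * x ^ i) = 0" by (rule sum.neutral) (auto simp: power_0_left)
  then show ?thesis by (simp add: pot_def)
qed

lemma dpot_0: "dpot x 0 = x ^ (N - 1)"
proof -
  have "(\<Sum>i<N. u i * 0 ^ (N - i) * (real i * x ^ (i - 1))) = 0" by (rule sum.neutral) (auto simp: power_0_left)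
  then show ?thesis by (simp add: dpot_def)
qed

text \<open>At e = 0 the potential is even, so the level curve is symmetric under a half
  turn.\<close>

lemma radius_pi: "radius (0, \<psi> + pi) = radius (0, \<psi>)"
  using N_facts by (simp add: radius_def energy_def pot_0 power_minus_even)

lemma omega_pi: "omega (0, \<psi> + pi) = omega (0, \<psi>)"
proof -
  have "odd (N - 1)" using N_facts by simp
  then show ?thesis by (simp add: omega_def denergy_def radius_pi dpot_0 power_minus_odd)
qed

text \<open>The half period is the integral of d\<psi> / \<open>omega\<close> over a half turn. The
  substitution x = - radius * cos \<psi> / R carries it into the integral in \<open>T0\<close>,
  because the energy relation turns 1 - x^N into (radius * sin \<psi>)^2 / 2.\<close>

lemma nn_0:
  "nn 0 = 2 * pi / (real N powr (1 / real N) * (LBINT x=-1..1. sqrt 2 / sqrt (1 - x ^ N)))"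
proof -
  have e: "\<bar>0\<bar> < eps0" using eps0 by simp
  \<comment> \<open>The largest abscissa on the limiting level curve, with R^N = N; dividing by it
    maps the half turn onto {-1..1}.\<close>
  define R where "R = real N powr (1 / real N)"
  have R: "R > 0" "R ^ N = real N" using N_facts by (simp_all add: R_def powr_realpow[symmetric] powr_powr)
  define f where "f x = sqrt 2 / sqrt (1 - x ^ N)" for x :: real
  define g where "g \<psi> = - (radius (0, \<psi>) * cos \<psi>) / R" for \<psi>
  define g' where "g' \<psi> = (radius (0, \<psi>) * sin \<psi>) / omega (0, \<psi>) / R" for \<psi>
  have p: "(0, \<psi>) \<in> dom" for \<psi> using eps0 by simp
  note r = radius[OF p] and om = omega_pos[OF p]
  have g: "(g has_real_derivative g' \<psi>) (at \<psi>)" for \<psi>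
    unfolding g_def g'_def using DERIV_cdivide[OF DERIV_minus[OF DERIV_curve(1)[OF e, of \<psi>]], of R] by simp
  have gN: "1 - g \<psi> ^ N = (radius (0, \<psi>) * sin \<psi>)\<^sup>2 / 2" for \<psi>
  proof -
    have "g \<psi> ^ N = (radius (0, \<psi>) * cos \<psi>) ^ N / real N"
      using N_facts R(2) by (simp add: g_def power_divide power_minus_even)
    then show ?thesis using r(3)[of \<psi>] by (simp add: energy_def pot_0)
  qed
  have pos: "radius (0, \<psi>) * sin \<psi> > 0" if "0 < \<psi>" "\<psi> < pi" for \<psi>
    using r(1)[of \<psi>] sin_gt_zero that by simp
  have fg: "f (g \<psi>) = 2 / (radius (0, \<psi>) * sin \<psi>)" if "0 < \<psi>" "\<psi> < pi" for \<psi>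
    unfolding f_def gN using pos[OF that] by (simp add: real_sqrt_divide)
  have fg': "f (g \<psi>) * g' \<psi> = 2 / R * (1 / omega (0, \<psi>))" if "0 < \<psi>" "\<psi> < pi" for \<psi>
  proof -
    have "radius (0, \<psi>) \<noteq> 0" "sin \<psi> \<noteq> 0" using pos[OF that] by auto
    then show ?thesis unfolding fg[OF that] g'_def by simp
  qed
  have r0: "radius (0, \<psi>) = R" if "sin \<psi> = 0" "(cos \<psi>) ^ N = 1" for \<psi>
  proof -
    have "radius (0, \<psi>) ^ N = R ^ N" using r(3)[of \<psi>] that N_facts R(2)
      by (simp add: energy_def pot_0 power_mult_distrib field_simps)
    then show ?thesis using r(1)[of \<psi>] R(1) N_facts by (simp add: power_eq_iff_eq_base)
  qed
  have g0: "g 0 = -1" "g pi = 1" using r0[of 0] r0[of pi] R(1) N_facts by (simp_all add: g_def)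
  \<comment> \<open>The integrand is unbounded at both ends, hence the substitution rule for
    nonnegative functions with limits at the endpoints.\<close>
  have "(LBINT x=ereal (-1)..ereal 1. f x) = (LBINT \<psi>=ereal 0..ereal pi. f (g \<psi>) * g' \<psi>)"
  proof (rule interval_integral_substitution_nonneg(2))
    show "ereal 0 < ereal pi" by simp
    show "DERIV g x :> g' x" for x by (rule g)
    show "isCont f (g x)" if x: "ereal 0 < ereal x" "ereal x < ereal pi" for x
    proof -
      have "(radius (0, x) * sin x)\<^sup>2 > 0" using pos[of x] x by (intro zero_less_power) simp
      then have "1 - g x ^ N > 0" unfolding gN by (rule half_gt_zero)
      then have "sqrt (1 - g x ^ N) \<noteq> 0" by simp
      then show ?thesis unfolding f_def by (intro continuous_intros) auto
    qed
    show "isCont g' x" for x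
    proof -
      have "smooth_on dom (\<lambda>p. radius p * sin (snd p) / omega p / R)"
        by (intro smooth_intros smooth_radius smooth_omega) (use omega_pos R in \<open>fastforce\<close>)+
      from DERIV_isCont[OF smooth_on_partial2[OF this p]] show ?thesis by (simp add: g'_def[abs_def])
    qed
    show "0 \<le> f (g x)" if "ereal 0 < ereal x" "ereal x < ereal pi" for x
      using fg[of x] pos[of x] that by simp
    show "0 \<le> g' x" if "ereal 0 \<le> ereal x" "ereal x \<le> ereal pi" for x
      using r(1)[of x] om[of x] R(1) sin_ge_zero[of x] that by (simp add: g'_def)
    show "((ereal \<circ> g \<circ> real_of_ereal) \<longlongrightarrow> ereal (-1)) (at_right (ereal 0))"
      "((ereal \<circ> g \<circ> real_of_ereal) \<longlongrightarrow> ereal 1) (at_left (ereal pi))"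
      unfolding ereal_tendsto_simps using DERIV_isCont[OF g, of 0] DERIV_isCont[OF g, of pi] g0
      by (simp_all add: isCont_def filterlim_at_split)
    have "set_integrable lborel (einterval (ereal 0) (ereal pi)) (\<lambda>\<psi>. 2 / R * (1 / omega (0, \<psi>)))"
    proof -
      have "continuous_on {0..pi} (\<lambda>\<psi>. 2 / R * (1 / omega (0, \<psi>)))"
        by (intro continuous_on_mult continuous_on_const continuous_on_subset[OF cont_inv_omega[OF e]]) simp
      from interval_integrable_continuous_on[OF _ this] show ?thesis
        by (simp add: interval_lebesgue_integrable_def)
    qed
    then show "set_integrable lborel (einterval (ereal 0) (ereal pi)) (\<lambda>x. f (g x) * g' x)"
    proof (rule set_integrable_cong[THEN iffD1, rotated -1])
      fix x assume "x \<in> einterval (ereal 0) (ereal pi)"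
      then have "0 < x" "x < pi" by (auto simp: einterval_iff)
      then show "2 / R * (1 / omega (0, x)) = f (g x) * g' x" using fg'[of x] by simp
    qed auto
  qed
  also have "\<dots> = (LBINT \<psi>=ereal 0..ereal pi. 2 / R * (1 / omega (0, \<psi>)))"
  proof (rule interval_integral_cong)
    fix x assume "x \<in> einterval (min (ereal 0) (ereal pi)) (max (ereal 0) (ereal pi))"
    then have "0 < x" "x < pi" by (auto simp: einterval_iff min_def max_def)
    then show "f (g x) * g' x = 2 / R * (1 / omega (0, x))" using fg'[of x] by simp
  qed
  also have "\<dots> = 2 / R * tm (0, pi)"
    unfolding interval_lebesgue_integral_mult_right by (simp add: tm_def zero_ereal_def)
  finally have "R * (LBINT x=ereal (-1)..ereal 1. f x) = 2 * tm (0, pi)" using R(1) by simp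
  moreover have "tper 0 = 2 * tm (0, pi)"
    using tm_add[OF e omega_pi, of pi] by (simp add: tper_def)
  moreover have "(LBINT x=-1..1. f x) = (LBINT x=ereal (-1)..ereal 1. f x)"
    by (simp add: one_ereal_def)
  ultimately show ?thesis unfolding nn_def f_def R_def by simp
qed

end

section \<open>The oscillator in amplitude-angle variables\<close>

lemma Ck_imp_Ck_on: "Ck k f \<Longrightarrow> Ck_on k UNIV f"
proof (induction k arbitrary: f)
  case (Suc k)
  have "(f has_derivative frechet_derivative f (at x)) (at x)" for x
    using Suc.prems frechet_derivative_works by auto
  moreover have "Ck_on k UNIV (\<lambda>x. frechet_derivative f (at x) v)" for v
    using Suc by auto
  ultimately show ?case by (intro Ck_on_SucI[where f'="\<lambda>x. frechet_derivative f (at x)"])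
qed simp

lemma smooth_imp_smooth_on: "smooth f \<Longrightarrow> smooth_on UNIV f"
  using Ck_imp_Ck_on by (auto simp: smooth_def smooth_on_def)

text \<open>Smoothness is given only for the whole sum. Its difference between 2 * x and x contains
  no constant coefficient; divided by x, it is a sum of degree n in place of n + 1, with
  coefficients multiplied by 2^(i + 1) - 1, which is not 0. The division is the reason for x not
  0.\<close>

lemma smooth_on_coefficients:
  fixes c :: "nat \<Rightarrow> real \<Rightarrow> real"
  assumes "\<And>x. x \<noteq> 0 \<Longrightarrow> smooth_on UNIV (\<lambda>S. \<Sum>i\<le>n. c i S * x ^ i)" "i \<le> n"
  shows "smooth_on UNIV (c i)"
  using assms
proof (induction n arbitrary: c i)
  case 0
  then show ?case using "0.prems"(1)[of 1] by simp
next
  case (Suc n)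
  have sm: "smooth_on UNIV (c (Suc j))" if j: "j \<le> n" for j
  proof -
    have "smooth_on UNIV (\<lambda>S. c (Suc j) S * (2 ^ Suc j - 1))"
    proof (rule Suc.IH[where c="\<lambda>j S. c (Suc j) S * (2 ^ Suc j - 1)", OF _ j])
      fix x :: real assume x: "x \<noteq> 0"
      have "smooth_on UNIV (\<lambda>S. ((\<Sum>i\<le>Suc n. c i S * (2 * x) ^ i) - (\<Sum>i\<le>Suc n. c i S * x ^ i)) * inverse x)"
        by (intro smooth_on_mult smooth_on_diff smooth_on_const Suc.prems(1)) (use x in auto)
      moreover have "((\<Sum>i\<le>Suc n. c i S * (2 * x) ^ i) - (\<Sum>i\<le>Suc n. c i S * x ^ i)) * inverse x
          = (\<Sum>i\<le>n. c (Suc i) S * (2 ^ Suc i - 1) * x ^ i)" for S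
        unfolding sum.atMost_Suc_shift using x
        by (simp add: sum_subtractf[symmetric] sum_distrib_right power_mult_distrib)
          (intro sum.cong refl, simp add: field_simps)
      ultimately show "smooth_on UNIV (\<lambda>S. \<Sum>i\<le>n. c (Suc i) S * (2 ^ Suc i - 1) * x ^ i)" by simp
    qed
    from smooth_on_mult[OF this smooth_on_const[of _ "inverse (2 ^ Suc j - 1)"]]
    show ?thesis
    proof -
      have "(2::real) ^ Suc j > 1" by (rule one_less_power) auto
      then have "(2::real) ^ Suc j - 1 \<noteq> 0" by linarith
      then show ?thesis
        using smooth_on_mult[OF \<open>smooth_on UNIV (\<lambda>S. c (Suc j) S * (2 ^ Suc j - 1))\<close> smooth_on_const[of _ "inverse (2 ^ Suc j - 1)"]]
        by (simp add: mult.assoc del: power_Suc)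
    qed
  qed
  show ?case
  proof (cases i)
    case 0
    have "smooth_on UNIV (\<lambda>S. (\<Sum>i\<le>Suc n. c i S * 1 ^ i) - (\<Sum>i\<le>n. c (Suc i) S))"
      by (intro smooth_on_diff smooth_on_sum Suc.prems(1) sm) auto
    moreover have "(\<Sum>i\<le>Suc n. c i S * 1 ^ i) - (\<Sum>i\<le>n. c (Suc i) S) = c 0 S" for S
      unfolding sum.atMost_Suc_shift by simp
    ultimately show ?thesis using 0 by simp
  next
    case (Suc j)
    then show ?thesis using sm[of j] Suc.prems by simp
  qed
qed

text \<open>For fixed x2 the sum is a polynomial in x1 whose coefficients are polynomials in x2, so
  the one-variable case applies twice.\<close>

lemma smooth_on_coefficients2:
  fixes c :: "nat \<Rightarrow> nat \<Rightarrow> real \<Rightarrow> real"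
  assumes s: "smooth (\<lambda>(x1, x2, S). \<Sum>i\<le>p. \<Sum>j\<le>l. c i j S * x1 ^ i * x2 ^ j)" and "i \<le> p" "j \<le> l"
  shows "smooth_on UNIV (c i j)"
proof (rule smooth_on_coefficients[where n=l])
  fix x2 :: real
  have s1: "smooth_on UNIV (\<lambda>S. \<Sum>i\<le>p. (\<Sum>j\<le>l. c i j S * x2 ^ j) * x1 ^ i)" for x1
  proof -
    have "smooth_on UNIV (\<lambda>S. (\<lambda>(x1, x2, S). \<Sum>i\<le>p. \<Sum>j\<le>l. c i j S * x1 ^ i * x2 ^ j) (x1, x2, S))"
      by (rule smooth_on_compose[OF smooth_imp_smooth_on[OF s]]) (intro smooth_intros, simp)
    then show ?thesis by (simp add: sum_distrib_left sum_distrib_right algebra_simps)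
  qed
  from smooth_on_coefficients[where n=p and c="\<lambda>i S. \<Sum>j\<le>l. c i j S * x2 ^ j", OF s1 \<open>i \<le> p\<close>]
  show "smooth_on UNIV (\<lambda>S. \<Sum>j\<le>l. c i j S * x2 ^ j)" .
qed (rule assms)

definition osc_deg :: "osc \<Rightarrow> nat" where "osc_deg D = 2 * halfdeg D + 2"

locale oscillator =
  fixes D :: osc and \<rho>0 :: real
  assumes adm: "admissible D" and thr: "amplitude_threshold D \<rho>0"
begin

abbreviation h :: nat where "h \<equiv> halfdeg D"
abbreviation N :: nat where "N \<equiv> osc_deg D"

sublocale scaled_oscillator "halfdeg D" "osc_deg D" "ucoef D"
  using adm by unfold_locales (auto simp: admissible_def osc_deg_def)

lemma potU_eq: "potU D x = pot x 1"
proof -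
  have "{..2 * h + 1} = {..<N}" by (auto simp: osc_deg_def)
  then show ?thesis unfolding potU_def pot_def osc_deg_def[symmetric] by simp
qed

lemma power_N: "(\<rho>::real) ^ N = \<rho> * \<rho> ^ (2 * h + 1)" "(\<rho>::real) ^ N = (\<rho> ^ (h + 1))\<^sup>2"
proof -
  have "N = Suc (2 * h + 1)" "N = (h + 1) * 2" by (simp_all add: osc_deg_def)
  then show "\<rho> ^ N = \<rho> * \<rho> ^ (2 * h + 1)" "\<rho> ^ N = (\<rho> ^ (h + 1))\<^sup>2"
    by (metis power_Suc, metis power_mult)
qed

lemma pot_scale: 
  assumes "\<rho> > 0" shows "pot (\<rho> * x) 1 = \<rho> ^ N * pot x (1 / \<rho>)"
proof -
  have "\<rho> ^ N * (1 / \<rho>) ^ (N - i) = \<rho> ^ i" if "i < N" for i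
    using assms that by (simp add: power_diff power_one_over)
  then have "(\<Sum>i<N. ucoef D i * 1 ^ (N - i) * (\<rho> * x) ^ i) = \<rho> ^ N * (\<Sum>i<N. ucoef D i * (1 / \<rho>) ^ (N - i) * x ^ i)"
    unfolding sum_distrib_left by (intro sum.cong refl) (simp add: power_mult_distrib algebra_simps del: power_Suc)
  then show ?thesis
    unfolding pot_def distrib_left by (simp only: power_mult_distrib times_divide_eq_right)
qed

lemma dpot_scale:
  assumes \<rho>: "\<rho> > 0" shows "dpot (\<rho> * x) 1 = \<rho> ^ (2 * h + 1) * dpot x (1 / \<rho>)"
proof -
  have "((\<lambda>x. pot (\<rho> * x) 1) has_real_derivative dpot (\<rho> * x) 1 * \<rho>) (at x)"
    by (rule DERIV_chain2[OF DERIV_pot]) (auto intro!: derivative_eq_intros)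
  moreover have "((\<lambda>x. \<rho> ^ N * pot x (1 / \<rho>)) has_real_derivative \<rho> ^ N * dpot x (1 / \<rho>)) (at x)"
    by (intro DERIV_cmult DERIV_pot)
  ultimately have "dpot (\<rho> * x) 1 * \<rho> = \<rho> ^ N * dpot x (1 / \<rho>)"
    using DERIV_unique unfolding pot_scale[OF \<rho>] by blast
  then have "\<rho> * dpot (\<rho> * x) 1 = \<rho> * (\<rho> ^ (2 * h + 1) * dpot x (1 / \<rho>))"
    by (simp only: power_N(1) mult.commute mult.left_commute)
  then show ?thesis using \<rho> by simp
qed

section \<open>Explicit orbits, period and frequency\<close>

lemma deriv_ham: "deriv (\<lambda>v. ham D x v) y = y" "deriv (\<lambda>v. ham D v y) x = dpot x 1"
  unfolding ham_def potU_eq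
  by (rule DERIV_imp_deriv, auto intro!: derivative_eq_intros DERIV_pot)+

text \<open>Strictly above \<rho>0, so that these amplitudes form an open set, and with 1 / \<rho>
  in the range where the scaled level curves are controlled.\<close>

definition big :: "real \<Rightarrow> bool" where "big \<rho> \<longleftrightarrow> \<rho> > \<rho>0 \<and> 1 / \<rho> < eps0"

lemma bigD: "big \<rho> \<Longrightarrow> \<rho> > 0" "big \<rho> \<Longrightarrow> \<rho> \<ge> \<rho>0" "big \<rho> \<Longrightarrow> \<bar>1 / \<rho>\<bar> < eps0"
  using thr by (auto simp: big_def amplitude_threshold_def)

lemma open_big: "open {\<rho>. big \<rho>}"
proof -
  have "open ({\<rho>0<..} \<inter> {1 / eps0<..})" by (intro open_Int open_greaterThan)
  moreover have "{\<rho>. big \<rho>} = {\<rho>0<..} \<inter> {1 / eps0<..}"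
    using thr eps0 by (auto simp: big_def amplitude_threshold_def field_simps)
  ultimately show ?thesis by simp
qed

text \<open>The scaling undone, with e = 1 / \<rho>: abscissas carry a factor \<rho>, ordinates
  \<rho>^(h + 1), and frequencies \<rho>^h.\<close>

definition nu :: "real \<Rightarrow> real" where "nu \<rho> = \<rho> ^ h * nn (1 / \<rho>)"

definition X1 :: "real \<times> real \<Rightarrow> real" where "X1 q = fst q * xi (1 / fst q, snd q)"

definition X2 :: "real \<times> real \<Rightarrow> real" where "X2 q = fst q ^ (h + 1) * eta (1 / fst q, snd q)"

lemma nu_pos: "big \<rho> \<Longrightarrow> nu \<rho> > 0"
  using bigD[of \<rho>] nn_pos[of "1 / \<rho>"] by (simp add: nu_def)

lemma DERIV_X:
  assumes \<rho>: "big \<rho>"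
  shows "((\<lambda>\<phi>. X1 (\<rho>, \<phi>)) has_real_derivative X2 (\<rho>, \<phi>) / nu \<rho>) (at \<phi>)"
    and "((\<lambda>\<phi>. X2 (\<rho>, \<phi>)) has_real_derivative - dpot (X1 (\<rho>, \<phi>)) 1 / nu \<rho>) (at \<phi>)"
proof -
  note b = bigD[OF \<rho>]
  show "((\<lambda>\<phi>. X1 (\<rho>, \<phi>)) has_real_derivative X2 (\<rho>, \<phi>) / nu \<rho>) (at \<phi>)"
    unfolding X1_def X2_def fst_conv snd_conv
    by (rule DERIV_cong[OF DERIV_cmult[OF DERIV_xi[OF b(3)]]]) (use b in \<open>simp add: nu_def\<close>)
  show "((\<lambda>\<phi>. X2 (\<rho>, \<phi>)) has_real_derivative - dpot (X1 (\<rho>, \<phi>)) 1 / nu \<rho>) (at \<phi>)"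
    unfolding X1_def X2_def fst_conv snd_conv dpot_scale[OF b(1)]
    by (rule DERIV_cong[OF DERIV_cmult[OF DERIV_eta[OF b(3)]]])
      (use b in \<open>simp add: nu_def power_add mult_2\<close>)
qed

lemma energy_X: "big \<rho> \<Longrightarrow> (X2 (\<rho>, \<phi>))\<^sup>2 / 2 + pot (X1 (\<rho>, \<phi>)) 1 = \<rho> ^ N"
proof -
  assume \<rho>: "big \<rho>"
  note b = bigD[OF \<rho>]
  have "(X2 (\<rho>, \<phi>))\<^sup>2 / 2 + pot (X1 (\<rho>, \<phi>)) 1 = \<rho> ^ N * ((eta (1 / \<rho>, \<phi>))\<^sup>2 / 2 + pot (xi (1 / \<rho>, \<phi>)) (1 / \<rho>))"
    by (simp only: X1_def X2_def fst_conv snd_conv pot_scale[OF b(1)] power_mult_distrib distrib_left power_N(2) times_divide_eq_right)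
  then show ?thesis unfolding energy_xi_eta[OF b(3)] by simp
qed

lemma X_2pi: "big \<rho> \<Longrightarrow> X1 (\<rho>, \<phi> + 2 * pi) = X1 (\<rho>, \<phi>)" "big \<rho> \<Longrightarrow> X2 (\<rho>, \<phi> + 2 * pi) = X2 (\<rho>, \<phi>)"
  using bigD(3) xi_2pi eta_2pi by (auto simp: X1_def X2_def)

lemma x_plus_eq:
  assumes \<rho>: "big \<rho>" shows "x_plus D \<rho> = X1 (\<rho>, 0)"
  unfolding x_plus_def osc_deg_def[symmetric]
proof (rule the1_equality)
  note b = bigD[OF \<rho>]
  show "\<exists>!x. 0 < x \<and> potU D x = \<rho> ^ N" using thr b(2) unfolding amplitude_threshold_def osc_deg_def[symmetric] by blast
  have "X2 (\<rho>, 0) = 0" "X1 (\<rho>, 0) > 0" using xi_eta_0[OF b(3)] b(1) by (simp_all add: X1_def X2_def)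
  then show "0 < X1 (\<rho>, 0) \<and> potU D (X1 (\<rho>, 0)) = \<rho> ^ N" using energy_X[OF \<rho>, of 0] by (simp add: potU_eq)
qed

text \<open>The explicit curve is an orbit, so the choice in \<open>xhat\<close> yields an orbit as
  well, and both start at the same point. Uniqueness identifies them.\<close>

lemma xhat_eq:
  assumes \<rho>: "big \<rho>" shows "xhat D \<rho> = (\<lambda>t. (X1 (\<rho>, nu \<rho> * t), X2 (\<rho>, nu \<rho> * t)))"
proof -
  note b = bigD[OF \<rho>]
  let ?o = "\<lambda>t. (X1 (\<rho>, nu \<rho> * t), X2 (\<rho>, nu \<rho> * t))"
  have n: "nu \<rho> \<noteq> 0" using nu_pos[OF \<rho>] by simp
  have lin: "((\<lambda>t. nu \<rho> * t) has_real_derivative nu \<rho>) (at t)" for t by (auto intro!: derivative_eq_intros)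
  have o1: "((\<lambda>t. X1 (\<rho>, nu \<rho> * t)) has_real_derivative X2 (\<rho>, nu \<rho> * t)) (at t)" for t
    using DERIV_chain2[OF DERIV_X(1)[OF \<rho>] lin] n by simp
  have o2: "((\<lambda>t. X2 (\<rho>, nu \<rho> * t)) has_real_derivative - dpot (X1 (\<rho>, nu \<rho> * t)) 1) (at t)" for t
    using DERIV_chain2[OF DERIV_X(2)[OF \<rho>] lin] n by simp
  have X20: "X2 (\<rho>, 0) = 0" using xi_eta_0[OF b(3)] by (simp add: X2_def)
  have o: "is_orbit D \<rho> ?o"
    unfolding is_orbit_def deriv_ham using o1 o2 by (simp add: x_plus_eq[OF \<rho>] X20)
  have x: "is_orbit D \<rho> (xhat D \<rho>)" unfolding xhat_def by (rule someI[of "is_orbit D \<rho>", OF o])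
  have "smooth_on UNIV (\<lambda>x. dpot x 1)" unfolding dpot_def by (intro smooth_intros)
  note sd = smooth_on_frechet_1[OF this open_UNIV]
  show ?thesis
  proof (rule planar_hamiltonian_unique[where c=1])
    show "((\<lambda>x. dpot x 1) has_real_derivative deriv (\<lambda>x. dpot x 1) x) (at x)" for x using sd(2) by simp
    show "continuous_on UNIV (deriv (\<lambda>x. dpot x 1))" using sd(1) by (rule smooth_on_continuous)
  qed (use x o in \<open>simp_all add: is_orbit_def deriv_ham\<close>)
qed

lemma min_period_unique: "is_min_period D \<rho> T \<Longrightarrow> is_min_period D \<rho> T' \<Longrightarrow> T = T'"
  unfolding is_min_period_def by (meson linorder_cases)

lemma period_eqI: "is_min_period D \<rho> T \<Longrightarrow> period D \<rho> = T"
  unfolding period_def using min_period_unique by blast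

lemma min_period_eq:
  assumes \<rho>: "big \<rho>" shows "is_min_period D \<rho> (2 * pi / nu \<rho>)"
  unfolding is_min_period_def xhat_eq[OF \<rho>]
proof (intro conjI allI impI notI)
  note b = bigD[OF \<rho>]
  have n: "nu \<rho> > 0" using nu_pos[OF \<rho>] by simp
  then show "2 * pi / nu \<rho> > 0" by simp
  show "(X1 (\<rho>, nu \<rho> * (t + 2 * pi / nu \<rho>)), X2 (\<rho>, nu \<rho> * (t + 2 * pi / nu \<rho>))) = (X1 (\<rho>, nu \<rho> * t), X2 (\<rho>, nu \<rho> * t))" for t
    using n X_2pi[OF \<rho>, of "nu \<rho> * t"] by (simp add: distrib_left)
  fix T assume T: "0 < T \<and> T < 2 * pi / nu \<rho>"
    and *: "\<forall>t. (X1 (\<rho>, nu \<rho> * (t + T)), X2 (\<rho>, nu \<rho> * (t + T))) = (X1 (\<rho>, nu \<rho> * t), X2 (\<rho>, nu \<rho> * t))"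
  have "0 < nu \<rho> * T" "nu \<rho> * T < 2 * pi" using T n by (simp_all add: field_simps)
  from xi_eta_minimal[OF b(3) this] *[rule_format, of 0] b(1) show False by (simp add: X1_def X2_def)
qed

lemma freq_eq: "big \<rho> \<Longrightarrow> freq D \<rho> = nu \<rho>"
  using period_eqI[OF min_period_eq] nu_pos[of \<rho>] by (simp add: freq_def)

lemma freq_scaled_eq: "big \<rho> \<Longrightarrow> freq_scaled D \<rho> = nn (1 / \<rho>)"
  using bigD(1)[of \<rho>] by (simp add: freq_scaled_def freq_eq nu_def)

lemma Xmap_eq: "big \<rho> \<Longrightarrow> Xmap D \<phi> \<rho> = (X1 (\<rho>, \<phi>), X2 (\<rho>, \<phi>))"
  using nu_pos[of \<rho>] by (simp add: Xmap_def xhat_eq freq_eq)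

section \<open>Injectivity on every window of angles\<close>

lemma Xmap_2pi:
  assumes "\<rho> \<ge> \<rho>0" shows "Xmap D (\<phi> + 2 * pi) \<rho> = Xmap D \<phi> \<rho>"
proof -
  obtain T where T: "is_min_period D \<rho> T" using thr assms unfolding amplitude_threshold_def by blast
  have "(\<phi> + 2 * pi) / freq D \<rho> = \<phi> / freq D \<rho> + T" "T > 0"
    using T by (auto simp: freq_def period_eqI[OF T] is_min_period_def field_simps)
  then show ?thesis using T by (simp add: Xmap_def is_min_period_def)
qed

lemma Xmap_multiple: "\<rho> \<ge> \<rho>0 \<Longrightarrow> Xmap D (\<phi> + real k * (2 * pi)) \<rho> = Xmap D \<phi> \<rho>"
proof (induction k)
  case (Suc k)
  have "\<phi> + real (Suc k) * (2 * pi) = (\<phi> + real k * (2 * pi)) + 2 * pi" by (simp add: algebra_simps)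
  then show ?case using Xmap_2pi[OF Suc.prems] Suc by metis
qed simp

lemma Xmap_multiple_int: "\<rho> \<ge> \<rho>0 \<Longrightarrow> Xmap D (\<phi> - of_int k * (2 * pi)) \<rho> = Xmap D \<phi> \<rho>"
proof (cases "k \<ge> 0")
  case True
  assume \<rho>: "\<rho> \<ge> \<rho>0"
  have "real (nat k) = of_int k" using True by simp
  then show ?thesis using Xmap_multiple[OF \<rho>, of "\<phi> - of_int k * (2 * pi)" "nat k"] by simp
next
  case False
  assume \<rho>: "\<rho> \<ge> \<rho>0"
  have "real (nat (- k)) = - of_int k" using False by simp
  then show ?thesis using Xmap_multiple[OF \<rho>, of \<phi> "nat (- k)"] by simp
qed

text \<open>The threshold speaks about angles in {0..<2 * pi}. Reducing both angles to that window
  does not change the points; two angles of one window of length 2 * pi that differ by a multiple of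
  2 * pi coincide.\<close>

lemma inj_Xmap: "inj_on (\<lambda>(\<rho>, \<phi>). Xmap D \<phi> \<rho>) ({\<rho>0..} \<times> {c..<c + 2 * pi})"
proof (rule inj_onI)
  fix q q'
  assume q: "q \<in> {\<rho>0..} \<times> {c..<c + 2 * pi}" "q' \<in> {\<rho>0..} \<times> {c..<c + 2 * pi}"
    and eq: "(\<lambda>(\<rho>, \<phi>). Xmap D \<phi> \<rho>) q = (\<lambda>(\<rho>, \<phi>). Xmap D \<phi> \<rho>) q'"
  obtain \<rho> \<phi> \<rho>' \<phi>' where qq: "q = (\<rho>, \<phi>)" "q' = (\<rho>', \<phi>')" by (cases q, cases q') auto
  have \<rho>: "\<rho> \<in> {\<rho>0..}" "\<rho>' \<in> {\<rho>0..}" and \<phi>: "\<phi> \<in> {c..<c + 2 * pi}" "\<phi>' \<in> {c..<c + 2 * pi}"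
    and eq: "Xmap D \<phi> \<rho> = Xmap D \<phi>' \<rho>'"
    using q eq by (auto simp: qq)
  define k where "k x = \<lfloor>x / (2 * pi)\<rfloor>" for x
  have red: "x - of_int (k x) * (2 * pi) \<in> {0..<2 * pi}" for x
  proof -
    have "of_int (k x) \<le> x / (2 * pi)" "x / (2 * pi) < of_int (k x) + 1" unfolding k_def by linarith+
    then show ?thesis by (auto simp: field_simps)
  qed
  have "Xmap D (\<phi> - of_int (k \<phi>) * (2 * pi)) \<rho> = Xmap D (\<phi>' - of_int (k \<phi>') * (2 * pi)) \<rho>'"
    using eq \<rho> by (simp add: Xmap_multiple_int)
  moreover have "inj_on (\<lambda>(\<rho>, \<phi>). Xmap D \<phi> \<rho>) ({\<rho>0..} \<times> {0..<2 * pi})"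
    using thr by (simp add: amplitude_threshold_def)
  ultimately have "(\<rho>, \<phi> - of_int (k \<phi>) * (2 * pi)) = (\<rho>', \<phi>' - of_int (k \<phi>') * (2 * pi))"
    using inj_onD[of "\<lambda>(\<rho>, \<phi>). Xmap D \<phi> \<rho>"] red \<rho> by (metis (no_types, lifting) SigmaI case_prod_conv)
  then have e: "\<rho> = \<rho>'" "\<phi> - \<phi>' = of_int (k \<phi> - k \<phi>') * (2 * pi)" by (auto simp: algebra_simps)
  have "\<bar>\<phi> - \<phi>'\<bar> < 2 * pi" using \<phi> by auto
  then have "\<bar>of_int (k \<phi> - k \<phi>') :: real\<bar> < 1" using e(2) by (simp add: abs_mult)
  then have "k \<phi> - k \<phi>' = 0" by linarith
  then show "q = q'" using e by (simp add: qq)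
qed

lemma Ybranch_Xmap: "\<rho> \<ge> \<rho>0 \<Longrightarrow> c \<le> \<phi> \<Longrightarrow> \<phi> < c + 2 * pi \<Longrightarrow> Ybranch D \<rho>0 c (Xmap D \<phi> \<rho>) = (\<rho>, \<phi>)"
  unfolding Ybranch_def using inv_into_f_f[OF inj_Xmap, of "(\<rho>, \<phi>)" c] by simp

end

lemma smooth_on_partial1:
  fixes f :: "real \<times> 'a::euclidean_space \<Rightarrow> real"
  assumes "smooth_on W f" "(x, t) \<in> W"
  shows "((\<lambda>x. f (x, t)) has_real_derivative frechet_derivative f (at (x, t)) (1, 0)) (at x)"
proof -
  have d: "(f has_derivative frechet_derivative f (at (x, t))) (at (x, t))"
    by (rule smooth_on_has_derivative[OF assms])
  have "((\<lambda>x. (x, t)) has_derivative (\<lambda>v. (v, 0))) (at x)" by (auto intro!: derivative_eq_intros)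
  from has_derivative_compose[OF this d]
  have "((\<lambda>x. f (x, t)) has_derivative (\<lambda>v. frechet_derivative f (at (x, t)) (v, 0))) (at x)" .
  moreover have "(\<lambda>v. frechet_derivative f (at (x, t)) (v, 0)) = (*) (frechet_derivative f (at (x, t)) (1, 0))"
  proof
    fix v :: real
    show "frechet_derivative f (at (x, t)) (v, 0) = frechet_derivative f (at (x, t)) (1, 0) * v"
      using linear_scale[OF has_derivative_linear[OF d], of v "(1, 0)"] by simp
  qed
  ultimately show ?thesis by (simp only: has_field_derivative_def)
qed

lemma frechet_derivative_split:
  fixes f :: "real \<times> real \<Rightarrow> real"
  assumes "smooth_on W f" "q \<in> W"
  shows "frechet_derivative f (at q) (a, b) = frechet_derivative f (at q) (1, 0) * a + frechet_derivative f (at q) (0, 1) * b"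
proof -
  have lin: "linear (frechet_derivative f (at q))"
    using has_derivative_linear[OF smooth_on_has_derivative[OF assms]] .
  then show ?thesis
    using linear_add[OF lin, of "a *\<^sub>R (1, 0)" "b *\<^sub>R (0, 1)"] linear_scale[OF lin, of a "(1, 0)"]
      linear_scale[OF lin, of b "(0, 1)"] by (simp add: mult.commute)
qed

lemma frechet_derivative_periodic:
  fixes f :: "'a::euclidean_space \<Rightarrow> real"
  assumes f: "smooth_on S f" and S: "open S" and p: "\<And>x. x \<in> S \<Longrightarrow> x + c \<in> S \<and> f (x + c) = f x" and x: "x \<in> S"
  shows "frechet_derivative f (at (x + c)) = frechet_derivative f (at x)"
proof -
  have "((\<lambda>x. x + c) has_derivative (\<lambda>v. v)) (at x)" by (auto intro!: derivative_eq_intros)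
  from has_derivative_compose[OF this smooth_on_has_derivative[OF f]] p[OF x]
  have "((\<lambda>x. f (x + c)) has_derivative frechet_derivative f (at (x + c))) (at x)" by simp
  then have "(f has_derivative frechet_derivative f (at (x + c))) (at x)"
    by (rule has_derivative_transform_within_open[OF _ S x]) (use p in auto)
  then show ?thesis using frechet_derivative_at by blast
qed

context oscillator
begin

section \<open>Derivatives of amplitude and angle with respect to the velocity\<close>

lemma big_nonzero: "big \<rho> \<Longrightarrow> \<rho> \<noteq> 0"
  using bigD(1) by fastforce

lemma big_dom: "big \<rho> \<Longrightarrow> (1 / \<rho>, \<phi>) \<in> dom"
proof -
  assume "big \<rho>"
  note b = bigD[OF this]
  then have "0 < 1 / \<rho>" "1 / \<rho> < eps0" by simp_all
  then show ?thesis unfolding mem_Times_iff fst_conv greaterThanLessThan_iff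
    using eps0 by (intro conjI UNIV_I) linarith+
qed

lemma chain_recip:
  assumes f: "smooth_on dom f" and \<rho>: "big \<rho>"
  shows "((\<lambda>\<rho>. f (1 / \<rho>, \<phi>)) has_real_derivative
    - frechet_derivative f (at (1 / \<rho>, \<phi>)) (1, 0) / \<rho>\<^sup>2) (at \<rho>)"
proof -
  note b = bigD[OF \<rho>]
  have d: "((\<lambda>\<rho>. 1 / \<rho>) has_real_derivative - 1 / \<rho>\<^sup>2) (at \<rho>)"
    using b by (auto intro!: derivative_eq_intros simp: power2_eq_square)
  from DERIV_chain2[OF smooth_on_partial1[OF f big_dom[OF \<rho>]] d] show ?thesis by simp
qed

lemma smooth_recip:
  assumes f: "smooth_on dom f"
  shows "smooth_on ({\<rho>. big \<rho>} \<times> UNIV) (\<lambda>q. f (1 / fst q, snd q))"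
  by (rule smooth_on_compose[OF f])
    (intro smooth_intros, auto dest: big_nonzero big_dom)

lemma smooth_X: "smooth_on ({\<rho>. big \<rho>} \<times> UNIV) X1" "smooth_on ({\<rho>. big \<rho>} \<times> UNIV) X2"
  unfolding X1_def X2_def
  by (intro smooth_intros smooth_recip[OF smooth_xi] smooth_recip[OF smooth_eta])+

text \<open>The \<rho>-derivative of \<rho> * xi (1 / \<rho>, \<phi>), that is of \<open>X1\<close>,
  written in e = 1 / \<rho>.\<close>

definition chi :: "real \<times> real \<Rightarrow> real" where
  "chi p = xi p - fst p * frechet_derivative xi (at p) (1, 0)"

text \<open>Inverting the Jacobian of (\<rho>, \<phi>) \<mapsto> (X1, X2) yields the x2-derivatives
  of amplitude (i = 1) and angle (i = 2). \<open>W i\<close> is what remains of them after the power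
  \<open>kexp i\<close> of 1 / \<rho> is split off.\<close>

definition W :: "nat \<Rightarrow> real \<times> real \<Rightarrow> real" where
  "W i p = (if i = 1 then eta p / real N else - (chi p * nn (fst p)) / real N)"

definition kexp :: "nat \<Rightarrow> nat" where "kexp i = (if i = 1 then h else h + 1)"

definition w :: "nat \<Rightarrow> real \<times> real \<Rightarrow> real" where
  "w i q = W i (1 / fst q, snd q) / fst q ^ kexp i"

text \<open>The chain rule for the second x2-derivative: the \<rho>-derivative of
  \<open>W i / \<rho> ^ kexp i\<close> produces the bracket, and the last term is the
  \<phi>-derivative; they are multiplied by the first derivatives of amplitude and angle. A common
  power of 1 / \<rho> is split off again.\<close>

definition V :: "nat \<Rightarrow> real \<times> real \<Rightarrow> real" where
  "V i p = (- real (kexp i) * W i p - fst p * frechet_derivative (W i) (at p) (1, 0)) * W 1 p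
    + frechet_derivative (W i) (at p) (0, 1) * W 2 p"

lemma smooth_W: "smooth_on dom (W i)"
proof -
  have "smooth_on dom chi" unfolding chi_def by (intro smooth_intros smooth_xi open_dom)
  then show ?thesis
    unfolding W_def using N_facts
    by (cases "i = 1") (auto intro!: smooth_intros smooth_eta smooth_on_compose[OF smooth_nn])
qed

lemma smooth_V: "smooth_on dom (V i)"
  unfolding V_def by (intro smooth_intros smooth_W open_dom)

lemma frechet_2pi:
  fixes f :: "real \<times> real \<Rightarrow> real"
  assumes "smooth_on dom f" "\<And>e \<phi>. \<bar>e\<bar> < eps0 \<Longrightarrow> f (e, \<phi> + 2 * pi) = f (e, \<phi>)" "\<bar>e\<bar> < eps0"
  shows "frechet_derivative f (at (e, \<phi> + 2 * pi)) = frechet_derivative f (at (e, \<phi>))"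
  using frechet_derivative_periodic[OF assms(1) open_dom, of "(0, 2 * pi)" "(e, \<phi>)"] assms(2,3)
  by (auto simp: abs_less_iff)

lemma W_2pi: "\<bar>e\<bar> < eps0 \<Longrightarrow> W i (e, \<phi> + 2 * pi) = W i (e, \<phi>)"
  by (simp add: W_def chi_def xi_2pi eta_2pi frechet_2pi[OF smooth_xi xi_2pi])

lemma V_2pi: "\<bar>e\<bar> < eps0 \<Longrightarrow> V i (e, \<phi> + 2 * pi) = V i (e, \<phi>)"
  by (simp add: V_def W_2pi frechet_2pi[OF smooth_W W_2pi])

text \<open>The \<phi>-derivatives are the Hamiltonian field divided by \<open>nu\<close>. The last
  identity is the \<rho>-derivative of the energy relation; it says that the Jacobian determinant is
  - N * \<rho>^(2 h + 1) / nu, in particular not 0.\<close>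

lemma X_partials:
  assumes \<rho>: "big \<rho>"
  shows "frechet_derivative X1 (at (\<rho>, \<phi>)) (0, 1) = X2 (\<rho>, \<phi>) / nu \<rho>"
    and "frechet_derivative X2 (at (\<rho>, \<phi>)) (0, 1) = - dpot (X1 (\<rho>, \<phi>)) 1 / nu \<rho>"
    and "frechet_derivative X1 (at (\<rho>, \<phi>)) (1, 0) = chi (1 / \<rho>, \<phi>)"
    and "X2 (\<rho>, \<phi>) * frechet_derivative X2 (at (\<rho>, \<phi>)) (1, 0)
      + dpot (X1 (\<rho>, \<phi>)) 1 * frechet_derivative X1 (at (\<rho>, \<phi>)) (1, 0) = real N * \<rho> ^ (2 * h + 1)"
proof -
  note b = bigD[OF \<rho>]
  have q: "(\<rho>, \<phi>) \<in> {\<rho>. big \<rho>} \<times> UNIV" using \<rho> by simp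
  show "frechet_derivative X1 (at (\<rho>, \<phi>)) (0, 1) = X2 (\<rho>, \<phi>) / nu \<rho>"
    by (rule DERIV_unique[OF smooth_on_partial2[OF smooth_X(1) q] DERIV_X(1)[OF \<rho>]])
  show "frechet_derivative X2 (at (\<rho>, \<phi>)) (0, 1) = - dpot (X1 (\<rho>, \<phi>)) 1 / nu \<rho>"
    by (rule DERIV_unique[OF smooth_on_partial2[OF smooth_X(2) q] DERIV_X(2)[OF \<rho>]])
  have "((\<lambda>\<rho>. X1 (\<rho>, \<phi>)) has_real_derivative chi (1 / \<rho>, \<phi>)) (at \<rho>)"
    unfolding X1_def fst_conv snd_conv
    by (rule DERIV_cong[OF DERIV_mult[OF DERIV_ident chain_recip[OF smooth_xi \<rho>]]])
      (use b in \<open>simp add: chi_def power2_eq_square\<close>)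
  from DERIV_unique[OF smooth_on_partial1[OF smooth_X(1) q] this]
  show "frechet_derivative X1 (at (\<rho>, \<phi>)) (1, 0) = chi (1 / \<rho>, \<phi>)" .
  have "((\<lambda>\<rho>. (X2 (\<rho>, \<phi>))\<^sup>2 / 2 + pot (X1 (\<rho>, \<phi>)) 1) has_real_derivative
      X2 (\<rho>, \<phi>) * frechet_derivative X2 (at (\<rho>, \<phi>)) (1, 0)
      + dpot (X1 (\<rho>, \<phi>)) 1 * frechet_derivative X1 (at (\<rho>, \<phi>)) (1, 0)) (at \<rho>)"
    by (rule DERIV_cong[OF DERIV_add[OF DERIV_cdivide[OF DERIV_power[OF smooth_on_partial1[OF smooth_X(2) q]]]
        DERIV_chain2[OF DERIV_pot smooth_on_partial1[OF smooth_X(1) q]]]]) simp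
  then have "((\<lambda>\<rho>. \<rho> ^ N) has_real_derivative
      X2 (\<rho>, \<phi>) * frechet_derivative X2 (at (\<rho>, \<phi>)) (1, 0)
      + dpot (X1 (\<rho>, \<phi>)) 1 * frechet_derivative X1 (at (\<rho>, \<phi>)) (1, 0)) (at \<rho>)"
    by (rule has_field_derivative_transform_within_open[OF _ open_big]) (use \<rho> energy_X in auto)
  moreover have "((\<lambda>\<rho>. \<rho> ^ N) has_real_derivative real N * \<rho> ^ (2 * h + 1)) (at \<rho>)"
    by (rule DERIV_cong[OF DERIV_pow]) (simp add: osc_deg_def)
  ultimately show "X2 (\<rho>, \<phi>) * frechet_derivative X2 (at (\<rho>, \<phi>)) (1, 0)
      + dpot (X1 (\<rho>, \<phi>)) 1 * frechet_derivative X1 (at (\<rho>, \<phi>)) (1, 0) = real N * \<rho> ^ (2 * h + 1)"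
    using DERIV_unique by blast
qed

abbreviation XX :: "real \<times> real \<Rightarrow> real \<times> real" where "XX q \<equiv> (X1 q, X2 q)"

lemma Ybranch_XX:
  "big \<rho> \<Longrightarrow> c \<le> \<phi> \<Longrightarrow> \<phi> < c + 2 * pi \<Longrightarrow> Ybranch D \<rho>0 c (XX (\<rho>, \<phi>)) = (\<rho>, \<phi>)"
  using Ybranch_Xmap[of \<rho> c \<phi>] bigD(2)[of \<rho>] by (simp add: Xmap_eq)

lemma cont_XX: "continuous_on ({\<rho>. big \<rho>} \<times> T) XX"
  by (intro continuous_on_Pair continuous_on_subset[OF smooth_on_continuous[OF smooth_X(1)]]
      continuous_on_subset[OF smooth_on_continuous[OF smooth_X(2)]]) auto

lemma open_region: "open ({\<rho>. big \<rho>} \<times> {c<..<c + 2 * pi})"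
  using open_big by (simp add: open_Times)

text \<open>By invariance of domain, with injectivity supplied by the left inverse
  \<open>Ybranch\<close>.\<close>

lemma open_image: "open (XX ` ({\<rho>. big \<rho>} \<times> {c<..<c + 2 * pi}))"
proof (rule invariance_of_domain[OF cont_XX open_region])
  show "inj_on XX ({\<rho>. big \<rho>} \<times> {c<..<c + 2 * pi})"
  proof (rule inj_on_inverseI)
    fix q assume "q \<in> {\<rho>. big \<rho>} \<times> {c<..<c + 2 * pi}"
    then show "Ybranch D \<rho>0 c (XX q) = q" using Ybranch_XX[of "fst q" c "snd q"] by auto
  qed
qed

text \<open>The stated map is the inverse of the Jacobian matrix: in the product the off-diagonal
  terms cancel, and each diagonal entry is the last identity of \<open>X_partials\<close> divided by
  its right side.\<close>

lemma has_derivative_Ybranch: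
  assumes \<rho>: "big \<rho>" and c: "c < \<phi>" "\<phi> < c + 2 * pi"
  shows "(Ybranch D \<rho>0 c has_derivative (\<lambda>(dx, dy).
     ((dpot (X1 (\<rho>, \<phi>)) 1 * dx + X2 (\<rho>, \<phi>) * dy) / (real N * \<rho> ^ (2 * h + 1)),
      (frechet_derivative X2 (at (\<rho>, \<phi>)) (1, 0) * dx - frechet_derivative X1 (at (\<rho>, \<phi>)) (1, 0) * dy) * nu \<rho>
        / (real N * \<rho> ^ (2 * h + 1))))) (at (XX (\<rho>, \<phi>)))"
proof (rule has_derivative_inverse_strong[where f=XX and S="{\<rho>. big \<rho>} \<times> {c<..<c + 2 * pi}", OF open_region _ cont_XX])
  let ?q = "(\<rho>, \<phi>)"
  have q: "?q \<in> {\<rho>. big \<rho>} \<times> UNIV" using \<rho> by simp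
  show "?q \<in> {\<rho>. big \<rho>} \<times> {c<..<c + 2 * pi}" using \<rho> c by simp
  show "Ybranch D \<rho>0 c (XX q) = q" if "q \<in> {\<rho>. big \<rho>} \<times> {c<..<c + 2 * pi}" for q
    using Ybranch_XX[of "fst q" c "snd q"] that by auto
  show "(XX has_derivative (\<lambda>v. (frechet_derivative X1 (at ?q) v, frechet_derivative X2 (at ?q) v))) (at ?q)"
    by (intro has_derivative_Pair smooth_on_has_derivative[OF smooth_X(1) q] smooth_on_has_derivative[OF smooth_X(2) q])
  let ?E = "real N * \<rho> ^ (2 * h + 1)"
  define a1 where "a1 = frechet_derivative X1 (at ?q) (1, 0)"
  define a2 where "a2 = frechet_derivative X2 (at ?q) (1, 0)"
  define x2 where "x2 = X2 ?q"
  define dU where "dU = dpot (X1 ?q) 1"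
  define E where "E = ?E"
  have E: "E > 0" using bigD[OF \<rho>] N_facts by (simp add: E_def)
  have n: "nu \<rho> > 0" by (rule nu_pos[OF \<rho>])
  note P = X_partials[OF \<rho>, of \<phi>]
  have en: "x2 * a2 + dU * a1 = E" using P(4) by (simp add: a1_def a2_def x2_def dU_def E_def)
  have s1: "frechet_derivative X1 (at ?q) (a, b) = a1 * a + x2 / nu \<rho> * b" for a b
    unfolding frechet_derivative_split[OF smooth_X(1) q, of a b] P(1) by (simp add: a1_def x2_def)
  have s2: "frechet_derivative X2 (at ?q) (a, b) = a2 * a + - dU / nu \<rho> * b" for a b
    unfolding frechet_derivative_split[OF smooth_X(2) q, of a b] P(2) by (simp add: a2_def dU_def)
  have "a1 * ((dU * x + x2 * y) / E) + x2 / nu \<rho> * ((a2 * x - a1 * y) * nu \<rho> / E) = x" for x y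
  proof -
    have "a1 * ((dU * x + x2 * y) / E) + x2 / nu \<rho> * ((a2 * x - a1 * y) * nu \<rho> / E) = (x2 * a2 + dU * a1) * x / E"
      using n E by (simp add: field_simps)
    then show ?thesis using en E by simp
  qed
  moreover have "a2 * ((dU * x + x2 * y) / E) + - dU / nu \<rho> * ((a2 * x - a1 * y) * nu \<rho> / E) = y" for x y
  proof -
    have "a2 * ((dU * x + x2 * y) / E) + - dU / nu \<rho> * ((a2 * x - a1 * y) * nu \<rho> / E) = (x2 * a2 + dU * a1) * y / E"
      using n E by (simp add: field_simps)
    then show ?thesis using en E by simp
  qed
  ultimately show "(\<lambda>v. (frechet_derivative X1 (at ?q) v, frechet_derivative X2 (at ?q) v)) \<circ>
    (\<lambda>(dx, dy). ((dpot (X1 ?q) 1 * dx + X2 ?q * dy) / ?E,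
      (frechet_derivative X2 (at ?q) (1, 0) * dx - frechet_derivative X1 (at ?q) (1, 0) * dy) * nu \<rho> / ?E)) = id"
    unfolding a1_def[symmetric] a2_def[symmetric] x2_def[symmetric] dU_def[symmetric] E_def[symmetric]
    by (auto simp: fun_eq_iff s1 s2)
qed

lemma DERIV_Ybranch:
  assumes \<rho>: "big \<rho>" and c: "c < \<phi>" "\<phi> < c + 2 * pi"
  shows "((\<lambda>y. Ybranch D \<rho>0 c (X1 (\<rho>, \<phi>), y)) has_derivative (\<lambda>v. (w 1 (\<rho>, \<phi>) * v, w 2 (\<rho>, \<phi>) * v))) (at (X2 (\<rho>, \<phi>)))"
proof -
  note b = bigD[OF \<rho>]
  have "((\<lambda>y. (X1 (\<rho>, \<phi>), y)) has_derivative (\<lambda>v. (0, v))) (at (X2 (\<rho>, \<phi>)))"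
    by (auto intro!: derivative_eq_intros)
  from has_derivative_compose[OF this has_derivative_Ybranch[OF assms]]
  show ?thesis
  proof (rule has_derivative_eq_rhs)
    have p: "\<rho> ^ (2 * h + 1) = \<rho> ^ h * \<rho> ^ (h + 1)" by (simp add: power_add mult_2)
    have e1: "X2 (\<rho>, \<phi>) / (real N * \<rho> ^ (2 * h + 1)) = w 1 (\<rho>, \<phi>)"
      unfolding p using b by (simp add: X2_def w_def W_def kexp_def)
    have e2: "- chi (1 / \<rho>, \<phi>) * nu \<rho> / (real N * \<rho> ^ (2 * h + 1)) = w 2 (\<rho>, \<phi>)"
      unfolding p using b by (simp add: nu_def w_def W_def kexp_def)
    show "(\<lambda>x. case (0, x) of (dx, dy) \<Rightarrow>
       ((dpot (X1 (\<rho>, \<phi>)) 1 * dx + X2 (\<rho>, \<phi>) * dy) / (real N * \<rho> ^ (2 * h + 1)),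
        (frechet_derivative X2 (at (\<rho>, \<phi>)) (1, 0) * dx - frechet_derivative X1 (at (\<rho>, \<phi>)) (1, 0) * dy) * nu \<rho> /
        (real N * \<rho> ^ (2 * h + 1)))) = (\<lambda>v. (w 1 (\<rho>, \<phi>) * v, w 2 (\<rho>, \<phi>) * v))"
      unfolding X_partials(3)[OF \<rho>] e1[symmetric] e2[symmetric] by (auto simp: fun_eq_iff mult_ac)
  qed
qed

lemma DERIV_Ycomp:
  assumes "big \<rho>" "c < \<phi>" "\<phi> < c + 2 * pi" "i \<in> {1, 2}"
  shows "((\<lambda>y. Ycomp D \<rho>0 i c (X1 (\<rho>, \<phi>)) y) has_real_derivative w i (\<rho>, \<phi>)) (at (X2 (\<rho>, \<phi>)))"
proof (cases "i = 1")
  case True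
  have "(\<lambda>v. w 1 (\<rho>, \<phi>) * v) = (*) (w 1 (\<rho>, \<phi>))" by auto
  then show ?thesis using has_derivative_fst[OF DERIV_Ybranch[OF assms(1-3)]] True
    by (simp add: Ycomp_def has_field_derivative_def)
next
  case False
  then have "i = 2" using assms by simp
  have "(\<lambda>v. w 2 (\<rho>, \<phi>) * v) = (*) (w 2 (\<rho>, \<phi>))" by auto
  then show ?thesis using has_derivative_snd[OF DERIV_Ybranch[OF assms(1-3)]] \<open>i = 2\<close>
    by (simp add: Ycomp_def has_field_derivative_def)
qed

lemma dY_1: "big \<rho> \<Longrightarrow> i \<in> {1, 2} \<Longrightarrow> dY D \<rho>0 1 i \<rho> \<phi> = w i (\<rho>, \<phi>)"
  using DERIV_imp_deriv[OF DERIV_Ycomp[of \<rho> "\<phi> - pi" \<phi> i]] by (simp add: dY_def Xmap_eq)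

lemma smooth_w: "smooth_on ({\<rho>. big \<rho>} \<times> UNIV) (w i)"
  unfolding w_def by (intro smooth_intros smooth_recip[OF smooth_W]) (auto dest: big_nonzero)

lemma w_partials:
  assumes \<rho>: "big \<rho>"
  shows "frechet_derivative (w i) (at (\<rho>, \<phi>)) (1, 0) =
      (- real (kexp i) * W i (1 / \<rho>, \<phi>) - 1 / \<rho> * frechet_derivative (W i) (at (1 / \<rho>, \<phi>)) (1, 0)) / \<rho> ^ (kexp i + 1)"
    and "frechet_derivative (w i) (at (\<rho>, \<phi>)) (0, 1) = frechet_derivative (W i) (at (1 / \<rho>, \<phi>)) (0, 1) / \<rho> ^ kexp i"
proof -
  note b = bigD[OF \<rho>]
  have q: "(\<rho>, \<phi>) \<in> {\<rho>. big \<rho>} \<times> UNIV" "(1 / \<rho>, \<phi>) \<in> dom" using \<rho> big_dom by auto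
  have "((\<lambda>\<phi>. w i (\<rho>, \<phi>)) has_real_derivative frechet_derivative (W i) (at (1 / \<rho>, \<phi>)) (0, 1) / \<rho> ^ kexp i) (at \<phi>)"
    unfolding w_def fst_conv snd_conv by (rule DERIV_cdivide[OF smooth_on_partial2[OF smooth_W q(2)]])
  from DERIV_unique[OF smooth_on_partial2[OF smooth_w q(1)] this]
  show "frechet_derivative (w i) (at (\<rho>, \<phi>)) (0, 1) = frechet_derivative (W i) (at (1 / \<rho>, \<phi>)) (0, 1) / \<rho> ^ kexp i" .
  have "((\<lambda>\<rho>. inverse (\<rho> ^ kexp i)) has_real_derivative - real (kexp i) / \<rho> ^ (kexp i + 1)) (at \<rho>)"
  proof (cases "kexp i")
    case (Suc k)
    then show ?thesis using b by (auto intro!: derivative_eq_intros simp: power2_eq_square field_simps) (cases k; simp)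
  qed auto
  from DERIV_mult[OF chain_recip[OF smooth_W \<rho>] this]
  have "((\<lambda>\<rho>. w i (\<rho>, \<phi>)) has_real_derivative
     (- real (kexp i) * W i (1 / \<rho>, \<phi>) - 1 / \<rho> * frechet_derivative (W i) (at (1 / \<rho>, \<phi>)) (1, 0)) / \<rho> ^ (kexp i + 1)) (at \<rho>)"
    unfolding w_def fst_conv snd_conv divide_inverse[of "W i _"]
    by (rule DERIV_cong) (use b in \<open>simp add: divide_inverse power2_eq_square algebra_simps\<close>)
  from DERIV_unique[OF smooth_on_partial1[OF smooth_w q(1)] this]
  show "frechet_derivative (w i) (at (\<rho>, \<phi>)) (1, 0) =
      (- real (kexp i) * W i (1 / \<rho>, \<phi>) - 1 / \<rho> * frechet_derivative (W i) (at (1 / \<rho>, \<phi>)) (1, 0)) / \<rho> ^ (kexp i + 1)" .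
qed

text \<open>A second derivative requires the formula for the first one in a whole neighbourhood,
  where amplitude and angle vary with the ordinate.\<close>

lemma dY_2:
  assumes \<rho>: "big \<rho>" and i: "i \<in> {1, 2}"
  shows "dY D \<rho>0 2 i \<rho> \<phi> = V i (1 / \<rho>, \<phi>) / \<rho> ^ (kexp i + h + 1)"
proof -
  note b = bigD[OF \<rho>]
  let ?c = "\<phi> - pi"
  let ?S = "{\<rho>. big \<rho>} \<times> {?c<..<?c + 2 * pi}"
  let ?x = "X1 (\<rho>, \<phi>)"
  let ?F = "\<lambda>y. Ycomp D \<rho>0 i ?c ?x y"
  have q: "(\<rho>, \<phi>) \<in> {\<rho>. big \<rho>} \<times> UNIV" using \<rho> by simp
  \<comment> \<open>The ordinates y for which (x, y) still comes from a large amplitude and an angle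
    interior to the same window. This set is open because the image of that region is.\<close>
  define T where "T = (\<lambda>y. (?x, y)) -` (XX ` ?S)"
  have T: "open T" unfolding T_def by (rule open_vimage[OF open_image]) (auto intro!: continuous_intros)
  have yT: "X2 (\<rho>, \<phi>) \<in> T" using \<rho> by (auto simp: T_def)
  have dF: "deriv ?F y = w i (Ybranch D \<rho>0 ?c (?x, y))" if "y \<in> T" for y
  proof -
    obtain \<rho>' \<phi>' where q': "big \<rho>'" "?c < \<phi>'" "\<phi>' < ?c + 2 * pi" "(?x, y) = XX (\<rho>', \<phi>')"
      using \<open>y \<in> T\<close> unfolding T_def by auto
    have "Ybranch D \<rho>0 ?c (?x, y) = (\<rho>', \<phi>')" unfolding q'(4) using q' by (intro Ybranch_XX) auto
    then show ?thesis using DERIV_imp_deriv[OF DERIV_Ycomp[OF q'(1-3) i]] q'(4) by simp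
  qed
  have Y: "Ybranch D \<rho>0 ?c (?x, X2 (\<rho>, \<phi>)) = (\<rho>, \<phi>)" using \<rho> by (intro Ybranch_XX) auto
  have dw: "(w i has_derivative frechet_derivative (w i) (at (\<rho>, \<phi>))) (at (Ybranch D \<rho>0 ?c (?x, X2 (\<rho>, \<phi>))))"
    unfolding Y by (rule smooth_on_has_derivative[OF smooth_w q])
  have "((\<lambda>y. w i (Ybranch D \<rho>0 ?c (?x, y))) has_derivative
     (\<lambda>v. frechet_derivative (w i) (at (\<rho>, \<phi>)) (w 1 (\<rho>, \<phi>) * v, w 2 (\<rho>, \<phi>) * v))) (at (X2 (\<rho>, \<phi>)))"
    by (rule has_derivative_compose[OF DERIV_Ybranch[OF \<rho>] dw]) auto
  moreover have "(\<lambda>v. frechet_derivative (w i) (at (\<rho>, \<phi>)) (w 1 (\<rho>, \<phi>) * v, w 2 (\<rho>, \<phi>) * v)) =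
      (*) (V i (1 / \<rho>, \<phi>) / \<rho> ^ (kexp i + h + 1))"
  proof
    fix v
    have w12: "w 1 (\<rho>, \<phi>) = W 1 (1 / \<rho>, \<phi>) / \<rho> ^ h" "w 2 (\<rho>, \<phi>) = W 2 (1 / \<rho>, \<phi>) / \<rho> ^ (h + 1)"
      by (simp_all add: w_def kexp_def)
    have "V i (1 / \<rho>, \<phi>) / \<rho> ^ (kexp i + h + 1) =
      frechet_derivative (w i) (at (\<rho>, \<phi>)) (1, 0) * w 1 (\<rho>, \<phi>) + frechet_derivative (w i) (at (\<rho>, \<phi>)) (0, 1) * w 2 (\<rho>, \<phi>)"
      unfolding w_partials[OF \<rho>] V_def w12 using b
      by (simp add: power_add add_divide_distrib mult_ac)
    then show "frechet_derivative (w i) (at (\<rho>, \<phi>)) (w 1 (\<rho>, \<phi>) * v, w 2 (\<rho>, \<phi>) * v) =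
      (*) (V i (1 / \<rho>, \<phi>) / \<rho> ^ (kexp i + h + 1)) v"
      unfolding frechet_derivative_split[OF smooth_w q, of i "w 1 (\<rho>, \<phi>) * v"] by (simp only: distrib_right mult.assoc)
  qed
  ultimately have "((\<lambda>y. w i (Ybranch D \<rho>0 ?c (?x, y))) has_real_derivative V i (1 / \<rho>, \<phi>) / \<rho> ^ (kexp i + h + 1)) (at (X2 (\<rho>, \<phi>)))"
    by (simp only: has_field_derivative_def)
  then have "(deriv ?F has_real_derivative V i (1 / \<rho>, \<phi>) / \<rho> ^ (kexp i + h + 1)) (at (X2 (\<rho>, \<phi>)))"
    by (rule has_field_derivative_transform_within_open[OF _ T yT]) (simp add: dF)
  from DERIV_imp_deriv[OF this] show ?thesis
    by (simp add: dY_def Xmap_eq[OF \<rho>] numeral_2_eq_2)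
qed

text \<open>The monomial x1^i * x2^j grows like \<rho>^(i + j * (h + 1)). Splitting off the top
  power leaves nonnegative powers of e = 1 / \<rho>, and the sum extends to e = 0. The argument is
  (e, \<phi>, S).\<close>

definition scaled_poly :: "(nat \<Rightarrow> nat \<Rightarrow> real \<Rightarrow> real) \<Rightarrow> nat \<Rightarrow> nat \<Rightarrow> real \<times> real \<times> real \<Rightarrow> real" where
  "scaled_poly c p l x = (\<Sum>i\<le>p. \<Sum>j\<le>l. c i j (snd (snd x)) * xi (fst x, fst (snd x)) ^ i
     * eta (fst x, fst (snd x)) ^ j * fst x ^ ((p - i) + (l - j) * (h + 1)))"

abbreviation dom3 :: "(real \<times> real \<times> real) set" where "dom3 \<equiv> {-eps0<..<eps0} \<times> UNIV"

lemma scaled_poly_eq: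
  assumes \<rho>: "big \<rho>"
  shows "(\<Sum>i\<le>p. \<Sum>j\<le>l. c i j S * X1 (\<rho>, \<phi>) ^ i * X2 (\<rho>, \<phi>) ^ j)
    = \<rho> ^ (p + l * (h + 1)) * scaled_poly c p l (1 / \<rho>, \<phi>, S)"
  unfolding scaled_poly_def sum_distrib_left
proof (intro sum.cong refl)
  fix i j assume ij: "i \<in> {..p}" "j \<in> {..l}"
  note b = bigD[OF \<rho>]
  let ?r = "(p - i) + (l - j) * (h + 1)"
  have "l = j + (l - j)" "p = i + (p - i)" using ij by auto
  then have "p + l * (h + 1) = (i + j * (h + 1)) + ?r"
    by (metis add.assoc add.left_commute add_mult_distrib)
  then have "\<rho> ^ (p + l * (h + 1)) * (1 / \<rho>) ^ ?r = \<rho> ^ (i + j * (h + 1)) * (\<rho> ^ ?r * (1 / \<rho>) ^ ?r)"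
    by (simp only: power_add mult.assoc)
  also have "\<rho> ^ ?r * (1 / \<rho>) ^ ?r = 1" unfolding power_mult_distrib[symmetric] using b by simp
  finally have r: "\<rho> ^ (p + l * (h + 1)) * (1 / \<rho>) ^ ?r = \<rho> ^ (i + j * (h + 1))" by simp
  have j: "(\<rho> ^ (h + 1)) ^ j = \<rho> ^ (j * (h + 1))" by (simp only: power_mult[symmetric] mult.commute)
  have "c i j S * X1 (\<rho>, \<phi>) ^ i * X2 (\<rho>, \<phi>) ^ j =
    (c i j S * xi (1 / \<rho>, \<phi>) ^ i * eta (1 / \<rho>, \<phi>) ^ j) * (\<rho> ^ (p + l * (h + 1)) * (1 / \<rho>) ^ ?r)"
    unfolding r X1_def X2_def fst_conv snd_conv power_mult_distrib j power_add[of \<rho> i] by (simp only: mult_ac)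
  then show "c i j S * X1 (\<rho>, \<phi>) ^ i * X2 (\<rho>, \<phi>) ^ j = \<rho> ^ (p + l * (h + 1)) *
       (c i j (snd (snd (1 / \<rho>, \<phi>, S))) * xi (fst (1 / \<rho>, \<phi>, S), fst (snd (1 / \<rho>, \<phi>, S))) ^ i *
        eta (fst (1 / \<rho>, \<phi>, S), fst (snd (1 / \<rho>, \<phi>, S))) ^ j * fst (1 / \<rho>, \<phi>, S) ^ ?r)"
    unfolding fst_conv snd_conv by (simp only: mult_ac)
qed

lemma smooth_dom3:
  assumes "smooth_on dom f" shows "smooth_on dom3 (\<lambda>x. f (fst x, fst (snd x)))"
  by (rule smooth_on_compose[OF assms]) (intro smooth_intros, auto)

lemma smooth_scaled_poly:
  assumes "\<And>i j. i \<le> p \<Longrightarrow> j \<le> l \<Longrightarrow> smooth_on UNIV (c i j)"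
  shows "smooth_on dom3 (scaled_poly c p l)"
  unfolding scaled_poly_def
  by (intro smooth_intros smooth_dom3[OF smooth_xi] smooth_dom3[OF smooth_eta]
      smooth_on_compose[where T=UNIV and g="\<lambda>x. snd (snd x)", OF assms]) auto

abbreviation Qpoly where "Qpoly \<equiv> scaled_poly (Qcoef D) (degp D) (degl D)"
abbreviation spoly where "spoly \<equiv> scaled_poly (sigcoef D) (degn D) (degm D)"

lemma smooth_Qpoly: "smooth_on dom3 Qpoly" and smooth_spoly: "smooth_on dom3 spoly"
proof -
  have "smooth (\<lambda>(x1, x2, S). Qfun D x1 x2 S)" "smooth (\<lambda>(x1, x2, S). sigfun D x1 x2 S)"
    using adm by (auto simp: admissible_def)
  then show "smooth_on dom3 Qpoly" "smooth_on dom3 spoly"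
    unfolding Qfun_def sigfun_def by (auto intro!: smooth_scaled_poly intro: smooth_on_coefficients2)
qed

text \<open>\<open>ff\<close>, \<open>gg\<close> and \<open>cc\<close> extend the coefficients with
  tilde to e = 0; their argument is (1 / \<rho>, \<phi>, S).\<close>

definition ff :: "nat \<Rightarrow> real \<times> real \<times> real \<Rightarrow> real" where
  "ff i x = Qpoly x * W i (fst x, fst (snd x))"

definition gg :: "nat \<Rightarrow> real \<times> real \<times> real \<Rightarrow> real" where
  "gg i x = (mu D)\<^sup>2 / 2 * (spoly x)\<^sup>2 * V i (fst x, fst (snd x))"

definition cc :: "nat \<Rightarrow> real \<times> real \<times> real \<Rightarrow> real" where
  "cc i x = spoly x * W i (fst x, fst (snd x))"

lemma smooth_ff: "smooth_on dom3 (ff i)"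
  unfolding ff_def by (intro smooth_intros smooth_Qpoly smooth_dom3 smooth_W)

lemma smooth_gg: "smooth_on dom3 (gg i)"
  unfolding gg_def by (intro smooth_intros smooth_spoly smooth_dom3 smooth_V)

lemma smooth_cc: "smooth_on dom3 (cc i)"
  unfolding cc_def by (intro smooth_intros smooth_spoly smooth_dom3 smooth_W)

lemma poly_2pi:
  assumes "\<bar>e\<bar> < eps0"
  shows "scaled_poly c p l (e, \<phi> + 2 * pi, S) = scaled_poly c p l (e, \<phi>, S)"
  by (simp add: scaled_poly_def xi_2pi[OF assms] eta_2pi[OF assms])

lemma poly_S_2pi:
  "Qpoly (e, \<phi>, S + 2 * pi) = Qpoly (e, \<phi>, S)" "spoly (e, \<phi>, S + 2 * pi) = spoly (e, \<phi>, S)"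
proof -
  have "Qcoef D i j (S + 2 * pi) = Qcoef D i j S" if "i \<le> degp D" "j \<le> degl D" for i j
    using adm that unfolding admissible_def by blast
  then show "Qpoly (e, \<phi>, S + 2 * pi) = Qpoly (e, \<phi>, S)"
    unfolding scaled_poly_def by (intro sum.cong refl) simp
  have "sigcoef D i j (S + 2 * pi) = sigcoef D i j S" if "i \<le> degn D" "j \<le> degm D" for i j
    using adm that unfolding admissible_def by blast
  then show "spoly (e, \<phi>, S + 2 * pi) = spoly (e, \<phi>, S)"
    unfolding scaled_poly_def by (intro sum.cong refl) simp
qed

lemma coefs_2pi:
  assumes "\<bar>e\<bar> < eps0"
  shows "ff i (e, \<phi> + 2 * pi, S) = ff i (e, \<phi>, S)" "gg i (e, \<phi> + 2 * pi, S) = gg i (e, \<phi>, S)"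
    "cc i (e, \<phi> + 2 * pi, S) = cc i (e, \<phi>, S)"
    "ff i (e, \<phi>, S + 2 * pi) = ff i (e, \<phi>, S)" "gg i (e, \<phi>, S + 2 * pi) = gg i (e, \<phi>, S)"
    "cc i (e, \<phi>, S + 2 * pi) = cc i (e, \<phi>, S)"
  by (simp_all add: ff_def gg_def cc_def poly_2pi[OF assms] poly_S_2pi W_2pi[OF assms] V_2pi[OF assms])

lemma Qfun_eq: "big \<rho> \<Longrightarrow> Qfun D (X1 (\<rho>, \<phi>)) (X2 (\<rho>, \<phi>)) S = \<rho> ^ (degp D + degl D * (h + 1)) * Qpoly (1 / \<rho>, \<phi>, S)"
  unfolding Qfun_def by (rule scaled_poly_eq)

lemma sigfun_eq: "big \<rho> \<Longrightarrow> sigfun D (X1 (\<rho>, \<phi>)) (X2 (\<rho>, \<phi>)) S = \<rho> ^ (degn D + degm D * (h + 1)) * spoly (1 / \<rho>, \<phi>, S)"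
  unfolding sigfun_def by (rule scaled_poly_eq)

text \<open>The natural powers from the polynomials and from the inverse map combine to the
  exponents a and b, which can be negative when l = 0 or m = 0; hence \<open>powr\<close>.\<close>

lemma powers:
  assumes \<rho>: "\<rho> > 0" and i: "i \<in> {1, 2}"
  shows "\<rho> ^ (degp D + degl D * (h + 1)) / \<rho> ^ kexp i = \<rho> powr (expa D + 2 - real i)"
    "\<rho> ^ (degn D + degm D * (h + 1)) / \<rho> ^ kexp i = \<rho> powr (expb D + 2 - real i)"
    "(\<rho> ^ (degn D + degm D * (h + 1)))\<^sup>2 / \<rho> ^ (kexp i + h + 1) = \<rho> powr (2 * expb D + 2 - real i)"
proof -
  have sq: "(\<rho> ^ k)\<^sup>2 = \<rho> ^ (k + k)" for k by (simp add: power2_eq_square power_add)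
  show "\<rho> ^ (degp D + degl D * (h + 1)) / \<rho> ^ kexp i = \<rho> powr (expa D + 2 - real i)"
    "\<rho> ^ (degn D + degm D * (h + 1)) / \<rho> ^ kexp i = \<rho> powr (expb D + 2 - real i)"
    "(\<rho> ^ (degn D + degm D * (h + 1)))\<^sup>2 / \<rho> ^ (kexp i + h + 1) = \<rho> powr (2 * expb D + 2 - real i)"
  unfolding sq
  unfolding powr_realpow[OF \<rho>, symmetric] powr_diff[symmetric]
  using i by (auto simp: expa_def expb_def kexp_def algebra_simps)
qed

lemma fcoef_eq:
  assumes \<rho>: "big \<rho>" and i: "i \<in> {1, 2}"
  shows "fcoef D \<rho>0 i \<rho> \<phi> S = \<rho> powr (expa D + 2 - real i) * ff i (1 / \<rho>, \<phi>, S)"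
    "gcoef D \<rho>0 i \<rho> \<phi> S = \<rho> powr (2 * expb D + 2 - real i) * gg i (1 / \<rho>, \<phi>, S)"
    "ccoef D \<rho>0 i \<rho> \<phi> S = \<rho> powr (expb D + 2 - real i) * cc i (1 / \<rho>, \<phi>, S)"
proof -
  note b = bigD[OF \<rho>]
  have w: "w i (\<rho>, \<phi>) = W i (1 / \<rho>, \<phi>) / \<rho> ^ kexp i" by (simp add: w_def)
  show "fcoef D \<rho>0 i \<rho> \<phi> S = \<rho> powr (expa D + 2 - real i) * ff i (1 / \<rho>, \<phi>, S)"
    "ccoef D \<rho>0 i \<rho> \<phi> S = \<rho> powr (expb D + 2 - real i) * cc i (1 / \<rho>, \<phi>, S)"
    unfolding powers(1,2)[OF b(1) i, symmetric]
    by (simp_all only: fcoef_def ccoef_def Xmap_eq[OF \<rho>] fst_conv snd_conv dY_1[OF \<rho> i] Qfun_eq[OF \<rho>] sigfun_eq[OF \<rho>] ff_def cc_def w)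
      (simp_all add: mult_ac)
  show "gcoef D \<rho>0 i \<rho> \<phi> S = \<rho> powr (2 * expb D + 2 - real i) * gg i (1 / \<rho>, \<phi>, S)"
    unfolding powers(3)[OF b(1) i, symmetric]
    by (simp only: gcoef_def Xmap_eq[OF \<rho>] fst_conv snd_conv dY_2[OF \<rho> i] sigfun_eq[OF \<rho>] gg_def)
      (simp add: mult_ac power_mult_distrib)
qed

lemma tilde_eq:
  assumes \<rho>: "big \<rho>" and i: "i \<in> {1, 2}"
  shows "ftilde D \<rho>0 i \<rho> \<phi> S = ff i (1 / \<rho>, \<phi>, S)"
    "gtilde D \<rho>0 i \<rho> \<phi> S = gg i (1 / \<rho>, \<phi>, S)"
    "ctilde D \<rho>0 i \<rho> \<phi> S = cc i (1 / \<rho>, \<phi>, S)"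
proof -
  have "\<rho> powr c * x * \<rho> powr (- c) = x" for c x
    using bigD(1)[OF \<rho>] by (simp add: powr_minus field_simps)
  then show "ftilde D \<rho>0 i \<rho> \<phi> S = ff i (1 / \<rho>, \<phi>, S)"
    "gtilde D \<rho>0 i \<rho> \<phi> S = gg i (1 / \<rho>, \<phi>, S)"
    "ctilde D \<rho>0 i \<rho> \<phi> S = cc i (1 / \<rho>, \<phi>, S)"
    by (simp_all only: ftilde_def gtilde_def ctilde_def fcoef_eq[OF assms])
qed

section \<open>The limiting oscillator\<close>

lemma nu0_eq: "nu0 D = nn 0"
  unfolding nn_0 nu0_def T0_def osc_deg_def[symmetric] ..

lemma limit_orbit: "is_limit_orbit D (\<lambda>\<phi>. (xi (0, \<phi>), eta (0, \<phi>)))"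
proof -
  have e: "\<bar>0\<bar> < eps0" using eps0 by simp
  note n = nn_pos[OF e]
  have N1: "N - 1 = 2 * h + 1" by (simp add: osc_deg_def)
  have "deriv (\<lambda>\<phi>. xi (0, \<phi>)) \<phi> = eta (0, \<phi>) / nn 0" "deriv (\<lambda>\<phi>. eta (0, \<phi>)) \<phi> = - (xi (0, \<phi>) ^ (2 * h + 1)) / nn 0" for \<phi>
    using DERIV_imp_deriv[OF DERIV_xi[OF e]] DERIV_imp_deriv[OF DERIV_eta[OF e]] unfolding dpot_0 N1 by simp_all
  moreover have "(\<lambda>\<phi>. xi (0, \<phi>)) differentiable (at \<phi>)" "(\<lambda>\<phi>. eta (0, \<phi>)) differentiable (at \<phi>)" for \<phi>
    unfolding real_differentiable_def using DERIV_xi[OF e] DERIV_eta[OF e] by blast+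
  ultimately show ?thesis
    unfolding is_limit_orbit_def fst_conv snd_conv nu0_eq osc_deg_def[symmetric]
    using n energy_xi_eta[OF e] xi_eta_0[OF e] xi_2pi[OF e] eta_2pi[OF e] by (simp add: pot_0 add.commute)
qed

text \<open>At angle 0 the second component vanishes and the energy relation gives x^N = N with x >
  0. So all limiting orbits have the same initial value, and uniqueness applies.\<close>

lemma X0_eq: "X0 D = (\<lambda>\<phi>. (xi (0, \<phi>), eta (0, \<phi>)))"
proof -
  let ?y = "\<lambda>\<phi>. (xi (0, \<phi>), eta (0, \<phi>))"
  have x: "is_limit_orbit D (X0 D)" unfolding X0_def by (rule someI[of "is_limit_orbit D", OF limit_orbit])
  have n: "nu0 D > 0" using nn_pos[of 0] eps0 by (simp add: nu0_eq)
  have der: "((\<lambda>\<phi>. fst (y \<phi>)) has_real_derivative 1 / nu0 D * snd (y \<phi>)) (at \<phi>)"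
      "((\<lambda>\<phi>. snd (y \<phi>)) has_real_derivative - (1 / nu0 D * fst (y \<phi>) ^ (2 * h + 1))) (at \<phi>)"
    if y: "is_limit_orbit D y" for y \<phi>
  proof -
    have "(\<lambda>\<phi>. fst (y \<phi>)) differentiable (at \<phi>)" "(\<lambda>\<phi>. snd (y \<phi>)) differentiable (at \<phi>)"
      using y by (auto simp: is_limit_orbit_def)
    then have "((\<lambda>\<phi>. fst (y \<phi>)) has_real_derivative deriv (\<lambda>\<phi>. fst (y \<phi>)) \<phi>) (at \<phi>)"
      "((\<lambda>\<phi>. snd (y \<phi>)) has_real_derivative deriv (\<lambda>\<phi>. snd (y \<phi>)) \<phi>) (at \<phi>)"
      using DERIV_deriv_iff_real_differentiable by blast+
    moreover have "nu0 D * deriv (\<lambda>\<phi>. fst (y \<phi>)) \<phi> = snd (y \<phi>)"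
      "nu0 D * deriv (\<lambda>\<phi>. snd (y \<phi>)) \<phi> = - (fst (y \<phi>) ^ (2 * h + 1))"
      using y by (auto simp: is_limit_orbit_def)
    then have "deriv (\<lambda>\<phi>. fst (y \<phi>)) \<phi> = 1 / nu0 D * snd (y \<phi>)"
      "deriv (\<lambda>\<phi>. snd (y \<phi>)) \<phi> = - (1 / nu0 D * fst (y \<phi>) ^ (2 * h + 1))"
      using n by (auto simp: field_simps)
    ultimately show "((\<lambda>\<phi>. fst (y \<phi>)) has_real_derivative 1 / nu0 D * snd (y \<phi>)) (at \<phi>)"
      "((\<lambda>\<phi>. snd (y \<phi>)) has_real_derivative - (1 / nu0 D * fst (y \<phi>) ^ (2 * h + 1))) (at \<phi>)" by simp_all
  qed
  have init: "fst (y 0) > 0 \<and> fst (y 0) ^ N = real N \<and> snd (y 0) = 0" if y: "is_limit_orbit D y" for y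
  proof -
    have "snd (y 0) = 0" "fst (y 0) > 0" "fst (y 0) ^ N / real N + (snd (y 0))\<^sup>2 / 2 = 1"
      using y unfolding is_limit_orbit_def osc_deg_def[symmetric] by blast+
    then show ?thesis using N_facts by simp
  qed
  show ?thesis
  proof (rule planar_hamiltonian_unique[where c="1 / nu0 D" and g="\<lambda>x. x ^ (2 * h + 1)"])
    show "((\<lambda>x. x ^ (2 * h + 1)) has_real_derivative real (2 * h + 1) * x ^ (2 * h)) (at x)" for x :: real
      by (rule DERIV_cong[OF DERIV_pow]) simp
    show "continuous_on UNIV (\<lambda>x::real. real (2 * h + 1) * x ^ (2 * h))" by (intro continuous_intros)
    have "fst (X0 D 0) = fst (?y 0)"
      using init[OF x] init[OF limit_orbit] N_facts power_eq_iff_eq_base[of N "fst (X0 D 0)" "fst (?y 0)"] by simp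
    then show "X0 D 0 = ?y 0" using init[OF x] init[OF limit_orbit] by (intro prod_eqI) auto
  qed (use der[OF x] der[OF limit_orbit] in simp_all)
qed

text \<open>At e = 0 the factor 0 ^ k is 1 for k = 0 and 0 otherwise, so only the top monomial i =
  p, j = l survives. The denominators agree since N = 2 * (h + 1).\<close>

lemma ff_limit: "ff 1 (0, \<phi>, S) = f10 D \<phi> S"
proof -
  have e: "\<bar>0\<bar> < eps0" using eps0 by simp
  note n = nn_pos[OF e]
  let ?t = "\<lambda>i j. Qcoef D i j S * xi (0, \<phi>) ^ i * eta (0, \<phi>) ^ j * 0 ^ ((degp D - i) + (degl D - j) * (h + 1))"
  have inner: "(\<Sum>j\<le>degl D. ?t i j) = (if i = degp D then Qcoef D i (degl D) S * xi (0, \<phi>) ^ i * eta (0, \<phi>) ^ degl D else 0)"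
    if "i \<le> degp D" for i
  proof -
    have "?t i j = (if j = degl D then (if i = degp D then Qcoef D i j S * xi (0, \<phi>) ^ i * eta (0, \<phi>) ^ j else 0) else 0)"
      if "j \<le> degl D" for j
      using that \<open>i \<le> degp D\<close> by (auto simp: power_0_left)
    then have "(\<Sum>j\<le>degl D. ?t i j) = (\<Sum>j\<le>degl D. if j = degl D then (if i = degp D then Qcoef D i j S * xi (0, \<phi>) ^ i * eta (0, \<phi>) ^ j else 0) else 0)"
      by (intro sum.cong refl) auto
    then show ?thesis by (simp add: sum.delta)
  qed
  have "Qpoly (0, \<phi>, S) = (\<Sum>i\<le>degp D. if i = degp D then Qcoef D i (degl D) S * xi (0, \<phi>) ^ i * eta (0, \<phi>) ^ degl D else 0)"
    unfolding scaled_poly_def fst_conv snd_conv by (intro sum.cong refl inner) auto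
  then have Q: "Qpoly (0, \<phi>, S) = Qcoef D (degp D) (degl D) S * xi (0, \<phi>) ^ degp D * eta (0, \<phi>) ^ degl D"
    by (simp add: sum.delta)
  have "deriv (X10 D) \<phi> = eta (0, \<phi>) / nn 0"
    unfolding X10_def[abs_def] X0_eq fst_conv by (rule DERIV_imp_deriv[OF DERIV_xi[OF e]])
  moreover have "2 * (real h + 1) = real N" by (simp add: osc_deg_def)
  ultimately show ?thesis
    unfolding f10_def nu0_eq ff_def Q using n by (simp add: X10_def X20_def X0_eq W_def)
qed

end

section \<open>The resonant amplitude\<close>

text \<open>Besides the data the locale fixes thresholds. Below e1 the quantity h - e * nn' / nn is
  positive; it is the logarithmic derivative of the frequency in ln \<rho>, so the resonance
  equation can be solved for the derivative of the amplitude. Beyond t1 the resonant amplitude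
  exceeds 2 * \<rho>0, because nearby solutions may have half of it. The constants 4 / e1 and 1 / (4
  * (r0 + 1)) leave a factor of two between the values that occur and the boundary of the domain
  \<open>S4\<close>.\<close>

locale resonance = oscillator D \<rho>0 for D :: osc and \<rho>0 :: real +
  fixes \<kappa> :: nat and \<rho>\<^sub>r :: "real \<Rightarrow> real" and r0 e1 t1 \<tau>1 :: real
  assumes kappa: "\<kappa> \<ge> 1" and r0: "r0 > 0"
    and e1: "0 < e1" "e1 \<le> eps0" "\<And>e. \<bar>e\<bar> < e1 \<Longrightarrow> real h - e * deriv nn e / nn e > 0"
    and t1: "0 < t1" "\<And>t. t > t1 \<Longrightarrow> freq D (\<rho>\<^sub>r t) = deriv (phase D) t / real \<kappa>"
      "\<And>t. t > t1 \<Longrightarrow> \<rho>\<^sub>r differentiable (at t)" "\<And>t. t > t1 \<Longrightarrow> \<rho>\<^sub>r t > 2 * \<rho>0"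
      "\<And>t. t > t1 \<Longrightarrow> \<rho>\<^sub>r t > 4 / e1" "\<And>t. t > t1 \<Longrightarrow> t powr (- expA D) < 1 / (4 * (r0 + 1))"
    and tau1: "1 \<le> \<tau>1" "t1 \<le> time D \<tau>1"
    and exponents: "- 1 \<le> Mmax D" "Mmax D < beta D" "3 * M1 D - 2 * M2 D \<ge> beta D"
begin

abbreviation A :: real where "A \<equiv> expA D"
abbreviation B :: real where "B \<equiv> expB D"
abbreviation C :: real where "C \<equiv> expC D"
abbreviation tt :: "real \<Rightarrow> real" where "tt \<equiv> time D"

lemma parameters_pos: "alpha D > 0" "beta D > 0" "sfreq D > 0" using adm by (auto simp: admissible_def)

text \<open>If M1 were at most M2, then 3 * M1 - 2 * M2 \<le> M1 < beta, against the last assumption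
  on the exponents.\<close>

lemma M_order: "M1 D > M2 D" "Mmax D = M1 D"
  using exponents by (auto simp: Mmax_def max_def split: if_splits)

lemma M1_M2_eq: "M1 D = beta D - 2 * A" "M2 D = beta D - 2 * C"
  using M_order by (auto simp: expA_def expC_def field_simps)

text \<open>Mmax < beta gives A > 0, - 1 \<le> Mmax gives 2 * A \<le> B, and 3 * M1 - 2 * M2 \<ge>
  beta gives 2 * C \<ge> 3 * A.\<close>

lemma exponent_order: "A > 0" "2 * A \<le> B" "2 * C \<ge> 3 * A" "B > 1" "C > A"
  using exponents M1_M2_eq M_order parameters_pos by (simp_all add: expB_def)

lemma tt_pos: "\<tau> > 0 \<Longrightarrow> tt \<tau> > 0"
  using exponent_order by (simp add: time_def)

lemma tt_powr: "\<tau> > 0 \<Longrightarrow> tt \<tau> powr x = B powr (x / B) * \<tau> powr (x / B)"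
  using exponent_order by (simp add: time_def powr_powr powr_mult)

lemma tt_powr_B: "\<tau> > 0 \<Longrightarrow> tt \<tau> powr B = B * \<tau>"
  using exponent_order by (simp add: tt_powr)

lemma DERIV_tt: "\<tau> > 0 \<Longrightarrow> (tt has_real_derivative tt \<tau> / (B * \<tau>)) (at \<tau>)"
proof -
  assume \<tau>: "\<tau> > 0"
  then have p: "B * \<tau> > 0" using exponent_order by simp
  have "((\<lambda>\<tau>. (B * \<tau>) powr (1 / B)) has_real_derivative (1 / B) * (B * \<tau>) powr (1 / B - 1) * B) (at \<tau>)"
    by (rule DERIV_chain2[where f="\<lambda>x. x powr (1 / B)" and g="\<lambda>\<tau>. B * \<tau>", OF has_real_derivative_powr[OF p]])
      (auto intro!: derivative_eq_intros)
  then show ?thesis unfolding time_def[abs_def]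
    by (rule DERIV_cong) (use p exponent_order in \<open>simp add: powr_diff\<close>)
qed

lemma tt_mono: "0 < \<tau> \<Longrightarrow> \<tau> < \<sigma> \<Longrightarrow> tt \<tau> < tt \<sigma>"
  unfolding time_def using exponent_order by (intro powr_less_mono2) auto

lemma tau_pos: "\<tau> > \<tau>1 \<Longrightarrow> \<tau> > 0" using tau1 by simp

lemma tt_t1: "\<tau> > \<tau>1 \<Longrightarrow> tt \<tau> > t1"
  using tt_mono[of \<tau>1 \<tau>] tau1 by simp

lemma filterlim_tt: "filterlim tt at_top at_top"
proof -
  have "filterlim (\<lambda>\<tau>. B * \<tau>) at_top at_top"
    using exponent_order by (intro filterlim_tendsto_pos_mult_at_top[OF tendsto_const]) (auto intro: filterlim_ident)
  moreover have "filterlim (\<lambda>x. x powr (1 / B)) at_top at_top"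
    using exponent_order by (intro real_powr_at_top) simp
  ultimately show ?thesis unfolding time_def by (rule filterlim_compose[rotated])
qed

lemma zeta_of_eq: "\<tau> > 0 \<Longrightarrow> zeta_of D \<tau> = sfreq D * B * \<tau>"
  using tt_powr_B by (simp add: zeta_of_def phase_def expB_def)

lemma deriv_phase: "t > 0 \<Longrightarrow> deriv (phase D) t = sfreq D * (beta D + 1) * t powr beta D"
  unfolding phase_def[abs_def] by (rule DERIV_imp_deriv) (auto intro!: derivative_eq_intros)

lemma rho_pos: "t > t1 \<Longrightarrow> \<rho>\<^sub>r t > 0"
  using t1(4)[of t] thr by (simp add: amplitude_threshold_def)

lemma inv_rho: 
  assumes "t > t1" shows "0 < 1 / \<rho>\<^sub>r t" "1 / \<rho>\<^sub>r t < e1 / 4" "big (\<rho>\<^sub>r t)" "\<bar>1 / \<rho>\<^sub>r t\<bar> < e1"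
proof -
  note p = rho_pos[OF assms]
  show 1: "0 < 1 / \<rho>\<^sub>r t" using p by simp
  show 2: "1 / \<rho>\<^sub>r t < e1 / 4" using t1(5)[OF assms] p e1(1) by (simp add: field_simps)
  show "\<bar>1 / \<rho>\<^sub>r t\<bar> < e1" using 1 2 e1(1) by linarith
  have "1 / \<rho>\<^sub>r t < eps0" using 2 e1 by linarith
  then show "big (\<rho>\<^sub>r t)" using t1(4)[OF assms] thr by (simp add: big_def amplitude_threshold_def)
qed

lemma rho_equation: "t > t1 \<Longrightarrow> \<rho>\<^sub>r t ^ h * nn (1 / \<rho>\<^sub>r t) = sfreq D * (beta D + 1) / real \<kappa> * t powr beta D"
  using t1(1) t1(2)[of t] freq_eq[OF inv_rho(3)[of t]] by (simp add: nu_def deriv_phase)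

lemma smooth_nn_e1: "smooth_on {-e1<..<e1} nn"
  by (rule smooth_on_subset[OF smooth_nn]) (use e1 in auto)

lemma nn_pos_e1: "\<bar>e\<bar> < e1 \<Longrightarrow> nn e > 0" using nn_pos e1(2) by simp

text \<open>The logarithmic derivative t * \<rho>' / \<rho> of the resonant amplitude as a function
  of e = 1 / \<rho>; its value beta / h at e = 0 is the limiting growth exponent.\<close>

definition kap :: "real \<Rightarrow> real" where
  "kap e = beta D / (real h - e * deriv nn e / nn e)"

lemma smooth_kap: "smooth_on {-e1<..<e1} kap"
  unfolding kap_def
proof (intro smooth_intros smooth_nn_e1 smooth_on_frechet_1(1))
  fix e assume "e \<in> {-e1<..<e1}"
  then have "\<bar>e\<bar> < e1" by auto
  then show "nn e \<noteq> 0" "real h - e * deriv nn e / nn e \<noteq> 0" using nn_pos_e1[of e] e1(3)[of e] by auto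
qed auto

lemma kap_0: "kap 0 = beta D / real h" by (simp add: kap_def)

text \<open>Take logarithms in the resonance equation, h * ln \<rho> + ln (nn (1 / \<rho>)) = const
  + beta * ln t, differentiate, and solve for \<rho>'. Positivity of h - e * nn' / nn permits the
  division.\<close>

lemma DERIV_rho:
  assumes t: "t > t1"
  shows "(\<rho>\<^sub>r has_real_derivative \<rho>\<^sub>r t * kap (1 / \<rho>\<^sub>r t) / t) (at t)"
proof -
  define \<rho>' where "\<rho>' = deriv \<rho>\<^sub>r t"
  have d: "(\<rho>\<^sub>r has_real_derivative \<rho>') (at t)"
    unfolding \<rho>'_def using t1(3)[OF t] by (simp add: DERIV_deriv_iff_real_differentiable)
  note p = rho_pos[OF t] and i = inv_rho[OF t]
  have t0: "t > 0" using t t1(1) by simp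
  let ?e = "1 / \<rho>\<^sub>r t"
  have e: "?e \<in> {-e1<..<e1}" using i(1,2) e1(1) unfolding greaterThanLessThan_iff by linarith
  have n: "nn ?e > 0" by (rule nn_pos_e1[OF i(4)])
  have "((\<lambda>t. 1 / \<rho>\<^sub>r t) has_real_derivative - \<rho>' / (\<rho>\<^sub>r t)\<^sup>2) (at t)"
    using p by (auto intro!: derivative_eq_intros d simp: power2_eq_square)
  from DERIV_chain2[OF smooth_on_frechet_1(2)[OF smooth_nn_e1 _ e] this]
  have dn: "((\<lambda>t. nn (1 / \<rho>\<^sub>r t)) has_real_derivative deriv nn ?e * (- \<rho>' / (\<rho>\<^sub>r t)\<^sup>2)) (at t)" by simp
  have "((\<lambda>t. real h * ln (\<rho>\<^sub>r t) + ln (nn (1 / \<rho>\<^sub>r t))) has_real_derivative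
     real h * (\<rho>' / \<rho>\<^sub>r t) + (deriv nn ?e * (- \<rho>' / (\<rho>\<^sub>r t)\<^sup>2)) / nn ?e) (at t)"
    using p n by (auto intro!: derivative_eq_intros d dn simp: mult.commute)
  then have "((\<lambda>t. ln (sfreq D * (beta D + 1) / real \<kappa>) + beta D * ln t) has_real_derivative
     real h * (\<rho>' / \<rho>\<^sub>r t) + (deriv nn ?e * (- \<rho>' / (\<rho>\<^sub>r t)\<^sup>2)) / nn ?e) (at t)"
  proof (rule has_field_derivative_transform_within_open[of _ _ _ "{t1<..}"])
    fix s assume s: "s \<in> {t1<..}"
    have s': "s > t1" "s > 0" using s t1(1) by auto
    have "ln (\<rho>\<^sub>r s ^ h * nn (1 / \<rho>\<^sub>r s)) = ln (sfreq D * (beta D + 1) / real \<kappa> * s powr beta D)"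
      using rho_equation[OF s'(1)] by simp
    moreover have "ln (\<rho>\<^sub>r s ^ h * nn (1 / \<rho>\<^sub>r s)) = real h * ln (\<rho>\<^sub>r s) + ln (nn (1 / \<rho>\<^sub>r s))"
      using rho_pos[OF s'(1)] nn_pos_e1[OF inv_rho(4)[OF s'(1)]] by (subst ln_mult) (auto simp: ln_realpow)
    moreover have "ln (sfreq D * (beta D + 1) / real \<kappa> * s powr beta D) = ln (sfreq D * (beta D + 1) / real \<kappa>) + beta D * ln s"
      using parameters_pos kappa s' by (subst ln_mult) (auto simp: ln_powr)
    ultimately show "real h * ln (\<rho>\<^sub>r s) + ln (nn (1 / \<rho>\<^sub>r s)) = ln (sfreq D * (beta D + 1) / real \<kappa>) + beta D * ln s"
      by simp
  qed (use t in auto)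
  moreover have "((\<lambda>t. ln (sfreq D * (beta D + 1) / real \<kappa>) + beta D * ln t) has_real_derivative beta D / t) (at t)"
    using t0 by (auto intro!: derivative_eq_intros)
  ultimately have "real h * (\<rho>' / \<rho>\<^sub>r t) + (deriv nn ?e * (- \<rho>' / (\<rho>\<^sub>r t)\<^sup>2)) / nn ?e = beta D / t"
    using DERIV_unique by blast
  moreover have "real h * (\<rho>' / \<rho>\<^sub>r t) + (deriv nn ?e * (- \<rho>' / (\<rho>\<^sub>r t)\<^sup>2)) / nn ?e
     = \<rho>' / \<rho>\<^sub>r t * (real h - ?e * deriv nn ?e / nn ?e)"
  proof -
    have "c * (x / r) + (d * (- x / r\<^sup>2)) / n = x / r * (c - 1 / r * d / n)" for c x r d n :: real
      by (simp add: power2_eq_square right_diff_distrib mult_ac)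
    then show ?thesis .
  qed
  ultimately have eq: "\<rho>' / \<rho>\<^sub>r t * (real h - ?e * deriv nn ?e / nn ?e) = beta D / t" by simp
  define Z where "Z = real h - ?e * deriv nn ?e / nn ?e"
  have "Z > 0" unfolding Z_def by (rule e1(3)[OF i(4)])
  then have "\<rho>' = \<rho>\<^sub>r t * (beta D / Z) / t" using eq p t0 unfolding Z_def[symmetric] by (simp add: field_simps)
  then show ?thesis using d unfolding kap_def Z_def by simp
qed

text \<open>The resonance equation determines the h-th power of \<open>zamp\<close> as s * (beta +
  1) / (\<kappa> * nn e); this is its positive root, a smooth function of e.\<close>

definition zf :: "real \<Rightarrow> real" where
  "zf e = (sfreq D * (beta D + 1) / (real \<kappa> * nn e)) powr (1 / real h)"

lemma zf_arg_pos: "\<bar>e\<bar> < e1 \<Longrightarrow> sfreq D * (beta D + 1) / (real \<kappa> * nn e) > 0"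
  using parameters_pos kappa nn_pos_e1 by simp

lemma zf_pos: "\<bar>e\<bar> < e1 \<Longrightarrow> zf e > 0"
proof -
  assume "\<bar>e\<bar> < e1"
  from zf_arg_pos[OF this] show "zf e > 0" unfolding zf_def powr_gt_zero by linarith
qed

lemma smooth_zf: "smooth_on {-e1<..<e1} zf"
  unfolding zf_def
proof (intro smooth_intros smooth_nn_e1)
  fix e assume "e \<in> {-e1<..<e1}"
  then have e: "\<bar>e\<bar> < e1" by auto
  then show "real \<kappa> * nn e \<noteq> 0" using nn_pos_e1[of e] kappa by simp
  show "sfreq D * (beta D + 1) / (real \<kappa> * nn e) > 0" by (rule zf_arg_pos[OF e])
qed

lemma zf_0: "zf 0 = z0 D \<kappa>"
  by (simp add: zf_def z0_def nu0_eq mult.commute)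

lemma zamp_eq:
  assumes t: "t > t1" shows "zamp D \<rho>\<^sub>r t = zf (1 / \<rho>\<^sub>r t)"
proof -
  note p = rho_pos[OF t] and i = inv_rho[OF t]
  have t0: "t > 0" using t t1(1) by simp
  let ?n = "nn (1 / \<rho>\<^sub>r t)"
  have n: "?n > 0" by (rule nn_pos_e1[OF i(4)])
  have zp: "zamp D \<rho>\<^sub>r t > 0" using p t0 by (simp add: zamp_def)
  have "zamp D \<rho>\<^sub>r t ^ h = \<rho>\<^sub>r t ^ h * t powr (- beta D)"
    unfolding zamp_def power_mult_distrib using t0 h1 by (simp add: powr_realpow[symmetric] powr_powr del: powr_realpow)
  also have "\<rho>\<^sub>r t ^ h = sfreq D * (beta D + 1) / real \<kappa> * t powr beta D / ?n"
  proof -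
    have "\<rho>\<^sub>r t ^ h = \<rho>\<^sub>r t ^ h * ?n / ?n" using n by simp
    then show ?thesis unfolding rho_equation[OF t] .
  qed
  also have "\<dots> * t powr (- beta D) = sfreq D * (beta D + 1) / (real \<kappa> * ?n)"
  proof -
    have "t powr beta D * t powr (- beta D) = 1" using t0 by (simp add: powr_minus)
    moreover have "sfreq D * (beta D + 1) / real \<kappa> * t powr beta D / ?n * t powr (- beta D)
      = sfreq D * (beta D + 1) / (real \<kappa> * ?n) * (t powr beta D * t powr (- beta D))" by simp
    ultimately show ?thesis by simp
  qed
  finally have "zamp D \<rho>\<^sub>r t ^ h = sfreq D * (beta D + 1) / (real \<kappa> * ?n)" .
  then have "zf (1 / \<rho>\<^sub>r t) = (zamp D \<rho>\<^sub>r t ^ h) powr (1 / real h)" by (simp add: zf_def)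
  also have "\<dots> = zamp D \<rho>\<^sub>r t" using zp h1 by (simp add: powr_realpow[symmetric] powr_powr del: powr_realpow)
  finally show ?thesis by simp
qed

definition ee :: "real \<Rightarrow> real" where "ee \<tau> = 1 / \<rho>\<^sub>r (tt \<tau>)"

definition dd :: "real \<Rightarrow> real" where "dd \<tau> = tt \<tau> powr (- A)"

lemma ee: "\<tau> > \<tau>1 \<Longrightarrow> 0 < ee \<tau>" "\<tau> > \<tau>1 \<Longrightarrow> ee \<tau> < e1 / 4" "\<tau> > \<tau>1 \<Longrightarrow> \<bar>ee \<tau>\<bar> < e1"
  using inv_rho tt_t1 by (auto simp: ee_def)

lemma dd: "\<tau> > \<tau>1 \<Longrightarrow> 0 < dd \<tau>" "\<tau> > \<tau>1 \<Longrightarrow> dd \<tau> < 1 / (4 * (r0 + 1))"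
proof -
  assume "\<tau> > \<tau>1"
  then show "0 < dd \<tau>" "dd \<tau> < 1 / (4 * (r0 + 1))"
    using t1(6)[OF tt_t1] tt_pos[OF tau_pos, of \<tau>] unfolding dd_def by auto
qed

text \<open>The derivative is again a smooth function of e, divided by \<tau>. Together with
  \<open>DERIV_dd\<close> this makes the calculus closed under \<tau> times the
  \<tau>-derivative.\<close>

lemma DERIV_ee: 
  assumes \<tau>: "\<tau> > \<tau>1" shows "(ee has_real_derivative - (ee \<tau> * kap (ee \<tau>)) / (B * \<tau>)) (at \<tau>)"
proof -
  note p = rho_pos[OF tt_t1[OF \<tau>]] and q = tt_pos[OF tau_pos[OF \<tau>]]
  have "((\<lambda>\<tau>. 1 / \<rho>\<^sub>r (tt \<tau>)) has_real_derivative
     - (\<rho>\<^sub>r (tt \<tau>) * kap (1 / \<rho>\<^sub>r (tt \<tau>)) / tt \<tau> * (tt \<tau> / (B * \<tau>))) / (\<rho>\<^sub>r (tt \<tau>))\<^sup>2) (at \<tau>)"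
  proof -
    have "((\<lambda>\<tau>. \<rho>\<^sub>r (tt \<tau>)) has_real_derivative \<rho>\<^sub>r (tt \<tau>) * kap (1 / \<rho>\<^sub>r (tt \<tau>)) / tt \<tau> * (tt \<tau> / (B * \<tau>))) (at \<tau>)"
      by (rule DERIV_chain2[where f="\<rho>\<^sub>r" and g=tt, OF DERIV_rho[OF tt_t1[OF \<tau>]] DERIV_tt[OF tau_pos[OF \<tau>]]])
    then show ?thesis using p by (auto intro!: derivative_eq_intros simp: power2_eq_square)
  qed
  then show ?thesis unfolding ee_def[abs_def]
    by (rule DERIV_cong) (use p q in \<open>simp add: power2_eq_square\<close>)
qed

lemma DERIV_dd:
  assumes \<tau>: "\<tau> > \<tau>1" shows "(dd has_real_derivative - (A * dd \<tau>) / (B * \<tau>)) (at \<tau>)"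
proof -
  note q = tt_pos[OF tau_pos[OF \<tau>]]
  have "((\<lambda>\<tau>. tt \<tau> powr (- A)) has_real_derivative - A * tt \<tau> powr (- A - 1) * (tt \<tau> / (B * \<tau>))) (at \<tau>)"
    by (rule DERIV_chain2[OF has_real_derivative_powr[OF q] DERIV_tt[OF tau_pos[OF \<tau>]]])
  then show ?thesis unfolding dd_def[abs_def]
    by (rule DERIV_cong) (use q in \<open>simp add: powr_diff\<close>)
qed

end

text \<open>At e = 0 the quantity h - e * nn' / nn equals h \<ge> 1, so continuity provides e1. All
  other thresholds come from limits at infinity.\<close>

lemma (in oscillator) resonance_exists:
  assumes k: "\<kappa> \<ge> 1" and res: "resonant_amplitude D \<kappa> \<rho>\<^sub>r" and r0: "r0 > 0"
    and ex: "- 1 \<le> Mmax D" "Mmax D < beta D" "3 * M1 D - 2 * M2 D \<ge> beta D"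
  obtains e1 t1 where "\<And>\<tau>1. 1 \<le> \<tau>1 \<Longrightarrow> t1 \<le> time D \<tau>1 \<Longrightarrow> resonance D \<rho>0 \<kappa> \<rho>\<^sub>r r0 e1 t1 \<tau>1"
proof -
  have sd: "smooth_on {-eps0<..<eps0} (\<lambda>e. real h - e * deriv nn e / nn e)"
    by (intro smooth_intros smooth_nn smooth_on_frechet_1(1)) (use nn_pos in \<open>fastforce simp: abs_less_iff\<close>)+
  have "((\<lambda>e. real h - e * deriv nn e / nn e) \<longlongrightarrow> real h - 0 * deriv nn 0 / nn 0) (at 0)"
  proof -
    have "isCont (\<lambda>e. real h - e * deriv nn e / nn e) 0"
      using smooth_on_continuous[OF sd] eps0(1) by (simp add: continuous_on_eq_continuous_at)
    then show ?thesis unfolding isCont_def .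
  qed
  then have "eventually (\<lambda>e. real h - e * deriv nn e / nn e > 0) (at 0)"
    by (rule order_tendstoD(1)) (use h1 in simp)
  then obtain d where d: "d > 0" "\<And>e. e \<noteq> 0 \<Longrightarrow> \<bar>e\<bar> < d \<Longrightarrow> real h - e * deriv nn e / nn e > 0"
    unfolding eventually_at by (auto simp: dist_real_def)
  define e1 where "e1 = min d eps0"
  have e1: "0 < e1" "e1 \<le> eps0" using d eps0 by (auto simp: e1_def)
  have e1': "real h - e * deriv nn e / nn e > 0" if "\<bar>e\<bar> < e1" for e
    using that d(2)[of e] h1 by (cases "e = 0") (auto simp: e1_def)
  have A: "expA D > 0" using ex by (simp add: expA_def)
  have lim: "filterlim \<rho>\<^sub>r at_top at_top" and ev: "\<forall>\<^sub>F t in at_top. freq D (\<rho>\<^sub>r t) = deriv (phase D) t / real \<kappa> \<and>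
        (\<forall>k. (deriv ^^ k) \<rho>\<^sub>r differentiable (at t))"
    using res by (auto simp: resonant_amplitude_def)
  have "((\<lambda>t. t powr (- expA D)) \<longlongrightarrow> 0) at_top"
    using A by (intro tendsto_neg_powr) (auto intro: filterlim_ident)
  then have "\<forall>\<^sub>F t in at_top. t powr (- expA D) < 1 / (4 * (r0 + 1))"
    by (rule order_tendstoD(2)) (use r0 in simp)
  with ev filterlim_at_top_dense[THEN iffD1, OF lim, rule_format, of "2 * \<rho>0"]
    filterlim_at_top_dense[THEN iffD1, OF lim, rule_format, of "4 / e1"]
  have "\<forall>\<^sub>F t in at_top. freq D (\<rho>\<^sub>r t) = deriv (phase D) t / real \<kappa> \<and> \<rho>\<^sub>r differentiable (at t) \<and> \<rho>\<^sub>r t > 2 * \<rho>0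
     \<and> \<rho>\<^sub>r t > 4 / e1 \<and> t powr (- expA D) < 1 / (4 * (r0 + 1))"
  proof eventually_elim
    case (elim t)
    \<comment> \<open>The iterate of order 0 is the amplitude itself.\<close>
    then have "(deriv ^^ 0) \<rho>\<^sub>r differentiable (at t)" by blast
    with elim show ?case by simp
  qed
  then obtain t1' where t1': "\<And>t. t \<ge> t1' \<Longrightarrow> freq D (\<rho>\<^sub>r t) = deriv (phase D) t / real \<kappa> \<and> \<rho>\<^sub>r differentiable (at t) \<and> \<rho>\<^sub>r t > 2 * \<rho>0
     \<and> \<rho>\<^sub>r t > 4 / e1 \<and> t powr (- expA D) < 1 / (4 * (r0 + 1))"
    unfolding eventually_at_top_linorder by blast
  show ?thesis
  proof (rule that[of "max t1' 1" e1])
    fix \<tau>1 :: real assume "1 \<le> \<tau>1" "max t1' 1 \<le> time D \<tau>1"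
    then show "resonance D \<rho>0 \<kappa> \<rho>\<^sub>r r0 e1 (max t1' 1) \<tau>1"
      using k r0 e1 e1' t1' ex by unfold_locales auto
  qed
qed

section \<open>Functions smooth up to the limit of infinite amplitude\<close>

lemma smooth_on_curve:
  fixes g :: "'a::euclidean_space \<Rightarrow> real" and c :: "real \<Rightarrow> 'a"
  assumes g: "smooth_on S g" and c: "(c has_derivative (\<lambda>h. h *\<^sub>R v)) (at s)" "c s \<in> S"
  shows "((\<lambda>s. g (c s)) has_real_derivative frechet_derivative g (at (c s)) v) (at s)"
proof -
  have d: "(g has_derivative frechet_derivative g (at (c s))) (at (c s))"
    by (rule smooth_on_has_derivative[OF g c(2)])
  have "((\<lambda>s. g (c s)) has_derivative (\<lambda>h. frechet_derivative g (at (c s)) (h *\<^sub>R v))) (at s)"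
    by (rule has_derivative_compose[OF c(1) d])
  moreover have "(\<lambda>h. frechet_derivative g (at (c s)) (h *\<^sub>R v)) = (*) (frechet_derivative g (at (c s)) v)"
    by (rule ext) (simp add: linear_scale[OF has_derivative_linear[OF d]] mult.commute)
  ultimately show ?thesis by (simp only: has_field_derivative_def)
qed

type_synonym pnt = "(real \<times> real \<times> real \<times> real) \<times> real"

context resonance
begin

text \<open>For |d| < dlt and |r| < r0 + 1 the product d * r stays below 1 / 2 in absolute value,
  which keeps 1 + d * r away from 0.\<close>

definition dlt :: real where "dlt = 1 / (2 * (r0 + 1))"

text \<open>Every function of \<open>(r, \<theta>, \<zeta>, \<tau>)\<close> that occurs depends on \<open>\<tau>\<close> only through \<open>1 / \<rho>\<^sub>r\<close> and \<open>t powr -A\<close>,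
  and smoothly so up to the limit where both vanish; this set is the domain of the corresponding
  functions of \<open>((1 / \<rho>\<^sub>r, t powr -A, r, \<theta>), \<zeta>)\<close>.\<close>

definition S4 :: "(real \<times> real \<times> real \<times> real) set" where
  "S4 = {-(e1/2)<..<e1/2} \<times> {-dlt<..<dlt} \<times> {-(r0 + 1)<..<r0 + 1} \<times> UNIV"

definition Om :: "pnt set" where "Om = S4 \<times> UNIV"

lemma open_S4: "open S4" by (simp add: S4_def open_Times)

lemma open_Om: "open Om" using open_S4 by (simp add: Om_def open_Times)

text \<open>The period in \<zeta> is 2 * pi * \<kappa>: it advances the angle \<zeta> / \<kappa> +
  \<theta> by one turn and the phase of the perturbation by \<kappa> turns.\<close>

definition ut :: pnt where "ut = ((0, 0, 0, 2 * pi), 0)"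
definition uz :: pnt where "uz = ((0, 0, 0, 0), 2 * pi * real \<kappa>)"

lemma Om_shift: "x \<in> Om \<Longrightarrow> x + c *\<^sub>R ut \<in> Om" "x \<in> Om \<Longrightarrow> x + c *\<^sub>R uz \<in> Om"
  by (auto simp: Om_def S4_def ut_def uz_def mem_Times_iff)

lemma Om_shift1: "x \<in> Om \<Longrightarrow> x + ut \<in> Om" "x \<in> Om \<Longrightarrow> x + uz \<in> Om"
  using Om_shift[of x 1] by simp_all

text \<open>These functions live on a neighbourhood of the limit points e = d = 0, which are not
  attained at any finite \<tau>. Periodicity reduces the angles to a compact set, so bounds and
  limits become uniform.\<close>

definition nfun :: "(pnt \<Rightarrow> real) \<Rightarrow> bool" where
  "nfun g \<longleftrightarrow> smooth_on Om g \<and> (\<forall>x\<in>Om. g (x + ut) = g x \<and> g (x + uz) = g x)"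

definition pt :: "real \<Rightarrow> real \<Rightarrow> real \<Rightarrow> real \<Rightarrow> pnt" where
  "pt r \<theta> \<zeta> \<tau> = ((ee \<tau>, dd \<tau>, r, \<theta>), \<zeta>)"

text \<open>Agreement on |r| < r0 + 1, beyond the strip |r| \<le> r0 of interest, makes two-sided
  derivatives in r available up to the boundary of that strip.\<close>

definition rep :: "fun4 \<Rightarrow> (pnt \<Rightarrow> real) \<Rightarrow> bool" where
  "rep G g \<longleftrightarrow> (\<forall>r \<theta> \<zeta> \<tau>. \<bar>r\<bar> < r0 + 1 \<longrightarrow> \<tau> > \<tau>1 \<longrightarrow> G r \<theta> \<zeta> \<tau> = g (pt r \<theta> \<zeta> \<tau>))"

definition nice :: "fun4 \<Rightarrow> bool" where "nice G \<longleftrightarrow> (\<exists>g. nfun g \<and> rep G g)"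

lemma pt_Om: "\<bar>r\<bar> < r0 + 1 \<Longrightarrow> \<tau> > \<tau>1 \<Longrightarrow> pt r \<theta> \<zeta> \<tau> \<in> Om"
proof -
  assume r: "\<bar>r\<bar> < r0 + 1" and \<tau>: "\<tau> > \<tau>1"
  have "1 / (4 * (r0 + 1)) < 1 / (2 * (r0 + 1))" using r0 by (simp add: field_simps)
  then have "dd \<tau> < dlt" "- dlt < dd \<tau>" using dd[OF \<tau>] by (auto simp: dlt_def)
  moreover have "ee \<tau> < e1 / 2" "- (e1 / 2) < ee \<tau>" using ee[OF \<tau>] e1(1) by auto
  ultimately show ?thesis using r by (auto simp: pt_def Om_def S4_def abs_less_iff)
qed

lemma nfun_const: "nfun (\<lambda>x. c)" by (simp add: nfun_def smooth_on_const)
lemma nfun_add: "nfun f \<Longrightarrow> nfun g \<Longrightarrow> nfun (\<lambda>x. f x + g x)" by (simp add: nfun_def smooth_on_add)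
lemma nfun_mult: "nfun f \<Longrightarrow> nfun g \<Longrightarrow> nfun (\<lambda>x. f x * g x)" by (simp add: nfun_def smooth_on_mult)
lemma nfun_diff: "nfun f \<Longrightarrow> nfun g \<Longrightarrow> nfun (\<lambda>x. f x - g x)" by (simp add: nfun_def smooth_on_diff)

lemma nfun_derivative: "nfun g \<Longrightarrow> nfun (\<lambda>x. frechet_derivative g (at x) v)"
  using frechet_derivative_periodic[OF _ open_Om] Om_shift1
  by (auto simp: nfun_def intro!: smooth_on_derivative open_Om)

definition S3 :: "(real \<times> real \<times> real) set" where
  "S3 = {-(e1/2)<..<e1/2} \<times> {-dlt<..<dlt} \<times> {-(r0 + 1)<..<r0 + 1}"

lemma nfun_S3:
  assumes "smooth_on S3 f"
  shows "nfun (\<lambda>x. f (fst (fst x), fst (snd (fst x)), fst (snd (snd (fst x)))))"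
  unfolding nfun_def
proof (intro conjI ballI)
  show "smooth_on Om (\<lambda>x. f (fst (fst x), fst (snd (fst x)), fst (snd (snd (fst x)))))"
    by (rule smooth_on_compose[OF assms]) (intro smooth_intros, auto simp: Om_def S4_def S3_def)
qed (simp_all add: ut_def uz_def)

lemma nice_const: "nice (\<lambda>r \<theta> \<zeta> \<tau>. c)"
  unfolding nice_def rep_def by (intro exI[of _ "\<lambda>x. c"]) (simp add: nfun_const)

lemma nice_add: "nice F \<Longrightarrow> nice G \<Longrightarrow> nice (\<lambda>r \<theta> \<zeta> \<tau>. F r \<theta> \<zeta> \<tau> + G r \<theta> \<zeta> \<tau>)"
proof -
  assume "nice F" "nice G"
  then obtain f g where "nfun f" "rep F f" "nfun g" "rep G g" by (auto simp: nice_def)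
  then show ?thesis unfolding nice_def rep_def
    by (intro exI[of _ "\<lambda>x. f x + g x"]) (simp add: nfun_add)
qed

lemma nice_mult: "nice F \<Longrightarrow> nice G \<Longrightarrow> nice (\<lambda>r \<theta> \<zeta> \<tau>. F r \<theta> \<zeta> \<tau> * G r \<theta> \<zeta> \<tau>)"
proof -
  assume "nice F" "nice G"
  then obtain f g where "nfun f" "rep F f" "nfun g" "rep G g" by (auto simp: nice_def)
  then show ?thesis unfolding nice_def rep_def
    by (intro exI[of _ "\<lambda>x. f x * g x"]) (simp add: nfun_mult)
qed

lemma nice_diff: "nice F \<Longrightarrow> nice G \<Longrightarrow> nice (\<lambda>r \<theta> \<zeta> \<tau>. F r \<theta> \<zeta> \<tau> - G r \<theta> \<zeta> \<tau>)"
proof -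
  assume "nice F" "nice G"
  then obtain f g where "nfun f" "rep F f" "nfun g" "rep G g" by (auto simp: nice_def)
  then show ?thesis unfolding nice_def rep_def
    by (intro exI[of _ "\<lambda>x. f x - g x"]) (simp add: nfun_diff)
qed

lemma nice_S3:
  assumes "smooth_on S3 f" shows "nice (\<lambda>r \<theta> \<zeta> \<tau>. f (ee \<tau>, dd \<tau>, r))"
  unfolding nice_def rep_def by (intro exI conjI, rule nfun_S3[OF assms]) (simp add: pt_def)

lemma nice_r: "nice (\<lambda>r \<theta> \<zeta> \<tau>. r)"
proof -
  have "smooth_on S3 (\<lambda>p. snd (snd p))" by (intro smooth_intros)
  from nice_S3[OF this] show ?thesis by simp
qed

lemma nice_power: "nice F \<Longrightarrow> nice (\<lambda>r \<theta> \<zeta> \<tau>. F r \<theta> \<zeta> \<tau> ^ n)"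
  by (induction n) (simp_all add: nice_const nice_mult)

lemma nice_cong:
  assumes "nice F" "\<And>r \<theta> \<zeta> \<tau>. \<bar>r\<bar> < r0 + 1 \<Longrightarrow> \<tau> > \<tau>1 \<Longrightarrow> F r \<theta> \<zeta> \<tau> = G r \<theta> \<zeta> \<tau>"
  shows "nice G"
proof -
  obtain f where f: "nfun f" "rep F f" using assms(1) by (auto simp: nice_def)
  then have "rep G f" using assms(2) unfolding rep_def by simp
  then show ?thesis using f(1) by (auto simp: nice_def)
qed

lemma rep_DERIV_r:
  assumes "nfun g" "rep G g" "\<bar>r\<bar> < r0 + 1" "\<tau> > \<tau>1"
  shows "((\<lambda>x. G x \<theta> \<zeta> \<tau>) has_real_derivative frechet_derivative g (at (pt r \<theta> \<zeta> \<tau>)) ((0, 0, 1, 0), 0)) (at r)"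
proof -
  have "((\<lambda>x. pt x \<theta> \<zeta> \<tau>) has_derivative (\<lambda>h. h *\<^sub>R ((0, 0, 1, 0), 0))) (at r)"
    unfolding pt_def by (auto intro!: derivative_eq_intros)
  then have "((\<lambda>x. g (pt x \<theta> \<zeta> \<tau>)) has_real_derivative frechet_derivative g (at (pt r \<theta> \<zeta> \<tau>)) ((0, 0, 1, 0), 0)) (at r)"
    using assms(1) by (intro smooth_on_curve[where S=Om]) (auto simp: nfun_def intro!: pt_Om assms)
  moreover have "open {-(r0 + 1)<..<r0 + 1}" "r \<in> {-(r0 + 1)<..<r0 + 1}" using assms(3) by (auto simp: abs_less_iff)
  ultimately show ?thesis
    by (rule has_field_derivative_transform_within_open) (use assms in \<open>auto simp: rep_def abs_less_iff\<close>)
qed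

lemma rep_DERIV_theta:
  assumes "nfun g" "rep G g" "\<bar>r\<bar> < r0 + 1" "\<tau> > \<tau>1"
  shows "((\<lambda>x. G r x \<zeta> \<tau>) has_real_derivative frechet_derivative g (at (pt r \<theta> \<zeta> \<tau>)) ((0, 0, 0, 1), 0)) (at \<theta>)"
proof -
  have "((\<lambda>x. pt r x \<zeta> \<tau>) has_derivative (\<lambda>h. h *\<^sub>R ((0, 0, 0, 1), 0))) (at \<theta>)"
    unfolding pt_def by (auto intro!: derivative_eq_intros)
  then have "((\<lambda>x. g (pt r x \<zeta> \<tau>)) has_real_derivative frechet_derivative g (at (pt r \<theta> \<zeta> \<tau>)) ((0, 0, 0, 1), 0)) (at \<theta>)"
    using assms(1) by (intro smooth_on_curve[where S=Om]) (auto simp: nfun_def intro!: pt_Om assms)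
  then show ?thesis using assms by (simp add: rep_def)
qed

lemma rep_DERIV_tau:
  assumes "nfun g" "rep G g" "\<bar>r\<bar> < r0 + 1" "\<tau> > \<tau>1"
  shows "((\<lambda>x. G r \<theta> \<zeta> x) has_real_derivative
    frechet_derivative g (at (pt r \<theta> \<zeta> \<tau>)) ((- (ee \<tau> * kap (ee \<tau>)) / (B * \<tau>), - (A * dd \<tau>) / (B * \<tau>), 0, 0), 0)) (at \<tau>)"
proof -
  have "(ee has_derivative (\<lambda>h. h * (- (ee \<tau> * kap (ee \<tau>)) / (B * \<tau>)))) (at \<tau>)"
    "(dd has_derivative (\<lambda>h. h * (- (A * dd \<tau>) / (B * \<tau>)))) (at \<tau>)"
    using DERIV_ee[OF assms(4)] DERIV_dd[OF assms(4)] by (simp_all only: has_field_derivative_def mult_commute_abs)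
  then have "((\<lambda>x. pt r \<theta> \<zeta> x) has_derivative (\<lambda>h. h *\<^sub>R ((- (ee \<tau> * kap (ee \<tau>)) / (B * \<tau>), - (A * dd \<tau>) / (B * \<tau>), 0, 0), 0))) (at \<tau>)"
    unfolding pt_def by (auto intro!: derivative_eq_intros simp: zero_prod_def)
  then have "((\<lambda>x. g (pt r \<theta> \<zeta> x)) has_real_derivative frechet_derivative g (at (pt r \<theta> \<zeta> \<tau>))
     ((- (ee \<tau> * kap (ee \<tau>)) / (B * \<tau>), - (A * dd \<tau>) / (B * \<tau>), 0, 0), 0)) (at \<tau>)"
    using assms(1) by (intro smooth_on_curve[where S=Om]) (auto simp: nfun_def intro!: pt_Om assms)
  moreover have "open {\<tau>1<..}" "\<tau> \<in> {\<tau>1<..}" using assms(4) by auto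
  ultimately show ?thesis
    by (rule has_field_derivative_transform_within_open) (use assms in \<open>auto simp: rep_def\<close>)
qed

lemma nice_DERIV:
  assumes "nice G" "\<bar>r\<bar> < r0 + 1" "\<tau> > \<tau>1"
  shows "((\<lambda>x. G x \<theta> \<zeta> \<tau>) has_real_derivative d_r G r \<theta> \<zeta> \<tau>) (at r)"
    "((\<lambda>x. G r x \<zeta> \<tau>) has_real_derivative d_theta G r \<theta> \<zeta> \<tau>) (at \<theta>)"
    "((\<lambda>x. G r \<theta> \<zeta> x) has_real_derivative d_tau G r \<theta> \<zeta> \<tau>) (at \<tau>)"
proof -
  obtain g where g: "nfun g" "rep G g" using assms(1) by (auto simp: nice_def)
  show "((\<lambda>x. G x \<theta> \<zeta> \<tau>) has_real_derivative d_r G r \<theta> \<zeta> \<tau>) (at r)"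
    unfolding d_r_def by (rule DERIV_deriv_iff_has_field_derivative[THEN iffD2]) (use rep_DERIV_r[OF g assms(2,3)] in blast)
  show "((\<lambda>x. G r x \<zeta> \<tau>) has_real_derivative d_theta G r \<theta> \<zeta> \<tau>) (at \<theta>)"
    unfolding d_theta_def by (rule DERIV_deriv_iff_has_field_derivative[THEN iffD2]) (use rep_DERIV_theta[OF g assms(2,3)] in blast)
  show "((\<lambda>x. G r \<theta> \<zeta> x) has_real_derivative d_tau G r \<theta> \<zeta> \<tau>) (at \<tau>)"
    unfolding d_tau_def by (rule DERIV_deriv_iff_has_field_derivative[THEN iffD2]) (use rep_DERIV_tau[OF g assms(2,3)] in blast)
qed

lemma nice_d_r: "nice G \<Longrightarrow> nice (d_r G)"
proof -
  assume "nice G"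
  then obtain g where g: "nfun g" "rep G g" by (auto simp: nice_def)
  show ?thesis unfolding nice_def rep_def d_r_def
    using DERIV_imp_deriv[OF rep_DERIV_r[OF g]] nfun_derivative[OF g(1)] by blast
qed

lemma nice_d_theta: "nice G \<Longrightarrow> nice (d_theta G)"
proof -
  assume "nice G"
  then obtain g where g: "nfun g" "rep G g" by (auto simp: nice_def)
  show ?thesis unfolding nice_def rep_def d_theta_def
    using DERIV_imp_deriv[OF rep_DERIV_theta[OF g]] nfun_derivative[OF g(1)] by blast
qed

lemma smooth_S3_e: "smooth_on {-e1<..<e1} f \<Longrightarrow> smooth_on S3 (\<lambda>p. f (fst p))"
  by (rule smooth_on_compose) (auto intro!: smooth_intros simp: S3_def)

lemma nice_e: "smooth_on {-e1<..<e1} f \<Longrightarrow> nice (\<lambda>r \<theta> \<zeta> \<tau>. f (ee \<tau>))"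
  using nice_S3[OF smooth_S3_e] by simp

text \<open>The \<tau>-derivative acts through e and d only, and each of their derivatives is a
  smooth function of e and d divided by \<tau>.\<close>

lemma nice_d_tau:
  assumes "nice G" shows "nice (\<lambda>r \<theta> \<zeta> \<tau>. \<tau> * d_tau G r \<theta> \<zeta> \<tau>)"
proof -
  obtain g where g: "nfun g" "rep G g" using assms by (auto simp: nice_def)
  define ge where "ge x = frechet_derivative g (at x) ((1, 0, 0, 0), 0)" for x
  define gd where "gd x = frechet_derivative g (at x) ((0, 1, 0, 0), 0)" for x
  define Ge where "Ge r \<theta> \<zeta> \<tau> = ge (pt r \<theta> \<zeta> \<tau>)" for r \<theta> \<zeta> \<tau>
  define Gd where "Gd r \<theta> \<zeta> \<tau> = gd (pt r \<theta> \<zeta> \<tau>)" for r \<theta> \<zeta> \<tau>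
  have G: "nice Ge" "nice Gd"
    unfolding nice_def rep_def Ge_def Gd_def
    using nfun_derivative[OF g(1), of "((1, 0, 0, 0), 0)"] nfun_derivative[OF g(1), of "((0, 1, 0, 0), 0)"]
    by (auto simp: ge_def[abs_def] gd_def[abs_def])
  have "nice (\<lambda>r \<theta> \<zeta> \<tau>. - (1 / B) * (ee \<tau> * kap (ee \<tau>)) * Ge r \<theta> \<zeta> \<tau> + - (A / B) * dd \<tau> * Gd r \<theta> \<zeta> \<tau>)"
    by (intro nice_add nice_mult nice_const G nice_e[of "\<lambda>e. e * kap e"] nice_S3[of "\<lambda>p. fst (snd p)", simplified]
        smooth_intros smooth_kap)
  then show ?thesis
  proof (rule nice_cong)
    fix r \<theta> \<zeta> \<tau> assume r: "\<bar>r\<bar> < r0 + 1" and \<tau>: "\<tau> > \<tau>1"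
    let ?x = "pt r \<theta> \<zeta> \<tau>"
    have lin: "linear (frechet_derivative g (at ?x))"
      using has_derivative_linear smooth_on_has_derivative pt_Om[OF r \<tau>] g(1) unfolding nfun_def by blast
    define p where "p = - (ee \<tau> * kap (ee \<tau>)) / (B * \<tau>)"
    define q where "q = - (A * dd \<tau>) / (B * \<tau>)"
    have "d_tau G r \<theta> \<zeta> \<tau> = frechet_derivative g (at ?x) ((p, q, 0, 0), 0)"
      unfolding d_tau_def p_def q_def by (rule DERIV_imp_deriv[OF rep_DERIV_tau[OF g r \<tau>]])
    also have "((p, q, 0, 0), 0) = p *\<^sub>R ((1, 0, 0, 0), 0) + q *\<^sub>R ((0, 1, 0, 0), 0 :: real)" by simp
    also have "frechet_derivative g (at ?x) \<dots> = p * Ge r \<theta> \<zeta> \<tau> + q * Gd r \<theta> \<zeta> \<tau>"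
      unfolding linear_add[OF lin] linear_scale[OF lin] by (simp add: Ge_def Gd_def ge_def gd_def)
    finally show "- (1 / B) * (ee \<tau> * kap (ee \<tau>)) * Ge r \<theta> \<zeta> \<tau> + - (A / B) * dd \<tau> * Gd r \<theta> \<zeta> \<tau> = \<tau> * d_tau G r \<theta> \<zeta> \<tau>"
      using tau_pos[OF \<tau>] exponent_order by (simp add: p_def q_def field_simps)
  qed
qed

section \<open>Averaging over the fast phase\<close>

abbreviation Lk :: real where "Lk \<equiv> 2 * pi * real \<kappa>"

lemma kappa_nonzero: "\<kappa> \<noteq> 0" using kappa by linarith

lemma Lk_pos: "Lk > 0" using kappa by simp

lemma nfun_cont: "nfun g \<Longrightarrow> x \<in> S4 \<Longrightarrow> continuous_on UNIV (\<lambda>y. g (x, y))"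
proof -
  assume g: "nfun g" and x: "x \<in> S4"
  have "continuous_on Om g" using g by (auto simp: nfun_def intro: smooth_on_continuous)
  then show ?thesis
    by (rule continuous_on_compose2) (use x in \<open>auto simp: Om_def intro!: continuous_intros\<close>)
qed

lemma nfun_avg:
  assumes g: "nfun g"
  shows "nfun (\<lambda>x. (LBINT y=0..ereal Lk. g (fst x, y)) / Lk)"
  unfolding nfun_def
proof (intro conjI ballI)
  have P: "smooth_on (S4 \<times> UNIV) (\<lambda>q. LBINT y=0..ereal (snd q). g (fst q, y))"
    using smooth_on_primitive[of S4 g] g open_S4 by (simp add: nfun_def Om_def)
  have "smooth_on Om (\<lambda>x. LBINT y=0..ereal Lk. g (fst x, y))"
  proof -
    have "smooth_on Om (\<lambda>x. (fst x, Lk))" by (intro smooth_intros)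
    from smooth_on_compose[OF P this] show ?thesis by (simp add: Om_def mem_Times_iff)
  qed
  then show "smooth_on Om (\<lambda>x. (LBINT y=0..ereal Lk. g (fst x, y)) / Lk)"
    using kappa_nonzero by (intro smooth_intros) auto
  fix x assume "x \<in> Om"
  then have "(fst x, y) \<in> Om" for y by (auto simp: Om_def)
  then have "g ((fst x, y) + ut) = g (fst x, y)" for y using g by (simp add: nfun_def)
  then have "g (fst (x + ut), y) = g (fst x, y)" for y by (simp add: ut_def)
  then show "(LBINT y=0..ereal Lk. g (fst (x + ut), y)) / Lk = (LBINT y=0..ereal Lk. g (fst x, y)) / Lk" by simp
  show "(LBINT y=0..ereal Lk. g (fst (x + uz), y)) / Lk = (LBINT y=0..ereal Lk. g (fst x, y)) / Lk"
  proof -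
    have "fst (x + uz) = fst x" by (cases x) (auto simp: uz_def zero_prod_def[symmetric])
    then show ?thesis by simp
  qed
qed

lemma nice_avg: "nice G \<Longrightarrow> nice (\<lambda>r \<theta> \<zeta> \<tau>. avg \<kappa> (\<lambda>\<zeta>'. G r \<theta> \<zeta>' \<tau>))"
proof -
  assume "nice G"
  then obtain g where g: "nfun g" "rep G g" by (auto simp: nice_def)
  show ?thesis unfolding nice_def rep_def
    by (intro exI conjI, rule nfun_avg[OF g(1)]) (use g(2) in \<open>auto simp: rep_def avg_def pt_def\<close>)
qed

text \<open>Vanishing mean makes the primitive periodic: its increment over one period does not
  depend on the starting point and is 0 at the origin.\<close>

lemma nfun_primitive:
  assumes g: "nfun g" and 0: "\<And>x. x \<in> S4 \<Longrightarrow> (LBINT y=0..ereal Lk. g (x, y)) = 0"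
  shows "nfun (\<lambda>x. LBINT y=0..ereal (snd x). g (fst x, y))"
  unfolding nfun_def
proof (intro conjI ballI)
  show "smooth_on Om (\<lambda>x. LBINT y=0..ereal (snd x). g (fst x, y))"
    using smooth_on_primitive[of S4 g] g open_S4 by (simp add: nfun_def Om_def)
  fix x assume x: "x \<in> Om"
  then have O: "(fst x, y) \<in> Om" for y by (auto simp: Om_def)
  then have "g ((fst x, y) + ut) = g (fst x, y)" for y using g by (simp add: nfun_def)
  then have "g (fst (x + ut), y) = g (fst x, y)" for y by (simp add: ut_def)
  then show "(LBINT y=0..ereal (snd (x + ut)). g (fst (x + ut), y)) = (LBINT y=0..ereal (snd x). g (fst x, y))"
    by (simp add: ut_def)
  have per: "g (fst x, y + Lk) = g (fst x, y)" for y
  proof -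
    have "g ((fst x, y) + uz) = g (fst x, y)" using g O by (simp add: nfun_def)
    then show ?thesis by (simp add: uz_def zero_prod_def[symmetric])
  qed
  have fx: "fst x \<in> S4" using x by (auto simp: Om_def)
  note der = LBINT_has_derivative[OF nfun_cont[OF g fx]]
  define H where "H y = (LBINT s=0..ereal (y + Lk). g (fst x, s)) - (LBINT s=0..ereal y. g (fst x, s))" for y
  have "(H has_real_derivative 0) (at y)" for y
    unfolding H_def by (rule DERIV_cong[OF DERIV_diff[OF DERIV_chain2[where g="\<lambda>y. y + Lk" and Db=1, OF der] der]])
      (auto intro!: derivative_eq_intros simp: per)
  then have "H (snd x) = H 0" using DERIV_isconst_all by blast
  then have "H (snd x) = 0" using 0[OF fx] by (simp add: H_def zero_ereal_def[symmetric])
  then show "(LBINT y=0..ereal (snd (x + uz)). g (fst (x + uz), y)) = (LBINT y=0..ereal (snd x). g (fst x, y))"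
    by (simp add: H_def uz_def zero_prod_def[symmetric])
qed

lemma vsig_pos: "vsig D > 0" using parameters_pos exponent_order by (simp add: vsig_def)

text \<open>The second claim is the purpose of the operator: \<open>vsig\<close> times the
  \<zeta>-derivative of \<open>Iop G\<close> is the mean of G minus G, so adding such a corrector
  replaces a term by its mean.\<close>

lemma nice_Iop_aux:
  assumes "nice G"
  shows "nice (Iop D \<kappa> G)"
    "\<bar>r\<bar> < r0 + 1 \<Longrightarrow> \<tau> > \<tau>1 \<Longrightarrow> ((\<lambda>x. Iop D \<kappa> G r \<theta> x \<tau>) has_real_derivative
      - (1 / vsig D) * (G r \<theta> \<zeta> \<tau> - avg \<kappa> (\<lambda>\<zeta>'. G r \<theta> \<zeta>' \<tau>))) (at \<zeta>)"
proof -
  obtain g where g: "nfun g" "rep G g" using assms by (auto simp: nice_def)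
  define gf where "gf x = g x - (LBINT y=0..ereal Lk. g (fst x, y)) / Lk" for x
  have gf: "nfun gf" unfolding gf_def by (intro nfun_diff g nfun_avg)
  have gf0: "(LBINT y=0..ereal Lk. gf (x, y)) = 0" if x: "x \<in> S4" for x
  proof -
    have "(LBINT y=0..ereal Lk. g (x, y) - c) = ((LBINT y=0..ereal Lk. g (x, y)) - c * Lk) - ((LBINT y=0..ereal 0. g (x, y)) - c * 0)" for c
    proof (rule LBINT_FTC)
      show "continuous_on UNIV (\<lambda>y. g (x, y) - c)" by (intro continuous_intros nfun_cont[OF g(1) x])
      show "((\<lambda>z. (LBINT y=0..ereal z. g (x, y)) - c * z) has_real_derivative g (x, z) - c) (at z)" for z
        by (auto intro!: derivative_eq_intros LBINT_has_derivative nfun_cont[OF g(1) x])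
    qed
    from this[of "(LBINT y=0..ereal Lk. g (x, y)) / Lk"] show ?thesis using kappa_nonzero by (simp add: gf_def zero_ereal_def[symmetric])
  qed
  define P where "P x = (LBINT y=0..ereal (snd x). gf (fst x, y))" for x
  have P: "nfun P" unfolding P_def by (rule nfun_primitive[OF gf gf0])
  have fl: "fluct \<kappa> (\<lambda>\<zeta>'. G r \<theta> \<zeta>' \<tau>) y = gf (pt r \<theta> y \<tau>)" if "\<bar>r\<bar> < r0 + 1" "\<tau> > \<tau>1" for r \<theta> \<tau> y
    using g(2) that by (simp add: fluct_def avg_def gf_def rep_def pt_def)
  have I: "Iop D \<kappa> G r \<theta> \<zeta> \<tau> = - (1 / vsig D) * (P (pt r \<theta> \<zeta> \<tau>) - (LBINT y=0..ereal Lk. P (fst (pt r \<theta> \<zeta> \<tau>), y)) / Lk)"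
    if "\<bar>r\<bar> < r0 + 1" "\<tau> > \<tau>1" for r \<theta> \<zeta> \<tau>
    unfolding Iop_def fl[OF that] by (simp add: fluct_def avg_def P_def pt_def)
  have "nfun (\<lambda>x. - (1 / vsig D) * (P x - (LBINT y=0..ereal Lk. P (fst x, y)) / Lk))"
    by (intro nfun_mult nfun_const nfun_diff P nfun_avg)
  then show "nice (Iop D \<kappa> G)" unfolding nice_def rep_def using I by blast
  assume r: "\<bar>r\<bar> < r0 + 1" and \<tau>: "\<tau> > \<tau>1"
  have S: "fst (pt r \<theta> \<zeta> \<tau>) \<in> S4" using pt_Om[OF r \<tau>, of \<theta> \<zeta>] by (auto simp: Om_def)
  have "((\<lambda>x. P (fst (pt r \<theta> \<zeta> \<tau>), x)) has_real_derivative gf (pt r \<theta> \<zeta> \<tau>)) (at \<zeta>)"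
    using LBINT_has_derivative[OF nfun_cont[OF gf S], of \<zeta>] by (simp add: P_def pt_def)
  then have "((\<lambda>x. - (1 / vsig D) * (P (pt r \<theta> x \<tau>) - (LBINT y=0..ereal Lk. P (fst (pt r \<theta> x \<tau>), y)) / Lk)) has_real_derivative
      - (1 / vsig D) * gf (pt r \<theta> \<zeta> \<tau>)) (at \<zeta>)"
    using vsig_pos by (auto intro!: derivative_eq_intros simp: pt_def)
  then show "((\<lambda>x. Iop D \<kappa> G r \<theta> x \<tau>) has_real_derivative
      - (1 / vsig D) * (G r \<theta> \<zeta> \<tau> - avg \<kappa> (\<lambda>\<zeta>'. G r \<theta> \<zeta>' \<tau>))) (at \<zeta>)"
    unfolding I[OF r \<tau>] fl[OF r \<tau>, symmetric] fluct_def .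
qed

lemmas nice_Iop = nice_Iop_aux(1)
lemmas Iop_DERIV_zeta = nice_Iop_aux(2)

section \<open>Uniform bounds and limits by compactness\<close>

lemma nfun_shift_nat:
  assumes "\<And>x. x \<in> Om \<Longrightarrow> x + u \<in> Om" "\<And>x. x \<in> Om \<Longrightarrow> g (x + u) = (g x :: real)"
  shows "x \<in> Om \<Longrightarrow> x + real n *\<^sub>R u \<in> Om \<and> g (x + real n *\<^sub>R u) = g x"
proof (induction n)
  case (Suc n)
  then show ?case using assms[of "x + real n *\<^sub>R u"] by (simp add: scaleR_add_left add.assoc add.commute[of u])
qed simp

lemma nfun_shift_int:
  assumes u: "\<And>x c. x \<in> Om \<Longrightarrow> x + c *\<^sub>R u \<in> Om" "\<And>x. x \<in> Om \<Longrightarrow> g (x + u) = (g x :: real)" and x: "x \<in> Om"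
  shows "g (x - of_int k *\<^sub>R u) = g x"
proof (cases "k \<ge> 0")
  case True
  then have k: "of_int k = real (nat k)" by simp
  have "x - of_int k *\<^sub>R u \<in> Om" using u(1)[OF x, of "- of_int k"] by simp
  from nfun_shift_nat[of u g, OF _ u(2) this, of "nat k"] u(1)[of _ 1] show ?thesis unfolding k by simp
next
  case False
  then have k: "- of_int k = real (nat (- k))" by simp
  have eq: "x - of_int k *\<^sub>R u = x + real (nat (- k)) *\<^sub>R u" unfolding k[symmetric] by simp
  have "x + real (nat (- k)) *\<^sub>R u \<in> Om \<and> g (x + real (nat (- k)) *\<^sub>R u) = g x"
    by (rule nfun_shift_nat[of u g x "nat (- k)"]) (use u(1)[of _ 1] u(2) x in simp_all)
  then show ?thesis unfolding eq by blast
qed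

text \<open>The reduced angles are the same for all e, d and r, so a value along the motion and its
  limit at e = d = 0 can be compared after one common reduction.\<close>

lemma nfun_reduce:
  assumes g: "nfun g"
  shows "\<exists>\<theta>'\<in>{0..2 * pi}. \<exists>\<zeta>'\<in>{0..Lk}. \<forall>e d r. ((e, d, r, \<theta>), \<zeta>) \<in> Om \<longrightarrow> g ((e, d, r, \<theta>), \<zeta>) = g ((e, d, r, \<theta>'), \<zeta>')"
proof -
  define k where "k = \<lfloor>\<theta> / (2 * pi)\<rfloor>"
  define m where "m = \<lfloor>\<zeta> / Lk\<rfloor>"
  have "of_int k \<le> \<theta> / (2 * pi)" "\<theta> / (2 * pi) < of_int k + 1" "of_int m \<le> \<zeta> / Lk" "\<zeta> / Lk < of_int m + 1"
    unfolding k_def m_def by linarith+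
  then have km: "\<theta> - of_int k * (2 * pi) \<in> {0..2 * pi}" "\<zeta> - of_int m * Lk \<in> {0..Lk}"
    using Lk_pos by (auto simp: field_simps)
  have "g ((e, d, r, \<theta>), \<zeta>) = g ((e, d, r, \<theta> - of_int k * (2 * pi)), \<zeta> - of_int m * Lk)" if x: "((e, d, r, \<theta>), \<zeta>) \<in> Om" for e d r
  proof -
    let ?x = "((e, d, r, \<theta>), \<zeta>)"
    have "g (?x - of_int k *\<^sub>R ut) = g ?x"
      by (rule nfun_shift_int[OF Om_shift(1) _ x]) (use g in \<open>auto simp: nfun_def\<close>)
    moreover have x2: "?x - of_int k *\<^sub>R ut \<in> Om" using Om_shift(1)[OF x, of "- of_int k"] by simp
    have "g (?x - of_int k *\<^sub>R ut - of_int m *\<^sub>R uz) = g (?x - of_int k *\<^sub>R ut)"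
      by (rule nfun_shift_int[OF Om_shift(2) _ x2]) (use g in \<open>auto simp: nfun_def\<close>)
    ultimately show ?thesis by (simp add: ut_def uz_def)
  qed
  then show ?thesis using km by blast
qed

text \<open>One period in each angle, and room for all values of e and d beyond \<tau>1 as well as
  for their limits 0.\<close>

definition Kc :: "pnt set" where
  "Kc = ({-(e1/4)..e1/4} \<times> {-(dlt/2)..dlt/2} \<times> {-r0..r0} \<times> {0..2*pi}) \<times> {0..Lk}"

lemma compact_Kc: "compact Kc" unfolding Kc_def by (intro compact_Times compact_Icc)

lemma Kc_Om: "Kc \<subseteq> Om"
  using e1(1) r0 unfolding Kc_def Om_def S4_def by (auto simp: dlt_def field_simps)

lemma ee_dd_bounds: "\<tau> > \<tau>1 \<Longrightarrow> ee \<tau> \<in> {-(e1/4)..e1/4}" "\<tau> > \<tau>1 \<Longrightarrow> dd \<tau> \<in> {-(dlt/2)..dlt/2}"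
proof -
  assume \<tau>: "\<tau> > \<tau>1"
  show "ee \<tau> \<in> {-(e1/4)..e1/4}" using ee[OF \<tau>] e1(1) by auto
  have "dlt / 2 = 1 / (4 * (r0 + 1))" by (simp add: dlt_def)
  then show "dd \<tau> \<in> {-(dlt/2)..dlt/2}" unfolding atLeastAtMost_iff using dd[OF \<tau>] by linarith
qed

lemma nice_bounded:
  assumes "nice G" shows "\<exists>M\<ge>0. \<forall>r \<theta> \<zeta> \<tau>. \<bar>r\<bar> \<le> r0 \<longrightarrow> \<tau> > \<tau>1 \<longrightarrow> \<bar>G r \<theta> \<zeta> \<tau>\<bar> \<le> M"
proof -
  obtain g where g: "nfun g" "rep G g" using assms by (auto simp: nice_def)
  have "compact (g ` Kc)"
    using g(1) Kc_Om by (intro compact_continuous_image compact_Kc continuous_on_subset[OF smooth_on_continuous]) (auto simp: nfun_def)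
  from compact_imp_bounded[OF this] obtain M where "\<forall>x\<in>g ` Kc. norm x \<le> M" unfolding bounded_iff by blast
  then have M: "\<And>x. x \<in> Kc \<Longrightarrow> \<bar>g x\<bar> \<le> M" by simp
  have "\<bar>G r \<theta> \<zeta> \<tau>\<bar> \<le> \<bar>M\<bar>" if r: "\<bar>r\<bar> \<le> r0" and \<tau>: "\<tau> > \<tau>1" for r \<theta> \<zeta> \<tau>
  proof -
    have r': "\<bar>r\<bar> < r0 + 1" using r by simp
    obtain \<theta>' \<zeta>' where tz: "\<theta>' \<in> {0..2*pi}" "\<zeta>' \<in> {0..Lk}" "g (pt r \<theta> \<zeta> \<tau>) = g ((ee \<tau>, dd \<tau>, r, \<theta>'), \<zeta>')"
      using nfun_reduce[OF g(1), of \<theta> \<zeta>] pt_Om[OF r' \<tau>, of \<theta> \<zeta>] unfolding pt_def by blast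
    have "((ee \<tau>, dd \<tau>, r, \<theta>'), \<zeta>') \<in> Kc" using tz ee_dd_bounds[OF \<tau>] r by (auto simp: Kc_def abs_le_iff)
    from M[OF this] show ?thesis using g(2) r' \<tau> tz(3) by (simp add: rep_def)
  qed
  then show ?thesis by (intro exI[of _ "\<bar>M\<bar>"]) auto
qed

lemma ee_tendsto: "filterlim \<rho>\<^sub>r at_top at_top \<Longrightarrow> (ee \<longlongrightarrow> 0) at_top"
  unfolding ee_def[abs_def] using tendsto_inverse_0_at_top[OF filterlim_compose[OF _ filterlim_tt]]
  by (simp add: inverse_eq_divide)

lemma dd_tendsto: "(dd \<longlongrightarrow> 0) at_top"
  unfolding dd_def[abs_def] using exponent_order by (intro tendsto_neg_powr filterlim_tt) simp

text \<open>Uniform continuity on \<open>Kc\<close> makes the limit uniform in r and, after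
  reduction, in both angles.\<close>

lemma nice_limit:
  assumes g: "nfun g" "rep G g" and \<rho>: "filterlim \<rho>\<^sub>r at_top at_top" and \<epsilon>: "\<epsilon> > 0"
  shows "\<forall>\<^sub>F \<tau> in at_top. \<forall>r \<theta> \<zeta>. \<bar>r\<bar> \<le> r0 \<longrightarrow> \<bar>G r \<theta> \<zeta> \<tau> - g ((0, 0, r, \<theta>), \<zeta>)\<bar> < \<epsilon>"
proof -
  have "uniformly_continuous_on Kc g"
    using g(1) Kc_Om by (intro compact_uniformly_continuous compact_Kc continuous_on_subset[OF smooth_on_continuous]) (auto simp: nfun_def)
  then obtain d where d: "d > 0" "\<And>x y. x \<in> Kc \<Longrightarrow> y \<in> Kc \<Longrightarrow> dist x y < d \<Longrightarrow> dist (g x) (g y) < \<epsilon>"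
    using \<epsilon> unfolding uniformly_continuous_on_def by metis
  have "\<forall>\<^sub>F \<tau> in at_top. \<bar>ee \<tau>\<bar> < d / 2" "\<forall>\<^sub>F \<tau> in at_top. \<bar>dd \<tau>\<bar> < d / 2"
    using tendstoD[OF ee_tendsto[OF \<rho>], of "d/2"] tendstoD[OF dd_tendsto, of "d/2"] d(1) by (simp_all add: dist_real_def)
  with eventually_gt_at_top[of \<tau>1] show ?thesis
  proof eventually_elim
    case (elim \<tau>)
    show ?case
    proof (intro allI impI)
      fix r \<theta> \<zeta> assume r: "\<bar>r\<bar> \<le> r0"
      then have r': "\<bar>r\<bar> < r0 + 1" by simp
      obtain \<theta>' \<zeta>' where tz: "\<theta>' \<in> {0..2*pi}" "\<zeta>' \<in> {0..Lk}"
        "\<And>e d r. ((e, d, r, \<theta>), \<zeta>) \<in> Om \<Longrightarrow> g ((e, d, r, \<theta>), \<zeta>) = g ((e, d, r, \<theta>'), \<zeta>')"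
        using nfun_reduce[OF g(1), of \<theta> \<zeta>] by blast
      let ?x = "((ee \<tau>, dd \<tau>, r, \<theta>'), \<zeta>')" and ?y = "((0, 0, r, \<theta>'), \<zeta>')"
      have O: "((0, 0, r, \<theta>), \<zeta>) \<in> Om" using e1(1) r0 r' by (auto simp: Om_def S4_def dlt_def abs_less_iff)
      have K: "?x \<in> Kc" "?y \<in> Kc" using tz ee_dd_bounds[OF elim(1)] r r0 e1(1) by (auto simp: Kc_def abs_le_iff dlt_def)
      have "dist ?x ?y = norm (ee \<tau>, dd \<tau>)" by (simp add: dist_norm norm_Pair)
      also have "\<dots> \<le> \<bar>ee \<tau>\<bar> + \<bar>dd \<tau>\<bar>" using norm_Pair_le[of "ee \<tau>" "dd \<tau>"] by simp
      finally have "dist ?x ?y < d" using elim by simp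
      from d(2)[OF K this] have "\<bar>g ?x - g ?y\<bar> < \<epsilon>" by (simp add: dist_real_def)
      then show "\<bar>G r \<theta> \<zeta> \<tau> - g ((0, 0, r, \<theta>), \<zeta>)\<bar> < \<epsilon>"
        using g(2) r' elim(1) tz(3)[OF O] tz(3)[of "ee \<tau>" "dd \<tau>" r] pt_Om[OF r' elim(1), of \<theta> \<zeta>] by (simp add: rep_def pt_def)
    qed
  qed
qed

section \<open>Coefficients near the resonant amplitude\<close>

abbreviation a :: real where "a \<equiv> expa D"
abbreviation b :: real where "b \<equiv> expb D"

lemma abs_less_mem: "\<bar>x\<bar> < c \<Longrightarrow> x \<in> {-c<..<c :: real}" by auto

text \<open>The reciprocal of the amplitude \<open>\<rho>\<^sub>r * (1 + d * r)\<close>, in the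
  variables (e, d, r).\<close>

definition qq :: "real \<times> real \<times> real \<Rightarrow> real" where
  "qq p = fst p / (1 + fst (snd p) * snd (snd p))"

text \<open>Since |d * r| < dlt * (r0 + 1) = 1 / 2, passing from e to the reciprocal of the
  perturbed amplitude at most doubles it; this is why the domain is cut at e1 / 2.\<close>

lemma S3_pos:
  assumes "p \<in> S3" shows "1 + fst (snd p) * snd (snd p) > 1 / 2" "\<bar>qq p\<bar> < e1"
proof -
  let ?d = "fst (snd p)" and ?r = "snd (snd p)"
  have d: "\<bar>?d\<bar> < dlt" "\<bar>?r\<bar> < r0 + 1" "\<bar>fst p\<bar> < e1 / 2" using assms by (auto simp: S3_def abs_less_iff)
  have "\<bar>?d * ?r\<bar> \<le> \<bar>?d\<bar> * (r0 + 1)" unfolding abs_mult using d(2) by (intro mult_left_mono) auto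
  also have "\<dots> < dlt * (r0 + 1)" using d r0 by (intro mult_strict_right_mono) auto
  also have "\<dots> = 1 / 2" using r0 by (simp add: dlt_def)
  finally have "\<bar>?d * ?r\<bar> < 1 / 2" .
  then show 1: "1 + ?d * ?r > 1 / 2" by linarith
  have "\<bar>qq p\<bar> = \<bar>fst p\<bar> / (1 + ?d * ?r)" using 1 by (simp add: qq_def)
  also have "\<dots> \<le> \<bar>fst p\<bar> / (1 / 2)" using 1 by (intro divide_left_mono) auto
  finally show "\<bar>qq p\<bar> < e1" using d by simp
qed

lemma smooth_qq: "smooth_on S3 qq"
  unfolding qq_def
proof (intro smooth_intros)
  fix p assume "p \<in> S3"
  from S3_pos(1)[OF this] show "1 + fst (snd p) * snd (snd p) \<noteq> 0" by linarith
qed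

lemma smooth_one_plus: "smooth_on S3 (\<lambda>p. (1 + fst (snd p) * snd (snd p)) powr c)"
proof (intro smooth_intros)
  fix p assume "p \<in> S3"
  from S3_pos(1)[OF this] show "1 + fst (snd p) * snd (snd p) > 0" by linarith
qed

lemma pt_S3: "\<bar>r\<bar> < r0 + 1 \<Longrightarrow> \<tau> > \<tau>1 \<Longrightarrow> (ee \<tau>, dd \<tau>, r) \<in> S3"
  using pt_Om[of r \<tau> 0 0] by (auto simp: pt_def Om_def S4_def S3_def)

abbreviation q :: "real \<Rightarrow> real \<Rightarrow> real" where "q r \<tau> \<equiv> qq (ee \<tau>, dd \<tau>, r)"

lemma nice_one_plus: "nice (\<lambda>r \<theta> \<zeta> \<tau>. (1 + dd \<tau> * r) powr c)"
  using nice_S3[OF smooth_one_plus] by simp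

lemma one_plus_pos: "\<bar>r\<bar> < r0 + 1 \<Longrightarrow> \<tau> > \<tau>1 \<Longrightarrow> 1 + dd \<tau> * r > 1 / 2"
  using S3_pos(1)[OF pt_S3] by simp

lemma amp_eq: "amp D \<rho>\<^sub>r r \<tau> = \<rho>\<^sub>r (tt \<tau>) * (1 + dd \<tau> * r)"
  by (simp add: amp_def dd_def)

lemma amp:
  assumes "\<bar>r\<bar> < r0 + 1" "\<tau> > \<tau>1"
  shows "1 / amp D \<rho>\<^sub>r r \<tau> = q r \<tau>" "big (amp D \<rho>\<^sub>r r \<tau>)"
proof -
  note t = tt_t1[OF assms(2)] and o = one_plus_pos[OF assms] and p = rho_pos[OF tt_t1[OF assms(2)]]
  show 1: "1 / amp D \<rho>\<^sub>r r \<tau> = q r \<tau>" by (simp add: amp_eq qq_def ee_def)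
  have r0': "\<rho>0 > 0" using thr by (simp add: amplitude_threshold_def)
  have "\<rho>0 < \<rho>\<^sub>r (tt \<tau>) * (1 / 2)" using t1(4)[OF t] by simp
  also have "\<dots> \<le> amp D \<rho>\<^sub>r r \<tau>" unfolding amp_eq using o p by (intro mult_left_mono) auto
  finally have "\<rho>0 < amp D \<rho>\<^sub>r r \<tau>" .
  moreover have "q r \<tau> < eps0" using S3_pos(2)[OF pt_S3[OF assms]] e1(2) by linarith
  ultimately show "big (amp D \<rho>\<^sub>r r \<tau>)" unfolding big_def 1 by blast
qed

lemma dom3_periods:
  fixes F :: "real \<times> real \<times> real \<Rightarrow> real"
  assumes "\<And>S. F (e, \<phi>, S + 2 * pi) = F (e, \<phi>, S)"
  shows "F (e, \<phi>, S + 2 * pi * real n) = F (e, \<phi>, S)"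
proof (induction n)
  case (Suc n)
  have "S + 2 * pi * real (Suc n) = (S + 2 * pi * real n) + 2 * pi" by (simp add: algebra_simps)
  then show ?case using assms[of "S + 2 * pi * real n"] Suc by metis
qed simp

text \<open>Pulls a function of (1 / \<rho>, \<phi>, S) back to the near-resonance variables, with
  \<phi> = \<zeta> / \<kappa> + \<theta> and S = \<zeta>.\<close>

definition osc_fun :: "(real \<times> real \<times> real \<Rightarrow> real) \<Rightarrow> pnt \<Rightarrow> real" where
  "osc_fun F x = F (qq (fst (fst x), fst (snd (fst x)), fst (snd (snd (fst x)))),
     snd x / real \<kappa> + snd (snd (snd (fst x))), snd x)"

lemma nfun_osc:
  assumes F: "smooth_on dom3 F" "\<And>e \<phi> S. \<bar>e\<bar> < eps0 \<Longrightarrow> F (e, \<phi> + 2 * pi, S) = F (e, \<phi>, S)"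
    "\<And>e \<phi> S. \<bar>e\<bar> < eps0 \<Longrightarrow> F (e, \<phi>, S + 2 * pi) = F (e, \<phi>, S)"
  shows "nfun (osc_fun F)"
  unfolding nfun_def
proof (intro conjI ballI)
  have S3: "(fst (fst x), fst (snd (fst x)), fst (snd (snd (fst x)))) \<in> S3" if "x \<in> Om" for x
    using that by (auto simp: Om_def S4_def S3_def)
  have q: "\<bar>qq (fst (fst x), fst (snd (fst x)), fst (snd (snd (fst x))))\<bar> < eps0" if "x \<in> Om" for x
    using S3_pos(2)[OF S3[OF that]] e1(2) by linarith
  show "smooth_on Om (osc_fun F)"
    unfolding osc_fun_def
  proof (rule smooth_on_compose[OF F(1)])
    show "smooth_on Om (\<lambda>x. (qq (fst (fst x), fst (snd (fst x)), fst (snd (snd (fst x)))),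
     snd x / real \<kappa> + snd (snd (snd (fst x))), snd x))"
      using kappa_nonzero by (intro smooth_intros smooth_on_compose[OF smooth_qq] S3) auto
  qed (use abs_less_mem[OF q] in simp)
  fix x assume x: "x \<in> Om"
  show "osc_fun F (x + ut) = osc_fun F x"
    using F(2)[OF q[OF x]] by (simp add: osc_fun_def ut_def add.assoc[symmetric])
  have "(snd x + Lk) / real \<kappa> + \<theta> = snd x / real \<kappa> + \<theta> + 2 * pi" for \<theta>
    using kappa_nonzero by (simp add: add_divide_distrib)
  then have "osc_fun F (x + uz) = F (qq (fst (fst x), fst (snd (fst x)), fst (snd (snd (fst x)))),
     snd x / real \<kappa> + snd (snd (snd (fst x))) + 2 * pi, snd x + Lk)"
    by (simp add: osc_fun_def uz_def zero_prod_def[symmetric] add_ac)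
  also have "\<dots> = osc_fun F x"
    unfolding F(2)[OF q[OF x]] dom3_periods[of F, OF F(3)[OF q[OF x]]] by (simp add: osc_fun_def)
  finally show "osc_fun F (x + uz) = osc_fun F x" .
qed

lemma nice_osc:
  assumes "nfun (osc_fun F)" shows "nice (\<lambda>r \<theta> \<zeta> \<tau>. F (q r \<tau>, ang \<kappa> \<theta> \<zeta>, \<zeta>))"
  unfolding nice_def rep_def using assms by (intro exI[of _ "osc_fun F"]) (simp add: osc_fun_def pt_def ang_def)

lemma nfun_coefs: "nfun (osc_fun (ff i))" "nfun (osc_fun (gg i))" "nfun (osc_fun (cc i))"
  by (rule nfun_osc[OF smooth_ff coefs_2pi(1,4)], assumption+,
    rule nfun_osc[OF smooth_gg coefs_2pi(2,5)], assumption+, rule nfun_osc[OF smooth_cc coefs_2pi(3,6)], assumption+)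

lemmas nice_coefs = nfun_coefs[THEN nice_osc]

lemma nice_zf: "nice (\<lambda>r \<theta> \<zeta> \<tau>. zf (ee \<tau>) powr c)"
  by (rule nice_e[of "\<lambda>e. zf e powr c"], intro smooth_intros smooth_zf) (auto intro: zf_pos)

lemma nice_zf_pow: "nice (\<lambda>r \<theta> \<zeta> \<tau>. zf (ee \<tau>) ^ n)"
  by (rule nice_e[of "\<lambda>e. zf e ^ n"], intro smooth_intros smooth_zf)

lemma zamp_tt: "\<tau> > \<tau>1 \<Longrightarrow> zamp D \<rho>\<^sub>r (tt \<tau>) = zf (ee \<tau>)"
  using zamp_eq[OF tt_t1] by (simp add: ee_def)

abbreviation FA where "FA \<equiv> F1_A D \<rho>0 \<kappa> \<rho>\<^sub>r"
abbreviation FBA where "FBA \<equiv> F1_BA D \<rho>\<^sub>r"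
abbreviation F2A where "F2A \<equiv> F1_2A D \<rho>0 \<kappa> \<rho>\<^sub>r"
abbreviation F2CA where "F2CA \<equiv> F1_2CA D \<rho>0 \<kappa> \<rho>\<^sub>r"
abbreviation GA where "GA \<equiv> F2_A D \<rho>\<^sub>r"
abbreviation G2A where "G2A \<equiv> F2_2A D \<rho>0 \<kappa> \<rho>\<^sub>r"
abbreviation xi10 where "xi10 \<equiv> xi1_0 D \<rho>0 \<kappa> \<rho>\<^sub>r"

lemma FA_eq: "\<bar>r\<bar> < r0 + 1 \<Longrightarrow> \<tau> > \<tau>1 \<Longrightarrow>
  FA r \<theta> \<zeta> \<tau> = B powr (- A / B) * zf (ee \<tau>) powr a * ff 1 (q r \<tau>, ang \<kappa> \<theta> \<zeta>, \<zeta>)"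
  using tilde_eq(1)[OF amp(2), of r \<tau> 1] by (simp add: F1_A_def zamp_tt amp(1))

lemma F2CA_eq: "\<bar>r\<bar> < r0 + 1 \<Longrightarrow> \<tau> > \<tau>1 \<Longrightarrow>
  F2CA r \<theta> \<zeta> \<tau> = B powr ((A - 2 * C) / B) * zf (ee \<tau>) powr (2 * b) * gg 1 (q r \<tau>, ang \<kappa> \<theta> \<zeta>, \<zeta>)"
  using tilde_eq(2)[OF amp(2), of r \<tau> 1] by (simp add: F1_2CA_def zamp_tt amp(1))

lemma xi10_eq: "\<bar>r\<bar> < r0 + 1 \<Longrightarrow> \<tau> > \<tau>1 \<Longrightarrow>
  xi10 r \<theta> \<zeta> \<tau> = B powr (- (C - A) / B) * zf (ee \<tau>) powr b * cc 1 (q r \<tau>, ang \<kappa> \<theta> \<zeta>, \<zeta>)"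
  using tilde_eq(3)[OF amp(2), of r \<tau> 1] by (simp add: xi1_0_def zamp_tt amp(1))

lemma nice_FA: "nice FA"
  by (rule nice_cong[OF _ FA_eq[symmetric]]) (intro nice_mult nice_const nice_zf nice_coefs)

lemma nice_F2CA: "nice F2CA"
  by (rule nice_cong[OF _ F2CA_eq[symmetric]]) (intro nice_mult nice_const nice_zf nice_coefs)

lemma nice_xi10: "nice xi10"
  by (rule nice_cong[OF _ xi10_eq[symmetric]]) (intro nice_mult nice_const nice_zf nice_coefs)

lemma nice_F2A: "nice F2A"
proof -
  have "F2A = (\<lambda>r \<theta> \<zeta> \<tau>. r * (B powr (- A / B) * (a + 1)) * FA r \<theta> \<zeta> \<tau>)"
    by (simp add: fun_eq_iff F1_2A_def)
  then show ?thesis by (simp only:) (intro nice_mult nice_const nice_r nice_FA)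
qed

lemma DERIV_ln_rho: "\<tau> > \<tau>1 \<Longrightarrow> tt \<tau> * deriv (\<lambda>t. ln (\<rho>\<^sub>r t)) (tt \<tau>) = kap (ee \<tau>)"
  "\<tau> > \<tau>1 \<Longrightarrow> deriv \<rho>\<^sub>r (tt \<tau>) = \<rho>\<^sub>r (tt \<tau>) * kap (ee \<tau>) / tt \<tau>"
proof -
  assume \<tau>: "\<tau> > \<tau>1"
  note d = DERIV_rho[OF tt_t1[OF \<tau>]] and p = rho_pos[OF tt_t1[OF \<tau>]] and t = tt_pos[OF tau_pos[OF \<tau>]]
  show "deriv \<rho>\<^sub>r (tt \<tau>) = \<rho>\<^sub>r (tt \<tau>) * kap (ee \<tau>) / tt \<tau>"
    using DERIV_imp_deriv[OF d] by (simp add: ee_def)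
  have "((\<lambda>t. ln (\<rho>\<^sub>r t)) has_real_derivative kap (ee \<tau>) / tt \<tau>) (at (tt \<tau>))"
    using d p by (auto intro!: derivative_eq_intros simp: ee_def)
  then show "tt \<tau> * deriv (\<lambda>t. ln (\<rho>\<^sub>r t)) (tt \<tau>) = kap (ee \<tau>)"
    using DERIV_imp_deriv t by fastforce
qed

lemma DERIV_ln_zamp:
  assumes \<tau>: "\<tau> > \<tau>1" shows "tt \<tau> * deriv (\<lambda>t. ln (zamp D \<rho>\<^sub>r t)) (tt \<tau>) = kap (ee \<tau>) - beta D / real h"
proof -
  note d = DERIV_rho[OF tt_t1[OF \<tau>]] and p = rho_pos[OF tt_t1[OF \<tau>]] and t = tt_pos[OF tau_pos[OF \<tau>]]
  have "((\<lambda>t. ln (\<rho>\<^sub>r t) + (- beta D / real h) * ln t) has_real_derivative (kap (ee \<tau>) - beta D / real h) / tt \<tau>) (at (tt \<tau>))"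
    using d p t h1 by (auto intro!: derivative_eq_intros simp: ee_def diff_divide_distrib)
  then have "((\<lambda>t. ln (zamp D \<rho>\<^sub>r t)) has_real_derivative (kap (ee \<tau>) - beta D / real h) / tt \<tau>) (at (tt \<tau>))"
  proof (rule has_field_derivative_transform_within_open[of _ _ _ "{t1<..}"])
    fix s assume "s \<in> {t1<..}"
    then have "\<rho>\<^sub>r s > 0" "s > 0" using rho_pos[of s] t1(1) by auto
    then show "ln (\<rho>\<^sub>r s) + (- beta D / real h) * ln s = ln (zamp D \<rho>\<^sub>r s)"
      unfolding zamp_def by (subst ln_mult) (auto simp: ln_powr)
  qed (use tt_t1[OF \<tau>] in auto)
  then show ?thesis using DERIV_imp_deriv t by fastforce
qed

lemma FBA_eq: "\<tau> > \<tau>1 \<Longrightarrow> FBA r \<theta> \<zeta> \<tau> = - (B powr ((A - B) / B)) * kap (ee \<tau>)"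
  by (simp add: F1_BA_def DERIV_ln_zamp)

lemma nice_FBA: "nice FBA"
  by (rule nice_cong[OF _ FBA_eq[symmetric]]) (intro nice_mult nice_const nice_e smooth_kap, assumption)

lemma hadamard_S3:
  assumes f: "smooth_on S3 f" and 0: "\<And>e r. \<bar>e\<bar> < e1 / 2 \<Longrightarrow> \<bar>r\<bar> < r0 + 1 \<Longrightarrow> f (e, 0, r) = (0 :: real)"
  obtains w1 where "smooth_on S3 w1" "\<And>p. p \<in> S3 \<Longrightarrow> f p = fst (snd p) * w1 p"
proof -
  let ?S = "{-(e1/2)<..<e1/2} \<times> {-(r0 + 1)<..<r0 + 1}"
  have "smooth_on (?S \<times> {-dlt<..<dlt}) (\<lambda>x. f (fst (fst x), snd x, snd (fst x)))"
    by (rule smooth_on_compose[OF f]) (intro smooth_intros, auto simp: S3_def)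
  moreover have "open ?S" by (simp add: open_Times)
  moreover have "(\<lambda>x. f (fst (fst x), snd x, snd (fst x))) (p, 0) = 0" if "p \<in> ?S" for p
    using 0[of "fst p" "snd p"] that by (auto simp: abs_less_iff)
  ultimately obtain w1 where w1: "smooth_on (?S \<times> {-dlt<..<dlt}) w1"
    "\<And>p t. p \<in> ?S \<Longrightarrow> \<bar>t\<bar> < dlt \<Longrightarrow> (\<lambda>x. f (fst (fst x), snd x, snd (fst x))) (p, t) = t * w1 (p, t)"
    using smooth_on_hadamard by blast
  show ?thesis
  proof (rule that[of "\<lambda>p. w1 ((fst p, snd (snd p)), fst (snd p))"])
    show "smooth_on S3 (\<lambda>p. w1 ((fst p, snd (snd p)), fst (snd p)))"
      by (rule smooth_on_compose[OF w1(1)]) (intro smooth_intros, auto simp: S3_def)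
    fix p assume "p \<in> S3"
    then show "f p = fst (snd p) * w1 ((fst p, snd (snd p)), fst (snd p))"
      using w1(2)[of "(fst p, snd (snd p))" "fst (snd p)"] by (auto simp: S3_def abs_less_iff)
  qed
qed

lemma smooth_nn_qq: "smooth_on S3 (\<lambda>p. nn (qq p))"
  by (rule smooth_on_compose[OF smooth_nn_e1 smooth_qq]) (rule abs_less_mem[OF S3_pos(2)])

lemma smooth_nn_fst: "smooth_on S3 (\<lambda>p. nn (fst p))"
  by (rule smooth_S3_e[OF smooth_nn_e1])

text \<open>The left side vanishes at d = 0, so a factor d = t powr (- A) splits off smoothly. With
  c = h it is the detuning of the frequency divided by the h-th power of the resonant amplitude;
  with c = 0 it is the difference of scaled frequencies.\<close>

lemma nu_difference:
  obtains w1 where "smooth_on S3 w1" "\<And>p. p \<in> S3 \<Longrightarrow> (1 + fst (snd p) * snd (snd p)) powr c * nn (qq p) - nn (fst p) = fst (snd p) * w1 p"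
proof (rule hadamard_S3[of "\<lambda>p. (1 + fst (snd p) * snd (snd p)) powr c * nn (qq p) - nn (fst p)"])
  show "smooth_on S3 (\<lambda>p. (1 + fst (snd p) * snd (snd p)) powr c * nn (qq p) - nn (fst p))"
    by (intro smooth_on_diff smooth_on_mult smooth_one_plus smooth_nn_qq smooth_nn_fst)
qed (auto simp: qq_def intro: that)

lemma freq_scaled_tt: "\<tau> > \<tau>1 \<Longrightarrow> freq_scaled D (\<rho>\<^sub>r (tt \<tau>)) = nn (ee \<tau>)"
  using freq_scaled_eq[OF inv_rho(3)[OF tt_t1]] by (simp add: ee_def)

lemma tt_A: "\<tau> > \<tau>1 \<Longrightarrow> tt \<tau> powr A * dd \<tau> = 1"
  using tt_pos[OF tau_pos, of \<tau>] by (simp add: dd_def powr_minus)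

lemma nice_freq_quotient:
  "nice (\<lambda>r \<theta> \<zeta> \<tau>. tt \<tau> powr A * (freq_scaled D (amp D \<rho>\<^sub>r r \<tau>) - freq_scaled D (\<rho>\<^sub>r (tt \<tau>))))"
proof -
  obtain w1 where w1: "smooth_on S3 w1" "\<And>p. p \<in> S3 \<Longrightarrow> (1 + fst (snd p) * snd (snd p)) powr 0 * nn (qq p) - nn (fst p) = fst (snd p) * w1 p"
    using nu_difference by blast
  show ?thesis
  proof (rule nice_cong[OF nice_S3[OF w1(1)]])
    fix r \<tau> :: real assume r: "\<bar>r\<bar> < r0 + 1" and \<tau>: "\<tau> > \<tau>1"
    have "freq_scaled D (amp D \<rho>\<^sub>r r \<tau>) - freq_scaled D (\<rho>\<^sub>r (tt \<tau>)) = dd \<tau> * w1 (ee \<tau>, dd \<tau>, r)"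
      using w1(2)[OF pt_S3[OF r \<tau>]] one_plus_pos[OF r \<tau>]
      by (simp add: freq_scaled_eq[OF amp(2)[OF r \<tau>]] freq_scaled_tt[OF \<tau>] amp(1)[OF r \<tau>])
    then have "tt \<tau> powr A * (freq_scaled D (amp D \<rho>\<^sub>r r \<tau>) - freq_scaled D (\<rho>\<^sub>r (tt \<tau>))) = (tt \<tau> powr A * dd \<tau>) * w1 (ee \<tau>, dd \<tau>, r)"
      by simp
    then show "w1 (ee \<tau>, dd \<tau>, r) = tt \<tau> powr A * (freq_scaled D (amp D \<rho>\<^sub>r r \<tau>) - freq_scaled D (\<rho>\<^sub>r (tt \<tau>)))"
      unfolding tt_A[OF \<tau>] by simp
  qed
qed

lemma nice_GA: "nice GA"
proof -
  have "nice (\<lambda>r \<theta> \<zeta> \<tau>. B powr (- A / B) * zf (ee \<tau>) ^ h * (real h * r * nn (ee \<tau>) + 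
     tt \<tau> powr A * (freq_scaled D (amp D \<rho>\<^sub>r r \<tau>) - freq_scaled D (\<rho>\<^sub>r (tt \<tau>)))))"
    by (intro nice_mult nice_add nice_const nice_zf_pow nice_r nice_e smooth_nn_e1 nice_freq_quotient)
  then show ?thesis by (rule nice_cong) (simp add: F2_A_def Let_def zamp_tt freq_scaled_tt)
qed

lemma nice_G2A: "nice G2A"
proof -
  have "nice (\<lambda>r \<theta> \<zeta> \<tau>. r * B powr (- 2 * A / B) * zf (ee \<tau>) ^ h * (real h / 2) * ((real h - 1) * r * nn (ee \<tau>) +
     2 * (tt \<tau> powr A * (freq_scaled D (amp D \<rho>\<^sub>r r \<tau>) - freq_scaled D (\<rho>\<^sub>r (tt \<tau>))))) +
     B powr (- 2 * A / B) * zf (ee \<tau>) powr a * ff 2 (q r \<tau>, ang \<kappa> \<theta> \<zeta>, \<zeta>))"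
    by (intro nice_mult nice_add nice_const nice_zf_pow nice_r nice_e smooth_nn_e1 nice_freq_quotient nice_zf nice_coefs)
  then show ?thesis
  proof (rule nice_cong)
    fix r \<theta> \<zeta> \<tau> assume r: "\<bar>r\<bar> < r0 + 1" and \<tau>: "\<tau> > \<tau>1"
    show "r * B powr (- 2 * A / B) * zf (ee \<tau>) ^ h * (real h / 2) * ((real h - 1) * r * nn (ee \<tau>) +
     2 * (tt \<tau> powr A * (freq_scaled D (amp D \<rho>\<^sub>r r \<tau>) - freq_scaled D (\<rho>\<^sub>r (tt \<tau>))))) +
     B powr (- 2 * A / B) * zf (ee \<tau>) powr a * ff 2 (q r \<tau>, ang \<kappa> \<theta> \<zeta>, \<zeta>) = G2A r \<theta> \<zeta> \<tau>"
      using tilde_eq(1)[OF amp(2)[OF r \<tau>], of 2] by (simp add: F2_2A_def Let_def zamp_tt[OF \<tau>] freq_scaled_tt[OF \<tau>] amp(1)[OF r \<tau>])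
  qed
qed

lemma rho_powr: "\<tau> > \<tau>1 \<Longrightarrow> \<rho>\<^sub>r (tt \<tau>) powr c = zf (ee \<tau>) powr c * tt \<tau> powr (c * beta D / real h)"
proof -
  assume \<tau>: "\<tau> > \<tau>1"
  note p = rho_pos[OF tt_t1[OF \<tau>]] and t = tt_pos[OF tau_pos[OF \<tau>]]
  have "\<rho>\<^sub>r (tt \<tau>) = zf (ee \<tau>) * tt \<tau> powr (beta D / real h)"
    using t unfolding zamp_tt[OF \<tau>, symmetric] by (simp add: zamp_def powr_minus)
  then have "\<rho>\<^sub>r (tt \<tau>) powr c = (zf (ee \<tau>) * tt \<tau> powr (beta D / real h)) powr c" by simp
  also have "\<dots> = zf (ee \<tau>) powr c * tt \<tau> powr (c * beta D / real h)"
    using t zf_pos[OF ee(3)[OF \<tau>]] by (simp add: powr_mult powr_powr mult.commute)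
  finally show ?thesis .
qed

lemma amp_powr: "\<bar>r\<bar> < r0 + 1 \<Longrightarrow> \<tau> > \<tau>1 \<Longrightarrow>
   amp D \<rho>\<^sub>r r \<tau> powr c = zf (ee \<tau>) powr c * tt \<tau> powr (c * beta D / real h) * (1 + dd \<tau> * r) powr c"
  using rho_pos[OF tt_t1, of \<tau>] one_plus_pos[of r \<tau>] by (simp add: amp_eq powr_mult rho_powr)

lemma exponents_M: "- alpha D + a * beta D / real h = beta D - 2 * A" "- 2 * gamma D + 2 * b * beta D / real h = beta D - 2 * C" "B = beta D + 1"
  using M1_M2_eq by (simp_all add: M1_def M2_def expB_def)

text \<open>Each power of the resonant amplitude contributes a power of t by
  \<open>rho_powr\<close>. Through M1 = beta - 2 * A and M2 = beta - 2 * C the exponents collapse to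
  the four orders shown.\<close>

lemma calF1_eq:
  assumes r: "\<bar>r\<bar> < r0 + 1" and \<tau>: "\<tau> > \<tau>1"
  shows "calF1 D \<rho>0 \<kappa> \<rho>\<^sub>r r \<theta> \<zeta> \<tau> =
     \<tau> powr (- A / B) * ((1 + dd \<tau> * r) powr (a + 1) * FA r \<theta> \<zeta> \<tau>)
   + \<tau> powr ((A - 2 * C) / B) * ((1 + dd \<tau> * r) powr (2 * b + 1) * F2CA r \<theta> \<zeta> \<tau>)
   + \<tau> powr ((A - B) / B) * FBA r \<theta> \<zeta> \<tau>
   + \<tau> powr (- 1) * (r * (A - kap (ee \<tau>)) / B)"
proof -
  let ?t = "tt \<tau>" and ?z = "zf (ee \<tau>)" and ?R = "\<rho>\<^sub>r (tt \<tau>)" and ?o = "1 + dd \<tau> * r"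
  let ?f = "ff 1 (q r \<tau>, ang \<kappa> \<theta> \<zeta>, \<zeta>)" and ?g = "gg 1 (q r \<tau>, ang \<kappa> \<theta> \<zeta>, \<zeta>)"
  note t = tt_pos[OF tau_pos[OF \<tau>]] and p = rho_pos[OF tt_t1[OF \<tau>]] and \<tau>0 = tau_pos[OF \<tau>]
  have F: "Fcoef D \<rho>0 1 (amp D \<rho>\<^sub>r r \<tau>) (ang \<kappa> \<theta> \<zeta>) \<zeta> ?t =
     ?t powr (- alpha D) * (amp D \<rho>\<^sub>r r \<tau> powr (a + 1) * ?f) + ?t powr (- 2 * gamma D) * (amp D \<rho>\<^sub>r r \<tau> powr (2 * b + 1) * ?g)"
    using fcoef_eq(1,2)[OF amp(2)[OF r \<tau>], of 1] by (simp add: Fcoef_def amp(1)[OF r \<tau>] add.commute)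
  have amp1: "amp D \<rho>\<^sub>r r \<tau> powr (c + 1) / ?R = ?z powr c * ?t powr (c * beta D / real h) * ?o powr (c + 1)" for c
  proof -
    have "amp D \<rho>\<^sub>r r \<tau> powr (c + 1) = ?R powr (c + 1) * ?o powr (c + 1)"
      using p one_plus_pos[OF r \<tau>] by (simp add: amp_eq powr_mult)
    then show ?thesis using p by (simp add: powr_add rho_powr[OF \<tau>])
  qed
  \<comment> \<open>The exponents add up to A + 1 - B + M1 = - A because B = beta + 1; in the next
    line M2 takes the place of M1.\<close>
  have e1: "?t powr (A + 1 - B) * ?t powr (- alpha D) * ?t powr (a * beta D / real h) = ?t powr (- A)"
    unfolding powr_add[symmetric] using exponents_M by (intro arg_cong2[of _ _ _ _ "(powr)"] refl) linarith
  have e2: "?t powr (A + 1 - B) * ?t powr (- 2 * gamma D) * ?t powr (2 * b * beta D / real h) = ?t powr (A - 2 * C)"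
    unfolding powr_add[symmetric] using exponents_M by (intro arg_cong2[of _ _ _ _ "(powr)"] refl) linarith
  have e3: "?t powr (A + 1 - B) / ?t = ?t powr (A - B)"
    using t by (simp add: powr_diff powr_add)
  have "?t powr (A + 1 - B) * (Fcoef D \<rho>0 1 (amp D \<rho>\<^sub>r r \<tau>) (ang \<kappa> \<theta> \<zeta>) \<zeta> ?t - deriv \<rho>\<^sub>r ?t) / ?R
    = ?t powr (A + 1 - B) * ?t powr (- alpha D) * (amp D \<rho>\<^sub>r r \<tau> powr (a + 1) / ?R) * ?f
    + ?t powr (A + 1 - B) * ?t powr (- 2 * gamma D) * (amp D \<rho>\<^sub>r r \<tau> powr (2 * b + 1) / ?R) * ?g
    - (?t powr (A + 1 - B) / ?t) * kap (ee \<tau>)"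
    unfolding F DERIV_ln_rho(2)[OF \<tau>] using p by (simp add: field_simps)
  also have "\<dots> = (?t powr (A + 1 - B) * ?t powr (- alpha D) * ?t powr (a * beta D / real h)) * (?z powr a * ?o powr (a + 1) * ?f)
    + (?t powr (A + 1 - B) * ?t powr (- 2 * gamma D) * ?t powr (2 * b * beta D / real h)) * (?z powr (2 * b) * ?o powr (2 * b + 1) * ?g)
    - (?t powr (A + 1 - B) / ?t) * kap (ee \<tau>)"
    unfolding amp1 by (simp only: mult_ac)
  also have "\<dots> = ?t powr (- A) * (?z powr a * ?o powr (a + 1) * ?f)
    + ?t powr (A - 2 * C) * (?z powr (2 * b) * ?o powr (2 * b + 1) * ?g) - ?t powr (A - B) * kap (ee \<tau>)"
    unfolding e1 e2 e3 ..
  also have "\<dots> = \<tau> powr (- A / B) * (?o powr (a + 1) * FA r \<theta> \<zeta> \<tau>) + \<tau> powr ((A - 2 * C) / B) * (?o powr (2 * b + 1) * F2CA r \<theta> \<zeta> \<tau>)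
    + \<tau> powr ((A - B) / B) * FBA r \<theta> \<zeta> \<tau>"
    unfolding FA_eq[OF r \<tau>] F2CA_eq[OF r \<tau>] FBA_eq[OF \<tau>] tt_powr[OF \<tau>0] by (simp add: mult_ac)
  finally have 1: "?t powr (A + 1 - B) * (Fcoef D \<rho>0 1 (amp D \<rho>\<^sub>r r \<tau>) (ang \<kappa> \<theta> \<zeta>) \<zeta> ?t - deriv \<rho>\<^sub>r ?t) / ?R
    = \<tau> powr (- A / B) * (?o powr (a + 1) * FA r \<theta> \<zeta> \<tau>) + \<tau> powr ((A - 2 * C) / B) * (?o powr (2 * b + 1) * F2CA r \<theta> \<zeta> \<tau>)
    + \<tau> powr ((A - B) / B) * FBA r \<theta> \<zeta> \<tau>" .
  have 2: "?t powr (- B) = \<tau> powr (- 1) / B"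
    using tt_powr_B[OF \<tau>0] \<tau>0 exponent_order by (simp add: powr_minus field_simps)
  show ?thesis unfolding calF1_def Let_def 1 2 DERIV_ln_rho(1)[OF \<tau>] by simp
qed

section \<open>The generator on the corrected variables\<close>

definition R4 :: "(real \<times> real \<times> real \<times> real) set" where
  "R4 = {-r0..r0} \<times> UNIV \<times> UNIV \<times> {\<tau>1<..}"

text \<open>Weaker than \<open>nice\<close>: it admits factors \<open>\<tau> powr c\<close> with c
  \<le> 0, which need not be smooth functions of e and d. The bound controls remainders; the
  continuity passes to the averaged field.\<close>

definition bc :: "fun4 \<Rightarrow> bool" where
  "bc G \<longleftrightarrow> (\<exists>M. \<forall>r \<theta> \<zeta> \<tau>. \<bar>r\<bar> \<le> r0 \<longrightarrow> \<tau> > \<tau>1 \<longrightarrow> \<bar>G r \<theta> \<zeta> \<tau>\<bar> \<le> M)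
     \<and> continuous_on R4 (\<lambda>(r, \<theta>, \<zeta>, \<tau>). G r \<theta> \<zeta> \<tau>)"

lemma bcD:
  assumes "bc G" shows "\<exists>M\<ge>0. \<forall>r \<theta> \<zeta> \<tau>. \<bar>r\<bar> \<le> r0 \<longrightarrow> \<tau> > \<tau>1 \<longrightarrow> \<bar>G r \<theta> \<zeta> \<tau>\<bar> \<le> M"
proof -
  obtain M where M: "\<forall>r \<theta> \<zeta> \<tau>. \<bar>r\<bar> \<le> r0 \<longrightarrow> \<tau> > \<tau>1 \<longrightarrow> \<bar>G r \<theta> \<zeta> \<tau>\<bar> \<le> M" using assms unfolding bc_def by blast
  have "M \<ge> 0" using M[rule_format, of 0 "\<tau>1 + 1" 0 0] r0 by (auto intro: order_trans[OF abs_ge_zero])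
  then show ?thesis using M by blast
qed

lemma bc_cont: "bc G \<Longrightarrow> continuous_on R4 (\<lambda>(r, \<theta>, \<zeta>, \<tau>). G r \<theta> \<zeta> \<tau>)" by (simp add: bc_def)

lemma bc_cong:
  assumes "bc F" "\<And>r \<theta> \<zeta> \<tau>. \<bar>r\<bar> \<le> r0 \<Longrightarrow> \<tau> > \<tau>1 \<Longrightarrow> F r \<theta> \<zeta> \<tau> = G r \<theta> \<zeta> \<tau>"
  shows "bc G"
proof -
  obtain M where M: "M \<ge> 0" "\<forall>r \<theta> \<zeta> \<tau>. \<bar>r\<bar> \<le> r0 \<longrightarrow> \<tau> > \<tau>1 \<longrightarrow> \<bar>F r \<theta> \<zeta> \<tau>\<bar> \<le> M"
    using bcD[OF assms(1)] by blast
  show ?thesis unfolding bc_def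
  proof (intro conjI exI[of _ M])
    show "\<forall>r \<theta> \<zeta> \<tau>. \<bar>r\<bar> \<le> r0 \<longrightarrow> \<tau> > \<tau>1 \<longrightarrow> \<bar>G r \<theta> \<zeta> \<tau>\<bar> \<le> M" using M(2) assms(2) by simp
    show "continuous_on R4 (\<lambda>(r, \<theta>, \<zeta>, \<tau>). G r \<theta> \<zeta> \<tau>)"
      by (rule continuous_on_eq[OF bc_cont[OF assms(1)]]) (auto simp: R4_def abs_le_iff intro!: assms(2))
  qed
qed

lemma bc_const: "bc (\<lambda>r \<theta> \<zeta> \<tau>. c)" unfolding bc_def by (auto intro!: exI[of _ "\<bar>c\<bar>"] simp: case_prod_unfold)

lemma bc_add: assumes "bc F" "bc G" shows "bc (\<lambda>r \<theta> \<zeta> \<tau>. F r \<theta> \<zeta> \<tau> + G r \<theta> \<zeta> \<tau>)"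
proof -
  obtain M where M: "M \<ge> 0" "\<forall>r \<theta> \<zeta> \<tau>. \<bar>r\<bar> \<le> r0 \<longrightarrow> \<tau> > \<tau>1 \<longrightarrow> \<bar>F r \<theta> \<zeta> \<tau>\<bar> \<le> M"
    using bcD[OF assms(1)] by blast
  obtain L where L: "L \<ge> 0" "\<forall>r \<theta> \<zeta> \<tau>. \<bar>r\<bar> \<le> r0 \<longrightarrow> \<tau> > \<tau>1 \<longrightarrow> \<bar>G r \<theta> \<zeta> \<tau>\<bar> \<le> L"
    using bcD[OF assms(2)] by blast
  show ?thesis unfolding bc_def
  proof (intro conjI exI[of _ "M + L"] allI impI)
    fix r \<theta> \<zeta> \<tau> assume "\<bar>r\<bar> \<le> r0" "\<tau> > \<tau>1"
    from M(2)[rule_format, OF this, of \<theta> \<zeta>] L(2)[rule_format, OF this, of \<theta> \<zeta>] show "\<bar>F r \<theta> \<zeta> \<tau> + G r \<theta> \<zeta> \<tau>\<bar> \<le> M + L" by linarith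
  next
    show "continuous_on R4 (\<lambda>(r, \<theta>, \<zeta>, \<tau>). F r \<theta> \<zeta> \<tau> + G r \<theta> \<zeta> \<tau>)"
      using continuous_on_add[OF bc_cont[OF assms(1)] bc_cont[OF assms(2)]] by (simp add: case_prod_unfold)
  qed
qed

lemma bc_mult: assumes "bc F" "bc G" shows "bc (\<lambda>r \<theta> \<zeta> \<tau>. F r \<theta> \<zeta> \<tau> * G r \<theta> \<zeta> \<tau>)"
proof -
  obtain M where M: "M \<ge> 0" "\<forall>r \<theta> \<zeta> \<tau>. \<bar>r\<bar> \<le> r0 \<longrightarrow> \<tau> > \<tau>1 \<longrightarrow> \<bar>F r \<theta> \<zeta> \<tau>\<bar> \<le> M"
    using bcD[OF assms(1)] by blast
  obtain L where L: "L \<ge> 0" "\<forall>r \<theta> \<zeta> \<tau>. \<bar>r\<bar> \<le> r0 \<longrightarrow> \<tau> > \<tau>1 \<longrightarrow> \<bar>G r \<theta> \<zeta> \<tau>\<bar> \<le> L"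
    using bcD[OF assms(2)] by blast
  show ?thesis unfolding bc_def
  proof (intro conjI exI[of _ "M * L"] allI impI)
    fix r \<theta> \<zeta> \<tau> assume "\<bar>r\<bar> \<le> r0" "\<tau> > \<tau>1"
    from M(2)[rule_format, OF this, of \<theta> \<zeta>] L(2)[rule_format, OF this, of \<theta> \<zeta>] M(1) show "\<bar>F r \<theta> \<zeta> \<tau> * G r \<theta> \<zeta> \<tau>\<bar> \<le> M * L"
      unfolding abs_mult by (intro mult_mono) auto
  next
    show "continuous_on R4 (\<lambda>(r, \<theta>, \<zeta>, \<tau>). F r \<theta> \<zeta> \<tau> * G r \<theta> \<zeta> \<tau>)"
      using continuous_on_mult[OF bc_cont[OF assms(1)] bc_cont[OF assms(2)]] by (simp add: case_prod_unfold)
  qed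
qed

lemma bc_diff: assumes "bc F" "bc G" shows "bc (\<lambda>r \<theta> \<zeta> \<tau>. F r \<theta> \<zeta> \<tau> - G r \<theta> \<zeta> \<tau>)"
  using bc_add[OF assms(1) bc_mult[OF bc_const[of "-1"] assms(2)]] by simp

lemma bc_tau: assumes "c \<le> 0" shows "bc (\<lambda>r \<theta> \<zeta> \<tau>. \<tau> powr c)"
  unfolding bc_def
proof (intro conjI exI[of _ 1] allI impI)
  fix \<tau> assume "\<tau> > \<tau>1"
  then have "\<tau> > 1" using tau1 by simp
  then have "\<tau> powr c \<le> \<tau> powr 0" using assms by (intro powr_mono) auto
  then show "\<bar>\<tau> powr c\<bar> \<le> 1" using \<open>\<tau> > 1\<close> by simp
next
  have "continuous_on R4 (\<lambda>x. snd (snd (snd x)) powr c)"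
    by (intro continuous_on_powr continuous_intros) (use tau1 in \<open>auto simp: R4_def\<close>)
  then show "continuous_on R4 (\<lambda>(r, \<theta>, \<zeta>, \<tau>). \<tau> powr c)" by (simp add: case_prod_unfold)
qed

lemma nice_bc: assumes "nice G" shows "bc G"
proof -
  obtain M where M: "\<forall>r \<theta> \<zeta> \<tau>. \<bar>r\<bar> \<le> r0 \<longrightarrow> \<tau> > \<tau>1 \<longrightarrow> \<bar>G r \<theta> \<zeta> \<tau>\<bar> \<le> M" using nice_bounded[OF assms] by blast
  obtain g where g: "nfun g" "rep G g" using assms by (auto simp: nice_def)
  have c: "continuous_on {\<tau>1<..} ee" "continuous_on {\<tau>1<..} dd"
    using DERIV_isCont[OF DERIV_ee] DERIV_isCont[OF DERIV_dd] by (auto intro!: continuous_at_imp_continuous_on)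
  have "continuous_on R4 (\<lambda>x. g ((ee (snd (snd (snd x))), dd (snd (snd (snd x))), fst x, fst (snd x)), fst (snd (snd x))))"
  proof (rule continuous_on_compose2[of Om g])
    show "continuous_on Om g" using g(1) by (auto simp: nfun_def intro: smooth_on_continuous)
    show "continuous_on R4 (\<lambda>x. ((ee (snd (snd (snd x))), dd (snd (snd (snd x))), fst x, fst (snd x)), fst (snd (snd x))))"
      by (intro continuous_intros continuous_on_compose2[OF c(1)] continuous_on_compose2[OF c(2)]) (auto simp: R4_def)
  qed (use pt_Om in \<open>force simp: R4_def pt_def\<close>)
  then have "continuous_on R4 (\<lambda>(r, \<theta>, \<zeta>, \<tau>). G r \<theta> \<zeta> \<tau>)"
    by (rule continuous_on_eq) (use g(2) in \<open>auto simp: R4_def rep_def pt_def\<close>)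
  then show ?thesis using M unfolding bc_def by blast
qed

abbreviation Fr where "Fr \<equiv> calF1 D \<rho>0 \<kappa> \<rho>\<^sub>r"
abbreviation Ft where "Ft \<equiv> calF2 D \<rho>0 \<kappa> \<rho>\<^sub>r"
abbreviation x1 where "x1 \<equiv> xi1 D \<rho>0 \<kappa> \<rho>\<^sub>r"
abbreviation x2 where "x2 \<equiv> xi2 D \<rho>0 \<kappa> \<rho>\<^sub>r"

lemma nice_x1: "nice x1"
proof -
  have "nice (\<lambda>r \<theta> \<zeta> \<tau>. B powr (- (C - A) / B) * zf (ee \<tau>) powr b * (1 + dd \<tau> * r) powr (b + 1) * cc 1 (q r \<tau>, ang \<kappa> \<theta> \<zeta>, \<zeta>))"
    by (intro nice_mult nice_const nice_zf nice_one_plus nice_coefs)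
  then show ?thesis
  proof (rule nice_cong)
    fix r \<theta> \<zeta> \<tau> assume r: "\<bar>r\<bar> < r0 + 1" and \<tau>: "\<tau> > \<tau>1"
    let ?t = "tt \<tau>" and ?R = "\<rho>\<^sub>r (tt \<tau>)" and ?c = "cc 1 (q r \<tau>, ang \<kappa> \<theta> \<zeta>, \<zeta>)"
    note t = tt_pos[OF tau_pos[OF \<tau>]] and p = rho_pos[OF tt_t1[OF \<tau>]]
    have am: "amp D \<rho>\<^sub>r r \<tau> powr (b + 1) / ?R = zf (ee \<tau>) powr b * ?t powr (b * beta D / real h) * (1 + dd \<tau> * r) powr (b + 1)"
    proof -
      have "amp D \<rho>\<^sub>r r \<tau> powr (b + 1) = ?R powr (b + 1) * (1 + dd \<tau> * r) powr (b + 1)"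
        using p one_plus_pos[OF r \<tau>] by (simp add: amp_eq powr_mult)
      then show ?thesis using p by (simp add: powr_add rho_powr[OF \<tau>])
    qed
    \<comment> \<open>The normalization of the noise makes all powers of t cancel; the identity
      below is M2 = beta - 2 * C divided by 2.\<close>
    have ex: "?t powr (C - gamma D + (1 - B) / 2) * ?t powr (b * beta D / real h) = 1"
    proof -
      have "C - gamma D + (1 - B) / 2 + b * beta D / real h = 0" using exponents_M(2,3) by (simp add: field_simps)
      then show ?thesis unfolding powr_add[symmetric] using t by simp
    qed
    have "ccoef D \<rho>0 1 (amp D \<rho>\<^sub>r r \<tau>) (ang \<kappa> \<theta> \<zeta>) \<zeta> = amp D \<rho>\<^sub>r r \<tau> powr (b + 1) * ?c"
      using fcoef_eq(3)[OF amp(2)[OF r \<tau>], of 1] by (simp add: amp(1)[OF r \<tau>] add.commute)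
    then have "x1 r \<theta> \<zeta> \<tau> = ?t powr (C - gamma D + (1 - B) / 2) * B powr (- (C - A) / B) * ((amp D \<rho>\<^sub>r r \<tau> powr (b + 1) / ?R) * ?c)"
      by (simp add: xi1_def Let_def)
    also have "\<dots> = (?t powr (C - gamma D + (1 - B) / 2) * ?t powr (b * beta D / real h)) *
        (B powr (- (C - A) / B) * zf (ee \<tau>) powr b * (1 + dd \<tau> * r) powr (b + 1) * ?c)"
      unfolding am by (simp only: mult_ac)
    finally show "B powr (- (C - A) / B) * zf (ee \<tau>) powr b * (1 + dd \<tau> * r) powr (b + 1) * ?c = x1 r \<theta> \<zeta> \<tau>"
      unfolding ex by simp
  qed
qed

lemma nice_x2: "nice x2"
proof -
  have "nice (\<lambda>r \<theta> \<zeta> \<tau>. B powr (- C / B) * zf (ee \<tau>) powr b * (1 + dd \<tau> * r) powr b * cc 2 (q r \<tau>, ang \<kappa> \<theta> \<zeta>, \<zeta>))"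
    by (intro nice_mult nice_const nice_zf nice_one_plus nice_coefs)
  then show ?thesis
  proof (rule nice_cong)
    fix r \<theta> \<zeta> \<tau> assume r: "\<bar>r\<bar> < r0 + 1" and \<tau>: "\<tau> > \<tau>1"
    let ?t = "tt \<tau>" and ?c = "cc 2 (q r \<tau>, ang \<kappa> \<theta> \<zeta>, \<zeta>)"
    note t = tt_pos[OF tau_pos[OF \<tau>]]
    have ex: "?t powr (C - gamma D + (1 - B) / 2) * ?t powr (b * beta D / real h) = 1"
    proof -
      have "C - gamma D + (1 - B) / 2 + b * beta D / real h = 0" using exponents_M(2,3) by (simp add: field_simps)
      then show ?thesis unfolding powr_add[symmetric] using t by simp
    qed
    have "ccoef D \<rho>0 2 (amp D \<rho>\<^sub>r r \<tau>) (ang \<kappa> \<theta> \<zeta>) \<zeta> = amp D \<rho>\<^sub>r r \<tau> powr b * ?c"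
      using fcoef_eq(3)[OF amp(2)[OF r \<tau>], of 2] by (simp add: amp(1)[OF r \<tau>])
    then have "x2 r \<theta> \<zeta> \<tau> = ?t powr (C - gamma D + (1 - B) / 2) * B powr (- C / B) * (amp D \<rho>\<^sub>r r \<tau> powr b * ?c)"
      by (simp add: xi2_def Let_def)
    also have "\<dots> = (?t powr (C - gamma D + (1 - B) / 2) * ?t powr (b * beta D / real h)) *
        (B powr (- C / B) * zf (ee \<tau>) powr b * (1 + dd \<tau> * r) powr b * ?c)"
      unfolding amp_powr[OF r \<tau>] by (simp only: mult_ac)
    finally show "B powr (- C / B) * zf (ee \<tau>) powr b * (1 + dd \<tau> * r) powr b * ?c = x2 r \<theta> \<zeta> \<tau>"
      unfolding ex by simp
  qed
qed

lemma tau_powr_split: "\<tau> > \<tau>1 \<Longrightarrow> c = d + e \<Longrightarrow> \<tau> powr c = \<tau> powr d * \<tau> powr e"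
  using tau_pos by (simp add: powr_add)

lemma exponent_signs:
  "(2 * A - 2 * C) / B \<le> 0" "(2 * A - B) / B \<le> 0" "(A - B) / B \<le> 0" "- A / B \<le> 0" "(3 * A - 2 * C) / B \<le> 0"
  "(A - 2 * C) / B \<le> 0" "(4 * A - 2 * B) / B \<le> 0"
  using exponent_order by (simp_all add: divide_nonpos_pos)

text \<open>At resonance the phase velocity is the frequency at the resonant amplitude, so only the
  detuning is left, and it has the factor d. The power t powr (1 - B) cancels the growth of the h-th
  power of the amplitude. The perturbation terms are of orders - 2 * A and - 2 * C in t.\<close>

lemma Ft_eq: obtains Y where "bc Y" "\<And>r \<theta> \<zeta> \<tau>. \<bar>r\<bar> \<le> r0 \<Longrightarrow> \<tau> > \<tau>1 \<Longrightarrow> Ft r \<theta> \<zeta> \<tau> = \<tau> powr (- A / B) * Y r \<theta> \<zeta> \<tau>"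
proof -
  obtain w1 where w1: "smooth_on S3 w1" "\<And>p. p \<in> S3 \<Longrightarrow> (1 + fst (snd p) * snd (snd p)) powr (real h) * nn (qq p) - nn (fst p) = fst (snd p) * w1 p"
    using nu_difference by blast
  define Y where "Y r \<theta> \<zeta> \<tau> = B powr (- A / B) * (zf (ee \<tau>) ^ h * w1 (ee \<tau>, dd \<tau>, r))
    + \<tau> powr (- A / B) * (B powr (- 2 * A / B) * (zf (ee \<tau>) powr a * (1 + dd \<tau> * r) powr a * ff 2 (q r \<tau>, ang \<kappa> \<theta> \<zeta>, \<zeta>)))
    + \<tau> powr ((A - 2 * C) / B) * (B powr (- 2 * C / B) * (zf (ee \<tau>) powr (2 * b) * (1 + dd \<tau> * r) powr (2 * b) * gg 2 (q r \<tau>, ang \<kappa> \<theta> \<zeta>, \<zeta>)))"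
    for r \<theta> \<zeta> \<tau>
  have "bc Y" unfolding Y_def
    by (intro bc_add bc_mult bc_const bc_tau exponent_signs nice_bc nice_zf nice_zf_pow nice_S3[OF w1(1)] nice_one_plus nice_coefs)
  moreover have "Ft r \<theta> \<zeta> \<tau> = \<tau> powr (- A / B) * Y r \<theta> \<zeta> \<tau>" if r: "\<bar>r\<bar> \<le> r0" and \<tau>: "\<tau> > \<tau>1" for r \<theta> \<zeta> \<tau>
  proof -
    have r': "\<bar>r\<bar> < r0 + 1" using r by simp
    let ?t = "tt \<tau>" and ?z = "zf (ee \<tau>)" and ?R = "\<rho>\<^sub>r (tt \<tau>)" and ?o = "1 + dd \<tau> * r" and ?m = "amp D \<rho>\<^sub>r r \<tau>"
    let ?f = "ff 2 (q r \<tau>, ang \<kappa> \<theta> \<zeta>, \<zeta>)" and ?g = "gg 2 (q r \<tau>, ang \<kappa> \<theta> \<zeta>, \<zeta>)"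
    note t = tt_pos[OF tau_pos[OF \<tau>]] and p = rho_pos[OF tt_t1[OF \<tau>]] and \<tau>0 = tau_pos[OF \<tau>] and o = one_plus_pos[OF r' \<tau>]
    have R: "?R ^ h = ?z ^ h * ?t powr beta D"
      using rho_powr[OF \<tau>, of "real h"] p zf_pos[OF ee(3)[OF \<tau>]] h1 by (simp add: powr_realpow)
    have "deriv (phase D) ?t / real \<kappa> = freq D ?R" using t1(2)[OF tt_t1[OF \<tau>]] by simp
    also have "\<dots> = ?R ^ h * nn (ee \<tau>)" unfolding freq_eq[OF inv_rho(3)[OF tt_t1[OF \<tau>]]] nu_def by (simp add: ee_def)
    finally have ph: "deriv (phase D) ?t / real \<kappa> = ?R ^ h * nn (ee \<tau>)" .
    have "freq D ?m = ?m ^ h * nn (q r \<tau>)" unfolding freq_eq[OF amp(2)[OF r' \<tau>]] nu_def amp(1)[OF r' \<tau>] ..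
    also have "?m ^ h = ?R ^ h * ?o powr real h" using o by (simp add: amp_eq power_mult_distrib powr_realpow)
    finally have fr: "freq D ?m - deriv (phase D) ?t / real \<kappa> = ?R ^ h * (?o powr real h * nn (q r \<tau>) - nn (ee \<tau>))"
      unfolding ph by (simp add: algebra_simps)
    have w: "?o powr real h * nn (q r \<tau>) - nn (ee \<tau>) = dd \<tau> * w1 (ee \<tau>, dd \<tau>, r)"
      using w1(2)[OF pt_S3[OF r' \<tau>]] by simp
    have F: "Fcoef D \<rho>0 2 ?m (ang \<kappa> \<theta> \<zeta>) \<zeta> ?t =
       ?t powr (- alpha D) * (?m powr a * ?f) + ?t powr (- 2 * gamma D) * (?m powr (2 * b) * ?g)"
      using fcoef_eq(1,2)[OF amp(2)[OF r' \<tau>], of 2] by (simp add: Fcoef_def amp(1)[OF r' \<tau>])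
    have e0: "?t powr (1 - B) * ?t powr beta D = 1"
      unfolding powr_add[symmetric] using exponents_M(3) t by simp
    have e1: "?t powr (1 - B) * ?t powr (- alpha D) * ?t powr (a * beta D / real h) = ?t powr (- 2 * A)"
      unfolding powr_add[symmetric] using exponents_M by (intro arg_cong2[of _ _ _ _ "(powr)"] refl) linarith
    have e2: "?t powr (1 - B) * ?t powr (- 2 * gamma D) * ?t powr (2 * b * beta D / real h) = ?t powr (- 2 * C)"
      unfolding powr_add[symmetric] using exponents_M by (intro arg_cong2[of _ _ _ _ "(powr)"] refl) linarith
    have s: "\<tau> powr (- 2 * A / B) = \<tau> powr (- A / B) * \<tau> powr (- A / B)"
      "\<tau> powr (- 2 * C / B) = \<tau> powr (- A / B) * \<tau> powr ((A - 2 * C) / B)"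
      by (rule tau_powr_split[OF \<tau>]; use exponent_order in \<open>simp add: field_simps\<close>)+
    have e3: "?t powr (- 2 * A) = B powr (- 2 * A / B) * \<tau> powr (- 2 * A / B)"
      "?t powr (- 2 * C) = B powr (- 2 * C / B) * \<tau> powr (- 2 * C / B)"
      by (rule tt_powr[OF \<tau>0])+
    have d: "dd \<tau> = B powr (- A / B) * \<tau> powr (- A / B)" unfolding dd_def using tt_powr[OF \<tau>0, of "- A"] by simp
    have "Ft r \<theta> \<zeta> \<tau> = ?t powr (1 - B) * (?R ^ h * (dd \<tau> * w1 (ee \<tau>, dd \<tau>, r)) +
       (?t powr (- alpha D) * (?m powr a * ?f) + ?t powr (- 2 * gamma D) * (?m powr (2 * b) * ?g)))"
      unfolding calF2_def Let_def fr w F ..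
    also have "\<dots> = (?t powr (1 - B) * ?t powr beta D) * (?z ^ h * (dd \<tau> * w1 (ee \<tau>, dd \<tau>, r)))
      + (?t powr (1 - B) * ?t powr (- alpha D) * ?t powr (a * beta D / real h)) * (?z powr a * ?o powr a * ?f)
      + (?t powr (1 - B) * ?t powr (- 2 * gamma D) * ?t powr (2 * b * beta D / real h)) * (?z powr (2 * b) * ?o powr (2 * b) * ?g)"
      unfolding amp_powr[OF r' \<tau>] R by (simp only: distrib_left mult_ac add_ac)
    also have "\<dots> = ?z ^ h * (dd \<tau> * w1 (ee \<tau>, dd \<tau>, r)) + (B powr (- 2 * A / B) * (\<tau> powr (- A / B) * \<tau> powr (- A / B))) * (?z powr a * ?o powr a * ?f)
      + (B powr (- 2 * C / B) * (\<tau> powr (- A / B) * \<tau> powr ((A - 2 * C) / B))) * (?z powr (2 * b) * ?o powr (2 * b) * ?g)"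
      unfolding e0 e1 e2 e3 s by simp
    also have "\<dots> = \<tau> powr (- A / B) * Y r \<theta> \<zeta> \<tau>"
    proof -
      have dw: "?z ^ h * (dd \<tau> * w1 (ee \<tau>, dd \<tau>, r)) = \<tau> powr (- A / B) * (B powr (- A / B) * (?z ^ h * w1 (ee \<tau>, dd \<tau>, r)))"
        by (subst (1) d) (simp only: mult_ac)
      show ?thesis unfolding Y_def dw distrib_left by (simp only: mult_ac)
    qed
    finally show ?thesis .
  qed
  ultimately show ?thesis using that by blast
qed

text \<open>By 2 * C \<ge> 3 * A and 2 * A \<le> B the drift caused by the noise and the term of
  order 1 / \<tau> fit into the remainder Y. The term with \<open>FBA\<close> stays visible, as it
  is of leading order when B = 2 * A.\<close>

lemma Fr_eq: obtains Y where "bc Y" "\<And>r \<theta> \<zeta> \<tau>. \<bar>r\<bar> \<le> r0 \<Longrightarrow> \<tau> > \<tau>1 \<Longrightarrow>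
   Fr r \<theta> \<zeta> \<tau> = \<tau> powr (- A / B) * ((1 + dd \<tau> * r) powr (a + 1) * FA r \<theta> \<zeta> \<tau> + \<tau> powr ((2 * A - B) / B) * FBA r \<theta> \<zeta> \<tau> + \<tau> powr (- A / B) * Y r \<theta> \<zeta> \<tau>)"
proof
  let ?Y = "\<lambda>r \<theta> \<zeta> \<tau>. \<tau> powr ((3 * A - 2 * C) / B) * ((1 + dd \<tau> * r) powr (2 * b + 1) * F2CA r \<theta> \<zeta> \<tau>)
    + \<tau> powr ((2 * A - B) / B) * ((1 / B) * (r * (A - kap (ee \<tau>))))"
  show "bc ?Y"
    by (intro bc_add bc_mult bc_const bc_tau exponent_signs nice_bc nice_one_plus nice_F2CA nice_r nice_diff nice_const nice_e smooth_kap)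
  fix r \<theta> \<zeta> \<tau> assume r: "\<bar>r\<bar> \<le> r0" and \<tau>: "\<tau> > \<tau>1"
  then have r': "\<bar>r\<bar> < r0 + 1" by simp
  have s: "\<tau> powr ((A - 2 * C) / B) = \<tau> powr (- A / B) * (\<tau> powr (- A / B) * \<tau> powr ((3 * A - 2 * C) / B))"
    "\<tau> powr ((A - B) / B) = \<tau> powr (- A / B) * \<tau> powr ((2 * A - B) / B)"
    "\<tau> powr (- 1) = \<tau> powr (- A / B) * (\<tau> powr (- A / B) * \<tau> powr ((2 * A - B) / B))"
    using tau_pos[OF \<tau>] exponent_order unfolding powr_add[symmetric]
    by (simp_all add: add_divide_distrib diff_divide_distrib)
  show "Fr r \<theta> \<zeta> \<tau> = \<tau> powr (- A / B) * ((1 + dd \<tau> * r) powr (a + 1) * FA r \<theta> \<zeta> \<tau> + \<tau> powr ((2 * A - B) / B) * FBA r \<theta> \<zeta> \<tau> + \<tau> powr (- A / B) * ?Y r \<theta> \<zeta> \<tau>)"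
    unfolding calF1_eq[OF r' \<tau>] s by (simp only: distrib_left mult_ac add_ac divide_inverse mult_1)
qed

text \<open>The partial derivatives of a function that enter the generator, in the order
  \<open>r, \<theta>, \<tau>, \<zeta>, rr, r\<theta>, \<theta>\<theta>\<close>.\<close>

definition gdata :: "fun4 \<Rightarrow> fun4 \<Rightarrow> fun4 \<Rightarrow> fun4 \<Rightarrow> fun4 \<Rightarrow> fun4 \<Rightarrow> fun4 \<Rightarrow> fun4 \<Rightarrow> bool" where
  "gdata G Gr Gt Gs Gz Grr Grt Gtt \<longleftrightarrow> (\<forall>r \<theta> \<zeta> \<tau>. \<bar>r\<bar> < r0 + 1 \<longrightarrow> \<tau> > \<tau>1 \<longrightarrow>
     ((\<lambda>x. G x \<theta> \<zeta> \<tau>) has_real_derivative Gr r \<theta> \<zeta> \<tau>) (at r) \<and>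
     ((\<lambda>x. G r x \<zeta> \<tau>) has_real_derivative Gt r \<theta> \<zeta> \<tau>) (at \<theta>) \<and>
     ((\<lambda>x. G r \<theta> \<zeta> x) has_real_derivative Gs r \<theta> \<zeta> \<tau>) (at \<tau>) \<and>
     ((\<lambda>x. G r \<theta> x \<tau>) has_real_derivative Gz r \<theta> \<zeta> \<tau>) (at \<zeta>) \<and>
     ((\<lambda>x. Gr x \<theta> \<zeta> \<tau>) has_real_derivative Grr r \<theta> \<zeta> \<tau>) (at r) \<and>
     ((\<lambda>x. Gt x \<theta> \<zeta> \<tau>) has_real_derivative Grt r \<theta> \<zeta> \<tau>) (at r) \<and>
     ((\<lambda>x. Gt r x \<zeta> \<tau>) has_real_derivative Gtt r \<theta> \<zeta> \<tau>) (at \<theta>))"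

definition genX :: "fun4 \<Rightarrow> fun4 \<Rightarrow> fun4 \<Rightarrow> fun4 \<Rightarrow> fun4 \<Rightarrow> fun4 \<Rightarrow> fun4 \<Rightarrow> fun4" where
  "genX Gr Gt Gs Gz Grr Grt Gtt r \<theta> \<zeta> \<tau> =
     Fr r \<theta> \<zeta> \<tau> * Gr r \<theta> \<zeta> \<tau> + Ft r \<theta> \<zeta> \<tau> * Gt r \<theta> \<zeta> \<tau> + Gs r \<theta> \<zeta> \<tau> + vsig D * Gz r \<theta> \<zeta> \<tau>
     + (mu D)\<^sup>2 / 2 * \<tau> powr (- 2 * (C - A) / B) *
       ((x1 r \<theta> \<zeta> \<tau>)\<^sup>2 * Grr r \<theta> \<zeta> \<tau> + 2 * \<tau> powr (- A / B) * x1 r \<theta> \<zeta> \<tau> * x2 r \<theta> \<zeta> \<tau> * Grt r \<theta> \<zeta> \<tau>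
        + \<tau> powr (- 2 * A / B) * (x2 r \<theta> \<zeta> \<tau>)\<^sup>2 * Gtt r \<theta> \<zeta> \<tau>)"

abbreviation gen where "gen \<equiv> generator D \<rho>0 \<kappa> \<rho>\<^sub>r"

lemma gen_genX:
  assumes g: "gdata G Gr Gt Gs Gz Grr Grt Gtt" and r: "\<bar>r\<bar> < r0 + 1" and \<tau>: "\<tau> > \<tau>1"
  shows "gen G r \<theta> \<zeta> \<tau> = genX Gr Gt Gs Gz Grr Grt Gtt r \<theta> \<zeta> \<tau>"
proof -
  have o: "open {-(r0 + 1)<..<r0 + 1}" "r \<in> {-(r0 + 1)<..<r0 + 1}" using abs_less_mem[OF r] by auto
  have 1: "d_r G x \<theta> \<zeta> \<tau> = Gr x \<theta> \<zeta> \<tau>" "d_theta G x \<theta> \<zeta> \<tau> = Gt x \<theta> \<zeta> \<tau>" if "x \<in> {-(r0 + 1)<..<r0 + 1}" for x \<theta>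
    unfolding d_r_def d_theta_def using g \<tau> that by (auto simp: gdata_def abs_less_iff intro!: DERIV_imp_deriv)
  have 2: "d_tau G r \<theta> \<zeta> \<tau> = Gs r \<theta> \<zeta> \<tau>" "d_zeta G r \<theta> \<zeta> \<tau> = Gz r \<theta> \<zeta> \<tau>"
    unfolding d_tau_def d_zeta_def using g \<tau> r by (auto simp: gdata_def intro!: DERIV_imp_deriv)
  have "((\<lambda>x. d_r G x \<theta> \<zeta> \<tau>) has_real_derivative Grr r \<theta> \<zeta> \<tau>) (at r)"
    by (rule has_field_derivative_transform_within_open[OF _ o]) (use g \<tau> r 1 in \<open>auto simp: gdata_def\<close>)
  then have 3: "d_r (d_r G) r \<theta> \<zeta> \<tau> = Grr r \<theta> \<zeta> \<tau>" unfolding d_r_def[of "d_r G"] by (rule DERIV_imp_deriv)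
  have "((\<lambda>x. d_theta G x \<theta> \<zeta> \<tau>) has_real_derivative Grt r \<theta> \<zeta> \<tau>) (at r)"
    by (rule has_field_derivative_transform_within_open[OF _ o]) (use g \<tau> r 1 in \<open>auto simp: gdata_def\<close>)
  then have 4: "d_r (d_theta G) r \<theta> \<zeta> \<tau> = Grt r \<theta> \<zeta> \<tau>" unfolding d_r_def[of "d_theta G"] by (rule DERIV_imp_deriv)
  have 5: "d_theta (d_theta G) r \<theta> \<zeta> \<tau> = Gtt r \<theta> \<zeta> \<tau>"
    unfolding d_theta_def[of "d_theta G"] 1(2)[OF o(2)] using g \<tau> r by (auto simp: gdata_def intro!: DERIV_imp_deriv)
  show ?thesis unfolding generator_def genX_def 1[OF o(2)] 2 3 4 5 ..
qed

lemma gdata_add: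
  "gdata F Fr' Ft' Fs Fz Frr Frt Ftt \<Longrightarrow> gdata G Gr Gt Gs Gz Grr Grt Gtt \<Longrightarrow>
   gdata (\<lambda>r \<theta> \<zeta> \<tau>. F r \<theta> \<zeta> \<tau> + G r \<theta> \<zeta> \<tau>) (\<lambda>r \<theta> \<zeta> \<tau>. Fr' r \<theta> \<zeta> \<tau> + Gr r \<theta> \<zeta> \<tau>) (\<lambda>r \<theta> \<zeta> \<tau>. Ft' r \<theta> \<zeta> \<tau> + Gt r \<theta> \<zeta> \<tau>)
    (\<lambda>r \<theta> \<zeta> \<tau>. Fs r \<theta> \<zeta> \<tau> + Gs r \<theta> \<zeta> \<tau>) (\<lambda>r \<theta> \<zeta> \<tau>. Fz r \<theta> \<zeta> \<tau> + Gz r \<theta> \<zeta> \<tau>) (\<lambda>r \<theta> \<zeta> \<tau>. Frr r \<theta> \<zeta> \<tau> + Grr r \<theta> \<zeta> \<tau>)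
    (\<lambda>r \<theta> \<zeta> \<tau>. Frt r \<theta> \<zeta> \<tau> + Grt r \<theta> \<zeta> \<tau>) (\<lambda>r \<theta> \<zeta> \<tau>. Ftt r \<theta> \<zeta> \<tau> + Gtt r \<theta> \<zeta> \<tau>)"
  unfolding gdata_def by (auto intro!: DERIV_add)

text \<open>Remembering the derivatives makes additivity of the generator free of differentiability side conditions.\<close>

definition has_gen :: "fun4 \<Rightarrow> fun4 \<Rightarrow> bool" where
  "has_gen G E \<longleftrightarrow> (\<exists>Gr Gt Gs Gz Grr Grt Gtt. gdata G Gr Gt Gs Gz Grr Grt Gtt \<and>
     (\<forall>r \<theta> \<zeta> \<tau>. \<bar>r\<bar> \<le> r0 \<longrightarrow> \<tau> > \<tau>1 \<longrightarrow> genX Gr Gt Gs Gz Grr Grt Gtt r \<theta> \<zeta> \<tau> = E r \<theta> \<zeta> \<tau>))"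

lemma has_genD: "has_gen G E \<Longrightarrow> \<bar>r\<bar> \<le> r0 \<Longrightarrow> \<tau> > \<tau>1 \<Longrightarrow> gen G r \<theta> \<zeta> \<tau> = E r \<theta> \<zeta> \<tau>"
  unfolding has_gen_def using gen_genX[of G _ _ _ _ _ _ _ r \<tau> \<theta> \<zeta>] by fastforce

lemma has_gen_add:
  assumes "has_gen F P" "has_gen G E"
  shows "has_gen (\<lambda>r \<theta> \<zeta> \<tau>. F r \<theta> \<zeta> \<tau> + G r \<theta> \<zeta> \<tau>) (\<lambda>r \<theta> \<zeta> \<tau>. P r \<theta> \<zeta> \<tau> + E r \<theta> \<zeta> \<tau>)"
proof -
  obtain Fr' Ft' Fs Fz Frr Frt Ftt where F: "gdata F Fr' Ft' Fs Fz Frr Frt Ftt"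
    "\<And>r \<theta> \<zeta> \<tau>. \<bar>r\<bar> \<le> r0 \<Longrightarrow> \<tau> > \<tau>1 \<Longrightarrow> genX Fr' Ft' Fs Fz Frr Frt Ftt r \<theta> \<zeta> \<tau> = P r \<theta> \<zeta> \<tau>"
    using assms(1) unfolding has_gen_def by blast
  obtain Gr Gt Gs Gz Grr Grt Gtt where G: "gdata G Gr Gt Gs Gz Grr Grt Gtt"
    "\<And>r \<theta> \<zeta> \<tau>. \<bar>r\<bar> \<le> r0 \<Longrightarrow> \<tau> > \<tau>1 \<Longrightarrow> genX Gr Gt Gs Gz Grr Grt Gtt r \<theta> \<zeta> \<tau> = E r \<theta> \<zeta> \<tau>"
    using assms(2) unfolding has_gen_def by blast
  show ?thesis unfolding has_gen_def
    by (intro exI conjI, rule gdata_add[OF F(1) G(1)])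
      (simp add: F(2)[symmetric] G(2)[symmetric] genX_def algebra_simps)
qed

lemma has_gen_r: "has_gen (\<lambda>r \<theta> \<zeta> \<tau>. r) Fr"
  unfolding has_gen_def
  by (rule exI[of _ "\<lambda>r \<theta> \<zeta> \<tau>. 1"], (rule exI[of _ "\<lambda>r \<theta> \<zeta> \<tau>. 0"])+) (auto simp: gdata_def genX_def intro!: derivative_eq_intros)

lemma has_gen_theta: "has_gen (\<lambda>r \<theta> \<zeta> \<tau>. \<theta>) Ft"
  unfolding has_gen_def
  by (rule exI[of _ "\<lambda>r \<theta> \<zeta> \<tau>. 0"], rule exI[of _ "\<lambda>r \<theta> \<zeta> \<tau>. 1"], (rule exI[of _ "\<lambda>r \<theta> \<zeta> \<tau>. 0"])+)
    (auto simp: gdata_def genX_def intro!: derivative_eq_intros)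

lemma tau_powr_minus_one: "\<tau> > \<tau>1 \<Longrightarrow> \<tau> powr (c - 1) = \<tau> powr c * (\<tau> powr (- A / B) * \<tau> powr ((A - B) / B))"
proof -
  assume "\<tau> > \<tau>1"
  have "c - 1 = c + (- A / B + (A - B) / B)" using exponent_order by (simp add: diff_divide_distrib)
  then show ?thesis by (simp only: powr_add)
qed

lemma Fr_bc: obtains Y where "bc Y" "\<And>r \<theta> \<zeta> \<tau>. \<bar>r\<bar> \<le> r0 \<Longrightarrow> \<tau> > \<tau>1 \<Longrightarrow> Fr r \<theta> \<zeta> \<tau> = \<tau> powr (- A / B) * Y r \<theta> \<zeta> \<tau>"
proof -
  obtain Y where Y: "bc Y" "\<And>r \<theta> \<zeta> \<tau>. \<bar>r\<bar> \<le> r0 \<Longrightarrow> \<tau> > \<tau>1 \<Longrightarrow>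
   Fr r \<theta> \<zeta> \<tau> = \<tau> powr (- A / B) * ((1 + dd \<tau> * r) powr (a + 1) * FA r \<theta> \<zeta> \<tau> + \<tau> powr ((2 * A - B) / B) * FBA r \<theta> \<zeta> \<tau> + \<tau> powr (- A / B) * Y r \<theta> \<zeta> \<tau>)"
    using Fr_eq by blast
  show ?thesis
  proof (rule that)
    show "bc (\<lambda>r \<theta> \<zeta> \<tau>. (1 + dd \<tau> * r) powr (a + 1) * FA r \<theta> \<zeta> \<tau> + \<tau> powr ((2 * A - B) / B) * FBA r \<theta> \<zeta> \<tau> + \<tau> powr (- A / B) * Y r \<theta> \<zeta> \<tau>)"
      by (intro bc_add bc_mult bc_tau exponent_signs Y(1) nice_bc nice_FA nice_FBA nice_one_plus)
  qed (rule Y(2))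
qed

text \<open>In the application P is \<tau> powr c, e is \<tau> powr (- A / B), u is \<tau> powr ((A
  - B) / B), e2 and e3 are the remaining powers from the diffusion part, v is \<open>vsig\<close>,
  and g and l are a function and its mean in \<zeta>.\<close>

lemma generator_term_algebra:
  fixes e :: real assumes "v \<noteq> 0"
  shows "e * yf * (P * zr) + e * yt * (P * zt) + (P * zs + c * (P * (e * u)) * z) + v * (P * (- (1 / v) * (g - l)))
     + m * (e * e2) * (p1\<^sup>2 * (P * zrr) + 2 * e * p1 * p2 * (P * zrt) + e3 * p2\<^sup>2 * (P * ztt))
   = P * (l - g) + P * zs + P * e * (yf * zr + yt * zt + u * (c * z)
     + m * (e2 * (p1 * p1 * zrr + 2 * (e * (p1 * p2 * zrt)) + e3 * (p2 * p2 * ztt))))"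
  using assms by (simp add: field_simps power2_eq_square)

text \<open>The \<zeta>-derivative alone acts at the order of the corrector itself, where it
  produces mean minus value. Everything else gains a factor \<tau> powr (- A / B): both drifts have
  it, the diffusion part has it by 2 * C \<ge> 3 * A, and the \<tau>-derivatives gain a full 1 /
  \<tau>.\<close>

lemma has_gen_term:
  assumes H: "nice H"
  obtains X where "bc X" "has_gen (\<lambda>r \<theta> \<zeta> \<tau>. \<tau> powr c * Iop D \<kappa> H r \<theta> \<zeta> \<tau>)
    (\<lambda>r \<theta> \<zeta> \<tau>. \<tau> powr c * (avg \<kappa> (\<lambda>\<zeta>'. H r \<theta> \<zeta>' \<tau>) - H r \<theta> \<zeta> \<tau>) + \<tau> powr c * \<tau> powr (- A / B) * X r \<theta> \<zeta> \<tau>)"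
proof -
  define Z where "Z = Iop D \<kappa> H"
  have Z: "nice Z" unfolding Z_def by (rule nice_Iop[OF H])
  note Zr = nice_d_r[OF Z] and Zt = nice_d_theta[OF Z]
  \<comment> \<open>The \<tau>-derivative is K / \<tau>, and 1 / \<tau> is \<tau> powr (- A / B) *
    \<tau> powr ((A - B) / B), so it fits into the remainder.\<close>
  define K where "K r \<theta> \<zeta> \<tau> = \<tau> * d_tau Z r \<theta> \<zeta> \<tau>" for r \<theta> \<zeta> \<tau>
  have K: "nice K" unfolding K_def[abs_def] by (rule nice_d_tau[OF Z])
  obtain YF where YF: "bc YF" "\<And>r \<theta> \<zeta> \<tau>. \<bar>r\<bar> \<le> r0 \<Longrightarrow> \<tau> > \<tau>1 \<Longrightarrow> Fr r \<theta> \<zeta> \<tau> = \<tau> powr (- A / B) * YF r \<theta> \<zeta> \<tau>"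
    using Fr_bc by blast
  obtain YT where YT: "bc YT" "\<And>r \<theta> \<zeta> \<tau>. \<bar>r\<bar> \<le> r0 \<Longrightarrow> \<tau> > \<tau>1 \<Longrightarrow> Ft r \<theta> \<zeta> \<tau> = \<tau> powr (- A / B) * YT r \<theta> \<zeta> \<tau>"
    using Ft_eq by blast
  let ?m = "(mu D)\<^sup>2 / 2"
  define X where "X r \<theta> \<zeta> \<tau> = YF r \<theta> \<zeta> \<tau> * d_r Z r \<theta> \<zeta> \<tau> + YT r \<theta> \<zeta> \<tau> * d_theta Z r \<theta> \<zeta> \<tau> + \<tau> powr ((A - B) / B) * (c * Z r \<theta> \<zeta> \<tau>)
     + ?m * (\<tau> powr ((3 * A - 2 * C) / B) * (x1 r \<theta> \<zeta> \<tau> * x1 r \<theta> \<zeta> \<tau> * d_r (d_r Z) r \<theta> \<zeta> \<tau>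
       + 2 * (\<tau> powr (- A / B) * (x1 r \<theta> \<zeta> \<tau> * x2 r \<theta> \<zeta> \<tau> * d_r (d_theta Z) r \<theta> \<zeta> \<tau>))
       + \<tau> powr (- 2 * A / B) * (x2 r \<theta> \<zeta> \<tau> * x2 r \<theta> \<zeta> \<tau> * d_theta (d_theta Z) r \<theta> \<zeta> \<tau>)))" for r \<theta> \<zeta> \<tau>
  have neg: "- 2 * A / B \<le> 0" using exponent_order by simp
  have X: "bc (\<lambda>r \<theta> \<zeta> \<tau>. X r \<theta> \<zeta> \<tau> + \<tau> powr ((A - B) / B) * K r \<theta> \<zeta> \<tau>)" unfolding X_def
    by (intro bc_add bc_mult bc_tau bc_const exponent_signs neg YF(1) YT(1) nice_bc Z K Zr Zt nice_x1 nice_x2 nice_d_r[OF Zr] nice_d_r[OF Zt] nice_d_theta[OF Zt])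
  have "has_gen (\<lambda>r \<theta> \<zeta> \<tau>. \<tau> powr c * Z r \<theta> \<zeta> \<tau>)
    (\<lambda>r \<theta> \<zeta> \<tau>. \<tau> powr c * (avg \<kappa> (\<lambda>\<zeta>'. H r \<theta> \<zeta>' \<tau>) - H r \<theta> \<zeta> \<tau>) + \<tau> powr c * \<tau> powr (- A / B) * (X r \<theta> \<zeta> \<tau> + \<tau> powr ((A - B) / B) * K r \<theta> \<zeta> \<tau>))"
    unfolding has_gen_def
  proof (intro exI conjI)
    let ?s = "\<lambda>r \<theta> \<zeta> \<tau>. \<tau> powr c * d_tau Z r \<theta> \<zeta> \<tau> + c * \<tau> powr (c - 1) * Z r \<theta> \<zeta> \<tau>"
    let ?z = "\<lambda>r \<theta> \<zeta> \<tau>. \<tau> powr c * (- (1 / vsig D) * (H r \<theta> \<zeta> \<tau> - avg \<kappa> (\<lambda>\<zeta>'. H r \<theta> \<zeta>' \<tau>)))"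
    show "gdata (\<lambda>r \<theta> \<zeta> \<tau>. \<tau> powr c * Z r \<theta> \<zeta> \<tau>) (\<lambda>r \<theta> \<zeta> \<tau>. \<tau> powr c * d_r Z r \<theta> \<zeta> \<tau>) (\<lambda>r \<theta> \<zeta> \<tau>. \<tau> powr c * d_theta Z r \<theta> \<zeta> \<tau>)
      ?s ?z (\<lambda>r \<theta> \<zeta> \<tau>. \<tau> powr c * d_r (d_r Z) r \<theta> \<zeta> \<tau>) (\<lambda>r \<theta> \<zeta> \<tau>. \<tau> powr c * d_r (d_theta Z) r \<theta> \<zeta> \<tau>) (\<lambda>r \<theta> \<zeta> \<tau>. \<tau> powr c * d_theta (d_theta Z) r \<theta> \<zeta> \<tau>)"
      unfolding gdata_def
    proof (intro allI impI conjI)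
      fix r \<theta> \<zeta> \<tau> assume r: "\<bar>r\<bar> < r0 + 1" and \<tau>: "\<tau> > \<tau>1"
      show "((\<lambda>x. x powr c * Z r \<theta> \<zeta> x) has_real_derivative ?s r \<theta> \<zeta> \<tau>) (at \<tau>)"
        using DERIV_mult'[OF has_real_derivative_powr[OF tau_pos[OF \<tau>]] nice_DERIV(3)[OF Z r \<tau>]] by simp
      show "((\<lambda>x. \<tau> powr c * Z r \<theta> x \<tau>) has_real_derivative ?z r \<theta> \<zeta> \<tau>) (at \<zeta>)"
        unfolding Z_def by (rule DERIV_cmult[OF Iop_DERIV_zeta[OF H r \<tau>]])
      show "((\<lambda>x. \<tau> powr c * Z x \<theta> \<zeta> \<tau>) has_real_derivative \<tau> powr c * d_r Z r \<theta> \<zeta> \<tau>) (at r)"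
        by (rule DERIV_cmult[OF nice_DERIV(1)[OF Z r \<tau>]])
      show "((\<lambda>x. \<tau> powr c * Z r x \<zeta> \<tau>) has_real_derivative \<tau> powr c * d_theta Z r \<theta> \<zeta> \<tau>) (at \<theta>)"
        by (rule DERIV_cmult[OF nice_DERIV(2)[OF Z r \<tau>]])
      show "((\<lambda>x. \<tau> powr c * d_r Z x \<theta> \<zeta> \<tau>) has_real_derivative \<tau> powr c * d_r (d_r Z) r \<theta> \<zeta> \<tau>) (at r)"
        by (rule DERIV_cmult[OF nice_DERIV(1)[OF Zr r \<tau>]])
      show "((\<lambda>x. \<tau> powr c * d_theta Z x \<theta> \<zeta> \<tau>) has_real_derivative \<tau> powr c * d_r (d_theta Z) r \<theta> \<zeta> \<tau>) (at r)"
        by (rule DERIV_cmult[OF nice_DERIV(1)[OF Zt r \<tau>]])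
      show "((\<lambda>x. \<tau> powr c * d_theta Z r x \<zeta> \<tau>) has_real_derivative \<tau> powr c * d_theta (d_theta Z) r \<theta> \<zeta> \<tau>) (at \<theta>)"
        by (rule DERIV_cmult[OF nice_DERIV(2)[OF Zt r \<tau>]])
    qed
    show "\<forall>r \<theta> \<zeta> \<tau>. \<bar>r\<bar> \<le> r0 \<longrightarrow> \<tau> > \<tau>1 \<longrightarrow> genX (\<lambda>r \<theta> \<zeta> \<tau>. \<tau> powr c * d_r Z r \<theta> \<zeta> \<tau>) (\<lambda>r \<theta> \<zeta> \<tau>. \<tau> powr c * d_theta Z r \<theta> \<zeta> \<tau>)
      ?s ?z (\<lambda>r \<theta> \<zeta> \<tau>. \<tau> powr c * d_r (d_r Z) r \<theta> \<zeta> \<tau>) (\<lambda>r \<theta> \<zeta> \<tau>. \<tau> powr c * d_r (d_theta Z) r \<theta> \<zeta> \<tau>) (\<lambda>r \<theta> \<zeta> \<tau>. \<tau> powr c * d_theta (d_theta Z) r \<theta> \<zeta> \<tau>)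
      r \<theta> \<zeta> \<tau> = \<tau> powr c * (avg \<kappa> (\<lambda>\<zeta>'. H r \<theta> \<zeta>' \<tau>) - H r \<theta> \<zeta> \<tau>) + \<tau> powr c * \<tau> powr (- A / B) * (X r \<theta> \<zeta> \<tau> + \<tau> powr ((A - B) / B) * K r \<theta> \<zeta> \<tau>)"
    proof (intro allI impI)
      fix r \<theta> \<zeta> \<tau> assume r: "\<bar>r\<bar> \<le> r0" and \<tau>: "\<tau> > \<tau>1"
      have s: "\<tau> powr (- 2 * (C - A) / B) = \<tau> powr (- A / B) * \<tau> powr ((3 * A - 2 * C) / B)"
        by (rule tau_powr_split[OF \<tau>]) (use exponent_order in \<open>simp add: field_simps\<close>)
      have "\<tau> powr (- A / B) * \<tau> powr ((A - B) / B) * \<tau> = \<tau> powr (- A / B + (A - B) / B + 1)"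
        using tau_pos[OF \<tau>] by (simp only: powr_add powr_one)
      also have "\<dots> = 1" using exponent_order tau_pos[OF \<tau>] by (simp add: diff_divide_distrib)
      finally have k: "\<tau> powr (- A / B) * (\<tau> powr ((A - B) / B) * K r \<theta> \<zeta> \<tau>) = d_tau Z r \<theta> \<zeta> \<tau>"
        unfolding K_def by (simp only: mult.assoc[symmetric] mult_1_left)
      note p = tau_powr_minus_one[OF \<tau>, of c]
      have kk: "\<tau> powr c * \<tau> powr (- A / B) * (X r \<theta> \<zeta> \<tau> + \<tau> powr ((A - B) / B) * K r \<theta> \<zeta> \<tau>) =
        \<tau> powr c * d_tau Z r \<theta> \<zeta> \<tau> + \<tau> powr c * \<tau> powr (- A / B) * X r \<theta> \<zeta> \<tau>"
        unfolding k[symmetric] by (simp only: distrib_left mult.assoc add.commute)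
      have v: "vsig D \<noteq> 0" using vsig_pos by simp
      show "genX (\<lambda>r \<theta> \<zeta> \<tau>. \<tau> powr c * d_r Z r \<theta> \<zeta> \<tau>) (\<lambda>r \<theta> \<zeta> \<tau>. \<tau> powr c * d_theta Z r \<theta> \<zeta> \<tau>)
        ?s ?z (\<lambda>r \<theta> \<zeta> \<tau>. \<tau> powr c * d_r (d_r Z) r \<theta> \<zeta> \<tau>) (\<lambda>r \<theta> \<zeta> \<tau>. \<tau> powr c * d_r (d_theta Z) r \<theta> \<zeta> \<tau>) (\<lambda>r \<theta> \<zeta> \<tau>. \<tau> powr c * d_theta (d_theta Z) r \<theta> \<zeta> \<tau>)
        r \<theta> \<zeta> \<tau> = \<tau> powr c * (avg \<kappa> (\<lambda>\<zeta>'. H r \<theta> \<zeta>' \<tau>) - H r \<theta> \<zeta> \<tau>) + \<tau> powr c * \<tau> powr (- A / B) * (X r \<theta> \<zeta> \<tau> + \<tau> powr ((A - B) / B) * K r \<theta> \<zeta> \<tau>)"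
        unfolding genX_def YF(2)[OF r \<tau>] YT(2)[OF r \<tau>] s p kk
        by (rule trans[OF generator_term_algebra[OF v]])
          (simp only: X_def add_ac)
    qed
  qed
  with X show ?thesis unfolding Z_def by (rule that)
qed

text \<open>A corrector of order \<tau> powr (- 2 * A / B) or smaller changes the drift at that
  order only; d is the excess of its exponent.\<close>

lemma has_gen_small:
  assumes H: "nice H" and c: "c = - A / B + - A / B + d" "d \<le> 0"
  obtains X where "bc X" "has_gen (\<lambda>r \<theta> \<zeta> \<tau>. \<tau> powr c * Iop D \<kappa> H r \<theta> \<zeta> \<tau>)
    (\<lambda>r \<theta> \<zeta> \<tau>. \<tau> powr (- A / B) * (\<tau> powr (- A / B) * X r \<theta> \<zeta> \<tau>))"
proof -
  obtain X where X: "bc X" "has_gen (\<lambda>r \<theta> \<zeta> \<tau>. \<tau> powr c * Iop D \<kappa> H r \<theta> \<zeta> \<tau>)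
    (\<lambda>r \<theta> \<zeta> \<tau>. \<tau> powr c * (avg \<kappa> (\<lambda>\<zeta>'. H r \<theta> \<zeta>' \<tau>) - H r \<theta> \<zeta> \<tau>) + \<tau> powr c * \<tau> powr (- A / B) * X r \<theta> \<zeta> \<tau>)"
    using has_gen_term[OF H] by blast
  show ?thesis
  proof (rule that)
    show "bc (\<lambda>r \<theta> \<zeta> \<tau>. \<tau> powr d * (avg \<kappa> (\<lambda>\<zeta>'. H r \<theta> \<zeta>' \<tau>) - H r \<theta> \<zeta> \<tau> + \<tau> powr (- A / B) * X r \<theta> \<zeta> \<tau>))"
      by (intro bc_mult bc_add bc_diff bc_tau c(2) exponent_signs X(1) nice_bc[OF H] nice_bc[OF nice_avg[OF H]])
    have e: "\<tau> powr c * (avg \<kappa> (\<lambda>\<zeta>'. H r \<theta> \<zeta>' \<tau>) - H r \<theta> \<zeta> \<tau>) + \<tau> powr c * \<tau> powr (- A / B) * X r \<theta> \<zeta> \<tau> =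
       \<tau> powr (- A / B) * (\<tau> powr (- A / B) * (\<tau> powr d * (avg \<kappa> (\<lambda>\<zeta>'. H r \<theta> \<zeta>' \<tau>) - H r \<theta> \<zeta> \<tau> + \<tau> powr (- A / B) * X r \<theta> \<zeta> \<tau>)))" for r \<theta> \<zeta> \<tau>
      unfolding c(1) powr_add by (simp only: distrib_left mult.assoc)
    show "has_gen (\<lambda>r \<theta> \<zeta> \<tau>. \<tau> powr c * Iop D \<kappa> H r \<theta> \<zeta> \<tau>)
      (\<lambda>r \<theta> \<zeta> \<tau>. \<tau> powr (- A / B) * (\<tau> powr (- A / B) * (\<tau> powr d * (avg \<kappa> (\<lambda>\<zeta>'. H r \<theta> \<zeta>' \<tau>) - H r \<theta> \<zeta> \<tau> + \<tau> powr (- A / B) * X r \<theta> \<zeta> \<tau>))))"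
      using X(2) unfolding e .
  qed
qed

section \<open>Drift of the corrected variables\<close>

abbreviation Rt where "Rt \<equiv> Rtilde D \<rho>0 \<kappa> \<rho>\<^sub>r"
abbreviation Tt where "Tt \<equiv> Thetatilde D \<rho>0 \<kappa> \<rho>\<^sub>r"

lemma nice_Z1_A: "nice (Z1_A D \<rho>0 \<kappa> \<rho>\<^sub>r)" unfolding Z1_A_def by (rule nice_Iop[OF nice_FA])

lemma nice_Lam1_A: "nice (Lam1_A D \<rho>0 \<kappa> \<rho>\<^sub>r)" unfolding Lam1_A_def[abs_def] by (rule nice_avg[OF nice_FA])

text \<open>From the second corrector on it only matters that each is \<open>Iop\<close> of a nice
  function, as its prefactor already has the size of the remainder.\<close>

lemma Z_forms:
  obtains H1 H2 H3 H4 where "nice H1" "nice H2" "nice H3" "nice H4"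
    "Z1_2A D \<rho>0 \<kappa> \<rho>\<^sub>r = Iop D \<kappa> H1" "Z2_2A D \<rho>0 \<kappa> \<rho>\<^sub>r = Iop D \<kappa> H2" "Z1_B D \<rho>0 \<kappa> \<rho>\<^sub>r = Iop D \<kappa> H3" "Z1_2CA D \<rho>0 \<kappa> \<rho>\<^sub>r = Iop D \<kappa> H4"
proof (rule that[OF _ _ _ _ Z1_2A_def Z2_2A_def Z1_B_def Z1_2CA_def])
qed (intro nice_add nice_diff nice_mult nice_const nice_power nice_d_r nice_d_theta nice_F2A nice_Z1_A nice_Lam1_A nice_FA nice_GA nice_G2A nice_FBA nice_F2CA nice_xi10)+

text \<open>The first corrector adds mean minus value of \<open>FA\<close>. The original
  \<open>FA\<close> still carries the factor (1 + d * r) powr (a + 1), so the cancellation becomes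
  exact only in the limit d = 0.\<close>

lemma generator_Rtilde:
  obtains X where "bc X" "\<And>r \<theta> \<zeta> \<tau>. \<bar>r\<bar> \<le> r0 \<Longrightarrow> \<tau> > \<tau>1 \<Longrightarrow> gen Rt r \<theta> \<zeta> \<tau> = \<tau> powr (- A / B) *
     ((1 + dd \<tau> * r) powr (a + 1) * FA r \<theta> \<zeta> \<tau> + (Lam1_A D \<rho>0 \<kappa> \<rho>\<^sub>r r \<theta> \<zeta> \<tau> - FA r \<theta> \<zeta> \<tau>)
      + \<tau> powr ((2 * A - B) / B) * FBA r \<theta> \<zeta> \<tau> + \<tau> powr (- A / B) * X r \<theta> \<zeta> \<tau>)"
proof -
  obtain H1 H2 H3 H4 where H: "nice H1" "nice H2" "nice H3" "nice H4"
    "Z1_2A D \<rho>0 \<kappa> \<rho>\<^sub>r = Iop D \<kappa> H1" "Z2_2A D \<rho>0 \<kappa> \<rho>\<^sub>r = Iop D \<kappa> H2" "Z1_B D \<rho>0 \<kappa> \<rho>\<^sub>r = Iop D \<kappa> H3" "Z1_2CA D \<rho>0 \<kappa> \<rho>\<^sub>r = Iop D \<kappa> H4"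
    using Z_forms by blast
  obtain Y where Y: "bc Y" "\<And>r \<theta> \<zeta> \<tau>. \<bar>r\<bar> \<le> r0 \<Longrightarrow> \<tau> > \<tau>1 \<Longrightarrow>
   Fr r \<theta> \<zeta> \<tau> = \<tau> powr (- A / B) * ((1 + dd \<tau> * r) powr (a + 1) * FA r \<theta> \<zeta> \<tau> + \<tau> powr ((2 * A - B) / B) * FBA r \<theta> \<zeta> \<tau> + \<tau> powr (- A / B) * Y r \<theta> \<zeta> \<tau>)"
    using Fr_eq by blast
  obtain X1 where X1: "bc X1" "has_gen (\<lambda>r \<theta> \<zeta> \<tau>. \<tau> powr (- A / B) * Iop D \<kappa> FA r \<theta> \<zeta> \<tau>)
    (\<lambda>r \<theta> \<zeta> \<tau>. \<tau> powr (- A / B) * (avg \<kappa> (\<lambda>\<zeta>'. FA r \<theta> \<zeta>' \<tau>) - FA r \<theta> \<zeta> \<tau>) + \<tau> powr (- A / B) * \<tau> powr (- A / B) * X1 r \<theta> \<zeta> \<tau>)"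
    using has_gen_term[OF nice_FA] by blast
  \<comment> \<open>The exponent of each further corrector is - 2 * A / B plus a rest that is
    nonpositive by 2 * A \<le> B and 3 * A \<le> 2 * C.\<close>
  have e: "- 2 * A / B = - A / B + - A / B + 0" "- 2 * (B - A) / B = - A / B + - A / B + (4 * A - 2 * B) / B"
    "- (2 * C - A) / B = - A / B + - A / B + (3 * A - 2 * C) / B" "- 1 = - A / B + - A / B + (2 * A - B) / B"
    using exponent_order by (simp_all add: field_simps)
  obtain X2 where X2: "bc X2" "has_gen (\<lambda>r \<theta> \<zeta> \<tau>. \<tau> powr (- 2 * A / B) * Iop D \<kappa> H1 r \<theta> \<zeta> \<tau>)
    (\<lambda>r \<theta> \<zeta> \<tau>. \<tau> powr (- A / B) * (\<tau> powr (- A / B) * X2 r \<theta> \<zeta> \<tau>))" by (rule has_gen_small[OF H(1) e(1) order_refl])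
  obtain X3 where X3: "bc X3" "has_gen (\<lambda>r \<theta> \<zeta> \<tau>. \<tau> powr (- 2 * (B - A) / B) * Iop D \<kappa> H3 r \<theta> \<zeta> \<tau>)
    (\<lambda>r \<theta> \<zeta> \<tau>. \<tau> powr (- A / B) * (\<tau> powr (- A / B) * X3 r \<theta> \<zeta> \<tau>))" by (rule has_gen_small[OF H(3) e(2) exponent_signs(7)])
  obtain X4 where X4: "bc X4" "has_gen (\<lambda>r \<theta> \<zeta> \<tau>. \<tau> powr (- (2 * C - A) / B) * Iop D \<kappa> H4 r \<theta> \<zeta> \<tau>)
    (\<lambda>r \<theta> \<zeta> \<tau>. \<tau> powr (- A / B) * (\<tau> powr (- A / B) * X4 r \<theta> \<zeta> \<tau>))" by (rule has_gen_small[OF H(4) e(3) exponent_signs(5)])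
  obtain X5 where X5: "bc X5" "has_gen (\<lambda>r \<theta> \<zeta> \<tau>. \<tau> powr (- 1) * Iop D \<kappa> H3 r \<theta> \<zeta> \<tau>)
    (\<lambda>r \<theta> \<zeta> \<tau>. \<tau> powr (- A / B) * (\<tau> powr (- A / B) * X5 r \<theta> \<zeta> \<tau>))" by (rule has_gen_small[OF H(3) e(4) exponent_signs(2)])
  have R: "Rt = (\<lambda>r \<theta> \<zeta> \<tau>. r + \<tau> powr (- A / B) * Iop D \<kappa> FA r \<theta> \<zeta> \<tau> + \<tau> powr (- 2 * A / B) * Iop D \<kappa> H1 r \<theta> \<zeta> \<tau>
     + \<tau> powr (- 2 * (B - A) / B) * Iop D \<kappa> H3 r \<theta> \<zeta> \<tau> + \<tau> powr (- (2 * C - A) / B) * Iop D \<kappa> H4 r \<theta> \<zeta> \<tau> + \<tau> powr (- 1) * Iop D \<kappa> H3 r \<theta> \<zeta> \<tau>)"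
    by (intro ext) (simp only: Rtilde_def Z1_2BA_def H(5-8) Z1_A_def)
  note G = has_gen_add[OF has_gen_add[OF has_gen_add[OF has_gen_add[OF has_gen_add[OF has_gen_r X1(2)] X2(2)] X3(2)] X4(2)] X5(2), folded R]
  show ?thesis
  proof (rule that)
    show "bc (\<lambda>r \<theta> \<zeta> \<tau>. Y r \<theta> \<zeta> \<tau> + X1 r \<theta> \<zeta> \<tau> + X2 r \<theta> \<zeta> \<tau> + X3 r \<theta> \<zeta> \<tau> + X4 r \<theta> \<zeta> \<tau> + X5 r \<theta> \<zeta> \<tau>)"
      by (intro bc_add Y(1) X1(1) X2(1) X3(1) X4(1) X5(1))
    fix r \<theta> \<zeta> \<tau> assume r: "\<bar>r\<bar> \<le> r0" and \<tau>: "\<tau> > \<tau>1"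
    show "gen Rt r \<theta> \<zeta> \<tau> = \<tau> powr (- A / B) * ((1 + dd \<tau> * r) powr (a + 1) * FA r \<theta> \<zeta> \<tau> + (Lam1_A D \<rho>0 \<kappa> \<rho>\<^sub>r r \<theta> \<zeta> \<tau> - FA r \<theta> \<zeta> \<tau>)
      + \<tau> powr ((2 * A - B) / B) * FBA r \<theta> \<zeta> \<tau>
      + \<tau> powr (- A / B) * (Y r \<theta> \<zeta> \<tau> + X1 r \<theta> \<zeta> \<tau> + X2 r \<theta> \<zeta> \<tau> + X3 r \<theta> \<zeta> \<tau> + X4 r \<theta> \<zeta> \<tau> + X5 r \<theta> \<zeta> \<tau>))"
      unfolding has_genD[OF G r \<tau>] Y(2)[OF r \<tau>] Lam1_A_def by (simp only: distrib_left add_ac mult.assoc)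
  qed
qed

lemma generator_Thetatilde:
  obtains X where "bc X" "\<And>r \<theta> \<zeta> \<tau>. \<bar>r\<bar> \<le> r0 \<Longrightarrow> \<tau> > \<tau>1 \<Longrightarrow> gen Tt r \<theta> \<zeta> \<tau> = X r \<theta> \<zeta> \<tau>"
proof -
  obtain H1 H2 H3 H4 where H: "nice H1" "nice H2" "nice H3" "nice H4"
    "Z1_2A D \<rho>0 \<kappa> \<rho>\<^sub>r = Iop D \<kappa> H1" "Z2_2A D \<rho>0 \<kappa> \<rho>\<^sub>r = Iop D \<kappa> H2" "Z1_B D \<rho>0 \<kappa> \<rho>\<^sub>r = Iop D \<kappa> H3" "Z1_2CA D \<rho>0 \<kappa> \<rho>\<^sub>r = Iop D \<kappa> H4"
    using Z_forms by blast
  obtain Y where Y: "bc Y" "\<And>r \<theta> \<zeta> \<tau>. \<bar>r\<bar> \<le> r0 \<Longrightarrow> \<tau> > \<tau>1 \<Longrightarrow> Ft r \<theta> \<zeta> \<tau> = \<tau> powr (- A / B) * Y r \<theta> \<zeta> \<tau>"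
    using Ft_eq by blast
  have e: "- 2 * A / B = - A / B + - A / B + 0" using exponent_order by (simp add: field_simps)
  obtain X where X: "bc X" "has_gen (\<lambda>r \<theta> \<zeta> \<tau>. \<tau> powr (- 2 * A / B) * Iop D \<kappa> H2 r \<theta> \<zeta> \<tau>)
    (\<lambda>r \<theta> \<zeta> \<tau>. \<tau> powr (- A / B) * (\<tau> powr (- A / B) * X r \<theta> \<zeta> \<tau>))" by (rule has_gen_small[OF H(2) e order_refl])
  have T: "Tt = (\<lambda>r \<theta> \<zeta> \<tau>. \<theta> + \<tau> powr (- 2 * A / B) * Iop D \<kappa> H2 r \<theta> \<zeta> \<tau>)"
    by (intro ext) (simp only: Thetatilde_def H(6))
  note G = has_gen_add[OF has_gen_theta X(2), folded T]
  show ?thesis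
  proof (rule that)
    show "bc (\<lambda>r \<theta> \<zeta> \<tau>. \<tau> powr (- A / B) * Y r \<theta> \<zeta> \<tau> + \<tau> powr (- A / B) * (\<tau> powr (- A / B) * X r \<theta> \<zeta> \<tau>))"
      by (intro bc_add bc_mult bc_tau exponent_signs Y(1) X(1))
  qed (simp only: has_genD[OF G] Y(2))
qed

lemma bc_gen_Rt: "bc (gen Rt)"
proof -
  obtain X where X: "bc X" "\<And>r \<theta> \<zeta> \<tau>. \<bar>r\<bar> \<le> r0 \<Longrightarrow> \<tau> > \<tau>1 \<Longrightarrow> gen Rt r \<theta> \<zeta> \<tau> = \<tau> powr (- A / B) *
     ((1 + dd \<tau> * r) powr (a + 1) * FA r \<theta> \<zeta> \<tau> + (Lam1_A D \<rho>0 \<kappa> \<rho>\<^sub>r r \<theta> \<zeta> \<tau> - FA r \<theta> \<zeta> \<tau>)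
      + \<tau> powr ((2 * A - B) / B) * FBA r \<theta> \<zeta> \<tau> + \<tau> powr (- A / B) * X r \<theta> \<zeta> \<tau>)"
    using generator_Rtilde by blast
  have "bc (\<lambda>r \<theta> \<zeta> \<tau>. \<tau> powr (- A / B) *
     ((1 + dd \<tau> * r) powr (a + 1) * FA r \<theta> \<zeta> \<tau> + (Lam1_A D \<rho>0 \<kappa> \<rho>\<^sub>r r \<theta> \<zeta> \<tau> - FA r \<theta> \<zeta> \<tau>)
      + \<tau> powr ((2 * A - B) / B) * FBA r \<theta> \<zeta> \<tau> + \<tau> powr (- A / B) * X r \<theta> \<zeta> \<tau>))"
    by (intro bc_mult bc_add bc_diff bc_tau exponent_signs X(1) nice_bc nice_FA nice_FBA nice_Lam1_A nice_one_plus)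
  then show ?thesis by (rule bc_cong) (rule X(2)[symmetric])
qed

lemma bc_gen_Tt: "bc (gen Tt)"
proof -
  obtain X where X: "bc X" "\<And>r \<theta> \<zeta> \<tau>. \<bar>r\<bar> \<le> r0 \<Longrightarrow> \<tau> > \<tau>1 \<Longrightarrow> gen Tt r \<theta> \<zeta> \<tau> = X r \<theta> \<zeta> \<tau>"
    using generator_Thetatilde by blast
  show ?thesis by (rule bc_cong[OF X(1)]) (rule X(2)[symmetric])
qed

lemma Z_exponent_signs: "- 2 * A / B \<le> 0" "- 2 * (B - A) / B \<le> 0" "- (2 * C - A) / B \<le> 0" "- 1 \<le> (0 :: real)"
  using exponent_order by (simp_all add: divide_nonpos_pos)

lemma bc_Rt: "bc Rt"
proof -
  obtain H1 H2 H3 H4 where H: "nice H1" "nice H2" "nice H3" "nice H4"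
    "Z1_2A D \<rho>0 \<kappa> \<rho>\<^sub>r = Iop D \<kappa> H1" "Z2_2A D \<rho>0 \<kappa> \<rho>\<^sub>r = Iop D \<kappa> H2" "Z1_B D \<rho>0 \<kappa> \<rho>\<^sub>r = Iop D \<kappa> H3" "Z1_2CA D \<rho>0 \<kappa> \<rho>\<^sub>r = Iop D \<kappa> H4"
    using Z_forms by blast
  show ?thesis unfolding Rtilde_def[abs_def] Z1_2BA_def H(5-8)
    by (intro bc_add bc_mult bc_tau exponent_signs(4) Z_exponent_signs nice_bc nice_r nice_Z1_A nice_Iop H(1-4))
qed

text \<open>The angle itself is unbounded; the displacement is what can be bounded.\<close>

lemma bc_Tt_diff: "bc (\<lambda>r \<theta> \<zeta> \<tau>. Tt r \<theta> \<zeta> \<tau> - \<theta>)"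
proof -
  obtain H1 H2 H3 H4 where H: "nice H1" "nice H2" "nice H3" "nice H4"
    "Z1_2A D \<rho>0 \<kappa> \<rho>\<^sub>r = Iop D \<kappa> H1" "Z2_2A D \<rho>0 \<kappa> \<rho>\<^sub>r = Iop D \<kappa> H2" "Z1_B D \<rho>0 \<kappa> \<rho>\<^sub>r = Iop D \<kappa> H3" "Z1_2CA D \<rho>0 \<kappa> \<rho>\<^sub>r = Iop D \<kappa> H4"
    using Z_forms by blast
  show ?thesis unfolding Thetatilde_def H(6) add_diff_cancel_left'
    by (intro bc_mult bc_tau Z_exponent_signs(1) nice_bc nice_Iop H(2))
qed

text \<open>At e = d = 0 the factor (1 + d * r) powr (a + 1) is 1, so the two copies of
  \<open>FA\<close> cancel and the mean remains; there the coefficient is \<open>f10\<close> and the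
  scaled amplitude is z0.\<close>

lemma Pfun_limit:
  obtains g where "nfun g" "rep (\<lambda>r \<theta> \<zeta> \<tau>. (1 + dd \<tau> * r) powr (a + 1) * FA r \<theta> \<zeta> \<tau> + (Lam1_A D \<rho>0 \<kappa> \<rho>\<^sub>r r \<theta> \<zeta> \<tau> - FA r \<theta> \<zeta> \<tau>)) g"
    "\<And>r \<theta> \<zeta>. g ((0, 0, r, \<theta>), \<zeta>) = B powr (- A / B) * z0 D \<kappa> powr a * avg \<kappa> (\<lambda>y. f10 D (y / real \<kappa> + \<theta>) y)"
proof -
  define k where "k x = B powr (- A / B) * zf (fst (fst x)) powr a * osc_fun (ff 1) x" for x :: pnt
  have "smooth_on {-e1<..<e1} (\<lambda>e. zf e powr a)" by (intro smooth_intros smooth_zf) (auto intro: zf_pos)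
  from nfun_S3[OF smooth_S3_e[OF this]] have k: "nfun k" unfolding k_def by (intro nfun_mult nfun_const nfun_coefs) simp
  have rk: "rep FA k" unfolding rep_def by (simp add: FA_eq k_def osc_fun_def pt_def ang_def)
  define m where "m x = (LBINT y=0..ereal Lk. k (fst x, y)) / Lk" for x :: pnt
  have rm: "rep (Lam1_A D \<rho>0 \<kappa> \<rho>\<^sub>r) m" using rk by (auto simp: rep_def Lam1_A_def avg_def m_def pt_def)
  define o' where "o' x = (1 + fst (snd (fst x)) * fst (snd (snd (fst x)))) powr (a + 1)" for x :: pnt
  have o: "nfun o'" using nfun_S3[OF smooth_one_plus[of "a + 1"]] by (simp add: o'_def[abs_def])
  show ?thesis
  proof (rule that)
    show "nfun (\<lambda>x. o' x * k x + (m x - k x))" unfolding m_def by (intro nfun_add nfun_mult nfun_diff nfun_avg o k)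
    show "rep (\<lambda>r \<theta> \<zeta> \<tau>. (1 + dd \<tau> * r) powr (a + 1) * FA r \<theta> \<zeta> \<tau> + (Lam1_A D \<rho>0 \<kappa> \<rho>\<^sub>r r \<theta> \<zeta> \<tau> - FA r \<theta> \<zeta> \<tau>)) (\<lambda>x. o' x * k x + (m x - k x))"
      using rk rm by (simp add: rep_def o'_def pt_def)
    fix r \<theta> \<zeta>
    have "k ((0, 0, r, \<theta>), y) = B powr (- A / B) * z0 D \<kappa> powr a * f10 D (y / real \<kappa> + \<theta>) y" for y
      by (simp add: k_def osc_fun_def qq_def ff_limit zf_0 del: One_nat_def)
    then show "o' ((0, 0, r, \<theta>), \<zeta>) * k ((0, 0, r, \<theta>), \<zeta>) + (m ((0, 0, r, \<theta>), \<zeta>) - k ((0, 0, r, \<theta>), \<zeta>)) =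
       B powr (- A / B) * z0 D \<kappa> powr a * avg \<kappa> (\<lambda>y. f10 D (y / real \<kappa> + \<theta>) y)"
      by (simp add: o'_def m_def avg_def)
  qed
qed

text \<open>The exponent (2 * A - B) / B is 0 for B = 2 * A and negative otherwise: the origin of
  the Kronecker delta in \<open>Pfun\<close>.\<close>

lemma FBA_tendsto:
  assumes \<rho>: "filterlim \<rho>\<^sub>r at_top at_top"
  shows "((\<lambda>\<tau>. \<tau> powr ((2 * A - B) / B) * (- (B powr ((A - B) / B)) * kap (ee \<tau>))) \<longlongrightarrow>
    (if B = 2 * A then 1 else 0) * (- (B powr ((A - B) / B)) * (beta D / real h))) at_top"
proof (intro tendsto_mult tendsto_const)
  have "continuous_on {-e1<..<e1} kap" by (rule smooth_on_continuous[OF smooth_kap])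
  then have "isCont kap 0" using e1(1) by (simp add: continuous_on_eq_continuous_at)
  from isCont_tendsto_compose[OF this ee_tendsto[OF \<rho>]] show "((\<lambda>\<tau>. kap (ee \<tau>)) \<longlongrightarrow> beta D / real h) at_top" by (simp add: kap_0)
  show "((\<lambda>\<tau>. \<tau> powr ((2 * A - B) / B)) \<longlongrightarrow> (if B = 2 * A then 1 else 0)) at_top"
  proof (cases "B = 2 * A")
    case True
    have "\<forall>\<^sub>F \<tau>::real in at_top. \<tau> powr ((2 * A - B) / B) = 1"
      using eventually_gt_at_top[of 0] by eventually_elim (simp add: True)
    from tendsto_eventually[OF this] True show ?thesis by simp
  next
    case False
    then have "(2 * A - B) / B < 0" using exponent_order by (simp add: divide_neg_pos)
    from tendsto_neg_powr[OF this filterlim_ident] False show ?thesis by simp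
  qed
qed

text \<open>Three errors are kept below \<epsilon> / 3: that of the averaged leading term, that of
  the \<open>FBA\<close> term, and the remainder of size \<tau> powr (- A / B).\<close>

lemma Rt_drift_limit:
  assumes \<rho>: "filterlim \<rho>\<^sub>r at_top at_top" and \<epsilon>: "\<epsilon> > 0"
  shows "\<forall>\<^sub>F \<tau> in at_top. \<forall>r \<theta> \<zeta>. \<bar>r\<bar> \<le> r0 \<longrightarrow> \<bar>\<tau> powr (A / B) * gen Rt r \<theta> \<zeta> \<tau> - Pfun D \<kappa> \<theta>\<bar> < \<epsilon>"
proof -
  obtain X where X: "bc X" "\<And>r \<theta> \<zeta> \<tau>. \<bar>r\<bar> \<le> r0 \<Longrightarrow> \<tau> > \<tau>1 \<Longrightarrow> gen Rt r \<theta> \<zeta> \<tau> = \<tau> powr (- A / B) *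
     ((1 + dd \<tau> * r) powr (a + 1) * FA r \<theta> \<zeta> \<tau> + (Lam1_A D \<rho>0 \<kappa> \<rho>\<^sub>r r \<theta> \<zeta> \<tau> - FA r \<theta> \<zeta> \<tau>)
      + \<tau> powr ((2 * A - B) / B) * FBA r \<theta> \<zeta> \<tau> + \<tau> powr (- A / B) * X r \<theta> \<zeta> \<tau>)"
    using generator_Rtilde by blast
  obtain M where M: "M \<ge> 0" "\<forall>r \<theta> \<zeta> \<tau>. \<bar>r\<bar> \<le> r0 \<longrightarrow> \<tau> > \<tau>1 \<longrightarrow> \<bar>X r \<theta> \<zeta> \<tau>\<bar> \<le> M" using bcD[OF X(1)] by blast
  let ?H = "\<lambda>r \<theta> \<zeta> \<tau>. (1 + dd \<tau> * r) powr (a + 1) * FA r \<theta> \<zeta> \<tau> + (Lam1_A D \<rho>0 \<kappa> \<rho>\<^sub>r r \<theta> \<zeta> \<tau> - FA r \<theta> \<zeta> \<tau>)"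
  let ?P = "\<lambda>\<theta>. B powr (- A / B) * z0 D \<kappa> powr a * avg \<kappa> (\<lambda>y. f10 D (y / real \<kappa> + \<theta>) y)"
  let ?K = "(if B = 2 * A then 1 else 0) * (- (B powr ((A - B) / B)) * (beta D / real h))"
  let ?k = "\<lambda>\<tau>. \<tau> powr ((2 * A - B) / B) * (- (B powr ((A - B) / B)) * kap (ee \<tau>))"
  obtain g where g: "nfun g" "rep ?H g" "\<And>r \<theta> \<zeta>. g ((0, 0, r, \<theta>), \<zeta>) = ?P \<theta>" using Pfun_limit by blast
  have \<epsilon>3: "\<epsilon> / 3 > 0" using \<epsilon> by simp
  have "\<forall>\<^sub>F \<tau> in at_top. \<forall>r \<theta> \<zeta>. \<bar>r\<bar> \<le> r0 \<longrightarrow> \<bar>?H r \<theta> \<zeta> \<tau> - ?P \<theta>\<bar> < \<epsilon> / 3"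
    using nice_limit[OF g(1,2) \<rho> \<epsilon>3] unfolding g(3) .
  moreover have "\<forall>\<^sub>F \<tau> in at_top. \<bar>?k \<tau> - ?K\<bar> < \<epsilon> / 3"
    using tendstoD[OF FBA_tendsto[OF \<rho>] \<epsilon>3] unfolding dist_real_def .
  moreover have "\<forall>\<^sub>F \<tau> in at_top. \<bar>\<tau> powr (- A / B) * M\<bar> < \<epsilon> / 3"
  proof -
    have "- A / B < 0" using exponent_order by simp
    from tendsto_mult_right[OF tendsto_neg_powr[OF this filterlim_ident], of M]
    have "((\<lambda>\<tau>. \<tau> powr (- A / B) * M) \<longlongrightarrow> 0) at_top" by simp
    from tendstoD[OF this \<epsilon>3] show ?thesis by (simp add: dist_real_def)
  qed
  ultimately show ?thesis using eventually_gt_at_top[of \<tau>1]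
  proof eventually_elim
    case (elim \<tau>)
    show ?case
    proof (intro allI impI)
      fix r \<theta> \<zeta> assume r: "\<bar>r\<bar> \<le> r0"
      have "\<tau> powr (A / B) * \<tau> powr (- A / B) = 1" using tau_pos[OF elim(4)] by (simp add: powr_add[symmetric])
      then have "\<tau> powr (A / B) * gen Rt r \<theta> \<zeta> \<tau> = ?H r \<theta> \<zeta> \<tau> + ?k \<tau> + \<tau> powr (- A / B) * X r \<theta> \<zeta> \<tau>"
        unfolding X(2)[OF r elim(4)] FBA_eq[OF elim(4)] mult.assoc[symmetric] by (simp only: mult_1_left mult.assoc)
      moreover have "Pfun D \<kappa> \<theta> = ?P \<theta> + ?K" unfolding Pfun_def by simp
      moreover have "\<bar>\<tau> powr (- A / B) * X r \<theta> \<zeta> \<tau>\<bar> \<le> \<bar>\<tau> powr (- A / B) * M\<bar>"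
        using M(1) M(2)[rule_format, OF r elim(4), of \<theta> \<zeta>] unfolding abs_mult by (intro mult_left_mono) auto
      ultimately show "\<bar>\<tau> powr (A / B) * gen Rt r \<theta> \<zeta> \<tau> - Pfun D \<kappa> \<theta>\<bar> < \<epsilon>"
        using elim(1)[rule_format, OF r, of \<theta> \<zeta>] elim(2,3) by linarith
    qed
  qed
qed

text \<open>Up to a constant, \<open>Pfun\<close> is the restriction of a smooth function on
  \<open>Om\<close> to e = d = r = 0.\<close>

lemma Pfun_continuous: "continuous_on UNIV (Pfun D \<kappa>)"
proof -
  obtain g where g: "nfun g" "rep (\<lambda>r \<theta> \<zeta> \<tau>. (1 + dd \<tau> * r) powr (a + 1) * FA r \<theta> \<zeta> \<tau> + (Lam1_A D \<rho>0 \<kappa> \<rho>\<^sub>r r \<theta> \<zeta> \<tau> - FA r \<theta> \<zeta> \<tau>)) g"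
    "\<And>r \<theta> \<zeta>. g ((0, 0, r, \<theta>), \<zeta>) = B powr (- A / B) * z0 D \<kappa> powr a * avg \<kappa> (\<lambda>y. f10 D (y / real \<kappa> + \<theta>) y)"
    using Pfun_limit by blast
  have "continuous_on UNIV (\<lambda>\<theta>. g ((0, 0, 0, \<theta>), 0))"
  proof (rule continuous_on_compose2[of Om g])
    show "continuous_on Om g" using g(1) by (auto simp: nfun_def intro: smooth_on_continuous)
    show "continuous_on UNIV (\<lambda>\<theta>::real. ((0::real, 0::real, 0::real, \<theta>), 0::real))" by (intro continuous_intros)
  qed (use e1(1) r0 in \<open>auto simp: Om_def S4_def dlt_def\<close>)
  then show ?thesis unfolding Pfun_def[abs_def] g(3) by (rule continuous_on_diff[OF _ continuous_on_const])
qed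

end

section \<open>Continuation of solutions and exit\<close>

text \<open>\<open>peano\<close> asks for a bounded field on the whole space. Composition with the
  nearest-point projection onto a closed ball around x T inside S provides one; for a short time the
  solution stays in the ball, where the projection is the identity.\<close>

lemma extend_past_endpoint:
  fixes f :: "real \<Rightarrow> 'a::euclidean_space \<Rightarrow> 'a"
  assumes f: "continuous_on ({t0..} \<times> S) (\<lambda>(t, x). f t x)"
    and J: "is_interval J" "T \<in> J" "J \<subseteq> {..T}" "t0 \<le> T"
    and x: "\<And>t. t \<in> J \<Longrightarrow> (x has_vector_derivative f t (x t)) (at t within J)" "x T \<in> interior S"
  obtains \<eta> y where "\<eta> > 0" "is_interval (J \<union> {T..T+\<eta>})" "\<And>t. t \<in> J \<Longrightarrow> y t = x t"
    "\<And>t. t \<in> {T..T+\<eta>} \<Longrightarrow> y t \<in> S"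
    "\<And>t. t \<in> J \<union> {T..T+\<eta>} \<Longrightarrow> (y has_vector_derivative f t (y t)) (at t within J \<union> {T..T+\<eta>})"
proof -
  obtain e where e: "e > 0" "cball (x T) e \<subseteq> S" using x(2) unfolding mem_interior_cball by blast
  define K where "K = cball (x T) e"
  define c where "c = closest_point K"
  have K: "convex K" "closed K" "K \<noteq> {}" "compact K" "K \<subseteq> S" using e by (auto simp: K_def)
  have cK: "c z \<in> K" for z unfolding c_def by (rule closest_point_in_set[OF K(2,3)])
  have cc: "continuous_on U c" for U unfolding c_def by (rule continuous_on_closest_point[OF K(1-3)])
  have fK: "continuous_on ({T..T+1} \<times> K) (\<lambda>(t, x). f t x)"
    by (rule continuous_on_subset[OF f]) (use J(4) K(5) in auto)
  have cont: "continuous_on ({T..T+1} \<times> UNIV) (\<lambda>(t, z). f t (c z))"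
  proof -
    have "continuous_on ({T..T+1} \<times> UNIV) (\<lambda>p. (case (fst p, c (snd p)) of (t, x) \<Rightarrow> f t x))"
      by (rule continuous_on_compose2[OF fK])
        (auto intro!: continuous_intros continuous_on_compose2[OF cc[of UNIV]] simp: cK)
    then show ?thesis by (simp add: case_prod_unfold)
  qed
  have "bounded ((\<lambda>(t, x). f t x) ` ({T..T+1} \<times> K))"
    by (intro compact_imp_bounded compact_continuous_image fK compact_Times compact_Icc K(4))
  then obtain M where M: "\<And>t x. t \<in> {T..T+1} \<Longrightarrow> x \<in> K \<Longrightarrow> norm (f t x) \<le> M" unfolding bounded_iff by fastforce
  obtain y where y: "y T = x T" "\<And>t. t \<in> {T..T+1} \<Longrightarrow> (y has_vector_derivative f t (c (y t))) (at t within {T..T+1})"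
    using peano[OF cont, of M "x T"] M cK by metis
  have "continuous (at T within {T..T+1}) y" by (rule has_vector_derivative_continuous[OF y(2)]) simp
  then obtain d where d: "d > 0" "\<And>t. t \<in> {T..T+1} \<Longrightarrow> dist t T < d \<Longrightarrow> dist (y t) (x T) < e"
    unfolding continuous_within_eps_delta y(1) using e(1) by blast
  define \<eta> where "\<eta> = min 1 (d / 2)"
  have \<eta>: "\<eta> > 0" "\<eta> \<le> 1" "\<eta> < d" using d(1) by (auto simp: \<eta>_def)
  have yK: "y t \<in> K" if "t \<in> {T..T+\<eta>}" for t
    using d(2)[of t] that \<eta> by (auto simp: K_def dist_commute dist_real_def)
  have y': "(y has_vector_derivative f t (y t)) (at t within {T..T+\<eta>})" if "t \<in> {T..T+\<eta>}" for t
    using has_vector_derivative_within_subset[OF y(2), of t "{T..T+\<eta>}"] that \<eta> closest_point_self[OF yK[OF that]]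
    by (simp add: c_def)
  have cl: "closure J \<subseteq> {..T}" by (rule closure_minimal[OF J(3)]) simp
  have u: "J \<union> {T..T+\<eta>} = J \<union> {T<..T+\<eta>}" using J(2) \<eta> by auto
  \<comment> \<open>The two pieces meet only at T, where their values and hence the field agree;
    this is the gluing condition.\<close>
  have int: "closure J \<inter> closure {T<..T+\<eta>} = {T}" using cl J(2) \<eta> closure_subset[of J] by auto
  show ?thesis
  proof (rule that[OF \<eta>(1)])
    show "is_interval (J \<union> {T..T+\<eta>})"
      using J(1,2) \<eta> by (auto simp: is_interval_connected_1 intro!: connected_Un)
    show "(if t \<in> J then x t else y t) = x t" if "t \<in> J" for t using that by simp
    show "(if t \<in> J then x t else y t) \<in> S" if "t \<in> {T..T+\<eta>}" for t
    proof (cases "t \<in> J")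
      case True
      then have "t = T" using J(3) that by auto
      then show ?thesis using True x(2) interior_subset by auto
    next
      case False
      then show ?thesis using yK[OF that] K(5) by auto
    qed
    fix t assume t: "t \<in> J \<union> {T..T+\<eta>}"
    have "((\<lambda>t. if t \<in> J then x t else y t) has_vector_derivative (if t \<in> J then f t (x t) else f t (y t))) (at t within J \<union> {T<..T+\<eta>})"
    proof (rule has_vector_derivative_If_within_closures)
      show "t \<in> J \<union> {T<..T+\<eta>}" using t u by simp
      show "(x has_vector_derivative f t (x t)) (at t within J \<union> (closure J \<inter> closure {T<..T+\<eta>}))"
        if "t \<in> J \<union> (closure J \<inter> closure {T<..T+\<eta>})"
        using x(1)[of t] that J(2) unfolding int by (simp add: insert_absorb)
      have "{T<..T+\<eta>} \<union> {T} = {T..T+\<eta>}" using \<eta> by auto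
      then show "(y has_vector_derivative f t (y t)) (at t within {T<..T+\<eta>} \<union> (closure J \<inter> closure {T<..T+\<eta>}))"
        if "t \<in> {T<..T+\<eta>} \<union> (closure J \<inter> closure {T<..T+\<eta>})"
        using y'[of t] that unfolding int by simp
      show "x t = y t" if "t \<in> closure J" "t \<in> closure {T<..T+\<eta>}"
        using int that y(1) by (metis IntI singletonD)
      then show "f t (x t) = f t (y t)" if "t \<in> closure J" "t \<in> closure {T<..T+\<eta>}"
        using that by simp
    qed simp
    then show "((\<lambda>t. if t \<in> J then x t else y t) has_vector_derivative f t (if t \<in> J then x t else y t)) (at t within J \<union> {T..T+\<eta>})"
      unfolding u by (simp split: if_splits)
  qed
qed

text \<open>The field is bounded on {s..T} times the closure of G, so x is Lipschitz up to T and has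
  a limit there. The extended function satisfies the integral equation on {s..T}, which yields its
  derivative at T.\<close>

lemma extend_to_limit:
  fixes f :: "real \<Rightarrow> 'a::euclidean_space \<Rightarrow> 'a"
  assumes f: "continuous_on ({t0..} \<times> S) (\<lambda>(t, x). f t x)"
    and J: "is_interval J" "s \<in> J" "J \<subseteq> {t0..<T}" "{s..<T} \<subseteq> J"
    and x: "\<And>t. t \<in> J \<Longrightarrow> (x has_vector_derivative f t (x t)) (at t within J)"
    and G: "bounded G" "closure G \<subseteq> S" "\<And>t. t \<in> {s..<T} \<Longrightarrow> x t \<in> G"
  obtains y where "is_interval (insert T J)" "\<And>t. t \<in> J \<Longrightarrow> y t = x t" "y T \<in> S"
    "\<And>t. t \<in> insert T J \<Longrightarrow> (y has_vector_derivative f t (y t)) (at t within insert T J)"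
proof -
  have sT: "t0 \<le> s" "s < T" using J(2,3) by auto
  have fG: "continuous_on ({s..T} \<times> closure G) (\<lambda>(t, x). f t x)"
    by (rule continuous_on_subset[OF f]) (use sT G(2) in auto)
  have "bounded ((\<lambda>(t, x). f t x) ` ({s..T} \<times> closure G))"
    using G(1) by (intro compact_imp_bounded compact_continuous_image fG compact_Times compact_Icc) (simp add: compact_closure)
  then obtain M where M: "\<And>t x. t \<in> {s..T} \<Longrightarrow> x \<in> closure G \<Longrightarrow> norm (f t x) \<le> M" unfolding bounded_iff by fastforce
  have xG: "x t \<in> closure G" if "t \<in> {s..<T}" for t using G(3)[OF that] closure_subset by auto
  have xd: "(x has_vector_derivative f t (x t)) (at t within {s..<T})" if "t \<in> {s..<T}" for t
    by (rule has_vector_derivative_within_subset[OF x J(4)]) (use that J(4) in auto)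
  have lip: "norm (x t - x t') \<le> \<bar>M\<bar> * norm (t - t')" if "t \<in> {s..<T}" "t' \<in> {s..<T}" for t t'
  proof (rule differentiable_bound[OF _ _ _ that(1,2)])
    show "convex {s..<T}" by (simp add: convex_real_interval)
    show "(x has_derivative (\<lambda>h. h *\<^sub>R f t (x t))) (at t within {s..<T})" if "t \<in> {s..<T}" for t
      using xd[OF that] by (simp add: has_vector_derivative_def)
    show "onorm (\<lambda>h. h *\<^sub>R f t (x t)) \<le> \<bar>M\<bar>" if "t \<in> {s..<T}" for t
    proof (rule onorm_le)
      fix h :: real
      have "norm (f t (x t)) \<le> \<bar>M\<bar>" using M[of t "x t"] xG[OF that] that by force
      then have "norm h * norm (f t (x t)) \<le> norm h * \<bar>M\<bar>" by (rule mult_left_mono) simp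
      then show "norm (h *\<^sub>R f t (x t)) \<le> \<bar>M\<bar> * norm h" by (simp only: norm_scaleR mult.commute real_norm_def)
    qed
  qed
  have "uniformly_continuous_on {s..<T} x"
    unfolding uniformly_continuous_on_def
  proof (intro allI impI)
    fix e :: real assume e: "e > 0"
    show "\<exists>d>0. \<forall>t\<in>{s..<T}. \<forall>t'\<in>{s..<T}. dist t' t < d \<longrightarrow> dist (x t') (x t) < e"
    proof (intro exI[of _ "e / (\<bar>M\<bar> + 1)"] conjI ballI impI)
      fix t t' assume t: "t \<in> {s..<T}" "t' \<in> {s..<T}" "dist t' t < e / (\<bar>M\<bar> + 1)"
      have "norm (x t' - x t) \<le> \<bar>M\<bar> * norm (t' - t)" by (rule lip[OF t(2,1)])
      also have "\<dots> \<le> (\<bar>M\<bar> + 1) * norm (t' - t)" by (intro mult_right_mono) auto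
      also have "\<dots> < e" using t(3) by (simp add: dist_norm pos_less_divide_eq mult.commute)
      finally show "dist (x t') (x t) < e" by (simp add: dist_norm)
    qed (use e in simp)
  qed
  moreover have "T \<in> closure {s..<T}" using sT by simp
  ultimately obtain l where l: "(x \<longlongrightarrow> l) (at T within {s..<T})"
    by (rule uniformly_continuous_on_extension_at_closure)
  define y where "y t = (if t = T then l else x t)" for t
  have yx: "y t = x t" if "t \<in> J" for t using that J(3) by (auto simp: y_def)
  have lG: "l \<in> closure G"
  proof (rule Lim_in_closed_set[OF closed_closure _ _ l])
    show "\<forall>\<^sub>F t in at T within {s..<T}. x t \<in> closure G" unfolding eventually_at_filter by (auto intro!: always_eventually xG)
    show "at T within {s..<T} \<noteq> bot" using sT by (simp add: trivial_limit_within islimpt_in_closure)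
  qed
  have yG: "y t \<in> closure G" if "t \<in> {s..T}" for t using that xG[of t] lG by (auto simp: y_def)
  have y_cont: "continuous_on {s..T} y"
    unfolding continuous_on_def
  proof
    fix t assume t: "t \<in> {s..T}"
    show "(y \<longlongrightarrow> y t) (at t within {s..T})"
    proof (cases "t = T")
      case True
      have "(y \<longlongrightarrow> l) (at T within {s..<T})"
        by (rule Lim_transform_eventually[OF l]) (auto simp: y_def eventually_at_filter)
      moreover have "at T within {s..T} = at T within {s..<T}"
        by (rule at_within_nhd[of _ UNIV]) auto
      ultimately show ?thesis using True by (simp add: y_def)
    next
      case False
      then have t': "t \<in> {s..<T}" using t by auto
      have "(x \<longlongrightarrow> x t) (at t within {s..<T})"
        using has_vector_derivative_continuous[OF xd[OF t']] by (simp add: continuous_within)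
      moreover have "(y \<longlongrightarrow> x t) (at t within {s..<T}) \<longleftrightarrow> (x \<longlongrightarrow> x t) (at t within {s..<T})"
        by (rule Lim_cong_within) (auto simp: y_def)
      moreover have "at t within {s..T} = at t within {s..<T}"
        by (rule at_within_nhd[of _ "{..<T}"]) (use t' in auto)
      ultimately show ?thesis using False by (simp add: y_def)
    qed
  qed
  have fy: "continuous_on {s..T} (\<lambda>t. f t (y t))"
  proof -
    have "continuous_on {s..T} (\<lambda>t. (case (t, y t) of (t, x) \<Rightarrow> f t x))"
      by (rule continuous_on_compose2[OF fG]) (auto intro!: continuous_intros y_cont yG)
    then show ?thesis by simp
  qed
  have yI: "y t = y s + integral {s..t} (\<lambda>t. f t (y t))" if t: "t \<in> {s..T}" for t
  proof -
    have "((\<lambda>t. f t (y t)) has_integral y t - y s) {s..t}"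
    proof (rule fundamental_theorem_of_calculus_interior)
      show "s \<le> t" using t by simp
      show "continuous_on {s..t} y" by (rule continuous_on_subset[OF y_cont]) (use t in auto)
      fix u assume u: "u \<in> {s<..<t}"
      then have u': "u \<in> {s..<T}" using t by auto
      have "(x has_vector_derivative f u (x u)) (at u within {s<..<T})"
        by (rule has_vector_derivative_within_subset[OF xd[OF u']]) auto
      then have "(x has_vector_derivative f u (x u)) (at u)"
        using u t by (simp add: at_within_open[of u "{s<..<T}"])
      then have "(x has_vector_derivative f u (y u)) (at u)" using u' by (simp add: y_def)
      then show "(y has_vector_derivative f u (y u)) (at u)"
        by (rule has_vector_derivative_transform_within_open[of x "f u (y u)" u "{..<T}"]) (use u' in \<open>auto simp: y_def\<close>)
    qed
    from integral_unique[OF this] show ?thesis by simp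
  qed
  have dT: "(y has_vector_derivative f T (y T)) (at T within {s..T})"
  proof (rule has_vector_derivative_transform[where f="\<lambda>t. y s + integral {s..t} (\<lambda>t. f t (y t))"])
    show "((\<lambda>t. y s + integral {s..t} (\<lambda>t. f t (y t))) has_vector_derivative f T (y T)) (at T within {s..T})"
      using has_vector_derivative_add[OF has_vector_derivative_const[of "y s" "at T within {s..T}"] integral_has_vector_derivative[OF fy, of T]] sT by simp
    show "y t = y s + integral {s..t} (\<lambda>t. f t (y t))" if "t \<in> {s..T}" for t by (rule yI[OF that])
  qed (use sT in auto)
  show ?thesis
  proof (rule that)
    have "insert T J = J \<union> {s..T}" using J(2-4) sT by (auto simp: subset_iff)
    moreover have "is_interval (J \<union> {s..T})"
      using J(1,2) sT by (auto simp: is_interval_connected_1 intro!: connected_Un)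
    ultimately show "is_interval (insert T J)" by simp
    show "y t = x t" if "t \<in> J" for t by (rule yx[OF that])
    show "y T \<in> S" using lG G(2) by (auto simp: y_def)
    fix t assume t: "t \<in> insert T J"
    show "(y has_vector_derivative f t (y t)) (at t within insert T J)"
    proof (cases "t = T")
      case True
      have "at T within insert T J = at T within {s..T}"
        by (rule at_within_nhd[of _ "{s<..}"]) (use sT J(3,4) in auto)
      then show ?thesis using dT True by simp
    next
      case False
      then have t': "t \<in> J" using t by simp
      have "(y has_vector_derivative f t (x t)) (at t within J)"
        by (rule has_vector_derivative_transform[OF t' yx x[OF t']])
      moreover have "at t within insert T J = at t within J"
        by (rule at_within_nhd[of _ "{..<T}"]) (use t' J(3) in auto)
      ultimately show ?thesis using yx[OF t'] by simp
    qed
  qed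
qed

context resonance
begin

section \<open>The averaged vector field and its solutions\<close>

lemma bc_along_zeta:
  assumes "bc G" "\<tau>0 > \<tau>1"
  shows "continuous_on ({\<tau>0..} \<times> ({-r0..r0} \<times> UNIV)) (\<lambda>p. G (fst (snd p)) (snd (snd p)) (zeta_of D (fst p)) (fst p))"
proof -
  let ?S = "{\<tau>0..} \<times> ({-r0..r0} \<times> (UNIV :: real set))"
  have "continuous_on ?S (\<lambda>p. (case (fst (snd p), snd (snd p), sfreq D * B * fst p, fst p) of (r, \<theta>, \<zeta>, \<tau>) \<Rightarrow> G r \<theta> \<zeta> \<tau>))"
    by (rule continuous_on_compose2[OF bc_cont[OF assms(1)]])
      (use assms(2) in \<open>auto simp: R4_def intro!: continuous_intros\<close>)
  then show ?thesis
    by (rule continuous_on_eq) (use assms(2) tau1 in \<open>auto simp: zeta_of_eq\<close>)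
qed

definition branch :: "real \<Rightarrow> real \<Rightarrow> real \<times> real \<Rightarrow> real \<times> real" where
  "branch \<zeta> \<tau> = inv_into ({-r0..r0} \<times> UNIV) (change_of_var D \<rho>0 \<kappa> \<rho>\<^sub>r \<zeta> \<tau>)"

lemma Lambda_branch:
  "Lambda1 D \<rho>0 \<kappa> \<rho>\<^sub>r r0 R \<Theta> \<zeta> \<tau> = gen Rt (fst (branch \<zeta> \<tau> (R, \<Theta>))) (snd (branch \<zeta> \<tau> (R, \<Theta>))) \<zeta> \<tau>"
  "Lambda2 D \<rho>0 \<kappa> \<rho>\<^sub>r r0 R \<Theta> \<zeta> \<tau> = gen Tt (fst (branch \<zeta> \<tau> (R, \<Theta>))) (snd (branch \<zeta> \<tau> (R, \<Theta>))) \<zeta> \<tau>"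
  by (simp_all add: Lambda1_def Lambda2_def branch_def case_prod_unfold Let_def)

lemma branch_in:
  assumes "invertible_change D \<rho>0 \<kappa> \<rho>\<^sub>r r0 R0 \<zeta> \<tau>" "\<bar>R\<bar> \<le> R0"
  shows "\<bar>fst (branch \<zeta> \<tau> (R, \<Theta>))\<bar> \<le> r0" "change_of_var D \<rho>0 \<kappa> \<rho>\<^sub>r \<zeta> \<tau> (branch \<zeta> \<tau> (R, \<Theta>)) = (R, \<Theta>)"
proof -
  have i: "(R, \<Theta>) \<in> change_of_var D \<rho>0 \<kappa> \<rho>\<^sub>r \<zeta> \<tau> ` ({-r0..r0} \<times> UNIV)"
    using assms by (auto simp: invertible_change_def abs_le_iff)
  show "change_of_var D \<rho>0 \<kappa> \<rho>\<^sub>r \<zeta> \<tau> (branch \<zeta> \<tau> (R, \<Theta>)) = (R, \<Theta>)" unfolding branch_def by (rule f_inv_into_f[OF i])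
  show "\<bar>fst (branch \<zeta> \<tau> (R, \<Theta>))\<bar> \<le> r0"
    using inv_into_into[OF i] unfolding branch_def by (auto simp: abs_le_iff mem_Times_iff)
qed

text \<open>The change of variables moves angles by a bounded amount, so preimages of bounded sets
  have bounded angles.\<close>

lemma branch_close:
  obtains M where "M \<ge> 0" "\<And>R0 R \<Theta> \<zeta> \<tau>. \<tau> > \<tau>1 \<Longrightarrow> invertible_change D \<rho>0 \<kappa> \<rho>\<^sub>r r0 R0 \<zeta> \<tau> \<Longrightarrow> \<bar>R\<bar> \<le> R0 \<Longrightarrow>
    \<bar>\<Theta> - snd (branch \<zeta> \<tau> (R, \<Theta>))\<bar> \<le> M"
proof -
  obtain M where M: "M \<ge> 0" "\<forall>r \<theta> \<zeta> \<tau>. \<bar>r\<bar> \<le> r0 \<longrightarrow> \<tau> > \<tau>1 \<longrightarrow> \<bar>Tt r \<theta> \<zeta> \<tau> - \<theta>\<bar> \<le> M" using bcD[OF bc_Tt_diff] by blast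
  show ?thesis
  proof (rule that[OF M(1)])
    fix R0 R \<Theta> \<zeta> \<tau> assume \<tau>: "\<tau> > \<tau>1" and i: "invertible_change D \<rho>0 \<kappa> \<rho>\<^sub>r r0 R0 \<zeta> \<tau>" and R: "\<bar>R\<bar> \<le> R0"
    have "Tt (fst (branch \<zeta> \<tau> (R, \<Theta>))) (snd (branch \<zeta> \<tau> (R, \<Theta>))) \<zeta> \<tau> = \<Theta>"
      using branch_in(2)[OF i R, of \<Theta>] by (simp add: change_of_var_def case_prod_unfold)
    then show "\<bar>\<Theta> - snd (branch \<zeta> \<tau> (R, \<Theta>))\<bar> \<le> M"
      using M(2)[rule_format, OF branch_in(1)[OF i R] \<tau>, of \<Theta> "snd (branch \<zeta> \<tau> (R, \<Theta>))" \<zeta>] by simp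
  qed
qed

text \<open>Continuity of the inverse change of variables comes from topology: a continuous
  injection of a compact set has a continuous inverse. As time and angle are unbounded, this is
  applied to slabs that contain all preimages near a given point.\<close>

lemma Lambda_continuous:
  assumes \<tau>0: "\<tau>0 > \<tau>1" and inv: "\<And>\<zeta> \<tau>. \<tau> \<ge> \<tau>0 \<Longrightarrow> invertible_change D \<rho>0 \<kappa> \<rho>\<^sub>r r0 R0 \<zeta> \<tau>"
  shows "continuous_on ({\<tau>0..} \<times> ({-R0..R0} \<times> UNIV))
    (\<lambda>(\<tau>, x). (Lambda1 D \<rho>0 \<kappa> \<rho>\<^sub>r r0 (fst x) (snd x) (zeta_of D \<tau>) \<tau>, Lambda2 D \<rho>0 \<kappa> \<rho>\<^sub>r r0 (fst x) (snd x) (zeta_of D \<tau>) \<tau>))"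
proof -
  let ?S = "{\<tau>0..} \<times> ({-r0..r0} \<times> (UNIV :: real set))" and ?K = "{\<tau>0..} \<times> ({-R0..R0} \<times> (UNIV :: real set))"
  define F where "F p = (fst p, change_of_var D \<rho>0 \<kappa> \<rho>\<^sub>r (zeta_of D (fst p)) (fst p) (snd p))" for p
  define g where "g y = (fst y, branch (zeta_of D (fst y)) (fst y) (snd y))" for y
  have gF: "g (F p) = p" if "p \<in> ?S" for p
  proof -
    have "inj_on (change_of_var D \<rho>0 \<kappa> \<rho>\<^sub>r (zeta_of D (fst p)) (fst p)) ({-r0..r0} \<times> UNIV)"
      using inv[of "fst p"] that by (auto simp: invertible_change_def)
    then show ?thesis using that by (auto simp: F_def g_def branch_def inv_into_f_f)
  qed
  have F: "continuous_on ?S F"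
  proof -
    have "continuous_on ?S (\<lambda>p. (Tt (fst (snd p)) (snd (snd p)) (zeta_of D (fst p)) (fst p) - snd (snd p)) + snd (snd p))"
      by (intro continuous_intros bc_along_zeta[OF bc_Tt_diff \<tau>0])
    then have "continuous_on ?S (\<lambda>p. Tt (fst (snd p)) (snd (snd p)) (zeta_of D (fst p)) (fst p))" by simp
    then show ?thesis unfolding F_def change_of_var_def case_prod_unfold
      by (intro continuous_intros bc_along_zeta[OF bc_Rt \<tau>0])
  qed
  have gK: "F (g y) = y" "g y \<in> ?S" if "y \<in> ?K" for y
    using branch_in[OF inv[of "fst y"], of "fst (snd y)" "zeta_of D (fst y)" "snd (snd y)"] that
    by (auto simp: F_def g_def mem_Times_iff abs_le_iff)
  obtain M where M: "M \<ge> 0" "\<And>R0 R \<Theta> \<zeta> \<tau>. \<tau> > \<tau>1 \<Longrightarrow> invertible_change D \<rho>0 \<kappa> \<rho>\<^sub>r r0 R0 \<zeta> \<tau> \<Longrightarrow> \<bar>R\<bar> \<le> R0 \<Longrightarrow>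
    \<bar>\<Theta> - snd (branch \<zeta> \<tau> (R, \<Theta>))\<bar> \<le> M" using branch_close by blast
  have g: "continuous_on ?K g"
    unfolding continuous_on_eq_continuous_within
  proof
    fix y assume y: "y \<in> ?K"
    \<comment> \<open>1 for the ball around y and M for the displacement of angles, so that
      preimages of points of the ball lie in the slab.\<close>
    define L where "L = \<bar>snd (snd y)\<bar> + 1 + M"
    define SL where "SL = {\<tau>0..fst y + 1} \<times> ({-r0..r0} \<times> {-L..L})"
    have SL: "SL \<subseteq> ?S" "compact SL" by (auto simp: SL_def intro!: compact_Times)
    have "continuous_on (F ` SL) g"
      by (rule continuous_on_inv[OF continuous_on_subset[OF F SL(1)] SL(2)]) (use SL(1) gF in blast)
    moreover have sub: "?K \<inter> ball y 1 \<subseteq> F ` SL"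
    proof
      fix z assume z: "z \<in> ?K \<inter> ball y 1"
      then have zK: "z \<in> ?K" by simp
      have d: "\<bar>fst y - fst z\<bar> < 1" "\<bar>snd (snd y) - snd (snd z)\<bar> < 1"
        using z dist_fst_le[of y z] dist_snd_le[of y z] dist_snd_le[of "snd y" "snd z"] by (auto simp: dist_real_def)
      have "\<bar>snd (snd z) - snd (snd (g z))\<bar> \<le> M"
        using M(2)[of "fst z" R0 "zeta_of D (fst z)" "fst (snd z)" "snd (snd z)"] inv[of "fst z"] zK \<tau>0
        by (simp add: g_def mem_Times_iff abs_le_iff)
      then have "snd (snd (g z)) \<in> {-L..L}" using d unfolding L_def by auto
      moreover have "fst (g z) \<in> {\<tau>0..fst y + 1}" using zK d by (auto simp: g_def mem_Times_iff)
      ultimately have "g z \<in> SL" using gK(2)[OF zK] by (auto simp: SL_def mem_Times_iff)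
      then show "z \<in> F ` SL" using gK(1)[OF zK] by (metis imageI)
    qed
    moreover have "y \<in> F ` SL" using sub y by auto
    ultimately have "continuous (at y within F ` SL) g" unfolding continuous_on_eq_continuous_within by blast
    then have "continuous (at y within ?K \<inter> ball y 1) g" by (rule continuous_within_subset[OF _ sub])
    moreover have "at y within ?K = at y within ?K \<inter> ball y 1" by (rule at_within_nhd[of _ "ball y 1"]) auto
    ultimately show "continuous (at y within ?K) g" by simp
  qed
  have "continuous_on ?K (\<lambda>y. (gen Rt (fst (snd (g y))) (snd (snd (g y))) (zeta_of D (fst (g y))) (fst (g y)),
     gen Tt (fst (snd (g y))) (snd (snd (g y))) (zeta_of D (fst (g y))) (fst (g y))))"
    by (intro continuous_on_Pair continuous_on_compose2[OF bc_along_zeta[OF bc_gen_Rt \<tau>0] g] continuous_on_compose2[OF bc_along_zeta[OF bc_gen_Tt \<tau>0] g])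
      (use gK(2) in blast)+
  then show ?thesis by (simp add: g_def case_prod_unfold Lambda_branch)
qed

text \<open>The range is an interval without 0. Carrying the sign as a factor \<sigma> treats both
  cases at once later on.\<close>

lemma Pfun_sign:
  assumes "\<forall>\<Theta>. Pfun D \<kappa> \<Theta> \<noteq> 0"
  obtains \<sigma> :: real where "\<bar>\<sigma>\<bar> = 1" "\<And>\<Theta>. \<sigma> * Pfun D \<kappa> \<Theta> > 0"
proof -
  have "is_interval (range (Pfun D \<kappa>))"
    using connected_continuous_image[OF Pfun_continuous connected_UNIV] by (simp add: is_interval_connected_1)
  then have "\<not> (Pfun D \<kappa> x < 0 \<and> Pfun D \<kappa> y > 0)" for x y
    using assms mem_is_interval_1_I[of "range (Pfun D \<kappa>)" "Pfun D \<kappa> x" "Pfun D \<kappa> y" 0] by auto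
  then consider "\<And>x. Pfun D \<kappa> x > 0" | "\<And>x. Pfun D \<kappa> x < 0" using assms by (metis linorder_neqE_linordered_idom)
  then show ?thesis
  proof cases
    case 1
    show ?thesis by (rule that[of 1]) (use 1 in auto)
  next
    case 2
    show ?thesis by (rule that[of "-1"]) (use 2 in auto)
  qed
qed

text \<open>For bounded \<Theta> the preimage angle lies in a compact interval, where
  \<open>Pfun\<close> is bounded away from 0. Since A / B \<le> 1 and \<tau> \<ge> 1, the decay
  \<tau> powr (- A / B) is no faster than 1 / \<tau>.\<close>

lemma Lambda1_lower_bound:
  assumes \<rho>: "filterlim \<rho>\<^sub>r at_top at_top" and P: "\<forall>\<Theta>. Pfun D \<kappa> \<Theta> \<noteq> 0" and L: "L \<ge> 0"
    and inv: "\<forall>\<^sub>F \<tau> in at_top. \<forall>\<zeta>. invertible_change D \<rho>0 \<kappa> \<rho>\<^sub>r r0 R0 \<zeta> \<tau>"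
  obtains \<sigma> c where "\<bar>\<sigma>\<bar> = 1" "c > 0"
    "\<forall>\<^sub>F \<tau> in at_top. \<forall>R \<Theta> \<zeta>. \<bar>R\<bar> \<le> R0 \<longrightarrow> \<bar>\<Theta>\<bar> \<le> L \<longrightarrow> \<sigma> * Lambda1 D \<rho>0 \<kappa> \<rho>\<^sub>r r0 R \<Theta> \<zeta> \<tau> \<ge> c / \<tau>"
proof -
  obtain \<sigma> where \<sigma>: "\<bar>\<sigma>\<bar> = 1" "\<And>\<Theta>. \<sigma> * Pfun D \<kappa> \<Theta> > 0" using Pfun_sign[OF P] by blast
  obtain M where M: "M \<ge> 0" "\<And>R0 R \<Theta> \<zeta> \<tau>. \<tau> > \<tau>1 \<Longrightarrow> invertible_change D \<rho>0 \<kappa> \<rho>\<^sub>r r0 R0 \<zeta> \<tau> \<Longrightarrow> \<bar>R\<bar> \<le> R0 \<Longrightarrow>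
    \<bar>\<Theta> - snd (branch \<zeta> \<tau> (R, \<Theta>))\<bar> \<le> M" using branch_close by blast
  have "continuous_on {-(L + M)..L + M} (\<lambda>\<theta>. \<sigma> * Pfun D \<kappa> \<theta>)"
    by (intro continuous_intros continuous_on_subset[OF Pfun_continuous]) auto
  moreover have "{-(L + M)..L + M} \<noteq> {}" using L M(1) by simp
  ultimately obtain m where m: "\<And>\<theta>. \<theta> \<in> {-(L + M)..L + M} \<Longrightarrow> \<sigma> * Pfun D \<kappa> m \<le> \<sigma> * Pfun D \<kappa> \<theta>"
    using continuous_attains_inf[OF compact_Icc] by metis
  \<comment> \<open>Half of the minimum: an error below c in the normalized drift leaves at least
    c.\<close>
  define c where "c = \<sigma> * Pfun D \<kappa> m / 2"
  have c: "c > 0" using \<sigma>(2)[of m] by (simp add: c_def)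
  show ?thesis
  proof (rule that[OF \<sigma>(1) c])
    show "\<forall>\<^sub>F \<tau> in at_top. \<forall>R \<Theta> \<zeta>. \<bar>R\<bar> \<le> R0 \<longrightarrow> \<bar>\<Theta>\<bar> \<le> L \<longrightarrow> \<sigma> * Lambda1 D \<rho>0 \<kappa> \<rho>\<^sub>r r0 R \<Theta> \<zeta> \<tau> \<ge> c / \<tau>"
      using Rt_drift_limit[OF \<rho> c] inv eventually_gt_at_top[of \<tau>1]
    proof eventually_elim
      case (elim \<tau>)
      show ?case
      proof (intro allI impI)
        fix R \<Theta> \<zeta> assume R: "\<bar>R\<bar> \<le> R0" and \<Theta>: "\<bar>\<Theta>\<bar> \<le> L"
        note i = elim(2)[rule_format, of \<zeta>]
        let ?r = "fst (branch \<zeta> \<tau> (R, \<Theta>))" and ?\<theta> = "snd (branch \<zeta> \<tau> (R, \<Theta>))"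
        let ?d = "gen Rt ?r ?\<theta> \<zeta> \<tau>"
        have \<tau>: "\<tau> \<ge> 1" using elim(3) tau1 by simp
        have "?\<theta> \<in> {-(L + M)..L + M}" using M(2)[OF elim(3) i R, of \<Theta>] \<Theta> by auto
        from m[OF this] have "2 * c \<le> \<sigma> * Pfun D \<kappa> ?\<theta>" by (simp add: c_def)
        moreover have "\<bar>\<sigma> * (\<tau> powr (A / B) * ?d - Pfun D \<kappa> ?\<theta>)\<bar> < c"
          using elim(1)[rule_format, OF branch_in(1)[OF i R, of \<Theta>], of ?\<theta> \<zeta>] \<sigma>(1) by (simp add: abs_mult)
        ultimately have "c \<le> \<sigma> * (\<tau> powr (A / B) * ?d)" unfolding right_diff_distrib by linarith
        then have d: "c \<le> \<tau> powr (A / B) * (\<sigma> * ?d)" by (simp only: mult_ac)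
        then have p: "0 \<le> \<sigma> * ?d" using c \<tau> by (metis dual_order.trans less_imp_le powr_gt_zero mult_le_cancel_left_pos mult_zero_right not_one_le_zero)
        have "\<tau> powr (A / B) \<le> \<tau> powr 1" using exponent_order \<tau> by (intro powr_mono) (auto simp: field_simps)
        then have "\<tau> powr (A / B) * (\<sigma> * ?d) \<le> \<tau> * (\<sigma> * ?d)" using \<tau> p by (intro mult_right_mono) auto
        with d have "c \<le> \<tau> * (\<sigma> * ?d)" by linarith
        then have "c / \<tau> \<le> \<sigma> * ?d" using \<tau> by (simp add: pos_divide_le_eq mult.commute)
        then show "c / \<tau> \<le> \<sigma> * Lambda1 D \<rho>0 \<kappa> \<rho>\<^sub>r r0 R \<Theta> \<zeta> \<tau>" by (simp add: Lambda_branch)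
      qed
    qed
  qed
qed

lemma exit_from_bounded_domain:
  assumes \<rho>: "filterlim \<rho>\<^sub>r at_top at_top" and P: "\<forall>\<Theta>. Pfun D \<kappa> \<Theta> \<noteq> 0"
    and \<tau>0: "\<tau>0 > \<tau>1" and inv: "\<And>\<zeta> \<tau>. \<tau> \<ge> \<tau>0 \<Longrightarrow> invertible_change D \<rho>0 \<kappa> \<rho>\<^sub>r r0 R0 \<zeta> \<tau>"
    and sol: "maximal_averaged_solution D \<rho>0 \<kappa> \<rho>\<^sub>r r0 R0 \<tau>0 J R \<Theta>"
    and G: "open G" "bounded G" "G \<subseteq> {-R0..R0} \<times> UNIV" and s: "s \<in> J"
  shows "\<exists>\<tau>\<in>J. s \<le> \<tau> \<and> (R \<tau>, \<Theta> \<tau>) \<notin> G"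
proof (rule ccontr)
  assume "\<not> ?thesis"
  then have stay: "(R \<tau>, \<Theta> \<tau>) \<in> G" if "\<tau> \<in> J" "s \<le> \<tau>" for \<tau> using that by blast
  let ?S = "{-R0..R0} \<times> (UNIV :: real set)"
  define f where "f \<tau> x = (Lambda1 D \<rho>0 \<kappa> \<rho>\<^sub>r r0 (fst x) (snd x) (zeta_of D \<tau>) \<tau>, Lambda2 D \<rho>0 \<kappa> \<rho>\<^sub>r r0 (fst x) (snd x) (zeta_of D \<tau>) \<tau>)" for \<tau> x
  define x where "x \<tau> = (R \<tau>, \<Theta> \<tau>)" for \<tau>
  have f: "continuous_on ({\<tau>0..} \<times> ?S) (\<lambda>(\<tau>, x). f \<tau> x)" unfolding f_def using Lambda_continuous[OF \<tau>0 inv] by simp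
  have J: "is_interval J" "J \<subseteq> {\<tau>0..}" and RJ: "\<And>\<tau>. \<tau> \<in> J \<Longrightarrow> \<bar>R \<tau>\<bar> \<le> R0"
    and R': "\<And>\<tau>. \<tau> \<in> J \<Longrightarrow> (R has_real_derivative Lambda1 D \<rho>0 \<kappa> \<rho>\<^sub>r r0 (R \<tau>) (\<Theta> \<tau>) (zeta_of D \<tau>) \<tau>) (at \<tau> within J)"
    and T': "\<And>\<tau>. \<tau> \<in> J \<Longrightarrow> (\<Theta> has_real_derivative Lambda2 D \<rho>0 \<kappa> \<rho>\<^sub>r r0 (R \<tau>) (\<Theta> \<tau>) (zeta_of D \<tau>) \<tau>) (at \<tau> within J)"
    using sol unfolding maximal_averaged_solution_def averaged_solution_def by auto
  have x': "(x has_vector_derivative f \<tau> (x \<tau>)) (at \<tau> within J)" if "\<tau> \<in> J" for \<tau>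
    unfolding x_def f_def fst_conv snd_conv
    by (intro has_vector_derivative_Pair R'[OF that, unfolded has_real_derivative_iff_has_vector_derivative]
      T'[OF that, unfolded has_real_derivative_iff_has_vector_derivative])
  \<comment> \<open>Maximality restated for curves in the plane, the form in which the continuation
    lemmas deliver their solutions.\<close>
  have maximal: "J' = J" if J': "is_interval J'" "J \<subseteq> J'" "J' \<subseteq> {\<tau>0..}" "\<And>t. t \<in> J \<Longrightarrow> y t = x t" "\<And>t. t \<in> J' \<Longrightarrow> y t \<in> ?S"
    "\<And>t. t \<in> J' \<Longrightarrow> (y has_vector_derivative f t (y t)) (at t within J')" for J' y
  proof -
    have d: "((\<lambda>t. fst (y t)) has_real_derivative fst (f t (y t))) (at t within J')"
      "((\<lambda>t. snd (y t)) has_real_derivative snd (f t (y t))) (at t within J')" if "t \<in> J'" for t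
      using bounded_linear.has_vector_derivative[OF bounded_linear_fst J'(6)[OF that]]
        bounded_linear.has_vector_derivative[OF bounded_linear_snd J'(6)[OF that]]
      by (simp_all add: has_real_derivative_iff_has_vector_derivative)
    have "averaged_solution D \<rho>0 \<kappa> \<rho>\<^sub>r r0 R0 \<tau>0 J' (\<lambda>t. fst (y t)) (\<lambda>t. snd (y t))"
      unfolding averaged_solution_def
      using J'(1-3) s d J'(5) by (auto simp: f_def mem_Times_iff abs_le_iff minus_le_iff)
    moreover have "\<forall>t\<in>J. fst (y t) = R t \<and> snd (y t) = \<Theta> t" using J'(4) by (simp add: x_def)
    ultimately show ?thesis using sol J'(2) unfolding maximal_averaged_solution_def by blast
  qed
  have xS: "x t \<in> ?S" if "t \<in> J" for t using RJ[OF that] by (auto simp: x_def abs_le_iff)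
  show False
  proof (cases "bdd_above J")
    case True
    define T where "T = Sup J"
    have T: "t \<le> T" if "t \<in> J" for t unfolding T_def by (rule cSup_upper[OF that True])
    have sT: "s \<le> T" "\<tau>0 \<le> s" using T[OF s] J(2) s by auto
    show False
    proof (cases "T \<in> J")
      case True
      \<comment> \<open>An open G inside the closed strip lies in its interior, which leaves room to
        continue past T.\<close>
      have xT: "x T \<in> interior ?S"
        using interior_maximal[OF G(3,1)] stay[OF True sT(1)] unfolding x_def by blast
      have JT: "J \<subseteq> {..T}" "\<tau>0 \<le> T" using T sT by auto
      obtain \<eta> y where y: "\<eta> > 0" "is_interval (J \<union> {T..T+\<eta>})" "\<And>t. t \<in> J \<Longrightarrow> y t = x t"
        "\<And>t. t \<in> {T..T+\<eta>} \<Longrightarrow> y t \<in> ?S"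
        "\<And>t. t \<in> J \<union> {T..T+\<eta>} \<Longrightarrow> (y has_vector_derivative f t (y t)) (at t within J \<union> {T..T+\<eta>})"
        using extend_past_endpoint[OF f J(1) True JT x' xT] by blast
      have eq: "J \<union> {T..T+\<eta>} = J"
      proof (rule maximal[OF y(2) _ _ y(3) _ y(5)])
        show "J \<union> {T..T+\<eta>} \<subseteq> {\<tau>0..}" using J(2) sT by auto
        show "y t \<in> ?S" if "t \<in> J \<union> {T..T+\<eta>}" for t using that y(3,4) xS by (metis Un_iff)
      qed auto
      have "T + \<eta> \<in> J \<union> {T..T+\<eta>}" using y(1) by simp
      from this[unfolded eq] have "T + \<eta> \<le> T" by (rule T)
      then show False using y(1) by simp
    next
      case False
      have JT: "J \<subseteq> {\<tau>0..<T}" using T False J(2) by (auto simp: order.strict_iff_order)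
      have sJ: "{s..<T} \<subseteq> J"
      proof
        fix t assume t: "t \<in> {s..<T}"
        then obtain u where "u \<in> J" "t < u" using less_cSup_iff[of J t] True s unfolding T_def by auto
        then show "t \<in> J" using J(1) s t unfolding is_interval_1 by (meson atLeastLessThan_iff less_imp_le)
      qed
      have cG: "closure G \<subseteq> ?S" by (rule closure_minimal[OF G(3)]) (simp add: closed_Times)
      have xG: "x t \<in> G" if "t \<in> {s..<T}" for t using stay[of t] sJ that by (auto simp: x_def)
      obtain y where y: "is_interval (insert T J)" "\<And>t. t \<in> J \<Longrightarrow> y t = x t" "y T \<in> ?S"
        "\<And>t. t \<in> insert T J \<Longrightarrow> (y has_vector_derivative f t (y t)) (at t within insert T J)"
        using extend_to_limit[OF f J(1) s JT sJ x' G(2) cG xG] by blast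
      have "insert T J = J"
      proof (rule maximal[OF y(1) _ _ y(2) _ y(4)])
        show "insert T J \<subseteq> {\<tau>0..}" using J(2) sT by auto
        show "y t \<in> ?S" if "t \<in> insert T J" for t using that y(2,3) xS by (metis insert_iff)
      qed auto
      then show False using False by blast
    qed
  next
    case False
    have sJ: "{s..} \<subseteq> J"
    proof
      fix t assume t: "t \<in> {s..}"
      obtain u where "u \<in> J" "t < u" using False by (metis bdd_above.I not_le_imp_less)
      then show "t \<in> J" using J(1) s t unfolding is_interval_1 by (meson atLeast_iff less_imp_le)
    qed
    obtain L where L: "L > 0" "\<And>z. z \<in> G \<Longrightarrow> norm z \<le> L" using G(2) bounded_pos by metis
    have TL: "\<bar>\<Theta> t\<bar> \<le> L" if "t \<ge> s" for t
    proof -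
      have "norm (R t, \<Theta> t) \<le> L" by (rule L(2)[OF stay]) (use sJ that in auto)
      then show ?thesis using norm_snd_le[of "\<Theta> t" "R t"] by simp
    qed
    have ev: "\<forall>\<^sub>F \<tau> in at_top. \<forall>\<zeta>. invertible_change D \<rho>0 \<kappa> \<rho>\<^sub>r r0 R0 \<zeta> \<tau>"
      using eventually_ge_at_top[of \<tau>0] by eventually_elim (use inv in blast)
    obtain \<sigma> c where \<sigma>: "\<bar>\<sigma>\<bar> = 1" "c > 0"
      and lo: "\<forall>\<^sub>F \<tau> in at_top. \<forall>R \<Theta> \<zeta>. \<bar>R\<bar> \<le> R0 \<longrightarrow> \<bar>\<Theta>\<bar> \<le> L \<longrightarrow> \<sigma> * Lambda1 D \<rho>0 \<kappa> \<rho>\<^sub>r r0 R \<Theta> \<zeta> \<tau> \<ge> c / \<tau>"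
      by (rule Lambda1_lower_bound[OF \<rho> P less_imp_le[OF L(1)] ev])
    obtain T1 where T1: "\<forall>\<tau>\<ge>T1. (\<forall>R \<Theta> \<zeta>. \<bar>R\<bar> \<le> R0 \<longrightarrow> \<bar>\<Theta>\<bar> \<le> L \<longrightarrow> \<sigma> * Lambda1 D \<rho>0 \<kappa> \<rho>\<^sub>r r0 R \<Theta> \<zeta> \<tau> \<ge> c / \<tau>)"
      using lo unfolding eventually_at_top_linorder by (rule exE)
    define T where "T = max (s + 1) (max 1 T1)"
    have T: "T > s" "T \<ge> 1" "T \<ge> T1" by (auto simp: T_def)
    \<comment> \<open>The bound c / \<tau> on the drift makes this nondecreasing, so \<sigma> * R
      grows at least like c * ln t.\<close>
    define k where "k t = \<sigma> * R t - c * ln t" for t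
    have k: "k T \<le> k t" if "t \<ge> T" for t
    proof (rule DERIV_nonneg_imp_nondecreasing[OF that])
      fix u assume u: "T \<le> u" "u \<le> t"
      then have uJ: "u \<in> J" and us: "u \<ge> s" using sJ T(1) by auto
      have "at u within J = at u"
        by (rule at_within_open_subset[of _ "{s<..}"]) (use u T sJ in auto)
      then have "(R has_real_derivative Lambda1 D \<rho>0 \<kappa> \<rho>\<^sub>r r0 (R u) (\<Theta> u) (zeta_of D u) u) (at u)"
        using R'[OF uJ] by simp
      then have "(k has_real_derivative \<sigma> * Lambda1 D \<rho>0 \<kappa> \<rho>\<^sub>r r0 (R u) (\<Theta> u) (zeta_of D u) u - c * (1 / u)) (at u)"
        unfolding k_def[abs_def] using u T(2) by (auto intro!: derivative_eq_intros)
      moreover have "\<sigma> * Lambda1 D \<rho>0 \<kappa> \<rho>\<^sub>r r0 (R u) (\<Theta> u) (zeta_of D u) u \<ge> c / u"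
        using T1[rule_format, OF _ RJ[OF uJ] TL[OF us], of u] u(1) T(3) by simp
      ultimately show "\<exists>y. (k has_real_derivative y) (at u) \<and> 0 \<le> y" by (intro exI conjI) auto
    qed
    \<comment> \<open>Late enough for c * ln t \<ge> R0 + 1 - k T, which would force \<sigma> * R t
      \<ge> R0 + 1.\<close>
    define t where "t = max T (exp ((R0 + 1 - k T) / c))"
    have t: "t \<ge> T" "t > 0" using T by (auto simp: t_def)
    have "(R0 + 1 - k T) / c \<le> ln t" using t(2) by (simp add: ln_ge_iff t_def)
    then have "R0 + 1 - k T \<le> c * ln t" using \<sigma>(2) by (simp add: pos_divide_le_eq mult.commute)
    moreover have "t \<in> J" using sJ t(1) T(1) by auto
    then have "\<sigma> * R t \<le> R0"
      using RJ[of t] sJ t(1) T(1) \<sigma>(1) abs_ge_self[of "\<sigma> * R t"] by (auto simp: abs_mult)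
    ultimately show False using k[OF t(1)] unfolding k_def[of t] by linarith
  qed
qed

end

theorem lemma4:
  fixes D :: osc and \<rho>0 :: real and \<kappa> :: nat and \<rho>\<^sub>r :: "real \<Rightarrow> real" and r0 R0 :: real
  assumes "admissible D"
    and "amplitude_threshold D \<rho>0"
    and "\<kappa> \<ge> 1"
    and "resonant_amplitude D \<kappa> \<rho>\<^sub>r"
    and "0 < R0" and "R0 < r0"
    and "\<forall>\<^sub>F \<tau> in at_top. \<forall>\<zeta>. invertible_change D \<rho>0 \<kappa> \<rho>\<^sub>r r0 R0 \<zeta> \<tau>"
    and "- 1 \<le> Mmax D" and "Mmax D < beta D"
    and "3 * M1 D - 2 * M2 D \<ge> beta D"
    and "\<forall>\<Theta>. Pfun D \<kappa> \<Theta> \<noteq> 0"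
  shows "\<forall>\<^sub>F \<tau>0 in at_top. \<forall>J R \<Theta> G.
    maximal_averaged_solution D \<rho>0 \<kappa> \<rho>\<^sub>r r0 R0 \<tau>0 J R \<Theta> \<longrightarrow>
    open G \<and> connected G \<and> bounded G \<and> G \<subseteq> {- R0..R0} \<times> UNIV \<longrightarrow>
    (\<forall>\<tau>\<^sub>s\<in>J. \<exists>\<tau>\<in>J. \<tau>\<^sub>s \<le> \<tau> \<and> (R \<tau>, \<Theta> \<tau>) \<notin> G)"
proof -
  interpret oscillator D \<rho>0 by unfold_locales (fact assms(1,2))+
  have r0: "r0 > 0" using assms(5,6) by simp
  obtain e1 t1 where res: "\<And>\<tau>1. 1 \<le> \<tau>1 \<Longrightarrow> t1 \<le> time D \<tau>1 \<Longrightarrow> resonance D \<rho>0 \<kappa> \<rho>\<^sub>r r0 e1 t1 \<tau>1"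
    using resonance_exists[OF assms(3,4) r0 assms(8-10)] by blast
  have B: "expB D > 1" using assms(1) by (simp add: admissible_def expB_def)
  define m where "m = max 1 t1"
  have m: "m \<ge> 1" "m \<ge> t1" by (auto simp: m_def)
  \<comment> \<open>Because B \<ge> 1, the time belonging to \<tau> is at least \<tau> powr (1 / B);
    the choice thus yields a time of at least m.\<close>
  define \<tau>1 where "\<tau>1 = m powr expB D"
  have "\<tau>1 \<ge> 1" unfolding \<tau>1_def using m(1) B by (intro ge_one_powr_ge_zero) auto
  moreover have "m \<le> time D \<tau>1"
  proof -
    have "m = (1 * \<tau>1) powr (1 / expB D)" using m(1) B by (simp add: \<tau>1_def powr_powr)
    also have "\<dots> \<le> (expB D * \<tau>1) powr (1 / expB D)" using B \<open>\<tau>1 \<ge> 1\<close> by (intro powr_mono2 mult_right_mono) auto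
    finally show ?thesis by (simp add: time_def)
  qed
  ultimately interpret resonance D \<rho>0 \<kappa> \<rho>\<^sub>r r0 e1 t1 \<tau>1 using m(2) by (intro res) auto
  obtain T where T: "\<And>\<tau> \<zeta>. \<tau> \<ge> T \<Longrightarrow> invertible_change D \<rho>0 \<kappa> \<rho>\<^sub>r r0 R0 \<zeta> \<tau>"
    using assms(7) unfolding eventually_at_top_linorder by blast
  have \<rho>: "filterlim \<rho>\<^sub>r at_top at_top" using assms(4) by (simp add: resonant_amplitude_def)
  show ?thesis
    using eventually_ge_at_top[of T] eventually_gt_at_top[of \<tau>1]
  proof eventually_elim
    case (elim \<tau>0)
    show ?case
    proof (intro allI impI ballI)
      fix J :: "real set" and R \<Theta> :: "real \<Rightarrow> real" and G :: "(real \<times> real) set" and \<tau>\<^sub>s :: real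
      assume sol: "maximal_averaged_solution D \<rho>0 \<kappa> \<rho>\<^sub>r r0 R0 \<tau>0 J R \<Theta>"
        and G: "open G \<and> connected G \<and> bounded G \<and> G \<subseteq> {- R0..R0} \<times> UNIV" and s: "\<tau>\<^sub>s \<in> J"
      show "\<exists>\<tau>\<in>J. \<tau>\<^sub>s \<le> \<tau> \<and> (R \<tau>, \<Theta> \<tau>) \<notin> G"
        by (rule exit_from_bounded_domain[OF \<rho> assms(11) elim(2) _ sol _ _ _ s]) (use T elim(1) G in auto)
    qed
  qed
qed

end
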